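(* Let $F$ be a field of characteristic different from $2$ and let $(A,\sigma)$ be an $F$-algebra with involution. Assume that for every $\mathcal{P}\in X_{(A,\sigma)}$, $1\in\mathcal{P}\cup-\mathcal{P}$. Then \[\bigcap\{\mathcal{P}\in X_{(A,\sigma)}\mid 1\in\mathcal{P}\}=\Bigl\{\sum_{i=1}^s\sigma(x_i)x_i\,\Big|\,s\in\mathbb{N},\ x_i\in A\Bigr\}.\]
   Context: An ordering on $F$ is a subset $P\subseteq F$ with $P+P\subseteq P$, $P\cdot P\subseteq P$, $P\cup -P=F$ and $P\cap -P=\{0\}$ (so $0\in P$); $F$ may have no orderings. An $F$-algebra with involution is a pair $(A,\sigma)$ where $A$ is a finite-dimensional simple $F$-algebra whose centre $K=Z(A)$ is a field and $\sigma:A\to A$ is an involution (additive, $\sigma(xy)=\sigma(y)\sigma(x)$, $\sigma^2=\mathrm{id}$) such that $F=K\cap \mathrm{Sym}(A,\sigma)$, where $\mathrm{Sym}(A,\sigma)=\{a\in A\mid \sigma(a)=a\}$. A prepositive cone on $(A,\sigma)$ is a subset $\mathcal{P}\subseteq \mathrm{Sym}(A,\sigma)$ such that (P1) $\mathcal{P}\neq\varnothing$; (P2) $\mathcal{P}+\mathcal{P}\subseteq\mathcal{P}$; (P3) $\sigma(a)\cdot\mathcal{P}\cdot a\subseteq\mathcal{P}$ for every $a\in A$; (P4) $\mathcal{P}_F:=\{u\in F\mid u\mathcal{P}\subseteq\mathcal{P}\}$ is an ordering on $F$; (P5) $\mathcal{P}\cap-\mathcal{P}=\{0\}$. A positive cone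 is a prepositive cone that is maximal with respect to inclusion; $X_{(A,\sigma)}$ is the set of all positive cones on $(A,\sigma)$. Intersections of families of positive cones are taken inside $\mathrm{Sym}(A,\sigma)$ (the empty intersection is $\mathrm{Sym}(A,\sigma)$). *)

theory Defs
  imports Complex_Main
begin

definition Sym :: "('a \<Rightarrow> 'a) \<Rightarrow> 'a set" where
  "Sym \<sigma> = {a. \<sigma> a = a}"

definition ring_centre :: "'a::ring_1 set" where
  "ring_centre = {z. \<forall>x. z * x = x * z}"

definition involution :: "('a::ring_1 \<Rightarrow> 'a) \<Rightarrow> bool" where
  "involution \<sigma> \<longleftrightarrow>
     (\<forall>x y. \<sigma> (x + y) = \<sigma> x + \<sigma> y) \<and> (\<forall>x y. \<sigma> (x * y) = \<sigma> y * \<sigma> x) \<and> (\<forall>x. \<sigma> (\<sigma> x) = x)"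

definition two_sided_ideal :: "'a::ring_1 set \<Rightarrow> bool" where
  "two_sided_ideal I \<longleftrightarrow>
     0 \<in> I \<and> (\<forall>x\<in>I. \<forall>y\<in>I. x + y \<in> I) \<and> (\<forall>x\<in>I. \<forall>a. a * x \<in> I \<and> x * a \<in> I)"

text \<open>The field \<open>F\<close> is the type \<open>'f\<close>, the algebra \<open>A\<close> is the type \<open>'a\<close> (nonzero, being of class
  \<open>ring_1\<close>), and \<open>F\<close> is identified with its image \<open>F \<cdot> 1\<close> in \<open>A\<close>. The centre is a commutative
  subring in any case, so inverses are all that is needed for it to be a field.\<close>

locale algebra_with_involution = vector_space scale
  for scale :: "'f::field \<Rightarrow> 'a::ring_1 \<Rightarrow> 'a" +
  fixes \<sigma> :: "'a \<Rightarrow> 'a"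
  assumes scale_mult_left: "scale c x * y = scale c (x * y)"
    and scale_mult_right: "x * scale c y = scale c (x * y)"
    and finite_dim: "\<exists>B. finite B \<and> span B = UNIV"
    and simple: "two_sided_ideal (I :: 'a set) \<Longrightarrow> I = {0} \<or> I = UNIV"
    and centre_field: "(z :: 'a) \<in> ring_centre \<Longrightarrow> z \<noteq> 0 \<Longrightarrow> \<exists>w\<in>ring_centre. z * w = 1"
    and involution: "involution \<sigma>"
    and base_field: "range (\<lambda>u. scale u 1) = ring_centre \<inter> Sym \<sigma>"

definition field_ordering :: "'f::field set \<Rightarrow> bool" where
  "field_ordering P \<longleftrightarrow>
     (\<forall>x\<in>P. \<forall>y\<in>P. x + y \<in> P) \<and> (\<forall>x\<in>P. \<forall>y\<in>P. x * y \<in> P) \<and>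
     P \<union> uminus ` P = UNIV \<and> P \<inter> uminus ` P = {0}"

text \<open>This is \<open>\<P>\<^sub>F\<close>.\<close>

definition cone_scalars :: "('f::field \<Rightarrow> 'a::ring_1 \<Rightarrow> 'a) \<Rightarrow> 'a set \<Rightarrow> 'f set" where
  "cone_scalars scale P = {u. \<forall>p\<in>P. scale u p \<in> P}"

definition prepositive_cone ::
    "('f::field \<Rightarrow> 'a::ring_1 \<Rightarrow> 'a) \<Rightarrow> ('a \<Rightarrow> 'a) \<Rightarrow> 'a set \<Rightarrow> bool" where
  "prepositive_cone scale \<sigma> P \<longleftrightarrow>
     P \<subseteq> Sym \<sigma> \<and>
     P \<noteq> {} \<and>
     (\<forall>x\<in>P. \<forall>y\<in>P. x + y \<in> P) \<and>
     (\<forall>a. \<forall>p\<in>P. \<sigma> a * p * a \<in> P) \<and>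
     field_ordering (cone_scalars scale P) \<and>
     P \<inter> uminus ` P = {0}"

definition positive_cones ::
    "('f::field \<Rightarrow> 'a::ring_1 \<Rightarrow> 'a) \<Rightarrow> ('a \<Rightarrow> 'a) \<Rightarrow> 'a set set" where
  "positive_cones scale \<sigma> =
     {P. prepositive_cone scale \<sigma> P \<and> (\<forall>Q. prepositive_cone scale \<sigma> Q \<and> P \<subseteq> Q \<longrightarrow> Q = P)}"

end

theory Submission
 imports Defs "HOL-Library.Function_Algebras" "HOL-Library.Multiset" "HOL-Library.Product_Plus" "HOL-Algebra.Algebraic_Closure_Type"
begin

text \<open>If \<open>\<sigma> x * x = 0\<close> for some \<open>x ~= 0\<close>, then every symmetric element is a sum of hermitian squares.
 Otherwise a minimal symmetric idempotent \<open>f\<close> reduces the claim to the division algebra \<open>D = f A f\<close>.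
 If \<open>b\<close> in \<open>D\<close> is not a sum of hermitian squares, then \<open>\<langle>1, -b\<rangle>\<close> is not torsion in the Witt group of
 \<open>D\<close>, by Witt cancellation. A maximality argument with Pfister forms yields an ordering \<open>T\<close> of \<open>F\<close> and
 then an ordering over \<open>T\<close> of a maximal commutative subfield \<open>E\<close> of symmetric elements containing \<open>b\<close>
 that still detect \<open>\<langle>1, -b\<rangle>\<close>. Projecting \<open>\<sigma> x * a * y\<close> to the centraliser of \<open>E\<close> gives a form with an
 integral signature \<open>phi a\<close> at that ordering. If \<open>a\<close> maximises \<open>phi\<close> on the cone generated over \<open>T\<close> by
 an element, then \<open>phi\<close> is constant on the cone generated by \<open>a\<close>. Since every positive cone contains
 \<open>1\<close> or \<open>-1\<close>, the cones generated by elements of the cones of \<open>1\<close> and of \<open>b\<close> meet or degenerate, and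
 this forces \<open>phi 1 = phi b\<close>. Then the forms of \<open>1\<close> and \<open>b\<close> over the centraliser agree up to a Pfister
 form, and transferring to \<open>F\<close> a form over \<open>E\<close> of nonzero total signature shows that \<open>\<langle>1, -b\<rangle>\<close> is
 torsion at \<open>T\<close>, a contradiction.\<close>

text \<open>Real closures and splitting fields are avoided: every ordering arises by maximality from
  a form that fails to vanish. Two rounds are needed because an ordering of \<open>F\<close> alone
  assigns no signs to symmetric elements of \<open>D\<close>. Symmetric elements of the centraliser
  of \<open>E\<close> lie in \<open>E\<close>, so an ordering of \<open>E\<close> with positive
  norms from the centraliser gives a law of inertia there.

  The extremal argument rests on additivity. An element \<open>c\<close> of the cone of
  \<open>a\<close> is a value of a form with entries \<open>t i\<close> times \<open>a\<close>;
  diagonalising that form with first entry \<open>c\<close> produces n elements of the cone whose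
  \<open>phi\<close> is at most \<open>phi a\<close> but adds up to n times \<open>phi a\<close>.
  Integrality and boundedness provide the maximum.

  Positive cones enter through the difference of two generated cones: if it were proper, some
  positive cone would contain \<open>p\<close> from the cone of 1 and \<open>-q\<close> with
  \<open>q\<close> from the cone of \<open>b\<close>, impossible whether it contains 1 or -1.

  Positivity of a transferred Pfister form is proved by splitting off the points of an etale algebra
  one at a time.\<close>

lemma fun_sum_apply: "(\<Sum>i\<in>I. f i) x = (\<Sum>i\<in>I. (f i :: 'b => 'a::comm_monoid_add) x)"
 by (induction I rule: infinite_finite_induct) auto

section \<open>Division subrings with involution\<close>

text \<open>The rings of coefficients below are subsets of a type rather than types, since they are found
 in the course of the proof (corners, centralisers and subfields of the given algebra); their unit
 \<open>e\<close> need not be the unit of the ambient ring.\<close>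

locale star_div =
 fixes D :: "'a::ring_1 set" and e :: 'a and \<sigma> :: "'a => 'a"
 assumes inv: "involution \<sigma>"
  and add_closed: "x : D ==> y : D ==> x + y : D"
  and neg_closed: "x : D ==> - x : D"
  and mult_closed: "x : D ==> y : D ==> x * y : D"
  and e_closed: "e : D" and e_nz: "e ~= 0"
  and e_left: "x : D ==> e * x = x" and e_right: "x : D ==> x * e = x"
  and ex_inverse: "x : D ==> x ~= 0 ==> EX y:D. x * y = e \<and> y * x = e"
  and star_closed: "x : D ==> \<sigma> x : D"
  and two_nz: "e + e ~= 0"
begin

lemma star_add: "\<sigma> (x + y) = \<sigma> x + \<sigma> y" and star_mult: "\<sigma> (x * y) = \<sigma> y * \<sigma> x"
 and star_star [simp]: "\<sigma> (\<sigma> x) = x"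
 using inv unfolding involution_def by auto

lemma star_zero [simp]: "\<sigma> 0 = 0"
 using star_add[of 0 0] by simp

lemma star_neg: "\<sigma> (- x) = - \<sigma> x"
 using star_add[of x "- x"] by (simp add: eq_neg_iff_add_eq_0 add.commute)

lemma star_diff: "\<sigma> (x - y) = \<sigma> x - \<sigma> y"
 using star_add[of x "- y"] star_neg by simp

lemma star_sum: "\<sigma> (\<Sum>i\<in>I. f i) = (\<Sum>i\<in>I. \<sigma> (f i))"
 by (induction I rule: infinite_finite_induct) (auto simp: star_add)

lemma star_eq_0 [simp]: "\<sigma> x = 0 \<longleftrightarrow> x = 0"
 by (metis star_star star_zero)

lemma zero_closed: "0 : D"
 using add_closed[OF e_closed neg_closed[OF e_closed]] by simp

lemma diff_closed: "x : D ==> y : D ==> x - y : D"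
 using add_closed[of x "- y"] neg_closed by simp

lemma sum_closed: "(!!i. i : I ==> f i : D) ==> (\<Sum>i\<in>I. f i) : D"
 by (induction I rule: infinite_finite_induct) (auto intro: add_closed zero_closed)

lemma star_e: "\<sigma> e = e"
 by (metis e_closed e_left e_right star_closed star_mult star_star)

definition dinv :: "'a => 'a" where
 "dinv x = (SOME y. y : D \<and> x * y = e \<and> y * x = e)"

lemma dinv: assumes "x : D" "x ~= 0"
 shows dinv_closed: "dinv x : D" and dinv_right: "x * dinv x = e" and dinv_left: "dinv x * x = e"
 using someI_ex[of "\<lambda>y. y : D \<and> x * y = e \<and> y * x = e"] ex_inverse[OF assms]
 unfolding dinv_def by auto

lemma dinv_nz: "x : D ==> x ~= 0 ==> dinv x ~= 0"
 using dinv_right[of x] e_nz by auto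

lemma no_zero_div: assumes "x : D" "y : D" "x * y = 0" shows "x = 0 \<or> y = 0"
 by (metis assms dinv_left e_left mult.assoc mult_zero_right)

lemma mult_nz: "x : D ==> y : D ==> x ~= 0 ==> y ~= 0 ==> x * y ~= 0"
 using no_zero_div by blast

lemma dinv_unique: assumes "x : D" "y : D" "x * y = e" shows "y = dinv x"
proof -
 have "x ~= 0" using assms e_nz by auto
 then have "dinv x * (x * y) = y" using assms dinv_left e_left by (metis mult.assoc)
 then show ?thesis using assms dinv_closed e_right \<open>x ~= 0\<close> by metis
qed

lemma star_dinv: assumes "x : D" "x ~= 0" shows "\<sigma> (dinv x) = dinv (\<sigma> x)"
 using assms by (intro dinv_unique star_closed dinv_closed) (simp_all flip: star_mult add: dinv_left star_e)

lemma add_self_nz: assumes "x : D" "x ~= 0" shows "x + x ~= 0"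
proof
 assume "x + x = 0"
 then have "dinv x * (x + x) = 0" by simp
 then show False using assms dinv_left two_nz by (simp add: distrib_left)
qed

text \<open>Gaussian elimination over a skew field. The unknowns stand on the right, so rows may be
  combined from the left; \<open>Y\<close> is the system after subtracting left multiples of the
  pivot row, and the pivot unknown is recovered by back substitution.\<close>

lemma linear_system:
 assumes "finite I" "finite J" "card I < card J" "!!i j. i : I ==> j : J ==> U i j : D"
 shows "EX c. (ALL j:J. c j : D) \<and> (EX j:J. c j ~= 0) \<and> (ALL i:I. (\<Sum>j\<in>J. U i j * c j) = 0)"
 using assms
proof (induction I arbitrary: J U rule: finite_induct)
 case empty
 then have "J ~= {}" by auto
 then show ?case using e_closed e_nz by (intro exI[of _ "\<lambda>_. e"]) auto
next
 case (insert i I)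
 show ?case
 proof (cases "ALL j:J. U i j = 0")
  case True
  have "card I < card J" using insert by simp
  from insert.IH[OF insert.prems(1) this, of U] insert.prems(3) True show ?thesis by force
 next
  case False
  then obtain p where p: "p : J" "U i p ~= 0" by auto
  have pD: "U i p : D" using insert.prems(3) p by auto
  let ?q = "dinv (U i p)"
  define Y where "Y k j = U k j - U k p * ?q * U i j" for k j
  have "card I < card (J - {p})" using insert p by simp
  moreover have "Y k j : D" if "k : I" "j : J - {p}" for k j
   using that insert.prems(3) p unfolding Y_def
   by (intro diff_closed mult_closed dinv_closed) auto
  ultimately obtain c where c: "ALL j:J - {p}. c j : D" "EX j:J - {p}. c j ~= 0"
   "ALL k:I. (\<Sum>j\<in>J - {p}. Y k j * c j) = 0"
   using insert.IH[of "J - {p}" Y] insert.prems(1) by auto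
  define s where "s = (\<Sum>j\<in>J - {p}. U i j * c j)"
  define d where "d = c(p := - (?q * s))"
  have sD: "s : D" unfolding s_def using c insert.prems(3) by (intro sum_closed mult_closed) auto
  have sum_d: "(\<Sum>j\<in>J. U k j * d j) = U k p * d p + (\<Sum>j\<in>J - {p}. U k j * c j)" for k
  proof -
   have "(\<Sum>j\<in>J - {p}. U k j * d j) = (\<Sum>j\<in>J - {p}. U k j * c j)"
    by (intro sum.cong) (auto simp: d_def)
   then show ?thesis using p insert.prems(1) by (simp add: sum.remove[of J p])
  qed
  have "ALL j:J. d j : D" using c sD pD p by (auto simp: d_def intro!: neg_closed mult_closed dinv_closed)
  moreover have "EX j:J. d j ~= 0" using c by (auto simp: d_def)
  moreover have "(\<Sum>j\<in>J. U i j * d j) = 0"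
  proof -
   have "U i p * d p = - s" using sD pD p dinv_right e_left by (simp add: d_def flip: mult.assoc)
   then show ?thesis unfolding sum_d s_def by simp
  qed
  moreover have "(\<Sum>j\<in>J. U k j * d j) = 0" if "k : I" for k
  proof -
   have "(\<Sum>j\<in>J - {p}. Y k j * c j) = (\<Sum>j\<in>J - {p}. U k j * c j) - U k p * ?q * s"
    unfolding Y_def s_def
    by (simp add: left_diff_distrib sum_subtractf sum_distrib_left mult.assoc)
   then show ?thesis using c(3) that unfolding sum_d by (simp add: d_def mult.assoc)
  qed
  ultimately show ?thesis by (intro exI[of _ d]) auto
 qed
qed

end

section \<open>Hermitian spaces\<close>

text \<open>Right vector spaces are subsets because one set is later regarded over several
  coefficient rings: \<open>D\<close> as a space over itself, over the centraliser \<open>C\<close>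
  and over the base field.\<close>

locale smod = star_div D e \<sigma> for D :: "'a::ring_1 set" and e \<sigma> +
 fixes M :: "'m::ab_group_add set" and act :: "'m => 'a => 'm"
 assumes M_zero: "0 : M" and M_add: "v : M ==> w : M ==> v + w : M"
  and M_act: "v : M ==> c : D ==> act v c : M"
  and act_add: "v : M ==> w : M ==> c : D ==> act (v + w) c = act v c + act w c"
  and act_plus: "v : M ==> c : D ==> d : D ==> act v (c + d) = act v c + act v d"
  and act_act: "v : M ==> c : D ==> d : D ==> act (act v c) d = act v (c * d)"
  and act_e: "v : M ==> act v e = v"
begin

lemma act_zero: "v : M ==> act v 0 = 0"
 using act_plus[of v 0 0] zero_closed by simp

lemma act_neg: "v : M ==> c : D ==> act v (- c) = - act v c"
 using act_plus[of v c "- c"] neg_closed act_zero by (simp add: eq_neg_iff_add_eq_0 add.commute)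

lemma M_neg: "v : M ==> - v : M"
 using act_neg[of v e] act_e e_closed M_act neg_closed by metis

lemma M_diff: "v : M ==> w : M ==> v - w : M"
 using M_add[of v "- w"] M_neg by simp

lemma M_sum: "(!!i. i : I ==> f i : M) ==> (\<Sum>i\<in>I. f i) : M"
 by (induction I rule: infinite_finite_induct) (auto intro: M_add M_zero)

lemma act_zero_left: "c : D ==> act 0 c = 0"
 using act_add[of 0 0 c] M_zero by simp

lemma act_sum: "(!!i. i : I ==> f i : M) ==> c : D ==> act (\<Sum>i\<in>I. f i) c = (\<Sum>i\<in>I. act (f i) c)"
 by (induction I rule: infinite_finite_induct) (auto simp: act_zero_left act_add M_sum)

lemma act_sum_right: "(!!i. i : I ==> c i : D) ==> v : M ==> act v (\<Sum>i\<in>I. c i) = (\<Sum>i\<in>I. act v (c i))"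
 by (induction I rule: infinite_finite_induct) (auto simp: act_zero act_plus sum_closed)

lemma span_dependent:
 assumes "finite I" "finite J" "card I < card J" "!!i. i : I ==> v i : M"
  "!!j i. j : J ==> i : I ==> U i j : D" "!!j. j : J ==> w j = (\<Sum>i\<in>I. act (v i) (U i j))"
 shows "EX c. (ALL j:J. c j : D) \<and> (EX j:J. c j ~= 0) \<and> (\<Sum>j\<in>J. act (w j) (c j)) = 0"
proof -
 obtain c where c: "ALL j:J. c j : D" "EX j:J. c j ~= 0" "ALL i:I. (\<Sum>j\<in>J. U i j * c j) = 0"
  using linear_system[OF assms(1-3), of U] assms(5) by blast
 have "(\<Sum>j\<in>J. act (w j) (c j)) = (\<Sum>j\<in>J. \<Sum>i\<in>I. act (v i) (U i j * c j))"
  using assms c by (intro sum.cong refl) (auto simp: act_sum M_act act_act)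
 also have "\<dots> = (\<Sum>i\<in>I. act (v i) (\<Sum>j\<in>J. U i j * c j))"
  using assms c by (subst sum.swap) (intro sum.cong refl act_sum_right[symmetric], auto simp: mult_closed)
 also have "\<dots> = 0" using c(3) assms(4) by (auto simp: act_zero)
 finally show ?thesis using c by auto
qed

definition spanning :: "'i set => ('i => 'm) => bool" where
 "spanning I b \<longleftrightarrow> finite I \<and> (ALL i:I. b i : M) \<and>
   (ALL x:M. EX k. (ALL i:I. k i : D) \<and> x = (\<Sum>i\<in>I. act (b i) (k i)))"

lemma spanning_dependent:
 assumes "spanning I b" "finite J" "card I < card J" "!!j. j : J ==> w j : M"
 shows "EX c. (ALL j:J. c j : D) \<and> (EX j:J. c j ~= 0) \<and> (\<Sum>j\<in>J. act (w j) (c j)) = 0"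
proof -
 have "ALL j:J. EX k. (ALL i:I. k i : D) \<and> w j = (\<Sum>i\<in>I. act (b i) (k i))"
  using assms(1,4) unfolding spanning_def by blast
 then obtain k where "ALL j:J. (ALL i:I. k j i : D) \<and> w j = (\<Sum>i\<in>I. act (b i) (k j i))" by metis
 then show ?thesis using assms
  by (intro span_dependent[where U = "\<lambda>i j. k j i" and I = I and v = b]) (auto simp: spanning_def)
qed

text \<open>A bound on the length of independent families, so that no basis has to be carried as
  data; a spanning family gives the bound.\<close>

definition finite_dim :: bool where
 "finite_dim \<longleftrightarrow> (EX N::nat. ALL v::nat => 'm. (ALL i<=N. v i : M) -->
    (EX c. (ALL i<=N. c i : D) \<and> (EX i<=N. c i ~= 0) \<and> (\<Sum>i\<le>N. act (v i) (c i)) = 0))"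

lemma spanning_finite_dim: assumes "spanning I b" shows finite_dim
 unfolding finite_dim_def
proof (intro exI[of _ "card I"] allI impI)
 fix v :: "nat => 'm" assume v: "ALL i<=card I. v i : M"
 show "EX c. (ALL i<=card I. c i : D) \<and> (EX i<=card I. c i ~= 0) \<and> (\<Sum>i\<le>card I. act (v i) (c i)) = 0"
  using spanning_dependent[OF assms, of "{..card I}" v] v by (auto simp: Bex_def Ball_def)
qed

end

locale herm = smod D e \<sigma> M act for D :: "'a::ring_1 set" and e \<sigma> and M :: "'m::ab_group_add set" and act +
 fixes h :: "'m => 'm => 'a"
 assumes h_closed: "v : M ==> w : M ==> h v w : D"
  and h_add: "u : M ==> v : M ==> w : M ==> h u (v + w) = h u v + h u w"
  and h_act: "v : M ==> w : M ==> c : D ==> h v (act w c) = h v w * c"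
  and h_star: "v : M ==> w : M ==> \<sigma> (h v w) = h w v"
  and nondeg: "v : M ==> (!!w. w : M ==> h v w = 0) ==> v = 0"
  and fin_dim: finite_dim
begin

lemma h_zero_right: "v : M ==> h v 0 = 0"
 using h_add[of v 0 0] M_zero by simp

lemma h_zero_left: "v : M ==> h 0 v = 0"
 by (metis M_zero h_star h_zero_right star_zero)

lemma h_neg_right: "v : M ==> w : M ==> h v (- w) = - h v w"
 using h_add[of v w "- w"] M_neg h_zero_right by (simp add: eq_neg_iff_add_eq_0 add.commute)

lemma h_diff_right: "u : M ==> v : M ==> w : M ==> h u (v - w) = h u v - h u w"
 using h_add[of u v "- w"] h_neg_right M_neg by simp

lemma h_add_left: "u : M ==> v : M ==> w : M ==> h (u + v) w = h u w + h v w"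
 by (metis M_add h_add h_star star_add)

lemma h_diff_left: "u : M ==> v : M ==> w : M ==> h (u - v) w = h u w - h v w"
 by (metis M_diff h_diff_right h_star star_diff)

lemma h_neg_left: "v : M ==> w : M ==> h (- v) w = - h v w"
 by (metis M_neg h_neg_right h_star star_neg)

lemma h_act_left: "v : M ==> w : M ==> c : D ==> h (act v c) w = \<sigma> c * h v w"
 by (metis M_act h_act h_star star_mult)

lemma h_sum_right: "(!!i. i : I ==> f i : M) ==> v : M ==> h v (\<Sum>i\<in>I. f i) = (\<Sum>i\<in>I. h v (f i))"
 by (induction I rule: infinite_finite_induct) (auto simp: h_zero_right h_add M_sum)

lemma h_sum_left: "(!!i. i : I ==> f i : M) ==> v : M ==> h (\<Sum>i\<in>I. f i) v = (\<Sum>i\<in>I. h (f i) v)"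
 by (induction I rule: infinite_finite_induct) (auto simp: h_zero_left h_add_left M_sum)

definition orth :: "'i set => ('i => 'm) => bool" where
 "orth I v \<longleftrightarrow> finite I \<and> (ALL i:I. v i : M \<and> h (v i) (v i) ~= 0) \<and> (ALL i:I. ALL j:I. i ~= j --> h (v i) (v j) = 0)"

text \<open>Completeness is expressed by the Fourier expansion along the orthogonal family, which
  supplies the coefficients explicitly.\<close>

definition basis :: "'i set => ('i => 'm) => bool" where
 "basis I v \<longleftrightarrow> orth I v \<and> (ALL x:M. x = (\<Sum>i\<in>I. act (v i) (dinv (h (v i) (v i)) * h (v i) x)))"

lemma orthD: assumes "orth I v"
 shows "finite I" "i : I ==> v i : M" "i : I ==> h (v i) (v i) ~= 0"
  "i : I ==> j : I ==> i ~= j ==> h (v i) (v j) = 0" "i : I ==> h (v i) (v i) : D"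
  "i : I ==> \<sigma> (h (v i) (v i)) = h (v i) (v i)"
 using assms h_closed h_star unfolding orth_def by auto

lemma basis_orth: "basis I v ==> orth I v"
 unfolding basis_def by auto

lemma orth_comb: assumes "orth I v" "i : I" "!!j. j : I ==> c j : D"
 shows "h (v i) (\<Sum>j\<in>I. act (v j) (c j)) = h (v i) (v i) * c i"
proof -
 have "h (v i) (\<Sum>j\<in>I. act (v j) (c j)) = (\<Sum>j\<in>I. h (v i) (v j) * c j)"
  using assms orthD[OF assms(1)] by (subst h_sum_right) (auto simp: M_act h_act)
 also have "\<dots> = (\<Sum>j\<in>I. if j = i then h (v i) (v i) * c i else 0)"
  using assms orthD(4)[OF assms(1)] by (intro sum.cong) auto
 finally show ?thesis using orthD(1)[OF assms(1)] assms(2) by simp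
qed

lemma orth_indep: assumes "orth I v" "!!j. j : I ==> c j : D" "(\<Sum>j\<in>I. act (v j) (c j)) = 0" "i : I"
 shows "c i = 0"
proof -
 have "h (v i) (v i) * c i = 0"
  using orth_comb[OF assms(1,4), of c] assms h_zero_right orthD[OF assms(1)] by simp
 then show ?thesis using no_zero_div orthD[OF assms(1)] assms by blast
qed

lemma orth_coeff_closed:
 assumes "orth I v" "i : I" "x : M" shows "dinv (h (v i) (v i)) * h (v i) x : D"
 using orthD[OF assms(1)] assms by (intro mult_closed dinv_closed h_closed) auto

lemma orth_subset: "orth I v ==> J \<subseteq> I ==> orth J v"
 unfolding orth_def by (meson finite_subset subset_iff)

lemma orth_reindex: assumes "orth I v" "bij_betw p J I" shows "orth J (v \<circ> p)"
proof -
 have "finite J" using assms orthD(1) bij_betw_finite by blast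
 moreover have "p j : I" if "j : J" for j using assms(2) that bij_betwE by fast
 moreover have "p i ~= p j" if "i : J" "j : J" "i ~= j" for i j
  using assms(2) that unfolding bij_betw_def inj_on_def by auto
 ultimately show ?thesis using orthD[OF assms(1)] unfolding orth_def by auto
qed

text \<open>Polarisation. Rescaling \<open>y\<close> so that \<open>h x y = e\<close> would turn the
  isotropy of the sum into \<open>e + e = 0\<close>; the two cross terms agree because
  \<open>\<sigma> e = e\<close>.\<close>

lemma isotropic_zero:
 assumes sub: "!!x y. x : W ==> y : W ==> x + y : W" "!!x c. x : W ==> c : D ==> act x c : W" "W \<subseteq> M"
  and iso: "!!x. x : W ==> h x x = 0" and xy: "x : W" "y : W"
 shows "h x y = 0"
proof (rule ccontr)
 assume nz: "h x y ~= 0"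
 have M: "x : M" "y : M" using xy sub by auto
 let ?d = "dinv (h x y)"
 have d: "?d : D" using nz M h_closed dinv_closed by auto
 have "h (x + act y ?d) (x + act y ?d) = 0" using sub iso xy d by auto
 then have "h x (act y ?d) + h (act y ?d) x = 0"
  using M M_act[OF M(2) d] iso[OF xy(1)] iso[OF sub(2)[OF xy(2) d]] by (simp add: h_add h_add_left M_add add.commute)
 moreover have "h x (act y ?d) = e" using M d h_act dinv_right nz h_closed by auto
 moreover have "h (act y ?d) x = \<sigma> (h x (act y ?d))" using M M_act[OF M(2) d] h_star by simp
 ultimately show False using star_e two_nz by simp
qed

lemma orth_residual: assumes "orth I v" "x : M" "i : I"
 shows "h (v i) (x - (\<Sum>j\<in>I. act (v j) (dinv (h (v j) (v j)) * h (v j) x))) = 0"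
proof -
 note o = orthD[OF assms(1)]
 let ?c = "\<lambda>j. dinv (h (v j) (v j)) * h (v j) x"
 have c: "!!j. j : I ==> ?c j : D" using orth_coeff_closed[OF assms(1) _ assms(2)] by auto
 have "h (v i) (v i) * ?c i = h (v i) x"
  using o assms dinv_right h_closed e_left by (simp flip: mult.assoc)
 then show ?thesis
  using orth_comb[OF assms(1,3), of ?c] c o assms
  by (subst h_diff_right) (auto intro!: M_sum M_act)
qed

text \<open>If every vector orthogonal to the family were isotropic, the orthogonal complement would
  be totally isotropic by polarisation. The residual \<open>x - ?p x\<close> is then orthogonal both
  to the family and to the complement, so it vanishes by nondegeneracy.\<close>

lemma orth_extend_one: assumes o: "orth I v" and nb: "\<not> basis I v"
 shows "EX x:M. h x x ~= 0 \<and> (ALL i:I. h (v i) x = 0)"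
proof (rule ccontr)
 assume contra: "\<not> ?thesis"
 define W where "W = {x\<in>M. ALL i:I. h (v i) x = 0}"
 have iso: "h x x = 0" if "x : W" for x using contra that unfolding W_def by auto
 have W: "h x y = 0" if "x : W" "y : W" for x y
  by (rule isotropic_zero[OF _ _ _ iso that])
    (use orthD[OF o] in \<open>auto simp: W_def M_add M_act h_add h_act\<close>)
 obtain x where x: "x : M" "x ~= (\<Sum>i\<in>I. act (v i) (dinv (h (v i) (v i)) * h (v i) x))"
  using nb o unfolding basis_def by auto
 let ?p = "\<lambda>x. (\<Sum>i\<in>I. act (v i) (dinv (h (v i) (v i)) * h (v i) x))"
 have pM: "?p y : M" if "y : M" for y using that orthD[OF o] orth_coeff_closed[OF o] by (intro M_sum M_act) auto
 have r: "y - ?p y : W" if "y : M" for y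
  using orth_residual[OF o that] M_diff pM that unfolding W_def by auto
 have "x - ?p x = 0"
 proof (rule nondeg)
  show "x - ?p x : M" using M_diff pM x by auto
  fix w assume w: "w : M"
  have rW: "x - ?p x : W" using r x by auto
  then have rM: "x - ?p x : M" by (auto simp: W_def)
  have perp: "h (x - ?p x) (v i) = 0" if "i : I" for i
   using rW h_star[of "v i" "x - ?p x"] orthD[OF o] that rM by (auto simp: W_def)
  have "h (x - ?p x) (?p w) = 0"
   using perp orthD[OF o] orth_coeff_closed[OF o] w rM
   by (subst h_sum_right) (auto intro!: M_act sum.neutral simp: h_act)
  moreover have "h (x - ?p x) (w - ?p w) = 0" using W rW r w by auto
  ultimately show "h (x - ?p x) w = 0" using h_diff_right[OF rM w pM[OF w]] by simp
 qed
 then show False using x by simp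
qed

lemma orth_card_bound: "EX N. ALL (I::nat set) v. orth I v --> card I \<le> N"
proof -
 obtain N :: nat where N: "!!v::nat => 'm. (ALL i<=N. v i : M) -->
    (EX c. (ALL i<=N. c i : D) \<and> (EX i<=N. c i ~= 0) \<and> (\<Sum>i\<le>N. act (v i) (c i)) = 0)"
  using fin_dim unfolding finite_dim_def by auto
 have "card I \<le> N" if o: "orth I v" for I :: "nat set" and v
 proof (rule ccontr)
  assume "\<not> card I \<le> N"
  then obtain J where J: "J \<subseteq> I" "card J = Suc N" "finite J"
   by (metis not_less_eq_eq obtain_subset_with_card_n)
  then obtain p where p: "bij_betw p {..N} J"
   by (metis bij_betw_iff_card card_atMost finite_atMost)
  have o': "orth {..N} (v \<circ> p)" using orth_reindex[OF orth_subset[OF o J(1)] p] .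
  from N[of "v \<circ> p"] orthD(2)[OF o'] obtain c where
   "ALL i<=N. c i : D" "EX i<=N. c i ~= 0" "(\<Sum>i\<le>N. act ((v \<circ> p) i) (c i)) = 0" by auto
  then show False using orth_indep[OF o', of c] by auto
 qed
 then show ?thesis by auto
qed

text \<open>A longest orthogonal family extending the given one is a basis. Indexing by natural
  numbers guarantees a fresh index for an added vector.\<close>

theorem orth_extend_basis: assumes o: "orth (I::nat set) v"
 shows "EX J w. I \<subseteq> J \<and> basis (J::nat set) w \<and> (ALL i:I. w i = v i)"
proof -
 obtain N where N: "!!(I::nat set) v. orth I v ==> card I \<le> N" using orth_card_bound by blast
 define P where "P n \<longleftrightarrow> (EX J w. I \<subseteq> J \<and> orth (J::nat set) w \<and> (ALL i:I. w i = v i) \<and> card J = n)" for n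
 have "P (card I)" unfolding P_def using o by auto
 moreover have "ALL n. P n --> n \<le> N" unfolding P_def using N by auto
 ultimately obtain n where n: "P n" "ALL m. P m --> m \<le> n"
  by (metis GreatestI_nat Greatest_le_nat)
 then obtain J w where J: "I \<subseteq> J" "orth (J::nat set) w" "ALL i:I. w i = v i" "card J = n" unfolding P_def by auto
 have "basis J w"
 proof (rule ccontr)
  assume "\<not> basis J w"
  then obtain x where x: "x : M" "h x x ~= 0" "ALL i:J. h (w i) x = 0" using orth_extend_one J by blast
  obtain k where k: "k \<notin> J" using orthD(1)[OF J(2)] ex_new_if_finite infinite_UNIV_nat by blast
  have x': "ALL i:J. h x (w i) = 0" using x orthD[OF J(2)] h_star by (metis star_zero)
  have eq: "(if i = k then x else w i) = w i" if "i : J" for i using that k by auto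
  have "orth (insert k J) (\<lambda>i. if i = k then x else w i)"
   using x x' k J(2) unfolding orth_def by (simp add: eq)
  moreover have "card (insert k J) = Suc n" using k J(4) orthD(1)[OF J(2)] by auto
  ultimately have "P (Suc n)" unfolding P_def using J k
   by (intro exI[of _ "insert k J"] exI[of _ "\<lambda>i. if i = k then x else w i"]) auto
  then show False using n by force
 qed
 then show ?thesis using J by auto
qed

corollary ex_basis: "EX J w. basis (J::nat set) w"
 using orth_extend_basis[of "{}"] unfolding orth_def by blast

lemma basis_dependent:
 assumes "basis I v" "finite J" "card I < card J" "!!j. j : J ==> w j : M"
 shows "EX c. (ALL j:J. c j : D) \<and> (EX j:J. c j ~= 0) \<and> (\<Sum>j\<in>J. act (w j) (c j)) = 0"
 using assms basis_orth[OF assms(1)]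
 by (intro span_dependent[where U = "\<lambda>i j. dinv (h (v i) (v i)) * h (v i) (w j)"])
   (auto simp: orthD orth_coeff_closed basis_def)

lemma basis_card_ge: assumes "basis I v" "orth J w" shows "card J \<le> card I"
 using basis_dependent[OF assms(1), of J w] orth_indep[OF assms(2)] orthD[OF assms(2)]
 by (metis not_le_imp_less)

lemma orth_card_le: assumes "spanning I b" "orth J w" shows "card J \<le> card I"
 using spanning_dependent[OF assms(1), of J w] orth_indep[OF assms(2)] orthD[OF assms(2)]
 by (metis not_le_imp_less)

text \<open>A missing vector could be adjoined under the index \<open>None\<close>, giving an
  orthogonal family longer than a spanning one.\<close>

lemma basis_if_spanning: assumes "spanning I b" "orth J w" "card I \<le> card J" shows "basis J w"
proof (rule ccontr)
 assume "\<not> basis J w"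
 then obtain x where x: "x : M" "h x x ~= 0" "ALL i:J. h (w i) x = 0" using orth_extend_one assms by blast
 have x': "ALL i:J. h x (w i) = 0" using x orthD[OF assms(2)] h_star by (metis star_zero)
 have "orth (insert None (Some ` J)) (\<lambda>i. case i of None => x | Some i => w i)"
  using x x' assms(2) unfolding orth_def by auto
 from orth_card_le[OF assms(1) this] show False
  using assms(3) orthD(1)[OF assms(2)] by (simp add: card_insert_if card_image)
qed

lemma basis_spanning: assumes "basis I v" shows "spanning I v"
 unfolding spanning_def
proof (intro conjI ballI)
 note o = orthD[OF basis_orth[OF assms]]
 show "finite I" "!!i. i : I ==> v i : M" using o by auto
 fix x assume x: "x : M"
 let ?k = "\<lambda>i. dinv (h (v i) (v i)) * h (v i) x"
 have "x = (\<Sum>i\<in>I. act (v i) (?k i))" using assms x unfolding basis_def by blast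
 moreover have "ALL i:I. ?k i : D" using orth_coeff_closed[OF basis_orth[OF assms] _ x] by blast
 ultimately show "EX k. (ALL i:I. k i : D) \<and> x = (\<Sum>i\<in>I. act (v i) (k i))"
  by (intro exI[of _ ?k] conjI)
qed

lemma basis_if_card: "basis I v ==> orth J w ==> card I \<le> card J ==> basis J w"
 using basis_if_spanning basis_spanning by blast

text \<open>The quasi-reflection along \<open>x - y\<close> or along \<open>x + y\<close> moves \<open>x\<close> to \<open>y\<close> or to \<open>- y\<close>.\<close>

lemma quasi_reflection:
 assumes s: "s : M" and x: "x : M" and nz: "h s x ~= 0" and eq: "h s s = h s x + h x s"
 defines "\<rho> \<equiv> \<lambda>v. v - act s (dinv (h s x) * h s v)"
 shows "\<rho> x = x - s" "v : M ==> \<rho> v : M" "v : M ==> w : M ==> h (\<rho> v) (\<rho> w) = h v w"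
proof -
 let ?c = "dinv (h s x)"
 have a: "h s x : D" using s x h_closed by auto
 have c: "?c : D" "\<sigma> ?c : D" using dinv_closed a nz star_closed by auto
 show "\<rho> x = x - s" using a nz dinv_left s act_e by (simp add: \<rho>_def)
 have cM: "?c * h s v : D" if "v : M" for v using that c s h_closed mult_closed by auto
 show "v : M ==> \<rho> v : M" unfolding \<rho>_def using cM s M_act M_diff by auto
 \<comment> \<open>The hypothesis \<open>eq\<close> on \<open>h s s\<close>, divided on both sides
   by \<open>h s x\<close>, becomes this identity; it cancels the two linear correction terms in
   \<open>h (\<rho> v) (\<rho> w)\<close>.\<close>
 have key: "\<sigma> ?c * h s s * ?c = ?c + \<sigma> ?c"
 proof -
  have "\<sigma> ?c * h x s = e" using a nz x s h_star[of s x] by (metis dinv_right star_e star_mult)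
  then show ?thesis using eq a c nz dinv_right e_left e_right
   by (simp add: distrib_left distrib_right mult.assoc)
 qed
 assume v: "v : M" and w: "w : M"
 have av: "act s (?c * h s v) : M" "act s (?c * h s w) : M" using cM v w s M_act by auto
 have "h (\<rho> v) (\<rho> w) = h v w - h v s * (?c * h s w) - \<sigma> (?c * h s v) * h s w
   + \<sigma> (?c * h s v) * h s s * (?c * h s w)"
  unfolding \<rho>_def using v w s av cM
  by (simp add: h_diff_left h_diff_right M_diff h_act h_act_left mult.assoc algebra_simps)
 also have "\<sigma> (?c * h s v) = h v s * \<sigma> ?c" using v s h_star by (simp add: star_mult)
 also have "h v s * \<sigma> ?c * h s s * (?c * h s w) = h v s * (\<sigma> ?c * h s s * ?c) * h s w"
  by (simp add: mult.assoc)
 finally show "h (\<rho> v) (\<rho> w) = h v w" unfolding key by (simp add: algebra_simps)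
qed

lemma witt_move:
 assumes x: "x : M" and y: "y : M" and eq: "h x x = h y y" and nz: "h x x ~= 0"
 obtains \<rho> where "\<rho> x = y \<or> \<rho> x = - y" "!!v. v : M ==> \<rho> v : M"
  "!!v w. v : M ==> w : M ==> h (\<rho> v) (\<rho> w) = h v w"
proof (cases "h (x - y) x = 0")
 case False
 have "h (x - y) (x - y) = h (x - y) x + h x (x - y)"
  using x y eq by (simp add: h_diff_left h_diff_right M_diff)
 from quasi_reflection[OF M_diff[OF x y] x False this] show ?thesis
  by (intro that[of "\<lambda>v. v - act (x - y) (dinv (h (x - y) x) * h (x - y) v)"]) auto
next
 case True
 \<comment> \<open>Orthogonality of \<open>x - y\<close> to \<open>x\<close> gives
   \<open>h y x = h x x\<close>, so \<open>h (x + y) x\<close> is twice \<open>h x x\<close> and the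
   reflection along the sum applies.\<close>
 then have "h (x + y) x = h x x + h x x" using x y by (simp add: h_diff_left h_add_left)
 then have nz': "h (x + y) x ~= 0" using nz x h_closed add_self_nz by simp
 have "h (x + y) (x + y) = h (x + y) x + h x (x + y)"
  using x y eq by (simp add: h_add_left h_add M_add add.assoc add.commute add.left_commute)
 from quasi_reflection[OF M_add[OF x y] x nz' this] show ?thesis
  by (intro that[of "\<lambda>v. v - act (x + y) (dinv (h (x + y) x) * h (x + y) v)"]) auto
qed

end

section \<open>Orderings detected by Witt-type predicates\<close>

text \<open>\<open>pfister zs M\<close> represents the form \<open>\<langle>1, z\<^sub>1\<rangle> \<otimes> \<dots> \<otimes> \<langle>1, z\<^sub>k\<rangle> \<otimes> M\<close>.\<close>

fun pfister :: "'a::ring_1 list => 'a multiset => 'a multiset" where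
 "pfister [] M = M"
| "pfister (z # zs) M = pfister zs M + image_mset ((*) z) (pfister zs M)"

text \<open>Commutativity comes from \<open>\<sigma>\<close>: it reverses products and fixes
  \<open>K\<close> pointwise.\<close>

locale sfield = star_div K e \<sigma> for K :: "'a::ring_1 set" and e \<sigma> +
 assumes star_id: "x : K ==> \<sigma> x = x"
begin

lemma comm: "x : K ==> y : K ==> x * y = y * x"
 by (metis star_id mult_closed star_mult)

lemma comm3: "x : K ==> y : K ==> x * (y * z) = y * (x * z)"
 using comm[of x y] by (metis mult.assoc)

definition units :: "'a set" where "units = K - {0}"

lemma units: "x : units ==> x : K" "x : units ==> x ~= 0"
 by (auto simp: units_def)

lemma unitsI: "x : K ==> x ~= 0 ==> x : units"
 by (auto simp: units_def)

lemma units_mult [simp]: "x : units ==> y : units ==> x * y : units"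
 using mult_closed mult_nz by (auto simp: units_def)

lemma units_neg [simp]: "x : units ==> - x : units"
 using neg_closed by (auto simp: units_def)

lemma units_e [simp]: "e : units"
 using e_closed e_nz by (auto simp: units_def)

lemma units_image: "set_mset M \<subseteq> units ==> z : units ==> set_mset (image_mset ((*) z) M) \<subseteq> units"
 using units_mult by auto

lemma units_image' [simp]:
 "A \<subseteq> units ==> z : units ==> (*) z ` A \<subseteq> units" "A \<subseteq> units ==> uminus ` A \<subseteq> units"
 "A \<subseteq> units ==> z : units ==> (\<lambda>x. - (z * x)) ` A \<subseteq> units"
 using units_mult units_neg by auto

lemma pfister_units: "set_mset M \<subseteq> units ==> set zs \<subseteq> units ==> set_mset (pfister zs M) \<subseteq> units"
 by (induction zs) (auto intro!: units_mult)

lemma image_mult_swap: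
 assumes "set_mset M \<subseteq> K" "x : K" "y : K"
 shows "image_mset ((*) x) (image_mset ((*) y) M) = image_mset ((*) y) (image_mset ((*) x) M)"
 using assms by (auto simp: multiset.map_comp comp_def intro!: image_mset_cong comm3)

lemma pfister_K: "set_mset M \<subseteq> K ==> set zs \<subseteq> K ==> set_mset (pfister zs M) \<subseteq> K"
 by (induction zs) (auto intro!: mult_closed)

lemma pfister_remove:
 "set_mset M \<subseteq> K ==> set zs \<subseteq> K ==> y : set zs ==> pfister zs M = pfister (y # remove1 y zs) M"
proof (induction zs)
 case (Cons z zs)
 show ?case
 proof (cases "z = y")
  case False
  then have y: "y : set zs" using Cons by auto
  then have IH: "pfister zs M = pfister (y # remove1 y zs) M" using Cons by auto
  have "set_mset (pfister (remove1 y zs) M) \<subseteq> K"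
   using Cons set_remove1_subset[of y zs] by (intro pfister_K) auto
  moreover have "z : K" "y : K" using Cons y by auto
  ultimately have "image_mset ((*) z) (image_mset ((*) y) (pfister (remove1 y zs) M))
    = image_mset ((*) y) (image_mset ((*) z) (pfister (remove1 y zs) M))"
   by (rule image_mult_swap)
  then show ?thesis using False IH by simp
 qed simp
qed simp

lemma pfister_cong:
 "set_mset M \<subseteq> K ==> set zs \<subseteq> K ==> mset zs = mset ws ==> pfister zs M = pfister ws M"
proof (induction zs arbitrary: ws)
 case (Cons z zs)
 have z: "z : set ws" using Cons.prems(3) by (metis list.set_intros(1) set_mset_mset)
 have ws: "set ws \<subseteq> K" using Cons.prems by (metis set_mset_mset)
 have "mset zs = mset (remove1 z ws)" using Cons.prems(3) by (simp flip: Cons.prems(3))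
 then have "pfister zs M = pfister (remove1 z ws) M" using Cons by auto
 then show ?case using pfister_remove[OF Cons.prems(1) ws z] by simp
qed simp

end

definition ordering_on :: "'a::ring_1 set => 'a set => bool" where
 "ordering_on K \<P> \<longleftrightarrow> \<P> \<subseteq> K \<and> (ALL x:\<P>. ALL y:\<P>. x + y : \<P>) \<and> (ALL x:\<P>. ALL y:\<P>. x * y : \<P>) \<and>
   (ALL x:K. x : \<P> \<or> - x : \<P>) \<and> (ALL x:\<P>. - x : \<P> --> x = 0)"

lemma ordering_onD: assumes "ordering_on K \<P>"
 shows "\<P> \<subseteq> K" "x : \<P> ==> y : \<P> ==> x + y : \<P>" "x : \<P> ==> y : \<P> ==> x * y : \<P>" "x : K ==> x : \<P> \<or> - x : \<P>"
  "x : \<P> ==> - x : \<P> ==> x = 0"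
 using assms unfolding ordering_on_def by blast+

lemma ordering_char0: assumes "ordering_on (UNIV :: 'f::field set) T" shows "of_nat (Suc n) ~= (0::'f)"
proof -
 have T: "!!x y. x : T ==> y : T ==> x + y : T" "!!x y. x : T ==> y : T ==> x * y : T" "!!x. x : T \<or> - x : T"
  "!!x. x : T ==> - x : T ==> x = 0" using assms unfolding ordering_on_def by blast+
 have one: "1 : T" using T(3)[of 1] T(2)[of "- 1" "- 1"] by auto
 have "of_nat m : T" for m
 proof (induction m)
  case 0
  show ?case using T(3)[of 0] by simp
 next
  case (Suc m)
  then show ?case using T(1)[OF one] by simp
 qed
 then show ?thesis using T(4)[OF one] by (metis add_eq_0_iff of_nat_Suc one_neq_zero)
qed

text \<open>\<open>Z M\<close> is to be thought of as: the form \<open>M\<close> vanishes in some torsion-free quotient of a Witt group.\<close>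

locale witt_pred = sfield K e \<sigma> for K :: "'a::ring_1 set" and e \<sigma> +
 fixes Z :: "'a multiset => bool"
 assumes Z_add: "set_mset M \<subseteq> units ==> set_mset N \<subseteq> units ==> Z M ==> Z N ==> Z (M + N)"
  and Z_cancel: "set_mset M \<subseteq> units ==> set_mset N \<subseteq> units ==> Z (M + N) ==> Z N ==> Z M"
  and Z_double: "set_mset M \<subseteq> units ==> Z (M + M) ==> Z M"
  and Z_hyp: "z : units ==> Z {#z, - z#}"
  and Z_square: "x : units ==> z : units ==> Z {#x * x * z, - z#}"
  and Z_exchange: "x : units ==> y : units ==> x + y : units ==>
   Z {#x, y, - (x + y), - (x * y * (x + y))#}"
begin

abbreviation neg :: "'a multiset => 'a multiset" where "neg M \<equiv> image_mset uminus M"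
abbreviation times_mset :: "'a => 'a multiset => 'a multiset" (infixr "\<cdot>" 70)
 where "z \<cdot> M \<equiv> image_mset ((*) z) M"

lemma Z_empty: "Z {#}"
 by (rule Z_cancel[of "{#}" "{#e, - e#}"]) (simp_all add: Z_hyp)

lemma units_negM: "set_mset M \<subseteq> units ==> set_mset (neg M) \<subseteq> units"
 using units_neg by auto

lemma Z_pointwise: assumes "set_mset M \<subseteq> units" "!!x. x \<in># M ==> f x : units \<and> g x : units \<and> Z {#f x, - g x#}"
 shows "Z (image_mset f M + neg (image_mset g M))"
 using assms
proof (induction M)
 case (add x M)
 have "Z ({#f x, - g x#} + (image_mset f M + neg (image_mset g M)))"
 proof (rule Z_add)
  show "Z (image_mset f M + neg (image_mset g M))" using add by simp
 qed (use add in \<open>auto simp: image_subset_iff\<close>)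
 then show ?case by (simp add: add_mset_commute)
qed (simp add: Z_empty)

lemma Z_hypM: "set_mset M \<subseteq> units ==> Z (M + neg M)"
 using Z_pointwise[of M "\<lambda>x. x" "\<lambda>x. x"] Z_hyp by (auto simp: subset_iff)

lemma Z_swap: assumes "set_mset A \<subseteq> units" "set_mset B \<subseteq> units" "set_mset L \<subseteq> units"
  and "Z (A + neg B)" "Z (A + L)"
 shows "Z (B + L)"
proof -
 have "Z ((B + L) + (A + neg B))"
  using Z_add[OF _ _ assms(5) Z_hypM[OF assms(2)]] assms(1-3) units_negM[OF assms(2)] by (simp add: ac_simps)
 then show ?thesis by (rule Z_cancel[rotated 2, OF _ assms(4)]) (use assms(1-3) in simp_all)
qed

lemma Z_pointwise4: assumes "set_mset M \<subseteq> units"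
  "!!x. x \<in># M ==> a x : units \<and> b x : units \<and> c x : units \<and> d x : units \<and> Z {#a x, b x, - c x, - d x#}"
 shows "Z (image_mset a M + image_mset b M + neg (image_mset c M) + neg (image_mset d M))"
 using assms
proof (induction M)
 case (add x M)
 have "Z ({#a x, b x, - c x, - d x#} + (image_mset a M + image_mset b M + neg (image_mset c M) + neg (image_mset d M)))"
 proof (rule Z_add)
  show "Z (image_mset a M + image_mset b M + neg (image_mset c M) + neg (image_mset d M))" using add by simp
 qed (use add in \<open>auto simp: image_subset_iff\<close>)
 then show ?case by (simp add: add_mset_commute)
qed (simp add: Z_empty)

lemma Z_squares: assumes "set_mset M \<subseteq> units" "a : units" "x : units"
 shows "Z ((a * (x * x)) \<cdot> M + neg (a \<cdot> M))"
proof (rule Z_pointwise[OF assms(1)])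
 fix m assume "m \<in># M"
 then have m: "m : units" using assms by auto
 have "a * (x * x) * m = x * x * (a * m)" using comm3[of a "x * x" m] units(1) mult_closed m assms by (metis mult.assoc)
 then show "(a * (x * x)) * m : units \<and> a * m : units \<and> Z {#(a * (x * x)) * m, - (a * m)#}"
  using Z_square[of x "a * m"] units_mult m assms by metis
qed

lemma Z_exchanges: assumes "set_mset M \<subseteq> units" "a : units" "x : units" "y : units" "x + y : units"
 shows "Z ((a * x) \<cdot> M + (a * y) \<cdot> M + neg ((a * (x + y)) \<cdot> M) + neg ((a * (x * y * (x + y))) \<cdot> M))"
proof (rule Z_pointwise4[OF assms(1)])
 fix m assume "m \<in># M"
 then have m: "m : units" using assms by auto
 let ?a = "a * m" and ?w = "x * y * (x + y)"
 have a: "?a : units" and w: "?w : units" using m assms units_mult by auto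
 have k: "a : K" "m : K" "x : K" "y : K" "x + y : K" using units(1) m assms by blast+
 note [simp] = k mult_closed
 have e1: "?a * x + ?a * y = ?a * (x + y)" by (simp add: distrib_left)
 have e2: "?a * x * (?a * y) * (?a * (x + y)) = ?a * ?a * (?a * ?w)"
  by (simp add: mult.assoc comm comm3)
 have "Z {#?a * x, ?a * y, - (?a * (x + y)), - (?a * ?a * (?a * ?w))#}"
  using Z_exchange[of "?a * x" "?a * y"] a assms unfolding e1 e2 by simp
 then have "Z ({#?a * x, ?a * y, - (?a * (x + y)), - (?a * ?a * (?a * ?w))#} + {#?a * ?a * (?a * ?w), - (?a * ?w)#})"
  using Z_square[OF a units_mult[OF a w]] a w assms by (intro Z_add) simp_all
 then have "Z ({#?a * x, ?a * y, - (?a * (x + y)), - (?a * ?w)#} + {#?a * ?a * (?a * ?w), - (?a * ?a * (?a * ?w))#})"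
  by (simp add: add_mset_commute)
 then have Z: "Z {#?a * x, ?a * y, - (?a * (x + y)), - (?a * ?w)#}"
  by (rule Z_cancel[rotated 2, OF _ Z_hyp]) (use a w assms in simp_all)
 have c: "a * t * m = ?a * t" if "t : K" for t using comm[OF k(2) that] by (simp add: mult.assoc)
 show "(a * x) * m : units \<and> (a * y) * m : units \<and> (a * (x + y)) * m : units \<and> (a * ?w) * m : units \<and>
   Z {#(a * x) * m, (a * y) * m, - ((a * (x + y)) * m), - ((a * ?w) * m)#}"
  using Z a w assms c by simp
qed

lemma neg_times: "neg (z \<cdot> M) = (- z) \<cdot> M" "neg (z \<cdot> M) = z \<cdot> neg M"
 unfolding multiset.map_comp comp_def by (intro image_mset_cong, simp)+

lemma times_times: "x \<cdot> (y \<cdot> M) = (x * y) \<cdot> M"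
 unfolding multiset.map_comp comp_def by (intro image_mset_cong) (simp add: mult.assoc)

end

section \<open>Orderings from maximal sets of Pfister entries\<close>

locale witt_pred_form = witt_pred +
 fixes M\<^sub>0 assumes M0: "set_mset M\<^sub>0 \<subseteq> units" and nZ: "\<not> Z M\<^sub>0"
begin

text \<open>All scalings \<open>z\<close> are quantified because adjoining an entry splits the
  Pfister product into two scaled copies: badness thus survives any further entry.\<close>

definition bad :: "'a list => bool" where
 "bad zs \<longleftrightarrow> (ALL z:units. Z (z \<cdot> pfister zs M\<^sub>0))"

lemma M0_K: "set_mset M\<^sub>0 \<subseteq> K"
 using M0 units by auto

lemma not_bad_Nil: "\<not> bad []"
proof
 assume "bad []"
 then have "Z (e \<cdot> M\<^sub>0)" using units_e unfolding bad_def by auto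
 moreover have "e \<cdot> M\<^sub>0 = image_mset (\<lambda>x. x) M\<^sub>0" using M0_K e_left by (intro image_mset_cong) auto
 ultimately show False using nZ by simp
qed

lemma pf_units: "set zs \<subseteq> units ==> set_mset (pfister zs M\<^sub>0) \<subseteq> units"
 using pfister_units[OF M0] .

lemma bad_Cons: assumes "bad zs" "set zs \<subseteq> units" "g : units" shows "bad (g # zs)"
 unfolding bad_def
proof
 fix z assume z: "z : units"
 have "Z (z \<cdot> pfister zs M\<^sub>0 + (z * g) \<cdot> pfister zs M\<^sub>0)"
  using assms z pf_units[OF assms(2)] unfolding bad_def by (intro Z_add) auto
 then show "Z (z \<cdot> pfister (g # zs) M\<^sub>0)" by (simp add: times_times)
qed

lemma bad_cong: "bad zs ==> set zs \<subseteq> units ==> mset zs = mset ws ==> bad ws"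
 using pfister_cong[OF M0_K, of zs ws] units unfolding bad_def by (auto simp: subset_iff)

lemma bad_append: "bad zs ==> set zs \<subseteq> units ==> set gs \<subseteq> units ==> bad (gs @ zs)"
 by (induction gs) (auto intro!: bad_Cons)

text \<open>Up to squares, the factor \<langle>1, y\<rangle> times itself is twice that factor;
  \<open>Z_double\<close> removes the two.\<close>

lemma bad_dup: assumes "bad (y # y # zs)" "set (y # zs) \<subseteq> units" shows "bad (y # zs)"
 unfolding bad_def
proof
 fix z assume z: "z : units"
 let ?P = "pfister zs M\<^sub>0" and ?Q = "pfister (y # zs) M\<^sub>0"
 have P: "set_mset ?P \<subseteq> units" using pf_units assms by auto
 have y: "y : units" using assms by auto
 have "Z ((z * (y * y)) \<cdot> ?P + neg (z \<cdot> ?P))"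
 proof (rule Z_pointwise[OF P])
  fix x assume "x \<in># ?P"
  then have x: "x : units" using P by auto
  have "z * (y * y) * x = y * y * (z * x)" using comm3[of "z" "y * y" x] units(1) mult_closed y z by (metis mult.assoc)
  then show "(z * (y * y)) * x : units \<and> z * x : units \<and> Z {#(z * (y * y)) * x, - (z * x)#}"
   using x y z Z_square[of y "z * x"] units_mult by (metis)
 qed
 moreover have "Z ((z * (y * y)) \<cdot> ?P + (z \<cdot> ?P + (z * y) \<cdot> ?P + (z * y) \<cdot> ?P))"
  using assms(1) z unfolding bad_def by (simp add: times_times ac_simps)
 ultimately have "Z (z \<cdot> ?P + (z \<cdot> ?P + (z * y) \<cdot> ?P + (z * y) \<cdot> ?P))"
  by (intro Z_swap[of "(z * (y * y)) \<cdot> ?P" "z \<cdot> ?P"]) (use P y z in simp_all)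
 then have "Z (z \<cdot> ?Q + z \<cdot> ?Q)" by (simp add: times_times ac_simps)
 then show "Z (z \<cdot> ?Q)"
  by (rule Z_double[rotated]) (use pf_units[of "y # zs"] z assms in simp)
qed

lemma bad_replicate: "bad (replicate (Suc n) y @ zs) ==> set (y # zs) \<subseteq> units ==> bad (y # zs)"
proof (induction n)
 case (Suc n)
 from Suc.prems show ?case using bad_dup[of y "replicate n y @ zs"] Suc.IH by (auto simp: subset_iff)
qed simp

text \<open>All copies of \<open>y\<close> collapse into one, so a bad list over
  \<open>insert y G\<close> yields a bad list with a single \<open>y\<close> in front of entries
  from \<open>G\<close>.\<close>

lemma bad_filter: assumes "bad zs" "set zs \<subseteq> units" "y : units" shows "bad (y # filter (\<lambda>x. x ~= y) zs)"
proof -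
 have "mset (y # zs) = mset (replicate (Suc (count (mset zs) y)) y @ filter (\<lambda>x. x ~= y) zs)"
  by (rule multiset_eqI) (auto simp: count_mset_gt_0 not_in_iff)
 then show ?thesis
  using bad_cong[OF bad_Cons[OF assms]] assms by (intro bad_replicate[of "count (mset zs) y"]) auto
qed

lemma Z_add4:
 assumes "Z A" "Z B" "Z C" "Z D"
  "set_mset A \<subseteq> units" "set_mset B \<subseteq> units" "set_mset C \<subseteq> units" "set_mset D \<subseteq> units"
 shows "Z (A + B + C + D)"
 by (rule Z_add[OF _ _ Z_add[OF _ _ Z_add[OF _ _ assms(1,2)] assms(3)] assms(4)]) (use assms in simp_all)

text \<open>The four entries \<open>1, y, - y, - (y * y)\<close> cancel in pairs up to a
  square.\<close>

lemma bad_neg: assumes y: "y : units" shows "bad [- y, y]"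
 unfolding bad_def
proof
 fix z assume z: "z : units"
 have A: "Z ((- (z * (y * y))) \<cdot> M\<^sub>0 + z \<cdot> M\<^sub>0)"
  using Z_squares[OF M0 units_neg[OF z] y] by (simp add: neg_times(1))
 have B: "Z ((z * y) \<cdot> M\<^sub>0 + (- (z * y)) \<cdot> M\<^sub>0)"
  using Z_hypM[of "(z * y) \<cdot> M\<^sub>0"] M0 z y by (simp add: neg_times(1))
 have "Z ((- (z * (y * y))) \<cdot> M\<^sub>0 + z \<cdot> M\<^sub>0 + ((z * y) \<cdot> M\<^sub>0 + (- (z * y)) \<cdot> M\<^sub>0))"
  by (rule Z_add[OF _ _ A B]) (use M0 z y in simp_all)
 then show "Z (z \<cdot> pfister [- y, y] M\<^sub>0)" by (simp add: times_times neg_times ac_simps)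
qed

text \<open>The Pfister form with entries \<open>x\<close>, \<open>y\<close> is unchanged by scaling
  with its value \<open>x + y\<close>. Concretely, the exchange relation scaled by \<open>z\<close>
  and by \<open>- z * (x + y)\<close>, together with two square relations, contains all eight
  required entries; what is left over, \<open>?R\<close> and \<open>?Q\<close>, is
  hyperbolic.\<close>

lemma bad_sum: assumes u: "x : units" "y : units" and s: "x + y : units" shows "bad [- (x + y), x, y]"
 unfolding bad_def
proof
 fix z assume z: "z : units"
 let ?s = "x + y"
 have k: "x : K" "y : K" "?s : K" "z : K" using units(1) u s z by blast+
 have zs: "z * ?s : units" using z s units_mult by auto
 have mu: "set_mset (a \<cdot> M\<^sub>0) \<subseteq> units" if "a : units" for a using that units_image M0 by auto
 have A: "Z ((z * x) \<cdot> M\<^sub>0 + (z * y) \<cdot> M\<^sub>0 + neg ((z * ?s) \<cdot> M\<^sub>0) + neg ((z * (x * y * ?s)) \<cdot> M\<^sub>0))" (is "Z ?A")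
  by (rule Z_exchanges[OF M0 z u s])
 have B: "Z (((- z) * ?s * x) \<cdot> M\<^sub>0 + ((- z) * ?s * y) \<cdot> M\<^sub>0 + neg (((- z) * ?s * ?s) \<cdot> M\<^sub>0) + neg (((- z) * ?s * (x * y * ?s)) \<cdot> M\<^sub>0))" (is "Z ?B")
  using Z_exchanges[OF M0 _ u s, of "(- z) * ?s"] z s by simp
 have C: "Z (((- z) * (?s * ?s)) \<cdot> M\<^sub>0 + neg ((- z) \<cdot> M\<^sub>0))" (is "Z ?C")
  using Z_squares[OF M0 units_neg[OF z] s] .
 have D: "Z (((- z) * (x * y) * (?s * ?s)) \<cdot> M\<^sub>0 + neg (((- z) * (x * y)) \<cdot> M\<^sub>0))" (is "Z ?D")
  using Z_squares[OF M0 units_mult[OF units_neg[OF z] units_mult[OF u]] s] by (simp add: mult.assoc)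
 let ?f = "\<lambda>a. a \<cdot> M\<^sub>0"
 have c1: "x * (y * ?s) = ?s * (x * y)" using comm[of "x * y" ?s] k mult_closed by (simp add: mult.assoc)
 have c2: "x * (y * (?s * ?s)) = ?s * (?s * (x * y))" using comm[of "x * y" "?s * ?s"] k mult_closed by (simp add: mult.assoc)
 let ?W = "?f z + ?f (z * y) + ?f (z * x) + ?f (z * (x * y)) + ?f (- (z * ?s)) + ?f (- (z * (?s * y)))
  + ?f (- (z * (?s * x))) + ?f (- (z * (?s * (x * y))))"
 let ?R = "?f (z * (?s * ?s)) + ?f (- (z * (?s * ?s)))" and ?Q = "?f (z * (?s * (?s * (x * y)))) + ?f (- (z * (?s * (?s * (x * y)))))"
 have Ru: "set_mset ?R \<subseteq> units" "set_mset ?Q \<subseteq> units" and Wu: "set_mset ?W \<subseteq> units"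
  using M0 z u s by simp_all
 have hyp: "Z (?f a + ?f (- a))" if "a : units" for a using Z_hypM[OF mu[OF that]] by (simp add: neg_times)
 have "Z (?A + ?B + ?C + ?D)"
  by (rule Z_add4[OF A B C D]) (use M0 z u s in simp_all)
 then have "Z (?W + (?R + ?Q))"
  by (simp add: neg_times(1) mult.assoc c1 c2 minus_mult_left[symmetric] ac_simps)
 moreover have "Z (?R + ?Q)" using Ru hyp z u s by (intro Z_add[of "?f a + ?f b" for a b]) simp_all
 ultimately have "Z ?W" by (rule Z_cancel[rotated 2]) (use Wu Ru in simp_all)
 then show "Z (z \<cdot> pfister [- ?s, x, y] M\<^sub>0)"
  by (simp add: times_times mult.assoc ac_simps del: minus_add_distrib)
qed

text \<open>The eight entries pair off: each of \<open>1\<close>, \<open>x\<close>, \<open>y\<close>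
  cancels against its negative times a square, and \<open>x * y\<close> against
  \<open>- (x * y)\<close>.\<close>

lemma bad_mult: assumes u: "x : units" "y : units" shows "bad [- (x * y), x, y]"
 unfolding bad_def
proof
 fix z assume z: "z : units"
 have k: "x : K" "y : K" "z : K" using units(1) u z by blast+
 have mu: "set_mset (a \<cdot> M\<^sub>0) \<subseteq> units" if "a : units" for a using that units_image M0 by auto
 let ?f = "\<lambda>a. a \<cdot> M\<^sub>0"
 have hyp: "Z (?f a + ?f (- a))" if "a : units" for a using Z_hypM[OF mu[OF that]] M0 by (simp add: neg_times)
 have A: "Z (?f ((- (z * x)) * (y * y)) + neg (?f (- (z * x))))" (is "Z ?A")
  using Z_squares[OF M0 _ u(2)] z u units_mult units_neg by blast
 have B: "Z (?f ((- (z * y)) * (x * x)) + neg (?f (- (z * y))))" (is "Z ?B")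
  using Z_squares[OF M0 _ u(1)] z u units_mult units_neg by blast
 have C: "Z (?f ((- z) * ((x * y) * (x * y))) + neg (?f (- z)))" (is "Z ?C")
  using Z_squares[OF M0 _ units_mult[OF u]] z units_neg by blast
 have D: "Z (?f (z * (x * y)) + ?f (- (z * (x * y))))" (is "Z ?D") using hyp z u units_mult by blast
 have c: "x * (y * x) = y * (x * x)" using comm3[of x y x] k by simp
 have "Z (?A + ?B + ?C + ?D)"
  by (rule Z_add4[OF A B C D]) (use M0 z u in simp_all)
 then have "Z (?f z + ?f (z * y) + ?f (z * x) + ?f (z * (x * y)) + ?f (- (z * (x * y))) + ?f (- (z * (x * (y * y))))
  + ?f (- (z * (x * (y * x)))) + ?f (- (z * (x * (y * (x * y))))))"
  by (simp add: neg_times(1) mult.assoc c minus_mult_left[symmetric] ac_simps)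
 then show "Z (z \<cdot> pfister [- (x * y), x, y] M\<^sub>0)"
  by (simp add: times_times mult.assoc ac_simps)
qed

definition good :: "'a set => bool" where
 "good G \<longleftrightarrow> G \<subseteq> units \<and> (ALL zs. set zs \<subseteq> G --> \<not> bad zs)"

text \<open>Badness is witnessed by a finite list, whose entries already lie in one member of a
  chain.\<close>

lemma ex_maximal_good: "EX G. good G \<and> (ALL H. good H --> G \<subseteq> H --> H = G)"
proof -
 have "EX G:{G. good G}. ALL H:{G. good G}. G \<subseteq> H --> H = G"
 proof (rule subset_Zorn')
  fix \<C> assume C: "subset.chain {G. good G} \<C>"
  have "\<not> bad zs" if "set zs \<subseteq> \<Union>\<C>" for zs
  proof (cases "\<C> = {}")
   case False
   have "EX G:\<C>. set zs \<subseteq> G"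
    using finite_subset_Union_chain[OF finite_set that False C] by blast
   then show ?thesis using C unfolding subset.chain_def good_def by auto
  qed (use that not_bad_Nil in auto)
  then show "\<Union>\<C> : {G. good G}" using C unfolding good_def subset.chain_def by auto
 qed
 then show ?thesis by auto
qed

text \<open>A maximal good set consists of the nonzero elements of an ordering: the lists
  \<open>[- y, y]\<close>, \<open>[- (x + y), x, y]\<close> and \<open>[- (x * y), x, y]\<close> are
  always bad, which gives the axioms once every unit is known to lie in \<open>G\<close> up to
  sign.\<close>

theorem ex_ordering:
 "EX \<P>. ordering_on K \<P> \<and> (ALL zs. set zs \<subseteq> \<P> - {0} --> (EX z:units. \<not> Z (z \<cdot> pfister zs M\<^sub>0)))"
proof -
 obtain G where G: "good G" and max: "!!H. good H ==> G \<subseteq> H ==> H = G" using ex_maximal_good by blast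
 have Gu: "G \<subseteq> units" using G good_def by auto
 have nb: "\<not> bad zs" if "set zs \<subseteq> G" for zs using G that good_def by auto
 have ext: "EX gs. set gs \<subseteq> G \<and> bad (y # gs)" if y: "y : units" "y \<notin> G" for y
 proof -
  have "\<not> good (insert y G)" using max[of "insert y G"] y by auto
  then obtain zs where zs: "set zs \<subseteq> insert y G" "bad zs" using y Gu unfolding good_def by auto
  have "bad (y # filter (\<lambda>x. x ~= y) zs)" using zs y Gu by (intro bad_filter) auto
  then show ?thesis using zs by (intro exI[of _ "filter (\<lambda>x. x ~= y) zs"]) auto
 qed
 have dich: "y : G \<or> - y : G" if y: "y : units" for y
 proof (rule ccontr)
  assume "\<not> (y : G \<or> - y : G)"
  then obtain gs hs where gs: "set gs \<subseteq> G" "bad (y # gs)" and hs: "set hs \<subseteq> G" "bad (- y # hs)"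
   using ext[of y] ext[of "- y"] y units_neg by auto
  have u: "set gs \<subseteq> units" "set hs \<subseteq> units" using gs hs Gu by auto
  have 1: "bad (y # gs @ hs)"
   using bad_append[OF gs(2), of hs] u y by (auto elim!: bad_cong)
  have 2: "bad (- y # gs @ hs)"
   using bad_append[OF hs(2), of gs] u y units_neg by (auto elim!: bad_cong)
  have "bad (gs @ hs)"
   unfolding bad_def
  proof
   fix z assume z: "z : units"
   let ?P = "pfister (gs @ hs) M\<^sub>0"
   have P: "set_mset ?P \<subseteq> units" using pf_units u by auto
   have zP: "set_mset (z \<cdot> ?P) \<subseteq> units" "set_mset ((z * y) \<cdot> ?P) \<subseteq> units"
    using P z y by simp_all
   \<comment> \<open>The copies of \<open>?P\<close> scaled by \<open>y\<close> and by
     \<open>- y\<close> cancel, leaving twice \<open>?P\<close>.\<close>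
   have "Z ((z \<cdot> ?P + (z * y) \<cdot> ?P) + (z \<cdot> ?P + (z * - y) \<cdot> ?P))"
    by (rule Z_add) (use 1 2 z P y in \<open>simp_all add: bad_def times_times\<close>)
   then have "Z ((z \<cdot> ?P + z \<cdot> ?P) + ((z * y) \<cdot> ?P + neg ((z * y) \<cdot> ?P)))"
    by (simp add: neg_times ac_simps)
   then have "Z (z \<cdot> ?P + z \<cdot> ?P)"
    by (rule Z_cancel[rotated 2, OF _ Z_hypM[OF zP(2)]]) (use P z y in simp_all)
   then show "Z (z \<cdot> ?P)" by (rule Z_double[rotated]) (use zP in simp)
  qed
  moreover have "\<not> bad (gs @ hs)" using gs(1) hs(1) by (intro nb) simp
  ultimately show False by blast
 qed
 have not_both: "- y \<notin> G" if "y : G" for y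
 proof
  assume "- y : G"
  then have "\<not> bad [- y, y]" using that by (intro nb) simp
  then show False using bad_neg that Gu by blast
 qed
 have add: "x + y : G" if "x : G" "y : G" for x y
 proof -
  have u: "x : units" "y : units" using that Gu by auto
  have "x + y ~= 0" using not_both[of x] that by (metis add_eq_0_iff)
  then have s: "x + y : units" using u add_closed by (simp add: units_def)
  have "- (x + y) \<notin> G"
  proof
   assume "- (x + y) : G"
   then have "\<not> bad [- (x + y), x, y]" using that by (intro nb) simp
   then show False using bad_sum[OF u s] by blast
  qed
  then show ?thesis using dich[OF s] by blast
 qed
 have mult: "x * y : G" if "x : G" "y : G" for x y
 proof -
  have u: "x : units" "y : units" using that Gu by auto
  have "- (x * y) \<notin> G"
  proof
   assume "- (x * y) : G"
   then have "\<not> bad [- (x * y), x, y]" using that by (intro nb) simp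
   then show False using bad_mult[OF u] by blast
  qed
  then show ?thesis using dich[OF units_mult[OF u]] by blast
 qed
 have "ordering_on K (insert 0 G)"
  unfolding ordering_on_def
  using Gu zero_closed dich not_both add mult by (auto simp: units_def)
 moreover have "EX z:units. \<not> Z (z \<cdot> pfister zs M\<^sub>0)" if "set zs \<subseteq> insert 0 G - {0}" for zs
  using nb[of zs] that unfolding bad_def by auto
 ultimately show ?thesis by blast
qed

end

section \<open>Signatures\<close>

text \<open>A product of symmetric elements need not be symmetric, so closure under products is
  replaced by closure under hermitian conjugation.\<close>

locale star_cone = star_div D e \<sigma> for D :: "'a::ring_1 set" and e \<sigma> +
 fixes \<P> :: "'a set"
 assumes cone_sub: "x : \<P> ==> x : D" and cone_sym: "x : \<P> ==> \<sigma> x = x"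
  and cone_add: "x : \<P> ==> y : \<P> ==> x + y : \<P>"
  and cone_conj: "x : \<P> ==> c : D ==> \<sigma> c * x * c : \<P>"
  and cone_antisym: "x : \<P> ==> - x : \<P> ==> x = 0"
  and cone_total: "x : D ==> \<sigma> x = x ==> x : \<P> \<or> - x : \<P>"
begin

text \<open>Zero receives the sign 1; signatures evaluate this only at nonzero diagonal
  entries.\<close>

definition csgn :: "'a => int" where "csgn x = (if x : \<P> then 1 else - 1)"

lemma cone_zero: "0 : \<P>"
 using cone_total[OF zero_closed] by simp

lemma cone_sum: "(!!i. i : I ==> f i : \<P>) ==> (\<Sum>i\<in>I. f i) : \<P>"
 by (induction I rule: infinite_finite_induct) (auto intro: cone_add cone_zero)

lemma cone_sum_eq_0: assumes "finite I" "!!i. i : I ==> f i : \<P>" "(\<Sum>i\<in>I. f i) = 0" "i : I"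
 shows "f i = 0"
proof -
 have "f i + (\<Sum>j\<in>I - {i}. f j) = 0" using assms by (simp add: sum.remove)
 then have "- f i = (\<Sum>j\<in>I - {i}. f j)" by (simp add: add_eq_0_iff2)
 moreover have "(\<Sum>j\<in>I - {i}. f j) : \<P>" using assms by (intro cone_sum) auto
 ultimately show ?thesis using cone_antisym assms by metis
qed

lemma conj_nz: assumes "x : D" "x ~= 0" "c : D" "c ~= 0" shows "\<sigma> c * x * c ~= 0"
 using assms by (intro mult_nz mult_closed star_closed) auto

lemma csgn_neg: assumes "x : D" "\<sigma> x = x" "x ~= 0" shows "csgn (- x) = - csgn x"
 using cone_total[OF assms(1,2)] cone_antisym[of x] assms by (auto simp: csgn_def)

end

locale herm_cone = star_cone D e \<sigma> \<P> + herm D e \<sigma> M act h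
 for D :: "'a::ring_1 set" and e \<sigma> \<P> and M :: "'m::ab_group_add set" and act h
begin

lemma h_comb: assumes "orth I v" "!!i. i : I ==> c i : D"
 shows "h (\<Sum>i\<in>I. act (v i) (c i)) (\<Sum>i\<in>I. act (v i) (c i)) = (\<Sum>i\<in>I. \<sigma> (c i) * h (v i) (v i) * c i)"
proof -
 note o = orthD[OF assms(1)]
 have s: "(\<Sum>i\<in>I. act (v i) (c i)) : M" using o assms(2) by (intro M_sum M_act) auto
 have "h (\<Sum>i\<in>I. act (v i) (c i)) (\<Sum>i\<in>I. act (v i) (c i)) = (\<Sum>i\<in>I. h (act (v i) (c i)) (\<Sum>i\<in>I. act (v i) (c i)))"
  using o assms(2) s by (intro h_sum_left M_act) auto
 also have "\<dots> = (\<Sum>i\<in>I. \<sigma> (c i) * (h (v i) (v i) * c i))"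
  using o assms s by (intro sum.cong refl) (simp add: h_act_left orth_comb[OF assms(1)])
 finally show ?thesis by (simp add: mult.assoc)
qed

text \<open>Inertia by counting: if \<open>w\<close> had more positive vectors than
  \<open>v\<close>, these together with the negative vectors of \<open>v\<close> would be linearly
  dependent. The dependency gives a vector whose value is both a sum of positive and a sum of
  negative terms, so every coefficient vanishes.\<close>

lemma sylvester_le: assumes v: "basis I v" and w: "orth J w" and card: "card J = card I"
 shows "card {j\<in>J. h (w j) (w j) : \<P>} \<le> card {i\<in>I. h (v i) (v i) : \<P>}"
proof (rule ccontr)
 let ?P = "{j\<in>J. h (w j) (w j) : \<P>}" and ?N = "{i\<in>I. h (v i) (v i) \<notin> \<P>}" and ?Q = "{i\<in>I. h (v i) (v i) : \<P>}"
 assume "\<not> card ?P \<le> card ?Q"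
 note ov = orthD[OF basis_orth[OF v]] and ow = orthD[OF w]
 let ?K = "Inl ` ?P \<union> Inr ` ?N"
 define u where "u = case_sum w v"
 have fin: "finite I" "finite J" using ov ow by auto
 have "card I = card ?Q + card ?N" using fin by (subst card_Un_disjoint[symmetric]) (auto intro: arg_cong[of _ _ card])
 moreover have "card ?K = card ?P + card ?N" using fin by (subst card_Un_disjoint) (auto simp: card_image)
 ultimately have "card I < card ?K" using \<open>\<not> _\<close> by simp
 moreover have "finite ?K" "!!j. j : ?K ==> u j : M" using fin ov ow by (auto simp: u_def)
 ultimately obtain c where c: "ALL j:?K. c j : D" "EX j:?K. c j ~= 0" "(\<Sum>j\<in>?K. act (u j) (c j)) = 0"
  using basis_dependent[OF v, of ?K u] by blast
 define x where "x = (\<Sum>j\<in>?P. act (w j) (c (Inl j)))"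
 define y where "y = (\<Sum>i\<in>?N. act (v i) (c (Inr i)))"
 have "x + y = 0"
  using c(3) fin unfolding x_def y_def
  by (subst (asm) sum.union_disjoint) (auto simp: sum.reindex u_def)
 then have xy: "x = - y" by (simp add: eq_neg_iff_add_eq_0)
 have cP: "!!j. j : ?P ==> c (Inl j) : D" and cN: "!!i. i : ?N ==> c (Inr i) : D" using c(1) by auto
 have oP: "orth ?P w" and oN: "orth ?N v" by (rule orth_subset[OF w], simp, rule orth_subset[OF basis_orth[OF v]], auto)
 have hx: "h x x = (\<Sum>j\<in>?P. \<sigma> (c (Inl j)) * h (w j) (w j) * c (Inl j))"
  unfolding x_def using oP cP by (rule h_comb)
 have hy: "h y y = (\<Sum>i\<in>?N. \<sigma> (c (Inr i)) * h (v i) (v i) * c (Inr i))"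
  unfolding y_def using oN cN by (rule h_comb)
 have yM: "y : M" unfolding y_def using ov cN by (intro M_sum M_act) auto
 have hxy: "h x x = h y y" using xy yM M_neg h_neg_left h_neg_right by simp
 have px: "!!j. j : ?P ==> \<sigma> (c (Inl j)) * h (w j) (w j) * c (Inl j) : \<P>" using cP cone_conj by auto
 have nv: "- h (v i) (v i) : \<P>" if "i : ?N" for i using cone_total[of "h (v i) (v i)"] ov that by auto
 have py: "!!i. i : ?N ==> - (\<sigma> (c (Inr i)) * h (v i) (v i) * c (Inr i)) : \<P>"
  using cN cone_conj[OF nv] by simp
 have "h x x : \<P>" unfolding hx using px by (rule cone_sum)
 moreover have "- h y y : \<P>" unfolding hy sum_negf[symmetric] using py by (rule cone_sum)
 ultimately have z: "h x x = 0" "h y y = 0" using cone_antisym hxy by auto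
 have "c (Inl j) = 0" if "j : ?P" for j
  using cone_sum_eq_0[of ?P "\<lambda>j. \<sigma> (c (Inl j)) * h (w j) (w j) * c (Inl j)" j] px z hx that
   conj_nz[of "h (w j) (w j)" "c (Inl j)"] ow cP fin by auto
 moreover have "c (Inr i) = 0" if "i : ?N" for i
  using cone_sum_eq_0[of ?N "\<lambda>i. - (\<sigma> (c (Inr i)) * h (v i) (v i) * c (Inr i))" i] py z hy that
   conj_nz[of "h (v i) (v i)" "c (Inr i)"] ov cN fin by (auto simp: sum_negf)
 ultimately show False using c(2) by auto
qed

lemma csgn_sum: assumes "finite I" shows "(\<Sum>i\<in>I. csgn (f i)) = 2 * int (card {i\<in>I. f i : \<P>}) - int (card I)"
 using assms
proof (induction I rule: finite_induct)
 case (insert x I)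
 have "{i : insert x I. f i : \<P>} = (if f x : \<P> then insert x {i : I. f i : \<P>} else {i : I. f i : \<P>})" by auto
 then show ?case using insert by (auto simp: csgn_def)
qed simp

theorem sylvester: assumes "basis I v" "basis J w"
 shows "(\<Sum>i\<in>I. csgn (h (v i) (v i))) = (\<Sum>j\<in>J. csgn (h (w j) (w j)))"
proof -
 have c: "card I = card J" using basis_card_ge assms basis_orth by (meson le_antisym)
 show ?thesis
  using sylvester_le[OF assms(1) basis_orth[OF assms(2)]] sylvester_le[OF assms(2) basis_orth[OF assms(1)]] c
   orthD(1)[OF basis_orth[OF assms(1)]] orthD(1)[OF basis_orth[OF assms(2)]]
  by (simp add: csgn_sum)
qed

text \<open>The index type is fixed to \<open>nat\<close> only to state the description;
  \<open>sig_eq\<close> evaluates it on bases with any index type.\<close>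

definition sig :: int where
 "sig = (THE s. EX (I::nat set) v. basis I v \<and> s = (\<Sum>i\<in>I. csgn (h (v i) (v i))))"

theorem sig_eq: assumes "basis I v" shows "sig = (\<Sum>i\<in>I. csgn (h (v i) (v i)))"
 unfolding sig_def
proof (rule the_equality)
 obtain J :: "nat set" and w where "basis J w" using ex_basis by auto
 then show "EX (J::nat set) w. basis J w \<and> (\<Sum>i\<in>I. csgn (h (v i) (v i))) = (\<Sum>i\<in>J. csgn (h (w i) (w i)))"
  using sylvester[OF assms] by blast
next
 fix s assume "EX (J::nat set) w. basis J w \<and> s = (\<Sum>i\<in>J. csgn (h (w i) (w i)))"
 then show "s = (\<Sum>i\<in>I. csgn (h (v i) (v i)))" using sylvester[OF assms] by metis
qed

end

section \<open>Isometry of diagonal forms\<close>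

lemma image_mset_set_bij:
 assumes "finite I" "finite J" "image_mset a (mset_set I) = image_mset b (mset_set J)"
 shows "EX p. bij_betw p I J \<and> (ALL i:I. a i = b (p i))"
 using assms
proof (induction I arbitrary: J rule: finite_induct)
 case empty
 then have "J = {}" by (metis image_mset_empty image_mset_is_empty_iff mset_set.empty mset_set_empty_iff)
 then show ?case by (auto simp: bij_betw_def)
next
 case (insert x I)
 have "a x \<in># image_mset b (mset_set J)" using insert.hyps insert.prems(2)[symmetric] by simp
 then obtain y where y: "y : J" "b y = a x" using insert.prems(1) by auto
 have "image_mset b (mset_set J) = add_mset (b y) (image_mset b (mset_set (J - {y})))"
  using y insert.prems(1) by (simp add: mset_set.remove)
 then have "image_mset a (mset_set I) = image_mset b (mset_set (J - {y}))"
  using insert y by simp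
 then obtain p where p: "bij_betw p I (J - {y})" "ALL i:I. a i = b (p i)"
  using insert.IH[of "J - {y}"] insert.prems(1) by auto
 have b: "bij_betw (p(x := y)) (insert x I) (insert y (J - {y}))"
 proof -
  have "bij_betw (p(x := y)) I (J - {y})" using p(1) insert.hyps by (subst bij_betw_cong[of _ _ p]) auto
  then show ?thesis using notIn_Un_bij_betw[of x I "p(x := y)" "J - {y}"] insert.hyps by simp
 qed
 have "insert y (J - {y}) = J" using y by auto
 then have "bij_betw (p(x := y)) (insert x I) J" using b by metis
 moreover have "ALL i:insert x I. a i = b ((p(x := y)) i)" using p(2) insert.hyps y by auto
 ultimately show ?case by blast
qed

context star_div
begin

definition symu :: "'a set" where "symu = {a\<in>D. \<sigma> a = a \<and> a ~= 0}"
definition vec :: "'i set => ('i => 'a) set" where "vec I = {x. (ALL i:I. x i : D) \<and> (ALL i. i \<notin> I --> x i = 0)}"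
definition vact :: "('i => 'a) => 'a => 'i => 'a" where "vact x c = (\<lambda>i. x i * c)"
definition dform :: "'i set => ('i => 'a) => ('i => 'a) => ('i => 'a) => 'a" where
 "dform I a x y = (\<Sum>i\<in>I. \<sigma> (x i) * a i * y i)"
definition unitv :: "'i => 'i => 'a" where "unitv i = (\<lambda>j. if j = i then e else 0)"
text \<open>Read as a matrix, \<open>w\<close> has columns with diagonal Gram matrix: for nonzero
  entries it is an isometric embedding of the form with entries \<open>b\<close> into the form with
  entries \<open>a\<close>.\<close>

definition frame :: "'i set => ('i => 'a) => 'j set => ('j => 'a) => ('j => 'i => 'a) => bool" where
 "frame I a J b w \<longleftrightarrow> (ALL j:J. w j : vec I) \<and>
   (ALL j:J. ALL k:J. dform I a (w j) (w k) = (if j = k then b j else 0))"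

text \<open>\<open>isoM M N\<close>: the diagonal forms with entries \<open>M\<close> and \<open>N\<close> are isometric.\<close>

definition isoM :: "'a multiset => 'a multiset => bool" where
 "isoM M N \<longleftrightarrow> (EX (n::nat) a b w. M = image_mset a (mset_set {..<n}) \<and> N = image_mset b (mset_set {..<n}) \<and>
   (ALL i<n. a i : symu \<and> b i : symu) \<and> frame {..<n} a {..<n} b w)"

lemma symu: "a : symu ==> a : D" "a : symu ==> \<sigma> a = a" "a : symu ==> a ~= 0"
 by (auto simp: symu_def)

lemma symuI: "a : D ==> \<sigma> a = a ==> a ~= 0 ==> a : symu"
 by (auto simp: symu_def)

lemma symu_e: "e : symu"
 using e_closed e_nz star_e by (simp add: symu_def)

lemma symu_neg: "a : symu ==> - a : symu"
 using neg_closed by (auto simp: symu_def star_neg)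

lemma symu_conj: "a : symu ==> c : D ==> c ~= 0 ==> \<sigma> c * a * c : symu"
 using mult_nz mult_closed star_closed by (auto simp: symu_def star_mult mult.assoc)

lemma vecD: "x : vec I ==> i : I ==> x i : D" "x : vec I ==> i \<notin> I ==> x i = 0"
 by (auto simp: vec_def)

lemma vec_D: "x : vec I ==> x i : D"
 by (cases "i : I") (auto simp: vecD zero_closed)

lemma vec_zero: "0 : vec I" and vec_add: "x : vec I ==> y : vec I ==> x + y : vec I"
 and vec_act: "x : vec I ==> c : D ==> vact x c : vec I"
 and unitv_vec: "i : I ==> unitv i : vec I"
 by (auto simp: vec_def vact_def unitv_def zero_closed add_closed mult_closed e_closed)

lemma dform_unitv: assumes "finite I" "i : I" "x : vec I" "!!i. i : I ==> a i : D"
 shows "dform I a (unitv i) x = a i * x i"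
proof -
 have "dform I a (unitv i) x = (\<Sum>j\<in>I. if j = i then a i * x i else 0)"
  unfolding dform_def unitv_def using assms by (intro sum.cong) (auto simp: star_e e_left vecD)
 then show ?thesis using assms by simp
qed

lemma vec_smod: fixes I :: "'i set" shows "smod D e \<sigma> (vec I) vact"
proof
 fix u v w :: "'i => 'a" and c d
 show "0 : vec I" by (rule vec_zero)
 show "v : vec I ==> w : vec I ==> v + w : vec I" by (rule vec_add)
 show "v : vec I ==> c : D ==> vact v c : vec I" by (rule vec_act)
 show "vact (v + w) c = vact v c + vact w c" by (auto simp: vact_def distrib_right)
 show "vact v (c + d) = vact v c + vact v d" by (auto simp: vact_def distrib_left)
 show "vact (vact v c) d = vact v (c * d)" by (auto simp: vact_def mult.assoc)
 show "v : vec I ==> vact v e = v" by (rule ext) (simp add: vact_def e_right vec_D)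
qed

lemma vec_sum_unitv: assumes "finite I" "x : vec I" shows "x = (\<Sum>i\<in>I. vact (unitv i) (x i))"
proof
 fix k
 have "(\<Sum>i\<in>I. vact (unitv i) (x i)) k = (\<Sum>i\<in>I. if i = k then x k else 0)"
  unfolding fun_sum_apply using assms by (intro sum.cong) (auto simp: vact_def unitv_def e_left vecD)
 then show "x k = (\<Sum>i\<in>I. vact (unitv i) (x i)) k" using assms by (auto simp: vecD)
qed

lemma vec_spanning: assumes "finite I" shows "smod.spanning D (vec I) vact I unitv"
 unfolding smod.spanning_def[OF vec_smod] using assms vec_sum_unitv[OF assms] vecD(1) unitv_vec by metis

lemma diag_herm: fixes I :: "'i set" assumes "finite I" "!!i. i : I ==> a i : symu"
 shows "herm D e \<sigma> (vec I) vact (dform I a)"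
proof -
 interpret smod D e \<sigma> "vec I" vact by (rule vec_smod)
 show ?thesis
 proof
 have a: "!!i. i : I ==> a i : D" "!!i. i : I ==> \<sigma> (a i) = a i" "!!i. i : I ==> a i ~= 0"
  using assms symu by auto
 fix u v w :: "'i => 'a" and c d
 show "v : vec I ==> w : vec I ==> dform I a v w : D"
  unfolding dform_def using a by (intro sum_closed mult_closed star_closed) (auto simp: vecD)
 show "dform I a u (v + w) = dform I a u v + dform I a u w"
  by (simp add: dform_def distrib_left sum.distrib)
 show "dform I a v (vact w c) = dform I a v w * c"
  by (simp add: dform_def vact_def sum_distrib_right mult.assoc)
 show "\<sigma> (dform I a v w) = dform I a w v"
  unfolding dform_def star_sum using a by (intro sum.cong) (auto simp: star_mult mult.assoc)
 show "v = 0" if v: "v : vec I" and z: "!!w. w : vec I ==> dform I a v w = 0"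
 proof
  fix i
  show "v i = 0 i"
  proof (cases "i : I")
   case True
   have "dform I a (unitv i) v = \<sigma> (dform I a v (unitv i))"
    unfolding dform_def star_sum using a by (intro sum.cong) (auto simp: star_mult mult.assoc)
   then have "a i * v i = 0" using z[OF unitv_vec[OF True]] dform_unitv[OF assms(1) True v] a by simp
   then show ?thesis using no_zero_div[of "a i" "v i"] a True vecD(1)[OF v True] by auto
  qed (use v in \<open>simp add: vecD\<close>)
 qed
 show finite_dim by (rule spanning_finite_dim[OF vec_spanning[OF assms(1)]])
 qed
qed

lemma unitv_same [simp]: "unitv i i = e"
 by (simp add: unitv_def)

lemma unitv_basis: assumes "finite I" "!!i. i : I ==> a i : symu"
 shows "herm.basis D e (vec I) vact (dform I a) I unitv"
  and "!!i. i : I ==> dform I a (unitv i) (unitv i) = a i"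
proof -
 interpret herm D e \<sigma> "vec I" vact "dform I a" using diag_herm[of I a] assms by blast
 have a: "!!i. i : I ==> a i : D" "!!i. i : I ==> a i ~= 0" using assms symu by auto
 have val: "dform I a (unitv i) (unitv j) = (if i = j then a i else 0)" if "i : I" "j : I" for i j
  using dform_unitv[OF assms(1) that(1) unitv_vec[OF that(2)]] a e_right that by (auto simp: unitv_def)
 then show "!!i. i : I ==> dform I a (unitv i) (unitv i) = a i" by simp
 have o: "orth I unitv" unfolding orth_def using assms val a by (auto simp: unitv_vec)
 show "basis I unitv" by (rule basis_if_spanning[OF vec_spanning[OF assms(1)] o order_refl])
qed

lemma frame_unitv: assumes "finite I" "!!i. i : I ==> a i : symu" shows "frame I a I a unitv"
 using unitv_basis[of I a] herm.basis_orth[OF diag_herm, of I a I unitv] herm.orthD(4)[OF diag_herm, of I a I unitv] assms unitv_vec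
 unfolding frame_def by auto

lemma frame_orth: assumes "finite I" "!!i. i : I ==> a i : symu" "finite J" "!!j. j : J ==> b j : symu"
  "frame I a J b w"
 shows "herm.orth (vec I) (dform I a) J w"
proof -
 interpret herm D e \<sigma> "vec I" vact "dform I a" using diag_herm[of I a] assms by blast
 show ?thesis unfolding orth_def using assms symu(3) by (auto simp: frame_def)
qed

lemma frame_isometry: assumes "finite I" "!!i. i : I ==> a i : symu" "finite J" "frame I a J b w"
  "x : vec J" "y : vec J"
 shows "dform I a (\<Sum>j\<in>J. vact (w j) (x j)) (\<Sum>j\<in>J. vact (w j) (y j)) = dform J b x y"
proof -
 interpret herm D e \<sigma> "vec I" vact "dform I a" using diag_herm[of I a] assms by blast
 have w: "!!j. j : J ==> w j : vec I" "!!j k. j : J ==> k : J ==> dform I a (w j) (w k) = (if j = k then b j else 0)"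
  using assms(4) by (auto simp: frame_def)
 have xy: "!!j. j : J ==> x j : D" "!!j. j : J ==> y j : D"
  using vec_D[OF assms(5)] vec_D[OF assms(6)] by auto
 have "dform I a (\<Sum>j\<in>J. vact (w j) (x j)) (\<Sum>j\<in>J. vact (w j) (y j))
   = (\<Sum>j\<in>J. \<Sum>k\<in>J. dform I a (vact (w j) (x j)) (vact (w k) (y k)))"
  using w xy by (subst h_sum_left) (auto intro!: sum.cong h_sum_right vec_act M_sum)
 also have "\<dots> = (\<Sum>j\<in>J. \<Sum>k\<in>J. if j = k then \<sigma> (x j) * b j * y j else 0)"
 proof (intro sum.cong refl)
  fix j k assume jk: "j : J" "k : J"
  have "dform I a (vact (w j) (x j)) (vact (w k) (y k)) = \<sigma> (x j) * dform I a (w j) (w k) * y k"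
   using h_act[OF vec_act[OF w(1)[OF jk(1)] xy(1)[OF jk(1)]] w(1)[OF jk(2)] xy(2)[OF jk(2)]]
    h_act_left[OF w(1)[OF jk(1)] w(1)[OF jk(2)] xy(1)[OF jk(1)]] by simp
  then show "dform I a (vact (w j) (x j)) (vact (w k) (y k)) = (if j = k then \<sigma> (x j) * b j * y j else 0)"
   using w(2)[OF jk] by (cases "j = k") simp_all
 qed
 also have "\<dots> = dform J b x y" using assms(3) by (simp add: dform_def)
 finally show ?thesis .
qed

lemma frame_reindex: assumes "frame I a J b w" "bij_betw p I' I" "bij_betw q J' J"
  "!!i. i : I' ==> a' i = a (p i)" "!!j. j : J' ==> b' j = b (q j)"
 shows "frame I' a' J' b' (\<lambda>j i. if i : I' then w (q j) (p i) else 0)"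
proof -
 have p: "!!i. i : I' ==> p i : I" and q: "!!j. j : J' ==> q j : J"
  using assms(2,3) bij_betwE by blast+
 have qi: "q j = q k \<longleftrightarrow> j = k" if "j : J'" "k : J'" for j k
  using assms(3) that by (auto simp: bij_betw_def inj_on_def)
 have "dform I' a' (\<lambda>i. if i : I' then w (q j) (p i) else 0) (\<lambda>i. if i : I' then w (q k) (p i) else 0)
   = dform I a (w (q j)) (w (q k))" for j k
  unfolding dform_def using assms(4)
  by (subst sum.reindex_bij_betw[OF assms(2), symmetric]) (auto intro!: sum.cong)
 then show ?thesis using assms(1,5) p q qi by (auto simp: frame_def vec_def)
qed

lemma isoM_I: assumes "finite I" "finite J" "card I = card J" "!!i. i : I ==> a i : symu" "!!j. j : J ==> b j : symu"
  "frame I a J b w"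
 shows "isoM (image_mset a (mset_set I)) (image_mset b (mset_set J))"
proof -
 obtain p where p: "bij_betw p {..<card I} I" using ex_bij_betw_nat_finite[OF assms(1)] by (auto simp: atLeast0LessThan)
 obtain q where q: "bij_betw q {..<card I} J" using ex_bij_betw_nat_finite[OF assms(2)] assms(3) by (auto simp: atLeast0LessThan)
 have pI: "!!i. i < card I ==> p i : I" and qJ: "!!i. i < card I ==> q i : J" using p q bij_betwE by blast+
 have im: "image_mset f (mset_set K) = image_mset (f \<circ> r) (mset_set {..<n})" if "bij_betw r {..<n} K"
  for f :: "'x => 'a" and K and r :: "nat => 'x" and n
  using that image_mset_mset_set[of r "{..<n}"] by (simp add: bij_betw_def multiset.map_comp[symmetric])
 show ?thesis
  unfolding isoM_def
  using im[OF p, of a] im[OF q, of b] frame_reindex[OF assms(6) p q, of "a \<circ> p" "b \<circ> q"] assms pI qJ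
  by (intro exI[of _ "card I"] exI[of _ "a \<circ> p"] exI[of _ "b \<circ> q"]) auto
qed

lemma isoM_E: assumes "isoM (image_mset a (mset_set I)) (image_mset b (mset_set J))" "finite I" "finite J"
 shows "EX w. frame I a J b w" "card I = card J" "i : I ==> a i : symu" "j : J ==> b j : symu"
proof -
 obtain n a' b' w where n: "image_mset a (mset_set I) = image_mset a' (mset_set {..<n::nat})"
   "image_mset b (mset_set J) = image_mset b' (mset_set {..<n})"
   "ALL i<n. a' i : symu \<and> b' i : symu" "frame {..<n} a' {..<n} b' w"
  using assms(1) unfolding isoM_def by auto
 obtain p where p: "bij_betw p I {..<n}" "ALL i:I. a i = a' (p i)" using image_mset_set_bij[OF assms(2) _ n(1)] by auto
 obtain q where q: "bij_betw q J {..<n}" "ALL i:J. b i = b' (q i)" using image_mset_set_bij[OF assms(3) _ n(2)] by auto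
 show "EX w. frame I a J b w" using frame_reindex[OF n(4) p(1) q(1), of a b] p q by auto
 show "card I = card J" using bij_betw_same_card[OF p(1)] bij_betw_same_card[OF q(1)] by simp
 show "i : I ==> a i : symu" using p n(3) bij_betwE[OF p(1)] by auto
 show "j : J ==> b j : symu" using q n(3) bij_betwE[OF q(1)] by auto
qed

lemma mset_rep: obtains n :: nat and a where "M = image_mset a (mset_set {..<n})"
proof -
 obtain xs where "M = mset xs" using ex_mset by metis
 then have "M = image_mset (\<lambda>i. xs ! i) (mset_set {..<length xs})"
  by (metis map_nth mset_map mset_upt atLeast0LessThan)
 then show ?thesis by (rule that)
qed

lemma isoM_symu: assumes "isoM M N" shows "set_mset M \<subseteq> symu" "set_mset N \<subseteq> symu"
 using assms unfolding isoM_def by auto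

lemma isoM_size: "isoM M N ==> size M = size N"
 unfolding isoM_def by auto

lemma isoM_refl: assumes "set_mset M \<subseteq> symu" shows "isoM M M"
proof -
 obtain n a where M: "M = image_mset a (mset_set {..<n::nat})" using mset_rep .
 then have a: "!!i. i : {..<n} ==> a i : symu" using assms by auto
 have "frame {..<n} a {..<n} a unitv" using a by (intro frame_unitv) auto
 then show ?thesis unfolding M using a by (intro isoM_I) auto
qed

lemma isoM_trans: assumes "isoM L M" "isoM M N" shows "isoM L N"
proof -
 obtain n a b w where 1: "L = image_mset a (mset_set {..<n::nat})" "M = image_mset b (mset_set {..<n})"
  "!!i. i < n ==> a i : symu" "!!i. i < n ==> b i : symu" "frame {..<n} a {..<n} b w"
  using assms(1) unfolding isoM_def by blast
 obtain m c where N: "N = image_mset c (mset_set {..<m::nat})" using mset_rep .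
 obtain u where u: "frame {..<n} b {..<m} c u" "n = m" "!!j. j < m ==> c j : symu"
  using isoM_E[OF assms(2)[unfolded 1(2) N]] by auto
 interpret herm D e \<sigma> "vec {..<n}" vact "dform {..<n} a" using diag_herm[of "{..<n}" a] 1 by blast
 have "frame {..<n} a {..<m} c (\<lambda>k. \<Sum>j<n. vact (w j) (u k j))"
  unfolding frame_def
 proof (intro conjI ballI)
  fix k l assume k: "k : {..<m}" and l: "l : {..<m}"
  have uv: "u k : vec {..<n}" "u l : vec {..<n}" using u(1) k l by (auto simp: frame_def)
  show "(\<Sum>j<n. vact (w j) (u k j)) : vec {..<n}"
   using 1(5) vec_D[OF uv(1)] by (intro M_sum vec_act) (auto simp: frame_def)
  show "dform {..<n} a (\<Sum>j<n. vact (w j) (u k j)) (\<Sum>j<n. vact (w j) (u l j)) = (if k = l then c k else 0)"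
   using frame_isometry[OF _ _ _ 1(5) uv] 1(3) u(1) k l by (auto simp: frame_def)
 qed
 then show ?thesis unfolding 1 N using 1 u by (intro isoM_I) auto
qed

text \<open>By counting, the frame is an orthogonal basis; the coordinates of the unit vectors in it
  form the inverse frame.\<close>

lemma isoM_sym: assumes "isoM M N" shows "isoM N M"
proof -
 obtain n a b w where 1: "M = image_mset a (mset_set {..<n::nat})" "N = image_mset b (mset_set {..<n})"
  "!!i. i < n ==> a i : symu" "!!i. i < n ==> b i : symu" "frame {..<n} a {..<n} b w"
  using assms unfolding isoM_def by blast
 interpret herm D e \<sigma> "vec {..<n}" vact "dform {..<n} a" using diag_herm[of "{..<n}" a] 1 by blast
 have o: "orth {..<n} w" using frame_orth[OF _ _ _ _ 1(5)] 1 by auto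
 have ub: "basis {..<n} unitv" "!!i. i < n ==> dform {..<n} a (unitv i) (unitv i) = a i"
  using unitv_basis[of "{..<n}" a] 1 by auto
 have bw: "basis {..<n} w" using basis_if_card[OF ub(1) o] by simp
 have val: "dform {..<n} a (w j) (w j) = b j" if "j < n" for j using 1(5) that by (auto simp: frame_def)
 define u where "u i = (\<lambda>j. if j < n then dinv (b j) * dform {..<n} a (w j) (unitv i) else 0)" for i
 have uv: "u i : vec {..<n}" if "i < n" for i
  using orth_coeff_closed[OF o, of _ "unitv i"] val unitv_vec[of i "{..<n}"] that by (auto simp: vec_def u_def)
 have ex: "unitv i = (\<Sum>j<n. vact (w j) (u i j))" if "i < n" for i
  using bw unitv_vec[of i "{..<n}"] that val unfolding basis_def by (auto simp: u_def intro!: sum.cong)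
 have "dform {..<n} b (u i) (u k) = dform {..<n} a (unitv i) (unitv k)" if "i < n" "k < n" for i k
  using frame_isometry[OF _ _ _ 1(5) uv[OF that(1)] uv[OF that(2)]] 1(3) ex that by auto
 moreover have "dform {..<n} a (unitv i) (unitv k) = (if i = k then a i else 0)" if "i < n" "k < n" for i k
  using ub that basis_orth[OF ub(1)] unfolding orth_def by auto
 ultimately have "frame {..<n} b {..<n} a u" using uv by (auto simp: frame_def)
 then show ?thesis unfolding 1 using 1 by (intro isoM_I) auto
qed

lemma isoM_add: assumes "isoM M N" "isoM M' N'" shows "isoM (M + M') (N + N')"
proof -
 obtain n a b w where 1: "M = image_mset a (mset_set {..<n::nat})" "N = image_mset b (mset_set {..<n})"
  "!!i. i < n ==> a i : symu" "!!i. i < n ==> b i : symu" "frame {..<n} a {..<n} b w"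
  using assms unfolding isoM_def by blast
 obtain n' a' b' w' where 2: "M' = image_mset a' (mset_set {..<n'::nat})" "N' = image_mset b' (mset_set {..<n'})"
  "!!i. i < n' ==> a' i : symu" "!!i. i < n' ==> b' i : symu" "frame {..<n'} a' {..<n'} b' w'"
  using assms unfolding isoM_def by blast
 let ?I = "{..<n} <+> {..<n'}"
 define W where "W = case_sum (\<lambda>j. case_sum (w j) (\<lambda>_. 0)) (\<lambda>j. case_sum (\<lambda>_. 0) (w' j))"
 have im: "image_mset (case_sum f g) (mset_set ?I) = image_mset f (mset_set {..<n}) + image_mset g (mset_set {..<n'})"
  for f g :: "nat => 'a"
 proof -
  have "mset_set ?I = image_mset Inl (mset_set {..<n}) + image_mset Inr (mset_set {..<n'})"
   unfolding Plus_def by (subst mset_set_Union) (auto simp: image_mset_mset_set)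
  then show ?thesis by (simp add: multiset.map_comp comp_def)
 qed
 have df: "dform ?I (case_sum a a') x y = dform {..<n} a (x \<circ> Inl) (y \<circ> Inl) + dform {..<n'} a' (x \<circ> Inr) (y \<circ> Inr)" for x y
  unfolding dform_def Plus_def by (subst sum.union_disjoint) (auto simp: sum.reindex)
 have comps: "W (Inl j) \<circ> Inl = w j" "W (Inl j) \<circ> Inr = (\<lambda>_. 0)" "W (Inr k) \<circ> Inl = (\<lambda>_. 0)" "W (Inr k) \<circ> Inr = w' k" for j k
  by (auto simp: W_def)
 have z: "dform K c (\<lambda>_. 0) y = 0" "dform K c y (\<lambda>_. 0) = 0" for K :: "nat set" and c y by (auto simp: dform_def)
 have "W j : vec ?I" if "j : ?I" for j
  using that 1(5) 2(5) zero_closed unfolding W_def frame_def vec_def by (auto split: sum.splits)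
 then have "frame ?I (case_sum a a') ?I (case_sum b b') W"
 proof -
  have h: "dform {..<n} a (w j) (w k) = (if j = k then b j else 0)" if "j < n" "k < n" for j k
   using 1(5) that unfolding frame_def by blast
  have h': "dform {..<n'} a' (w' j) (w' k) = (if j = k then b' j else 0)" if "j < n'" "k < n'" for j k
   using 2(5) that unfolding frame_def by blast
  show ?thesis unfolding frame_def df using \<open>!!j. j : ?I ==> W j : vec ?I\<close> by (auto simp: comps z h h' split: if_split_asm)
 qed
 then have "isoM (image_mset (case_sum a a') (mset_set ?I)) (image_mset (case_sum b b') (mset_set ?I))"
  using 1 2 by (intro isoM_I) auto
 then show ?thesis unfolding im 1 2 .
qed

text \<open>Witt cancellation. The index \<open>None\<close> carries the entry \<open>x\<close>. An
  isometry moves \<open>w None\<close> to the unit vector there, up to sign, and the images of the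
  other frame vectors, being orthogonal to it, have no coordinate at \<open>None\<close>.\<close>

lemma isoM_cancel1: assumes "isoM (add_mset x M) (add_mset x N)" shows "isoM M N"
proof -
 obtain n a where M: "M = image_mset a (mset_set {..<n::nat})" using mset_rep .
 obtain m b where N: "N = image_mset b (mset_set {..<m::nat})" using mset_rep .
 let ?I = "insert None (Some ` {..<n})" and ?J = "insert None (Some ` {..<m})"
 let ?a = "case_option x a" and ?b = "case_option x b"
 have im: "add_mset x (image_mset f (mset_set {..<k})) = image_mset (case_option x f) (mset_set (insert None (Some ` {..<k})))"
  for f :: "nat => 'a" and k
 proof -
  have "mset_set (insert None (Some ` {..<k})) = add_mset None (image_mset Some (mset_set {..<k}))"
   by (subst mset_set.insert) (auto simp: image_mset_mset_set)
  then show ?thesis by (simp add: multiset.map_comp comp_def)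
 qed
 note E = isoM_E[OF assms[unfolded M N im]]
 have card: "n = m" using isoM_size[OF assms] unfolding M N by simp
 have a: "!!i. i : ?I ==> ?a i : symu" and b: "!!j. j : ?J ==> ?b j : symu" using E(3,4) by auto
 obtain w where w: "frame ?I ?a ?J ?b w" using E(1) by auto
 interpret herm D e \<sigma> "vec ?I" vact "dform ?I ?a" using diag_herm[of ?I ?a] a by blast
 have x: "x : symu" using a[of None] by simp
 have wv: "!!j. j : ?J ==> w j : vec ?I"
  and wh: "!!j k. j : ?J ==> k : ?J ==> dform ?I ?a (w j) (w k) = (if j = k then ?b j else 0)"
  using w unfolding frame_def by blast+
 have un: "dform ?I ?a (unitv None) y = x * y None" if "y : vec ?I" for y
  using dform_unitv[of ?I None y ?a] that a symu by auto
 have unv: "unitv None : vec ?I" by (rule unitv_vec) simp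
 obtain \<rho> where \<rho>: "\<rho> (w None) = unitv None \<or> \<rho> (w None) = - unitv None" "!!v. v : vec ?I ==> \<rho> v : vec ?I"
   "!!v y. v : vec ?I ==> y : vec ?I ==> dform ?I ?a (\<rho> v) (\<rho> y) = dform ?I ?a v y"
  using witt_move[of "w None" "unitv None"] wv[of None] unv wh[of None None] un[OF unv] x symu e_right
  by auto
 have z: "\<rho> (w j) None = 0" if "j : Some ` {..<m}" for j
 proof -
  have j: "j : ?J" "j ~= None" using that by auto
  have "dform ?I ?a (\<rho> (w None)) (\<rho> (w j)) = 0" using \<rho>(3) wv j wh by force
  then have "dform ?I ?a (unitv None) (\<rho> (w j)) = 0"
   using \<rho>(1) h_neg_left[OF unv \<rho>(2)[OF wv[OF j(1)]]] by auto
  then have "x * \<rho> (w j) None = 0" using un \<rho>(2) wv j by auto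
  then show ?thesis using no_zero_div x symu vecD(1)[OF \<rho>(2)[OF wv[OF j(1)]], of None] by blast
 qed
 have "frame (Some ` {..<n}) ?a (Some ` {..<m}) ?b (\<lambda>j. \<rho> (w j))"
  unfolding frame_def
 proof (intro conjI ballI)
  fix j k assume jk: "j : Some ` {..<m}" "k : Some ` {..<m}"
  then have J: "j : ?J" "k : ?J" by auto
  show "\<rho> (w j) : vec (Some ` {..<n})"
   using \<rho>(2)[OF wv[OF J(1)]] z[OF jk(1)] unfolding vec_def by (smt (verit) insert_iff mem_Collect_eq)
  have "dform (Some ` {..<n}) ?a (\<rho> (w j)) (\<rho> (w k)) = dform ?I ?a (\<rho> (w j)) (\<rho> (w k))"
   using z jk by (simp add: dform_def)
  then show "dform (Some ` {..<n}) ?a (\<rho> (w j)) (\<rho> (w k)) = (if j = k then ?b j else 0)"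
   using \<rho>(3) wv wh J by auto
 qed
 then have "isoM (image_mset ?a (mset_set (Some ` {..<n}))) (image_mset ?b (mset_set (Some ` {..<m})))"
  using a b card by (intro isoM_I) (auto simp: card_image)
 moreover have "image_mset (case_option x f) (mset_set (Some ` {..<k})) = image_mset f (mset_set {..<k})" for f :: "nat => 'a" and k
  by (simp add: image_mset_mset_set[symmetric] multiset.map_comp comp_def)
 ultimately show ?thesis unfolding M N by simp
qed

theorem isoM_cancel: "isoM (M + L) (N + L) ==> isoM M N"
 by (induction L) (auto dest: isoM_cancel1)

end

section \<open>The torsion predicate\<close>

context star_div
begin

lemma isoM_conj: assumes "a : symu" "c : D" "c ~= 0" shows "isoM {#a#} {#\<sigma> c * a * c#}"
proof -
 have "isoM (image_mset (\<lambda>_. a) (mset_set {()})) (image_mset (\<lambda>_. \<sigma> c * a * c) (mset_set {()}))"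
  using assms symu_conj
  by (intro isoM_I[where w = "\<lambda>_ _. c"]) (auto simp: frame_def vec_def dform_def)
 then show ?thesis by simp
qed

lemma isoM_image: assumes "!!x. x \<in># M ==> isoM {#f x#} {#g x#}" shows "isoM (image_mset f M) (image_mset g M)"
 using assms
proof (induction M)
 case (add x M)
 then show ?case using isoM_add[of "{#f x#}" "{#g x#}" "image_mset f M" "image_mset g M"] by auto
qed (use isoM_refl[of "{#}"] in auto)

lemma isoM_repeat: assumes "isoM M N" shows "isoM (repeat_mset n M) (repeat_mset n N)"
 by (induction n) (use isoM_refl[of "{#}"] isoM_add[OF assms] in auto)

lemma isoM_two:
 assumes a: "a : symu" "b : symu" "a' : symu" "b' : symu" and p: "p : D" "q : D" "r : D" "s : D"
  and "\<sigma> p * a * p + \<sigma> q * b * q = a'" "\<sigma> r * a * r + \<sigma> s * b * s = b'" "\<sigma> p * a * r + \<sigma> q * b * s = 0"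
 shows "isoM {#a, b#} {#a', b'#}"
proof -
 have "\<sigma> (\<sigma> p * a * r + \<sigma> q * b * s) = \<sigma> r * a * p + \<sigma> s * b * q"
  using symu(2) a by (simp add: star_add star_mult mult.assoc)
 then have sym: "\<sigma> r * a * p + \<sigma> s * b * q = 0" using assms(11) by simp
 have UN: "image_mset (\<lambda>i. if i then x else y) (mset_set (UNIV :: bool set)) = {#x, y#}" for x y :: 'a
  by (simp add: UNIV_bool)
 have "isoM (image_mset (\<lambda>i. if i then a else b) (mset_set (UNIV :: bool set))) (image_mset (\<lambda>i. if i then a' else b') (mset_set (UNIV :: bool set)))"
  using assms sym by (intro isoM_I[where w = "\<lambda>j i. if j then (if i then p else q) else (if i then r else s)"])
   (auto simp: frame_def vec_def dform_def UNIV_bool add.commute)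
 then show ?thesis unfolding UN .
qed

text \<open>In the plane with entries \<open>x\<close>, \<open>y\<close> the vectors
  \<open>(e, e)\<close> and \<open>(y, - x)\<close> are orthogonal with values \<open>x + y\<close>
  and \<open>x * y * (x + y)\<close>.\<close>

lemma isoM_exchange: assumes "x : symu" "y : symu" "x + y : symu" "x * y = y * x"
 shows "isoM {#x, y#} {#x + y, x * y * (x + y)#}"
proof (rule isoM_two[where p = e and q = e and r = y and s = "- x"])
 have D: "x : D" "y : D" "\<sigma> x = x" "\<sigma> y = y" "x ~= 0" "y ~= 0" using assms symu by auto
 have c: "x * (y * z) = y * (x * z)" for z using assms(4) by (metis mult.assoc)
 show "x * y * (x + y) : symu"
 proof (rule symuI)
  show "x * y * (x + y) : D" using D mult_closed add_closed by auto
  show "x * y * (x + y) ~= 0" using D symu[OF assms(3)] by (intro mult_nz mult_closed) auto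
  show "\<sigma> (x * y * (x + y)) = x * y * (x + y)"
   using D assms(4) by (simp add: star_mult star_add distrib_left distrib_right mult.assoc c)
 qed
 show "\<sigma> e * x * e + \<sigma> e * y * e = x + y" using D by (simp add: star_e e_left e_right)
 show "\<sigma> y * x * y + \<sigma> (- x) * y * - x = x * y * (x + y)"
  using D assms(4) by (simp add: star_neg distrib_left mult.assoc c)
 show "\<sigma> e * x * y + \<sigma> e * y * - x = 0" using D assms(4) by (simp add: star_e e_left)
qed (use assms symu e_closed neg_closed in auto)

text \<open>With \<open>t\<close> one half and \<open>c\<close> equal to \<open>t\<close> divided by
  \<open>a\<close>, the new basis is \<open>(t + c, t - c)\<close> and
  \<open>(t - c, t + c)\<close>: the value at the first vector is four times \<open>t * t\<close>,
  which is \<open>e\<close>. The computation uses that \<open>t\<close> is central and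
  \<open>c\<close> commutes with \<open>a\<close>.\<close>

lemma isoM_plane: assumes a: "a : symu" shows "isoM {#a, - a#} {#e, - e#}"
proof -
 define t where "t = dinv (e + e)"
 have ee: "e + e : D" using add_closed e_closed by auto
 have t: "t : D" "t + t = e" "\<sigma> t = t"
 proof -
  show "t : D" unfolding t_def using dinv_closed ee two_nz by auto
  show "t + t = e" using dinv_right[OF ee two_nz] e_left[OF \<open>t : D\<close>] by (simp add: t_def distrib_right)
  show "\<sigma> t = t" unfolding t_def star_dinv[OF ee two_nz] by (simp add: star_add star_e)
 qed
 have tc: "t * d = d * t" if d: "d : D" for d
 proof -
  have "d = t * d + t * d" using t d e_left by (metis distrib_right)
  then have "d * t = (t * d + t * d) * t" by simp
  also have "\<dots> = t * d * (t + t)" by (simp add: distrib_left distrib_right)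
  finally show ?thesis using t d e_right mult_closed by simp
 qed
 define c where "c = dinv a * t"
 have aD: "a : D" "a ~= 0" "\<sigma> a = a" using a symu by auto
 have ia: "dinv a : D" "\<sigma> (dinv a) = dinv a" using dinv_closed star_dinv aD by auto
 have c: "c : D" "a * c = t" "c * a = t" "\<sigma> c = c"
  using ia aD t tc[OF ia(1)] dinv_right dinv_left mult_closed e_left tc[OF aD(1)]
  unfolding c_def by (auto simp: star_mult) (metis e_left mult.assoc, metis e_right mult.assoc)
 have 4: "t * t + t * t + (t * t + t * t) = e"
  using t e_left by (metis distrib_left distrib_right e_right)
 have pa: "(t + c) * a = t * a + t" "(t - c) * a = t * a - t" using c by (simp_all add: distrib_right left_diff_distrib)
 have tac: "t * a * c = t * t" using c by (simp add: mult.assoc)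
 have pap: "(t + c) * a * (t + c) = t * a * t + t * t + t * t + t * c"
  unfolding pa by (simp add: distrib_left distrib_right tac)
 have qaq: "(t - c) * a * (t - c) = t * a * t - t * t - t * t + t * c"
  unfolding pa by (simp add: right_diff_distrib left_diff_distrib tac)
 have paq: "(t + c) * a * (t - c) = t * a * t - t * c"
  unfolding pa by (simp add: right_diff_distrib distrib_right tac)
 have qap: "(t - c) * a * (t + c) = t * a * t - t * c"
  unfolding pa by (simp add: distrib_left left_diff_distrib tac)
 have sp: "\<sigma> (t + c) = t + c" "\<sigma> (t - c) = t - c" using t c by (simp_all add: star_add star_diff)
 have gen: "U + T + T + Y + - (U - T - T + Y) = T + T + (T + T)"
  "U - T - T + Y + - (U + T + T + Y) = - (T + T + (T + T))" for U Y T :: 'a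
  by (simp_all add: algebra_simps)
 show ?thesis
 proof (rule isoM_two[where p = "t + c" and q = "t - c" and r = "t - c" and s = "t + c"])
  show "\<sigma> (t + c) * a * (t + c) + \<sigma> (t - c) * - a * (t - c) = e"
   unfolding sp mult_minus_right mult_minus_left pap qaq gen(1) 4 ..
  show "\<sigma> (t - c) * a * (t - c) + \<sigma> (t + c) * - a * (t + c) = - e"
   unfolding sp mult_minus_right mult_minus_left pap qaq gen(2) 4 ..
  show "\<sigma> (t + c) * a * (t - c) + \<sigma> (t - c) * - a * (t + c) = 0"
   unfolding sp by (simp add: paq qap)
 qed (use aD a t c symu_neg symu_e add_closed diff_closed in auto)
qed

lemma isoM_scale: assumes "isoM M N" "f : symu" "!!d. d : D ==> f * d = d * f"
 shows "isoM (image_mset ((*) f) M) (image_mset ((*) f) N)"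
proof -
 obtain n a b w where 1: "M = image_mset a (mset_set {..<n::nat})" "N = image_mset b (mset_set {..<n})"
  "!!i. i < n ==> a i : symu" "!!i. i < n ==> b i : symu" "frame {..<n} a {..<n} b w"
  using assms unfolding isoM_def by blast
 have fs: "f * x : symu" if "x : symu" for x
  using that assms(2,3) mult_nz mult_closed by (auto simp: symu_def star_mult)
 have w: "w j k : D" if "j < n" for j k using 1(5) that vec_D[of "w j"] unfolding frame_def by auto
 have "dform {..<n} ((*) f \<circ> a) (w j) (w k) = f * dform {..<n} a (w j) (w k)" if "j < n" "k < n" for j k
  unfolding dform_def sum_distrib_left
 proof (intro sum.cong refl)
  fix i assume "i : {..<n}"
  have "\<sigma> (w j i) * f = f * \<sigma> (w j i)" using assms(3) w that star_closed by metis
  then show "\<sigma> (w j i) * ((*) f \<circ> a) i * w k i = f * (\<sigma> (w j i) * a i * w k i)"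
   by (simp add: mult.assoc[symmetric])
 qed
 then have "frame {..<n} ((*) f \<circ> a) {..<n} ((*) f \<circ> b) w" using 1(5) by (auto simp: frame_def)
 then have "isoM (image_mset ((*) f \<circ> a) (mset_set {..<n})) (image_mset ((*) f \<circ> b) (mset_set {..<n}))"
  using 1 fs by (intro isoM_I) auto
 then show ?thesis unfolding 1 by (simp add: multiset.map_comp)
qed

definition hyp :: "nat => 'a multiset" where "hyp k = repeat_mset k {#e, - e#}"

lemma hyp_add: "hyp (k + l) = hyp k + hyp l" and hyp_mult: "repeat_mset n (hyp k) = hyp (n * k)"
 unfolding hyp_def by (rule repeat_mset_distrib, rule repeat_mset_right)

lemma hyp_size: "size (hyp k) = 2 * k"
 by (simp add: hyp_def)

lemma in_repeat_mset [simp]: "x \<in># repeat_mset n M \<longleftrightarrow> n > 0 \<and> x \<in># M"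
 by (simp flip: count_greater_zero_iff)

text \<open>\<open>torsion M\<close>: the form with entries \<open>M\<close> is a torsion element of the Witt group of \<open>(D, \<sigma>)\<close>.\<close>

definition torsion :: "'a multiset => bool" where
 "torsion M \<longleftrightarrow> (EX n>0. EX k. isoM (repeat_mset n M) (hyp k))"

lemma torsion_symu: "torsion M ==> set_mset M \<subseteq> symu"
 unfolding torsion_def by (auto dest!: isoM_symu(1) simp: subset_iff)

lemma torsion_add: assumes "torsion M" "torsion N" shows "torsion (M + N)"
proof -
 obtain n k m l where 1: "n > 0" "isoM (repeat_mset n M) (hyp k)" "m > 0" "isoM (repeat_mset m N) (hyp l)"
  using assms unfolding torsion_def by auto
 have "isoM (repeat_mset (m * n) M + repeat_mset (n * m) N) (hyp (m * k) + hyp (n * l))"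
  using isoM_add[OF isoM_repeat[OF 1(2), of m] isoM_repeat[OF 1(4), of n]] by (simp add: hyp_mult)
 then show ?thesis unfolding torsion_def using 1
  by (intro exI[of _ "m * n"] conjI exI[of _ "m * k + n * l"]) (auto simp: hyp_add repeat_mset_distrib mult.commute)
qed

lemma torsion_iso: assumes "isoM M N" "torsion N" shows "torsion M"
 using assms isoM_trans[OF isoM_repeat[OF assms(1)]] unfolding torsion_def by blast

text \<open>Passing to the multiple \<open>m * n\<close> makes both the sum and \<open>N\<close>
  hyperbolic; Witt cancellation removes the planes that come from \<open>N\<close>, and the size
  count shows that there are enough of them.\<close>

lemma torsion_cancel: assumes "torsion (M + N)" "torsion N" shows "torsion M"
proof -
 obtain n k m l where 1: "n > 0" "isoM (repeat_mset n (M + N)) (hyp k)" "m > 0" "isoM (repeat_mset m N) (hyp l)"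
  using assms unfolding torsion_def by auto
 have s: "n * (size M + size N) = 2 * k" "m * size N = 2 * l"
  using isoM_size[OF 1(2)] isoM_size[OF 1(4)] by (simp_all add: hyp_size distrib_left)
 have "2 * (m * k) = m * n * size M + n * (2 * l)"
  using s by (metis distrib_left mult.assoc mult.commute mult.left_commute)
 then have le: "n * l \<le> m * k" by simp
 have Ms: "set_mset (repeat_mset (m * n) M) \<subseteq> symu" using torsion_symu[OF assms(1)] by auto
 have "isoM (repeat_mset (m * n) M + hyp (n * l)) (repeat_mset (m * n) M + repeat_mset (n * m) N)"
  using isoM_add[OF isoM_refl[OF Ms] isoM_sym[OF isoM_repeat[OF 1(4), of n]]] by (simp add: hyp_mult)
 moreover have "isoM (repeat_mset (m * n) M + repeat_mset (n * m) N) (hyp (m * k - n * l) + hyp (n * l))"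
  using isoM_repeat[OF 1(2), of m] le by (simp add: hyp_mult repeat_mset_distrib mult.commute flip: hyp_add)
 ultimately have "isoM (repeat_mset (m * n) M + hyp (n * l)) (hyp (m * k - n * l) + hyp (n * l))"
  by (rule isoM_trans)
 from isoM_cancel[OF this] show ?thesis unfolding torsion_def using 1 by (intro exI[of _ "m * n"]) auto
qed

lemma torsion_repeat: assumes "torsion (repeat_mset n M)" "n > 0" shows "torsion M"
proof -
 obtain m k where "m > 0" "isoM (repeat_mset m (repeat_mset n M)) (hyp k)" using assms unfolding torsion_def by auto
 then show ?thesis unfolding torsion_def using assms(2) by (intro exI[of _ "m * n"]) auto
qed

lemma torsion_double: "torsion (M + M) ==> torsion M"
 using torsion_repeat[of 2 M] by (simp add: numeral_2_eq_2)

lemma torsion_empty: "torsion {#}"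
 unfolding torsion_def using isoM_refl[of "{#}"] by (intro exI[of _ 1] conjI exI[of _ 0]) (auto simp: hyp_def)

lemma torsion_hyp: assumes "a : symu" shows "torsion {#a, - a#}"
proof -
 have "repeat_mset 1 M = M" for M :: "'a multiset" by simp
 then have "isoM (repeat_mset 1 {#a, - a#}) (hyp 1)" unfolding hyp_def using isoM_plane[OF assms] by metis
 then show ?thesis unfolding torsion_def by (intro exI[of _ 1]) auto
qed

lemma torsion_diff: assumes "isoM M N" shows "torsion (M + image_mset uminus N)"
proof -
 have N: "set_mset N \<subseteq> symu" using isoM_symu assms by auto
 have "torsion (N + image_mset uminus N)"
  using N
 proof (induction N)
  case (add x N)
  then have "torsion ({#x, - x#} + (N + image_mset uminus N))" by (intro torsion_add[OF torsion_hyp]) auto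
  then show ?case by (simp add: add_mset_commute)
 qed (simp add: torsion_empty)
 moreover have "isoM (M + image_mset uminus N) (N + image_mset uminus N)"
  using assms N symu_neg by (intro isoM_add isoM_refl) auto
 ultimately show ?thesis using torsion_iso by blast
qed

lemma torsion_scale: assumes "torsion M" "f : symu" "!!d. d : D ==> f * d = d * f"
 shows "torsion (image_mset ((*) f) M)"
proof -
 obtain n k where 1: "n > 0" "isoM (repeat_mset n M) (hyp k)" using assms unfolding torsion_def by auto
 have im: "image_mset g (repeat_mset n U) = repeat_mset n (image_mset g U)" for g :: "'a => 'a" and U and n
  by (induction n) auto
 have fD: "f : D" using assms symu by auto
 have "isoM (repeat_mset n (image_mset ((*) f) M)) (repeat_mset k {#f, - f#})"
  using isoM_scale[OF 1(2) assms(2,3)] fD e_right unfolding hyp_def im by simp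
 then have "isoM (repeat_mset n (image_mset ((*) f) M)) (hyp k)"
  unfolding hyp_def using isoM_trans isoM_repeat[OF isoM_plane[OF assms(2)]] by blast
 then show ?thesis unfolding torsion_def using 1 by auto
qed

text \<open>If \<open>n \<langle>1, -b\<rangle>\<close> is hyperbolic, then Witt cancellation makes \<open>n \<langle>1\<rangle>\<close> and \<open>n \<langle>b\<rangle>\<close> isometric.\<close>

theorem torsion_sum_squares: assumes "torsion {#e, - b#}"
 shows "EX (n::nat) x. (ALL i<n. x i : D) \<and> b = (\<Sum>i<n. \<sigma> (x i) * x i)"
proof -
 obtain n k where 1: "n > 0" "isoM (repeat_mset n {#e, - b#}) (hyp k)" using assms unfolding torsion_def by auto
 have k: "k = n" using isoM_size[OF 1(2)] by (simp add: hyp_size)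
 have split: "repeat_mset n {#x, y#} = repeat_mset n {#y#} + repeat_mset n {#x#}" for x y :: 'a
  by (simp flip: repeat_mset_distrib)
 have "isoM (repeat_mset n {#- b#}) (repeat_mset n {#- e#})"
  using 1(2) unfolding k hyp_def split by (rule isoM_cancel)
 then have iso: "isoM (repeat_mset n {#- e#}) (repeat_mset n {#- b#})" by (rule isoM_sym)
 have rep: "repeat_mset n {#x#} = image_mset (\<lambda>_. x) (mset_set {..<n})" for x :: 'a
  by (simp add: image_mset_const_eq)
 obtain w where w: "frame {..<n} (\<lambda>_. - e) {..<n} (\<lambda>_. - b) w"
  using isoM_E(1)[OF iso[unfolded rep]] by auto
 \<comment> \<open>A first column exists since \<open>n > 0\<close>; its value is \<open>- b\<close>
   for a form whose entries are all \<open>- e\<close>.\<close>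
 then have "w 0 : vec {..<n}" "dform {..<n} (\<lambda>_. - e) (w 0) (w 0) = - b"
  using 1(1) by (auto simp: frame_def)
 moreover from this have "dform {..<n} (\<lambda>_. - e) (w 0) (w 0) = - (\<Sum>i<n. \<sigma> (w 0 i) * w 0 i)"
  unfolding dform_def sum_negf[symmetric]
  by (intro sum.cong refl) (simp add: vecD star_closed e_right)
 ultimately show ?thesis by (intro exI[of _ n] exI[of _ "w 0"]) (auto simp: vecD)
qed

end

lemma sum_prod_eq: "(\<Sum>i\<in>I. f i) = (\<Sum>i\<in>I. fst (f i), \<Sum>i\<in>I. snd (f i))"
 for f :: "'i => 'b::comm_monoid_add \<times> 'c::comm_monoid_add"
 by (induction I rule: infinite_finite_induct) (auto simp: prod_eq_iff)

section \<open>Orthogonal sums and trace forms\<close>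

lemma spanning_prod:
 fixes M\<^sub>1 :: "'m::ab_group_add set" and M\<^sub>2 :: "'n::ab_group_add set"
 assumes M1: "smod D e \<sigma> M\<^sub>1 act\<^sub>1" and M2: "smod D e \<sigma> M\<^sub>2 act\<^sub>2"
  and sp: "smod.spanning D M\<^sub>1 act\<^sub>1 I v" "smod.spanning D M\<^sub>2 act\<^sub>2 J w"
 defines "act \<equiv> \<lambda>v c. (act\<^sub>1 (fst v) c, act\<^sub>2 (snd v) c)"
 shows "smod D e \<sigma> (M\<^sub>1 \<times> M\<^sub>2) act"
  and "smod.spanning D (M\<^sub>1 \<times> M\<^sub>2) act (I <+> J) (case_sum (\<lambda>i. (v i, 0)) (\<lambda>j. (0, w j)))" (is "smod.spanning _ _ _ _ ?u")
proof -
 interpret A: smod D e \<sigma> M\<^sub>1 act\<^sub>1 by fact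
 interpret B: smod D e \<sigma> M\<^sub>2 act\<^sub>2 by fact
 show P: "smod D e \<sigma> (M\<^sub>1 \<times> M\<^sub>2) act"
  by unfold_locales
   (auto simp: act_def zero_prod_def A.M_zero B.M_zero A.M_add B.M_add A.M_act B.M_act A.act_add B.act_add
    A.act_plus B.act_plus A.act_act B.act_act A.act_e B.act_e)
 have ov: "finite I" "!!i. i : I ==> v i : M\<^sub>1" and ow: "finite J" "!!i. i : J ==> w i : M\<^sub>2"
  using sp unfolding A.spanning_def B.spanning_def by auto
 have a0: "c : D ==> act\<^sub>1 0 c = 0" "c : D ==> act\<^sub>2 0 c = 0" for c
  using A.act_zero_left B.act_zero_left by auto
 show "smod.spanning D (M\<^sub>1 \<times> M\<^sub>2) act (I <+> J) ?u"
  unfolding smod.spanning_def[OF P]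
 proof (intro conjI ballI)
  show "finite (I <+> J)" using ov ow by auto
  show "!!i. i : I <+> J ==> ?u i : M\<^sub>1 \<times> M\<^sub>2" using ov ow A.M_zero B.M_zero by auto
  fix x assume "x : M\<^sub>1 \<times> M\<^sub>2"
  then have x: "fst x : M\<^sub>1" "snd x : M\<^sub>2" by auto
  obtain k where k: "ALL i:I. k i : D" "fst x = (\<Sum>i\<in>I. act\<^sub>1 (v i) (k i))"
   using sp(1) x unfolding A.spanning_def by blast
  obtain l where l: "ALL i:J. l i : D" "snd x = (\<Sum>i\<in>J. act\<^sub>2 (w i) (l i))"
   using sp(2) x unfolding B.spanning_def by blast
  have "(\<Sum>i\<in>I <+> J. act (?u i) (case_sum k l i)) = (\<Sum>i\<in>I. (act\<^sub>1 (v i) (k i), 0)) + (\<Sum>j\<in>J. (0, act\<^sub>2 (w j) (l j)))"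
   using ov ow k l a0 unfolding Plus_def
   by (subst sum.union_disjoint) (auto simp: sum.reindex act_def)
  also have "\<dots> = x" using k l by (simp add: sum_prod_eq prod_eq_iff)
  finally have "x = (\<Sum>i\<in>I <+> J. act (?u i) (case_sum k l i))" by simp
  moreover have "ALL i:I <+> J. case_sum k l i : D" using k l by auto
  ultimately show "EX k. (ALL i:I <+> J. k i : D) \<and> x = (\<Sum>i\<in>I <+> J. act (?u i) (k i))" by blast
 qed
qed

lemma herm_cone_prod:
 fixes M\<^sub>1 :: "'m::ab_group_add set" and M\<^sub>2 :: "'n::ab_group_add set"
 assumes "herm_cone D e \<sigma> \<P> M\<^sub>1 act\<^sub>1 h\<^sub>1" "herm_cone D e \<sigma> \<P> M\<^sub>2 act\<^sub>2 h\<^sub>2"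
 defines "act \<equiv> \<lambda>v c. (act\<^sub>1 (fst v) c, act\<^sub>2 (snd v) c)"
  and "h \<equiv> \<lambda>v w. h\<^sub>1 (fst v) (fst w) + h\<^sub>2 (snd v) (snd w)"
 shows "herm_cone D e \<sigma> \<P> (M\<^sub>1 \<times> M\<^sub>2) act h"
  and "herm_cone.sig D e \<P> (M\<^sub>1 \<times> M\<^sub>2) act h = herm_cone.sig D e \<P> M\<^sub>1 act\<^sub>1 h\<^sub>1 + herm_cone.sig D e \<P> M\<^sub>2 act\<^sub>2 h\<^sub>2"
proof -
 interpret A: herm_cone D e \<sigma> \<P> M\<^sub>1 act\<^sub>1 h\<^sub>1 by fact
 interpret B: herm_cone D e \<sigma> \<P> M\<^sub>2 act\<^sub>2 h\<^sub>2 by fact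
 obtain I :: "nat set" and v where v: "A.basis I v" using A.ex_basis by auto
 obtain J :: "nat set" and w where w: "B.basis J w" using B.ex_basis by auto
 note ov = A.orthD[OF A.basis_orth[OF v]] and ow = B.orthD[OF B.basis_orth[OF w]]
 define u where "u = case_sum (\<lambda>i. (v i, 0 :: 'n)) (\<lambda>j. (0 :: 'm, w j))"
 note sp = spanning_prod[OF A.smod_axioms B.smod_axioms A.basis_spanning[OF v] B.basis_spanning[OF w], folded act_def u_def]
 interpret P: smod D e \<sigma> "M\<^sub>1 \<times> M\<^sub>2" act by (rule sp(1))
 note span = sp(2)
 have nd: "v = 0" if "v : M\<^sub>1 \<times> M\<^sub>2" "!!w. w : M\<^sub>1 \<times> M\<^sub>2 ==> h v w = 0" for v
 proof -
  have m: "fst v : M\<^sub>1" "snd v : M\<^sub>2" using that(1) by auto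
  have "h\<^sub>1 (fst v) w = 0" if "w : M\<^sub>1" for w
   using \<open>!!w. w : M\<^sub>1 \<times> M\<^sub>2 ==> h v w = 0\<close>[of "(w, 0)"] that m B.M_zero by (simp add: h_def B.h_zero_right)
  moreover have "h\<^sub>2 (snd v) w = 0" if "w : M\<^sub>2" for w
   using \<open>!!w. w : M\<^sub>1 \<times> M\<^sub>2 ==> h v w = 0\<close>[of "(0, w)"] that m A.M_zero by (simp add: h_def A.h_zero_right)
  ultimately show "v = 0" using A.nondeg[OF m(1)] B.nondeg[OF m(2)] by (simp add: prod_eq_iff)
 qed
 have hm: "herm D e \<sigma> (M\<^sub>1 \<times> M\<^sub>2) act h"
 proof
  show "P.finite_dim" by (rule P.spanning_finite_dim[OF span])
 qed (use nd in \<open>auto simp: h_def act_def A.h_closed B.h_closed A.add_closed A.h_add B.h_add A.h_act B.h_act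
   distrib_right A.star_add A.h_star B.h_star\<close>)
 then show hc: "herm_cone D e \<sigma> \<P> (M\<^sub>1 \<times> M\<^sub>2) act h"
  by (intro herm_cone.intro A.star_cone_axioms)
 interpret herm_cone D e \<sigma> \<P> "M\<^sub>1 \<times> M\<^sub>2" act h by (rule hc)
 have hu1: "h (u (Inl i)) (u (Inl j)) = h\<^sub>1 (v i) (v j)" if "i : I" "j : I" for i j
  using that by (auto simp: h_def u_def B.h_zero_right B.M_zero)
 have hu2: "h (u (Inr i)) (u (Inr j)) = h\<^sub>2 (w i) (w j)" if "i : J" "j : J" for i j
  using that by (auto simp: h_def u_def A.h_zero_right A.M_zero)
 have hu3: "h (u (Inl i)) (u (Inr j)) = 0" "h (u (Inr j)) (u (Inl i)) = 0" if "i : I" "j : J" for i j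
  using that ov ow by (auto simp: h_def u_def A.h_zero_right B.h_zero_right A.h_zero_left B.h_zero_left)
 have "orth (I <+> J) u"
  unfolding orth_def using ov ow span
  by (auto simp: P.spanning_def hu1 hu2 hu3) (use ov(4) ow(4) in blast)+
 then have "basis (I <+> J) u" by (rule basis_if_spanning[OF span _ order_refl])
 from sig_eq[OF this] have "sig = (\<Sum>i\<in>I <+> J. A.csgn (h (u i) (u i)))" .
 also have "\<dots> = (\<Sum>i\<in>I. A.csgn (h\<^sub>1 (v i) (v i))) + (\<Sum>j\<in>J. A.csgn (h\<^sub>2 (w j) (w j)))"
  unfolding Plus_def using ov(1) ow(1)
  by (subst sum.union_disjoint) (auto simp: sum.reindex hu1 hu2 intro!: arg_cong2[of _ _ _ _ "(+)"] sum.cong)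
 finally show "sig = A.sig + B.sig" using A.sig_eq[OF v] B.sig_eq[OF w] by simp
qed

section \<open>Orderings of a field and transfers from a finite extension\<close>

context sfield
begin

lemma ordering_square: assumes "ordering_on K \<P>" "x : K" shows "x * x : \<P>"
 using assms unfolding ordering_on_def by (metis minus_mult_minus)

lemma ordering_cone: assumes "ordering_on K \<P>" shows "star_cone K e \<sigma> \<P>"
proof
 have o: "\<P> \<subseteq> K" "!!x y. x : \<P> ==> y : \<P> ==> x + y : \<P>" "!!x y. x : \<P> ==> y : \<P> ==> x * y : \<P>"
  "!!x. x : K ==> x : \<P> \<or> - x : \<P>" "!!x. x : \<P> ==> - x : \<P> ==> x = 0"
  using assms unfolding ordering_on_def by blast+
 fix x c y
 show "x : \<P> ==> x : K" using o by auto
 show "x : \<P> ==> \<sigma> x = x" using o star_id by auto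
 show "x : \<P> ==> y : \<P> ==> x + y : \<P>" by (rule o)
 show "x : \<P> ==> - x : \<P> ==> x = 0" by (rule o)
 show "x : K ==> x : \<P> \<or> - x : \<P>" by (rule o)
 show "\<sigma> c * x * c : \<P>" if x: "x : \<P>" and c: "c : K"
 proof -
  have "\<sigma> c * x * c = x * (c * c)" using comm[of c x] c subsetD[OF o(1) x] star_id by (simp add: mult.assoc[symmetric])
  then show ?thesis using o(3)[OF x ordering_square[OF assms c]] by simp
 qed
qed

lemma csgn_mult: assumes "ordering_on K \<P>" "x : K" "x ~= 0" "k : \<P>" "k ~= 0"
 shows "star_cone.csgn \<P> (x * k) = star_cone.csgn \<P> x" "star_cone.csgn \<P> (k * x) = star_cone.csgn \<P> x"
proof -
 interpret star_cone K e \<sigma> \<P> by (rule ordering_cone) fact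
 have k: "k : K" using assms cone_sub by auto
 have o: "!!x y. x : \<P> ==> y : \<P> ==> x * y : \<P>" using assms unfolding ordering_on_def by blast
 have "x * k : \<P> \<longleftrightarrow> x : \<P>"
 proof
  assume xk: "x * k : \<P>"
  show "x : \<P>"
  proof (rule ccontr)
   assume "x \<notin> \<P>"
   then have "- x : \<P>" using cone_total assms(2) star_id by blast
   then have "- (x * k) : \<P>" using o[of "- x" k] assms(4) by simp
   then show False using cone_antisym[OF xk] mult_nz assms k by blast
  qed
 qed (use o assms in auto)
 then show "csgn (x * k) = csgn x" by (simp add: csgn_def)
 then show "csgn (k * x) = csgn x" using comm assms k by simp
qed

end

text \<open>The forms \<open>tform z\<close> built from \<open>\<tau>\<close> are the transfers to
  \<open>K\<close> of the one-dimensional forms over \<open>L\<close> with entry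
  \<open>z\<close>.\<close>

locale trace_ext = L: sfield L e \<sigma> + K: sfield K e \<sigma> for L :: "'a::ring_1 set" and e \<sigma> and K +
 fixes \<P> :: "'a set" and \<tau> :: "'a => 'a"
 assumes sub: "K \<subseteq> L" and ord: "ordering_on K \<P>"
  and tau_K: "x : L ==> \<tau> x : K" and tau_add: "x : L ==> y : L ==> \<tau> (x + y) = \<tau> x + \<tau> y"
  and tau_lin: "x : L ==> k : K ==> \<tau> (x * k) = \<tau> x * k" and tau_nz: "EX x:L. \<tau> x ~= 0"
  and span: "EX (I::nat set) b. smod.spanning K L (*) I b"
begin

lemma KL: "k : K ==> k : L" using sub by auto

sublocale star_cone K e \<sigma> \<P> by (rule K.ordering_cone[OF ord])

sublocale mod: smod K e \<sigma> L "(*)"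
 by unfold_locales
  (auto simp: L.zero_closed L.add_closed L.mult_closed KL distrib_left distrib_right mult.assoc L.e_right)

definition tform :: "'a => 'a => 'a => 'a" where "tform z x y = \<tau> (z * x * y)"

lemma tform_herm: assumes "z : L.units" shows "herm_cone K e \<sigma> \<P> L (*) (tform z)"
proof -
 have z: "z : L" "z ~= 0" using assms L.units by auto
 have "herm K e \<sigma> L (*) (tform z)"
 proof
  fix u v w c assume v: "v : L"
  show "w : L ==> tform z v w : K" using v z by (auto simp: tform_def L.mult_closed tau_K)
  show "u : L ==> w : L ==> tform z u (v + w) = tform z u v + tform z u w"
   using v z by (auto simp: tform_def L.mult_closed tau_add distrib_left)
  show "w : L ==> c : K ==> tform z v (w * c) = tform z v w * c"
   using v z tau_lin[of "z * v * w" c] by (auto simp: tform_def L.mult_closed mult.assoc)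
  show "\<sigma> (tform z v w) = tform z w v" if w: "w : L"
   using v z w by (simp add: tform_def K.star_id tau_K L.mult_closed mult.assoc L.comm[of v w])
  show "v = 0" if nd: "!!w. w : L ==> tform z v w = 0"
  proof (rule ccontr)
   assume nz: "v ~= 0"
   obtain x where x: "x : L" "\<tau> x ~= 0" using tau_nz by auto
   have zv: "z * v : L" "z * v ~= 0" using z v nz L.mult_closed L.mult_nz by auto
   have d: "L.dinv (z * v) : L" using L.dinv_closed zv by auto
   have "z * v * (L.dinv (z * v) * x) = x" using zv x L.dinv_right L.e_left by (simp flip: mult.assoc)
   then show False using nd[OF L.mult_closed[OF d x(1)]] x(2) by (simp add: tform_def)
  qed
 next
  show "mod.finite_dim" using span mod.spanning_finite_dim by blast
 qed
 then show ?thesis by (intro herm_cone.intro star_cone_axioms)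
qed

definition tsig :: "'a => int" where "tsig z = herm_cone.sig K e \<P> L (*) (tform z)"

lemma tsig_eq: "z : L.units ==> herm.basis K e L (*) (tform z) I v ==> tsig z = (\<Sum>i\<in>I. csgn (tform z (v i) (v i)))"
 unfolding tsig_def using herm_cone.sig_eq[OF tform_herm] .

lemma tsig_basis: assumes "z : L.units"
 obtains I :: "nat set" and v where "herm.basis K e L (*) (tform z) I v" "tsig z = (\<Sum>i\<in>I. csgn (tform z (v i) (v i)))"
  "finite I" "!!i. i : I ==> v i : L" "!!i. i : I ==> tform z (v i) (v i) : K" "!!i. i : I ==> tform z (v i) (v i) ~= 0"
  "!!i j. i : I ==> j : I ==> i ~= j ==> tform z (v i) (v j) = 0"
proof -
 interpret herm_cone K e \<sigma> \<P> L "(*)" "tform z" by (rule tform_herm[OF assms])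
 obtain I :: "nat set" and v where v: "basis I v" using ex_basis by auto
 show ?thesis using that[OF v tsig_eq[OF assms v]] orthD[OF basis_orth[OF v]] by auto
qed

lemma tsig_compare:
 assumes z: "z : L.units" and z': "z' : L.units"
  and corr: "!!I v. herm.orth L (tform z) (I::nat set) v ==> herm.orth L (tform z') I (\<lambda>i. \<phi> (v i)) \<and>
   (ALL i:I. csgn (tform z' (\<phi> (v i)) (\<phi> (v i))) = s * csgn (tform z (v i) (v i)))"
 shows "tsig z' = s * tsig z"
proof -
 interpret A: herm_cone K e \<sigma> \<P> L "(*)" "tform z" by (rule tform_herm[OF z])
 interpret B: herm_cone K e \<sigma> \<P> L "(*)" "tform z'" by (rule tform_herm[OF z'])
 obtain I :: "nat set" and v where v: "A.basis I v" using A.ex_basis by auto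
 note c = corr[OF A.basis_orth[OF v]]
 have "B.basis I (\<lambda>i. \<phi> (v i))" using B.basis_if_spanning[OF A.basis_spanning[OF v]] c by blast
 then have "tsig z' = (\<Sum>i\<in>I. csgn (tform z' (\<phi> (v i)) (\<phi> (v i))))" by (rule tsig_eq[OF z'])
 then show ?thesis using tsig_eq[OF z v] c by (simp add: sum_distrib_left)
qed

lemma tsig_neg: assumes z: "z : L.units" shows "tsig (- z) = - tsig z"
proof -
 interpret A: herm_cone K e \<sigma> \<P> L "(*)" "tform z" by (rule tform_herm[OF z])
 interpret B: herm_cone K e \<sigma> \<P> L "(*)" "tform (- z)" by (rule tform_herm[OF L.units_neg[OF z]])
 have neg: "tform (- z) x y = - tform z x y" if "x : L" "y : L" for x y
  using tau_lin[of "z * x * y" "- e"] that z L.units K.neg_closed K.e_closed L.mult_closed tau_K K.e_right L.e_right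
  by (simp add: tform_def)
 have "tsig (- z) = - 1 * tsig z"
 proof (rule tsig_compare[OF z L.units_neg[OF z]])
  fix I :: "nat set" and v assume o: "A.orth I v"
  note o' = A.orthD[OF o]
  show "B.orth I (\<lambda>i. v i) \<and> (ALL i:I. csgn (tform (- z) (v i) (v i)) = - 1 * csgn (tform z (v i) (v i)))"
   using o' neg csgn_neg by (auto simp: B.orth_def)
 qed
 then show ?thesis by simp
qed

lemma tsig_pos: assumes z: "z : L.units" and k: "k : \<P>" "k ~= 0" shows "tsig (z * k) = tsig z"
proof -
 have zk: "z * k : L.units" using z k L.units_mult KL cone_sub L.unitsI by auto
 interpret A: herm_cone K e \<sigma> \<P> L "(*)" "tform z" by (rule tform_herm[OF z])
 interpret B: herm_cone K e \<sigma> \<P> L "(*)" "tform (z * k)" by (rule tform_herm[OF zk])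
 have kK: "k : K" using k cone_sub by auto
 have mul: "tform (z * k) x y = tform z x y * k" if "x : L" "y : L" for x y
 proof -
  have "z * k * x * y = z * x * y * k" using L.comm[of k "x * y"] KL[OF kK] that L.mult_closed by (simp add: mult.assoc)
  then show ?thesis using tau_lin[of "z * x * y" k] that z kK L.units L.mult_closed by (simp add: tform_def)
 qed
 have "tsig (z * k) = 1 * tsig z"
 proof (rule tsig_compare[OF z zk])
  fix I :: "nat set" and v assume o: "A.orth I v"
  note o' = A.orthD[OF o]
  show "B.orth I (\<lambda>i. v i) \<and> (ALL i:I. csgn (tform (z * k) (v i) (v i)) = 1 * csgn (tform z (v i) (v i)))"
   using o' mul k K.mult_nz kK K.csgn_mult[OF ord] by (auto simp: B.orth_def)
 qed
 then show ?thesis by simp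
qed

lemma tsig_square: assumes z: "z : L.units" and x: "x : L.units" shows "tsig (x * x * z) = tsig z"
proof -
 have zx: "x * x * z : L.units" using z x L.units_mult by auto
 interpret A: herm_cone K e \<sigma> \<P> L "(*)" "tform z" by (rule tform_herm[OF z])
 interpret B: herm_cone K e \<sigma> \<P> L "(*)" "tform (x * x * z)" by (rule tform_herm[OF zx])
 let ?d = "L.dinv x"
 have d: "?d : L" "x * ?d = e" using L.dinv_closed L.dinv_right x L.units by auto
 have xL: "x : L" "z : L" using x z L.units by auto
 have eq: "tform (x * x * z) (?d * v) (?d * w) = tform z v w" if "v : L" "w : L" for v w
 proof -
  have "x * x * z * (?d * v) * (?d * w) = (x * ?d) * ((x * ?d) * (z * v * w))"
   using that xL d(1) by (simp add: mult.assoc L.comm L.comm3 L.mult_closed)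
  then show ?thesis using d that xL by (simp add: tform_def L.e_left L.mult_closed)
 qed
 have "tsig (x * x * z) = 1 * tsig z"
 proof (rule tsig_compare[OF z zx, where \<phi> = "\<lambda>v. ?d * v"])
  fix I :: "nat set" and v assume o: "A.orth I v"
  note o' = A.orthD[OF o]
  show "B.orth I (\<lambda>i. ?d * v i) \<and> (ALL i:I. csgn (tform (x * x * z) (?d * v i) (?d * v i)) = 1 * csgn (tform z (v i) (v i)))"
   using o' eq d L.mult_closed by (auto simp: B.orth_def)
 qed
 then show ?thesis by simp
qed

lemma tau_zero: "\<tau> 0 = 0"
 using tau_add[of 0 0] L.zero_closed by simp

text \<open>The vectors \<open>(v, v)\<close> and \<open>(y * u, - (x * u))\<close> realise over
  \<open>K\<close> the decomposition of the plane with entries \<open>x\<close>, \<open>y\<close>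
  into entries \<open>x + y\<close> and \<open>x * y * (x + y)\<close>.\<close>

lemma tsig_exchange: assumes x: "x : L.units" and y: "y : L.units" and xy: "x + y : L.units"
 shows "tsig x + tsig y = tsig (x + y) + tsig (x * y * (x + y))"
proof -
 let ?w = "x * y * (x + y)"
 have w: "?w : L.units" using x y xy L.units_mult by auto
 have D: "x : L" "y : L" "x + y : L" using x y xy L.units by auto
 let ?act = "\<lambda>v c. (fst v * c, snd v * c)" and ?h = "\<lambda>v w. tform x (fst v) (fst w) + tform y (snd v) (snd w)"
 note P = herm_cone_prod[OF tform_herm[OF x] tform_herm[OF y]]
 interpret P: herm_cone K e \<sigma> \<P> "L \<times> L" ?act ?h by (rule P(1))
 obtain I :: "nat set" and v where v: "tsig (x + y) = (\<Sum>i\<in>I. csgn (tform (x + y) (v i) (v i)))" "finite I"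
  "!!i. i : I ==> v i : L" "!!i. i : I ==> tform (x + y) (v i) (v i) ~= 0"
  "!!i j. i : I ==> j : I ==> i ~= j ==> tform (x + y) (v i) (v j) = 0" "herm.basis K e L (*) (tform (x + y)) I v"
  by (rule tsig_basis[OF xy]) (rule that; assumption)
 obtain J :: "nat set" and u where u: "tsig ?w = (\<Sum>i\<in>J. csgn (tform ?w (u i) (u i)))" "finite J"
  "!!i. i : J ==> u i : L" "!!i. i : J ==> tform ?w (u i) (u i) ~= 0"
  "!!i j. i : J ==> j : J ==> i ~= j ==> tform ?w (u i) (u j) = 0" "herm.basis K e L (*) (tform ?w) J u"
  by (rule tsig_basis[OF w]) (rule that; assumption)
 define r where "r = case_sum (\<lambda>i. (v i, v i)) (\<lambda>j. (y * u j, - (x * u j)))"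
 have h1: "?h (a, a) (b, b) = tform (x + y) a b" if "a : L" "b : L" for a b
  using that D by (simp add: tform_def distrib_right tau_add L.mult_closed)
 have h2: "?h (y * a, - (x * a)) (y * b, - (x * b)) = tform ?w a b" if "a : L" "b : L" for a b
 proof -
  have "x * (y * a) * (y * b) + y * (x * a) * (x * b) = ?w * a * b"
   using that D by (simp add: mult.assoc L.comm L.comm3 L.mult_closed distrib_left distrib_right)
  then show ?thesis using that D by (simp add: tform_def tau_add[symmetric] L.mult_closed)
 qed
 have h3: "?h (a, a) (y * b, - (x * b)) = 0" "?h (y * b, - (x * b)) (a, a) = 0" if "a : L" "b : L" for a b
 proof -
  have "x * a * (y * b) + y * a * (- (x * b)) = 0" "x * (y * b) * a + y * (- (x * b)) * a = 0"
   using that D by (simp_all add: mult.assoc L.comm L.comm3 L.mult_closed)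
  then show "?h (a, a) (y * b, - (x * b)) = 0" "?h (y * b, - (x * b)) (a, a) = 0"
   using that D tau_add[of "x * a * (y * b)" "y * a * (- (x * b))"] tau_add[of "x * (y * b) * a" "y * (- (x * b)) * a"] tau_zero
   by (simp_all add: tform_def L.mult_closed L.neg_closed)
 qed
 have orth: "P.orth (I <+> J) r"
  unfolding P.orth_def using u v D h1 h2 h3 L.mult_closed L.neg_closed
  by (auto simp: r_def) (use u(5) v(5) in blast)+
 obtain I1 :: "nat set" and v1 where 1: "herm.basis K e L (*) (tform x) I1 v1" by (rule tsig_basis[OF x]) (rule that; assumption)
 obtain I2 :: "nat set" and v2 where 2: "herm.basis K e L (*) (tform y) I2 v2" by (rule tsig_basis[OF y]) (rule that; assumption)
 have card: "card A = card B" if "herm.basis K e L (*) (tform a) A f" "herm.basis K e L (*) (tform b) B g" "a : L.units" "b : L.units"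
  for a b A B and f g :: "nat => 'a"
 proof -
  interpret A: herm_cone K e \<sigma> \<P> L "(*)" "tform a" by (rule tform_herm[OF that(3)])
  interpret B: herm_cone K e \<sigma> \<P> L "(*)" "tform b" by (rule tform_herm[OF that(4)])
  show ?thesis using A.orth_card_le[OF B.basis_spanning[OF that(2)] A.basis_orth[OF that(1)]]
   B.orth_card_le[OF A.basis_spanning[OF that(1)] B.basis_orth[OF that(2)]] by simp
 qed
 have sp: "mod.spanning I v" using herm.basis_spanning[OF _ v(6)] tform_herm[OF xy] herm_cone.axioms by blast
 have "P.spanning (I <+> I) (case_sum (\<lambda>i. (v i, 0)) (\<lambda>i. (0, v i)))"
  by (rule spanning_prod(2)[OF mod.smod_axioms mod.smod_axioms sp sp])
 moreover have "card (I <+> I) \<le> card (I <+> J)" using card[OF v(6) u(6) xy w] u(2) v(2) by (simp add: card_Plus)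
 ultimately have "P.basis (I <+> J) r" using P.basis_if_spanning orth by blast
 from P.sig_eq[OF this] have "P.sig = (\<Sum>i\<in>I <+> J. csgn (?h (r i) (r i)))" .
 also have "\<dots> = (\<Sum>i\<in>I. csgn (tform (x + y) (v i) (v i))) + (\<Sum>j\<in>J. csgn (tform ?w (u j) (u j)))"
  unfolding Plus_def using u(2) v(2)
 proof (subst sum.union_disjoint)
  show "(\<Sum>i\<in>Inl ` I. csgn (?h (r i) (r i))) + (\<Sum>i\<in>Inr ` J. csgn (?h (r i) (r i)))
   = (\<Sum>i\<in>I. csgn (tform (x + y) (v i) (v i))) + (\<Sum>j\<in>J. csgn (tform ?w (u j) (u j)))"
   using h1 h2 u(3) v(3) by (simp add: sum.reindex r_def)
 qed auto
 finally show ?thesis using P(2) u(1) v(1) by (simp add: tsig_def)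
qed

text \<open>Vanishing of the total transferred signature is a Witt predicate on \<open>L\<close>, so
  a form on which it does not vanish yields an ordering. That ordering extends \<open>\<P>\<close>:
  scaling by a nonzero element \<open>c\<close> of \<open>\<P>\<close> leaves \<open>tsig\<close>
  unchanged, hence a Pfister entry \<open>- c\<close> makes every total signature zero.\<close>

theorem ex_ordering_ext:
 assumes M: "set_mset M \<subseteq> L.units" and nz: "(\<Sum>z\<in>#M. tsig z) ~= 0"
 shows "EX \<P>'. ordering_on L \<P>' \<and> \<P> \<subseteq> \<P>'"
proof -
 interpret witt_pred_form L e \<sigma> "\<lambda>M. (\<Sum>z\<in>#M. tsig z) = 0" M
 proof
  fix x z assume "x : L.units" "z : L.units"
  then show "(\<Sum>z\<in>#{#x * x * z, - z#}. tsig z) = 0" by (simp add: tsig_neg tsig_square)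
 next
  fix x y assume "x : L.units" "y : L.units" "x + y : L.units"
  then show "(\<Sum>z\<in>#{#x, y, - (x + y), - (x * y * (x + y))#}. tsig z) = 0"
   using tsig_exchange[of x y] tsig_neg[of "x + y"] tsig_neg[of "x * y * (x + y)"] L.units_mult by simp
 qed (use M nz tsig_neg in auto)
 obtain \<P>' where o: "ordering_on L \<P>'"
  and nz': "!!zs. set zs \<subseteq> \<P>' - {0} ==> EX z:L.units. (\<Sum>x\<in>#image_mset ((*) z) (pfister zs M). tsig x) ~= 0"
  using ex_ordering by auto
 have "c : \<P>'" if c: "c : \<P>" for c
 proof (rule ccontr)
  assume n: "c \<notin> \<P>'"
  have cL: "c : L" using c cone_sub KL by auto
  have "- c : \<P>'" using n o cL unfolding ordering_on_def by auto
  moreover have c0: "c ~= 0" using n o L.zero_closed unfolding ordering_on_def by (metis neg_0_equal_iff_equal)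
  ultimately obtain z where z: "z : L.units" "(\<Sum>x\<in>#image_mset ((*) z) (pfister [- c] M). tsig x) ~= 0"
   using nz'[of "[- c]"] by auto
  have eq: "tsig (z * (- c * x)) = - tsig (z * x)" if "x \<in># M" for x
  proof -
   have x: "x : L.units" using that M by auto
   have "z * (- c * x) = - (z * x * c)" using L.comm[of c x] cL x L.units by (simp add: mult.assoc)
   then show ?thesis using tsig_neg[of "z * x * c"] tsig_pos[of "z * x" c] L.units_mult z x c c0 L.unitsI[OF cL] by simp
  qed
  have "(\<Sum>x\<in>#image_mset ((*) z) (pfister [- c] M). tsig x) = (\<Sum>x\<in>#M. tsig (z * x)) + (\<Sum>x\<in>#M. tsig (z * (- c * x)))"
   by (simp add: multiset.map_comp comp_def)
  also have "(\<Sum>x\<in>#M. tsig (z * (- c * x))) = (\<Sum>x\<in>#M. - tsig (z * x))"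
   by (intro arg_cong[of _ _ sum_mset] image_mset_cong eq)
  also have "\<dots> = - (\<Sum>x\<in>#M. tsig (z * x))" by (induction M) auto
  finally show False using z(2) by simp
 qed
 then show ?thesis using o by auto
qed

end

text \<open>Only signs and nonvanishing of the values matter for a signature, so the coefficients
  may change along \<open>c\<close> as long as spanning families go to spanning families.\<close>

lemma sig_transport:
 fixes M :: "'m::ab_group_add set" and M' :: "'n::ab_group_add set"
 assumes A: "herm_cone D e \<sigma> \<P> M act h" and B: "herm_cone D' e' \<sigma>' \<P>' M' act' h'"
  and h: "!!v w. v : M ==> w : M ==> h' (g v) (g w) = c (h v w)"
  and c: "c 0 = 0" "!!x. x : D ==> c x = 0 ==> x = 0" "!!x. x : D ==> \<sigma> x = x ==> c x : \<P>' \<longleftrightarrow> x : \<P>"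
  and sp: "!!(I::nat set) b. smod.spanning D M act I b ==> smod.spanning D' M' act' I (\<lambda>i. g (b i))"
 shows "herm_cone.sig D' e' \<P>' M' act' h' = herm_cone.sig D e \<P> M act h"
proof -
 interpret A: herm_cone D e \<sigma> \<P> M act h by (rule A)
 interpret B: herm_cone D' e' \<sigma>' \<P>' M' act' h' by (rule B)
 obtain I :: "nat set" and v where v: "A.basis I v" using A.ex_basis by auto
 note o = A.orthD[OF A.basis_orth[OF v]]
 have s: "B.spanning I (\<lambda>i. g (v i))" by (rule sp[OF A.basis_spanning[OF v]])
 have nz: "c (h (v i) (v i)) ~= 0" if "i : I" for i using o(3,5)[OF that] c(2) by blast
 have "B.orth I (\<lambda>i. g (v i))"
  using o c(1) nz s unfolding B.orth_def B.spanning_def by (auto simp: h)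
 then have "B.basis I (\<lambda>i. g (v i))" by (rule B.basis_if_spanning[OF s _ order_refl])
 from B.sig_eq[OF this] have "B.sig = (\<Sum>i\<in>I. B.csgn (h' (g (v i)) (g (v i))))" .
 also have "\<dots> = (\<Sum>i\<in>I. A.csgn (h (v i) (v i)))"
  using o c by (intro sum.cong) (auto simp: h A.csgn_def B.csgn_def)
 finally show ?thesis using A.sig_eq[OF v] by simp
qed

section \<open>Trace forms of etale algebras\<close>

text \<open>A finite etale algebra over a subfield \<open>K\<close> of an algebraically closed field is realised as an algebra
 \<open>B\<close> of functions on the finite set \<open>U\<close> of its points; its trace is the sum over the points.\<close>

definition ind :: "nat set => nat => 'o::field" where "ind Y = (\<lambda>x. if x : Y then 1 else 0)"
definition sact :: "(nat => 'o::field) => 'o => nat => 'o" where "sact b k = (\<lambda>x. b x * k)"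
definition trh :: "nat set => (nat => 'o::field) => (nat => 'o) => (nat => 'o) => 'o" where
 "trh U z v w = (\<Sum>x\<in>U. z x * v x * w x)"

text \<open>The values of functions in \<open>B\<close> need not lie in \<open>K\<close>, only their
  sums over \<open>U\<close> do; a point of \<open>U\<close> need not split off before scalars are
  extended.\<close>

locale etale = sfield K 1 id for K :: "'o::field set" +
 fixes \<P> :: "'o set" and U :: "nat set" and B :: "(nat => 'o) set"
 assumes ord: "ordering_on K \<P>" and finX: "finite U"
  and B_supp: "b : B ==> x \<notin> U ==> b x = 0" and B_ind: "ind U : B"
  and B_add: "b : B ==> b' : B ==> b + b' : B" and B_mult: "b : B ==> b' : B ==> b * b' : B"
  and B_sact: "b : B ==> k : K ==> sact b k : B"
  and sep: "x : U ==> y : U ==> x ~= y ==> EX b:B. b x ~= b y"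
  and B_tr: "b : B ==> (\<Sum>x\<in>U. b x) : K"
  and nondegenerate: "b : B ==> (!!w. w : B ==> (\<Sum>x\<in>U. b x * w x) = 0) ==> b = 0"
  and span: "EX (I::nat set) b. smod.spanning K B sact I b"
begin

sublocale star_cone K 1 id \<P> by (rule ordering_cone[OF ord])

lemma B_zero: "0 : B"
proof -
 have "sact (ind U) 0 = (0 :: nat => 'o)" by (rule ext) (simp add: sact_def)
 then show ?thesis using B_sact[OF B_ind zero_closed] by simp
qed

sublocale mod: smod K 1 id B sact
 by unfold_locales (use B_zero B_add B_sact in \<open>auto simp: sact_def distrib_left distrib_right mult.assoc\<close>)

lemma B_neg: "b : B ==> - b : B"
 using B_sact[OF _ neg_closed[OF e_closed], of b] by (simp add: sact_def fun_Compl_def)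

lemma B_diff: "b : B ==> c : B ==> b - c : B"
 using B_add[OF _ B_neg, of b c] by simp

definition Bu :: "(nat => 'o) set" where "Bu = {z : B. ALL x:U. z x ~= 0}"

lemma ind_left: "b : B ==> ind U * b = b"
 using B_supp by (auto simp: ind_def fun_eq_iff)

text \<open>Divide a polynomial relation among the powers of \<open>t\<close> by its lowest term:
  where \<open>t\<close> does not vanish this expresses 1 as \<open>t\<close> times a polynomial
  \<open>s\<close> in \<open>t\<close>, and elsewhere the product is zero. Hence \<open>B\<close>
  contains the indicator of the support of \<open>t\<close>.\<close>

lemma supp: assumes t: "t : B"
 shows "EX s:B. t * s = ind {x : U. t x ~= 0}"
proof -
 have pw: "ind U * t ^ j : B" for j
 proof (induction j)
  case (Suc j)
  have "ind U * t ^ Suc j = (ind U * t ^ j) * t" by (simp only: power_Suc2 mult.assoc)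
  then show ?case using B_mult[OF Suc t] by (simp only:)
 qed (simp add: B_ind)
 have pa: "(ind U * t ^ j) x = t x ^ j" if "x : U" for j x
  using that by (induction j) (auto simp: ind_def)
 obtain I :: "nat set" and b where sp: "mod.spanning I b" using span by auto
 obtain N :: nat where N: "ALL v. (ALL i<=N. v i : B) -->
   (EX c. (ALL i<=N. c i : K) \<and> (EX i<=N. c i ~= 0) \<and> (\<Sum>i\<le>N. sact (v i) (c i)) = 0)"
  using mod.spanning_finite_dim[OF sp] unfolding mod.finite_dim_def by (elim exE) (rule that)
 have "EX c. (ALL i<=N. c i : K) \<and> (EX i<=N. c i ~= 0) \<and> (\<Sum>i\<le>N. sact (ind U * t ^ Suc i) (c i)) = 0"
  by (rule mp[OF spec[OF N, of "\<lambda>i. ind U * t ^ Suc i"]]) (intro allI impI pw)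
 then obtain c where c: "ALL i<=N. c i : K" "EX i<=N. c i ~= 0" "(\<Sum>i\<le>N. sact (ind U * t ^ Suc i) (c i)) = 0"
  by - (erule exE, erule conjE, erule conjE, rule that; assumption)
 define m where "m = (LEAST i. i \<le> N \<and> c i ~= 0)"
 have m: "m \<le> N" "c m ~= 0" using LeastI_ex[OF c(2)] unfolding m_def by auto
 have lt: "c i = 0" if "i < m" for i using not_less_Least[OF that[unfolded m_def]] that m(1) by simp
 define d where "d = dinv (c m)"
 have d: "d : K" "c m * d = 1" using m c(1) dinv_closed dinv_right by (auto simp: d_def)
 define s where "s = (\<Sum>i\<in>{m<..N}. sact (ind U * t ^ (i - Suc m)) (- (c i * d)))"
 have s: "s : B" unfolding s_def
  using pw c(1) d(1) by (intro mod.M_sum B_sact neg_closed mult_closed) auto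
 have "(t * s) x = ind {x : U. t x ~= 0} x" for x
 proof (cases "x : U \<and> t x ~= 0")
  case False
  then show ?thesis using B_supp[OF s] by (auto simp: ind_def)
 next
  case True
  then have x: "x : U" "t x ~= 0" by auto
  have "0 = (\<Sum>i\<le>N. sact (ind U * t ^ Suc i) (c i)) x" using c(3) by simp
  also have "\<dots> = (\<Sum>i\<le>N. t x ^ Suc i * c i)" unfolding fun_sum_apply sact_def using pa x by (intro sum.cong) auto
  also have "\<dots> = (\<Sum>i\<in>{m..N}. t x ^ Suc i * c i)" using lt by (intro sum.mono_neutral_right) auto
  also have "{m..N} = insert m {m<..N}" using m by auto
  also have "(\<Sum>i\<in>insert m {m<..N}. t x ^ Suc i * c i) = t x ^ Suc m * c m + (\<Sum>i\<in>{m<..N}. t x ^ Suc i * c i)"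
   by (subst sum.insert) auto
  also have "(\<Sum>i\<in>{m<..N}. t x ^ Suc i * c i) = (\<Sum>i\<in>{m<..N}. t x ^ Suc m * (t x * t x ^ (i - Suc m) * c i))"
  proof (intro sum.cong refl)
   fix i assume "i : {m<..N}"
   then have "Suc i = Suc m + Suc (i - Suc m)" by auto
   then have "t x ^ Suc i = t x ^ Suc m * t x ^ Suc (i - Suc m)" by (simp only: power_add)
   then show "t x ^ Suc i * c i = t x ^ Suc m * (t x * t x ^ (i - Suc m) * c i)"
    by (simp only: power_Suc[of "t x" "i - Suc m"] mult.assoc)
  qed
  also have "\<dots> = t x ^ Suc m * (\<Sum>i\<in>{m<..N}. t x * t x ^ (i - Suc m) * c i)" by (simp only: sum_distrib_left)
  finally have "t x ^ Suc m * (c m + (\<Sum>i\<in>{m<..N}. t x * t x ^ (i - Suc m) * c i)) = 0" by (simp only: distrib_left)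
  then have z: "(\<Sum>i\<in>{m<..N}. t x * t x ^ (i - Suc m) * c i) = - c m"
   using x by (simp add: add_eq_0_iff)
  have "(t * s) x = t x * (\<Sum>i\<in>{m<..N}. t x ^ (i - Suc m) * (- (c i * d)))"
   using pa x by (simp add: s_def fun_sum_apply sact_def)
  also have "\<dots> = - (d * (\<Sum>i\<in>{m<..N}. t x * t x ^ (i - Suc m) * c i))"
   by (simp add: sum_distrib_left sum_negf ac_simps)
  also have "\<dots> = 1" using z d(2) by (simp add: ac_simps)
  finally show ?thesis using x by (simp add: ind_def)
 qed
 then have "t * s = ind {x : U. t x ~= 0}" by (rule ext)
 then show ?thesis using s by (rule bexI)
qed

lemma Bu_inverse: assumes "z : Bu" shows "EX s:B. z * s = ind U"
proof -
 have "{x : U. z x ~= 0} = U" "z : B" using assms by (auto simp: Bu_def)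
 then show ?thesis using supp[of z] by simp
qed

lemma Bu_ind: "ind U : Bu" and Bu_mult: "z : Bu ==> w : Bu ==> z * w : Bu"
 by (auto simp: Bu_def B_ind B_mult) (simp add: ind_def)

lemma pfister_Bu: "set zs \<subseteq> Bu ==> set_mset (pfister zs {#ind U#}) \<subseteq> Bu"
 by (induction zs) (auto intro!: Bu_mult simp: Bu_ind)

lemma trh_herm: assumes "z : Bu" shows "herm_cone K 1 id \<P> B sact (trh U z)"
proof -
 have z: "z : B" using assms by (auto simp: Bu_def)
 obtain s where s: "s : B" "z * s = ind U" using Bu_inverse[OF assms] by auto
 have "herm K 1 id B sact (trh U z)"
 proof
  fix u v w c assume v: "v : B"
  show "w : B ==> trh U z v w : K"
   using B_tr[OF B_mult[OF B_mult[OF z v]], of w] by (simp add: trh_def)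
  show "trh U z u (v + w) = trh U z u v + trh U z u w" by (simp add: trh_def distrib_left sum.distrib)
  show "trh U z v (sact w c) = trh U z v w * c" by (simp add: trh_def sact_def sum_distrib_right mult.assoc)
  show "id (trh U z v w) = trh U z w v" by (simp add: trh_def ac_simps)
  show "v = 0" if nd: "!!w. w : B ==> trh U z v w = 0"
  proof (rule nondegenerate[OF v])
   fix w assume w: "w : B"
   have "(\<Sum>x\<in>U. v x * w x) = trh U z v (s * w)" unfolding trh_def
   proof (intro sum.cong refl)
    fix x assume "x : U"
    then have "z x * s x = 1" using fun_cong[OF s(2), of x] by (simp add: ind_def)
    then show "v x * w x = z x * v x * (s * w) x" by (simp add: mult.assoc[symmetric])
   qed
   then show "(\<Sum>x\<in>U. v x * w x) = 0" using nd[OF B_mult[OF s(1) w]] by simp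
  qed
 next
  show "mod.finite_dim" using span mod.spanning_finite_dim by blast
 qed
 then show ?thesis by (intro herm_cone.intro star_cone_axioms)
qed

definition sg :: "(nat => 'o) => int" where "sg z = herm_cone.sig K 1 \<P> B sact (trh U z)"

definition cut :: "nat set => (nat => 'o) set" where "cut Y = {b : B. ALL x. x \<notin> Y --> b x = 0}"

lemma cut_B: "b : cut Y ==> b : B" and cut_ind: "ind Y : B ==> b : B ==> ind Y * b : cut Y"
 using B_mult by (auto simp: cut_def ind_def)

lemma cut_ind_eq: "b : cut Y ==> ind Y * b = b"
 by (auto simp: cut_def ind_def fun_eq_iff)

lemma sum_cut: assumes "Y \<subseteq> U" shows "(\<Sum>x\<in>Y. f x) = (\<Sum>x\<in>U. ind Y x * f x)"
 using finX assms by (intro sum.mono_neutral_cong_left) (auto simp: ind_def)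

lemma cut_spanning: assumes Y: "Y \<subseteq> U" "ind Y : B" and sp: "mod.spanning I b"
 shows "finite I" "!!i. i : I ==> ind Y * b i : cut Y"
  "!!x. x : cut Y ==> EX k. (ALL i:I. k i : K) \<and> x = (\<Sum>i\<in>I. sact (ind Y * b i) (k i))"
proof -
 show "finite I" "!!i. i : I ==> ind Y * b i : cut Y" using sp cut_ind Y unfolding mod.spanning_def by auto
 fix x assume x: "x : cut Y"
 obtain k where k: "ALL i:I. k i : K" "x = (\<Sum>i\<in>I. sact (b i) (k i))"
  using sp cut_B[OF x] unfolding mod.spanning_def by auto
 have "x = ind Y * x" using cut_ind_eq[OF x] by simp
 also have "\<dots> = (\<Sum>i\<in>I. sact (ind Y * b i) (k i))"
  unfolding k(2) by (rule ext) (simp add: fun_sum_apply sact_def sum_distrib_left mult.assoc)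
 finally show "EX k. (ALL i:I. k i : K) \<and> x = (\<Sum>i\<in>I. sact (ind Y * b i) (k i))" using k(1) by auto
qed

lemma etale_cut: assumes Y: "Y \<subseteq> U" "ind Y : B" shows "etale K \<P> Y (cut Y)"
proof -
 interpret C: smod K 1 id "cut Y" sact
  by unfold_locales (use B_zero B_add B_sact in \<open>auto simp: cut_def sact_def distrib_left distrib_right mult.assoc\<close>)
 show ?thesis
 proof unfold_locales
  fix x y b b' k
  show "ordering_on K \<P>" by (rule ord)
  show "finite Y" using finX Y finite_subset by auto
  show "b : cut Y ==> x \<notin> Y ==> b x = 0" by (auto simp: cut_def)
  show "ind Y : cut Y" using Y by (auto simp: cut_def ind_def)
  show "b : cut Y ==> b' : cut Y ==> b + b' : cut Y" by (rule C.M_add)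
  show "b : cut Y ==> b' : cut Y ==> b * b' : cut Y" by (auto simp: cut_def B_mult)
  show "b : cut Y ==> k : K ==> sact b k : cut Y" by (rule C.M_act)
  show "EX b:cut Y. b x ~= b y" if xy: "x : Y" "y : Y" "x ~= y"
  proof -
   obtain b where b: "b : B" "b x ~= b y" using sep[of x y] xy Y by auto
   then show ?thesis using xy by (intro bexI[of _ "ind Y * b"] cut_ind Y) (auto simp: ind_def)
  qed
  show "b = 0" if b: "b : cut Y" and nd: "!!w. w : cut Y ==> (\<Sum>x\<in>Y. b x * w x) = 0"
  proof (rule nondegenerate[OF cut_B[OF b]])
   fix w assume w: "w : B"
   have "(\<Sum>x\<in>U. b x * w x) = (\<Sum>x\<in>U. ind Y x * (b x * (ind Y * w) x))"
    by (intro sum.cong refl, case_tac "x : Y") (use b in \<open>simp_all add: cut_def ind_def\<close>)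
   also have "\<dots> = 0" using nd[OF cut_ind[OF Y(2) w]] unfolding sum_cut[OF Y(1), of "\<lambda>x. b x * (ind Y * w) x"] .
   finally show "(\<Sum>x\<in>U. b x * w x) = 0" .
  qed
  show "EX (I::nat set) b. smod.spanning K (cut Y) sact I b"
  proof -
   obtain I :: "nat set" and b where sp: "mod.spanning I b" using span by auto
   have "C.spanning I (\<lambda>i. ind Y * b i)"
    unfolding C.spanning_def by (intro conjI ballI cut_spanning[OF Y sp])
   then show ?thesis by blast
  qed
 next
  fix b assume b: "b : cut Y"
  have "(\<Sum>x\<in>Y. b x) = (\<Sum>x\<in>U. b x)"
   using b Y finX by (intro sum.mono_neutral_left) (auto simp: cut_def)
  then show "(\<Sum>x\<in>Y. b x) : K" using B_tr[OF cut_B[OF b]] by simp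
 qed
qed

lemma ind_compl: "Y \<subseteq> U ==> ind (U - Y) = (ind U - ind Y :: nat => 'o)"
 by (auto simp: ind_def fun_eq_iff)

lemma Bu_cut: assumes "Y \<subseteq> U" "ind Y : B" "z : Bu" shows "ind Y * z : etale.Bu Y (cut Y)"
 using assms cut_ind by (auto simp: etale.Bu_def[OF etale_cut[OF assms(1,2)]] Bu_def ind_def)

text \<open>The functions supported on \<open>Y\<close> and those supported on its complement are
  orthogonal and add up to \<open>B\<close>; adding the two components is the isometry.\<close>

lemma sg_cut: assumes Y: "Y \<subseteq> U" "ind Y : B" and z: "z : Bu"
 shows "sg z = etale.sg K \<P> Y (cut Y) (ind Y * z) + etale.sg K \<P> (U - Y) (cut (U - Y)) (ind (U - Y) * z)"
proof -
 have Y': "U - Y \<subseteq> U" "ind (U - Y) : B" using Y B_diff[OF B_ind Y(2)] ind_compl by auto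
 interpret C: etale K \<P> Y "cut Y" by (rule etale_cut[OF Y])
 interpret D: etale K \<P> "U - Y" "cut (U - Y)" by (rule etale_cut[OF Y'])
 note P = herm_cone_prod[OF C.trh_herm[OF Bu_cut[OF Y z]] D.trh_herm[OF Bu_cut[OF Y' z]]]
 interpret H: herm_cone K 1 id \<P> B sact "trh U z" by (rule trh_herm[OF z])
 interpret P: herm_cone K 1 id \<P> "cut Y \<times> cut (U - Y)" "\<lambda>v c. (sact (fst v) c, sact (snd v) c)"
  "\<lambda>v w. trh Y (ind Y * z) (fst v) (fst w) + trh (U - Y) (ind (U - Y) * z) (snd v) (snd w)" by (rule P(1))
 have t1: "trh Y (ind Y * z) v w = (\<Sum>x\<in>U. ind Y x * (z x * v x * w x))" for v w
  unfolding trh_def by (subst sum_cut[OF Y(1)]) (auto intro!: sum.cong simp: ind_def)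
 have t2: "trh (U - Y) (ind (U - Y) * z) v w = (\<Sum>x\<in>U. ind (U - Y) x * (z x * v x * w x))" for v w
  unfolding trh_def by (subst sum_cut[OF Y'(1)]) (auto intro!: sum.cong simp: ind_def)
 have "H.sig = P.sig"
 proof (rule sig_transport[OF P(1) trh_herm[OF z], where g = "\<lambda>v. fst v + snd v" and c = "\<lambda>x. x"])
  fix v w assume "v : cut Y \<times> cut (U - Y)" "w : cut Y \<times> cut (U - Y)"
  then have vw: "fst v x = ind Y x * fst v x" "snd v x = ind (U - Y) x * snd v x"
   "fst w x = ind Y x * fst w x" "snd w x = ind (U - Y) x * snd w x" for x
   by (auto simp: cut_def ind_def)
  show "trh U z (fst v + snd v) (fst w + snd w) =
    trh Y (ind Y * z) (fst v) (fst w) + trh (U - Y) (ind (U - Y) * z) (snd v) (snd w)"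
   unfolding t1 t2 unfolding trh_def sum.distrib[symmetric]
  proof (intro sum.cong refl)
   fix x assume "x : U"
   show "z x * (fst v + snd v) x * (fst w + snd w) x =
     ind Y x * (z x * fst v x * fst w x) + ind (U - Y) x * (z x * snd v x * snd w x)"
    using vw[of x] \<open>x : U\<close> by (cases "x : Y") (simp_all add: ind_def)
  qed
 next
  fix I :: "nat set" and b assume sp: "P.spanning I b"
  show "mod.spanning I (\<lambda>i. fst (b i) + snd (b i))"
   unfolding mod.spanning_def
  proof (intro conjI ballI)
   show "finite I" "!!i. i : I ==> fst (b i) + snd (b i) : B"
    using sp cut_B B_add unfolding P.spanning_def by (auto simp: mem_Times_iff)
   fix w assume w: "w : B"
   have "(ind Y * w, ind (U - Y) * w) : cut Y \<times> cut (U - Y)" using cut_ind[OF Y(2) w] cut_ind[OF Y'(2) w] by auto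
   then obtain k where k: "ALL i:I. k i : K"
    "(ind Y * w, ind (U - Y) * w) = (\<Sum>i\<in>I. (sact (fst (b i)) (k i), sact (snd (b i)) (k i)))"
    using sp unfolding P.spanning_def by blast
   have "ind Y * w = (\<Sum>i\<in>I. sact (fst (b i)) (k i))" "ind (U - Y) * w = (\<Sum>i\<in>I. sact (snd (b i)) (k i))"
    using k(2) by (simp_all add: sum_prod_eq)
   moreover have "w = ind Y * w + ind (U - Y) * w"
    using B_supp[OF w] Y(1) by (auto simp: ind_def fun_eq_iff)
   ultimately have "w = (\<Sum>i\<in>I. sact (fst (b i)) (k i)) + (\<Sum>i\<in>I. sact (snd (b i)) (k i))" by simp
   also have "\<dots> = (\<Sum>i\<in>I. sact (fst (b i) + snd (b i)) (k i))"
    unfolding sum.distrib[symmetric] by (intro sum.cong refl) (auto simp: sact_def distrib_right)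
   finally show "EX k. (ALL i:I. k i : K) \<and> w = (\<Sum>i\<in>I. sact (fst (b i) + snd (b i)) (k i))" using k(1) by blast
  qed
 qed auto
 then show ?thesis using P(2) by (simp add: sg_def C.sg_def D.sg_def)
qed

end

lemma sact_sum: "sact (\<Sum>i\<in>I. f i) k = (\<Sum>i\<in>I. sact (f i) k)"
 by (rule ext) (simp add: sact_def fun_sum_apply sum_distrib_right)

lemma sact_sact: "sact (sact b k) l = sact b (k * l)"
 by (simp add: sact_def mult.assoc)

lemma sact_sum_right: "sact b (\<Sum>i\<in>I. f i) = (\<Sum>i\<in>I. sact b (f i))"
 by (rule ext) (simp add: sact_def fun_sum_apply sum_distrib_left)

lemma sact_mult: "sact b k * sact c l = sact (b * c) (k * l)"
 by (rule ext) (simp add: sact_def ac_simps)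

section \<open>Scalar extension and Pfister sums of trace forms\<close>

locale etale_ext = etale K \<P> U B + K': sfield K' 1 id
 for K :: "'o::field set" and \<P> U B and K' :: "'o set" +
 fixes \<P>' :: "'o set" and I :: "nat set" and v :: "nat => nat => 'o"
 assumes sub: "K \<subseteq> K'" and ord': "ordering_on K' \<P>'" and subo: "\<P> \<subseteq> \<P>'"
  and bas: "herm.basis K 1 B sact (trh U (ind U)) I v"
begin

interpretation H: herm_cone K 1 id \<P> B sact "trh U (ind U)" by (rule trh_herm[OF Bu_ind])

lemmas o = H.orthD[OF H.basis_orth[OF bas]]

lemma ord_restrict: assumes "x : K" shows "x : \<P>' \<longleftrightarrow> x : \<P>"
proof
 assume x: "x : \<P>'"
 show "x : \<P>"
 proof (rule ccontr)
  assume n: "x \<notin> \<P>"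
  then have "- x : \<P>" using cone_total assms by auto
  then have "x = 0" using x subo ord' unfolding ordering_on_def by blast
  then show False using n cone_zero by simp
 qed
qed (use subo in auto)

text \<open>The scalar extension of \<open>B\<close> to \<open>K'\<close>, realised inside the
  functions. Orthogonality of \<open>v\<close> for the trace form keeps it independent over
  \<open>K'\<close>.\<close>

definition Be :: "(nat => 'o) set" where
 "Be = {w. EX k. (ALL i:I. k i : K') \<and> w = (\<Sum>i\<in>I. sact (v i) (k i))}"

lemma Be_I: "(!!i. i : I ==> k i : K') ==> (\<Sum>i\<in>I. sact (v i) (k i)) : Be"
 by (auto simp: Be_def)

lemma Be_E: assumes "w : Be"
 obtains k where "ALL i:I. k i : K'" "w = (\<Sum>i\<in>I. sact (v i) (k i))"
 using assms unfolding Be_def by auto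

lemma Be_add: assumes "w : Be" "w' : Be" shows "w + w' : Be"
proof -
 obtain k where k: "ALL i:I. k i : K'" "w = (\<Sum>i\<in>I. sact (v i) (k i))" by (rule Be_E[OF assms(1)])
 obtain l where l: "ALL i:I. l i : K'" "w' = (\<Sum>i\<in>I. sact (v i) (l i))" by (rule Be_E[OF assms(2)])
 have "w + w' = (\<Sum>i\<in>I. sact (v i) (k i + l i))"
  unfolding k(2) l(2) sum.distrib[symmetric] by (intro sum.cong refl ext) (simp add: sact_def distrib_left)
 then show ?thesis using Be_I[of "\<lambda>i. k i + l i"] k(1) l(1) K'.add_closed by simp
qed

lemma Be_sact: assumes "w : Be" "l : K'" shows "sact w l : Be"
proof -
 obtain k where k: "ALL i:I. k i : K'" "w = (\<Sum>i\<in>I. sact (v i) (k i))" by (rule Be_E[OF assms(1)])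
 have "sact w l = (\<Sum>i\<in>I. sact (v i) (k i * l))" unfolding k(2) by (simp add: sact_sum sact_sact)
 then show ?thesis using Be_I[of "\<lambda>i. k i * l"] k(1) assms(2) K'.mult_closed by simp
qed

lemma B_Be: assumes "b : B" shows "b : Be"
proof -
 obtain k where "ALL i:I. k i : K" "b = (\<Sum>i\<in>I. sact (v i) (k i))"
  using H.basis_spanning[OF bas] assms unfolding mod.spanning_def by auto
 then show ?thesis using Be_I[of k] sub by auto
qed

lemma Be_zero: "0 : Be"
 by (rule B_Be[OF B_zero])

lemma Be_sum: "(!!i. i : J ==> f i : Be) ==> (\<Sum>i\<in>J. f i) : Be"
 by (induction J rule: infinite_finite_induct) (auto intro: Be_add Be_zero)

lemma Be_mult: assumes "w : Be" "w' : Be" shows "w * w' : Be"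
proof -
 obtain k where k: "ALL i:I. k i : K'" "w = (\<Sum>i\<in>I. sact (v i) (k i))" by (rule Be_E[OF assms(1)])
 obtain l where l: "ALL i:I. l i : K'" "w' = (\<Sum>i\<in>I. sact (v i) (l i))" by (rule Be_E[OF assms(2)])
 have "w * w' = (\<Sum>i\<in>I. \<Sum>j\<in>I. sact (v i * v j) (k i * l j))"
  unfolding k(2) l(2) sum_product sact_mult ..
 also have "\<dots> : Be"
  using o k(1) l(1) K'.mult_closed by (intro Be_sum Be_sact B_Be B_mult) auto
 finally show ?thesis .
qed

sublocale E: smod K' 1 id Be sact
 by unfold_locales (use Be_zero Be_add Be_sact in \<open>auto simp: sact_def distrib_left distrib_right mult.assoc\<close>)

lemma spanning_ext: assumes "mod.spanning J b" shows "E.spanning J b"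
 unfolding E.spanning_def
proof (intro conjI ballI)
 show "finite J" "!!i. i : J ==> b i : Be" using assms B_Be unfolding mod.spanning_def by auto
 fix w assume "w : Be"
 then obtain k where k: "ALL i:I. k i : K'" "w = (\<Sum>i\<in>I. sact (v i) (k i))" by (rule Be_E)
 have "ALL i:I. EX c. (ALL j:J. c j : K) \<and> v i = (\<Sum>j\<in>J. sact (b j) (c j))"
  using assms o(2) unfolding mod.spanning_def by blast
 from bchoice[OF this] obtain c where c: "!!i j. i : I ==> j : J ==> c i j : K"
  "!!i. i : I ==> v i = (\<Sum>j\<in>J. sact (b j) (c i j))" by blast
 have "w = (\<Sum>i\<in>I. \<Sum>j\<in>J. sact (b j) (c i j * k i))"
  unfolding k(2) by (intro sum.cong refl) (subst c(2), auto simp: sact_sum sact_sact)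
 also have "\<dots> = (\<Sum>j\<in>J. sact (b j) (\<Sum>i\<in>I. c i j * k i))"
  unfolding sact_sum_right by (rule sum.swap)
 finally have "w = (\<Sum>j\<in>J. sact (b j) (\<Sum>i\<in>I. c i j * k i))" .
 moreover have "ALL j:J. (\<Sum>i\<in>I. c i j * k i) : K'"
  using c(1) k(1) sub by (intro ballI K'.sum_closed K'.mult_closed) auto
 ultimately show "EX k. (ALL i:J. k i : K') \<and> w = (\<Sum>i\<in>J. sact (b i) (k i))"
  by (intro exI[of _ "\<lambda>j. \<Sum>i\<in>I. c i j * k i"] conjI)
qed

lemma ind_one: "x : U ==> ind U x = 1"
 by (simp add: ind_def)

lemma etale_Be: "etale K' \<P>' U Be"
proof unfold_locales
 fix x y b b' k
 show "ordering_on K' \<P>'" by (rule ord')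
 show "finite U" by (rule finX)
 show "b x = 0" if b: "b : Be" and x: "x \<notin> U"
 proof -
  obtain k where k: "ALL i:I. k i : K'" "b = (\<Sum>i\<in>I. sact (v i) (k i))" by (rule Be_E[OF b])
  show ?thesis unfolding k(2) fun_sum_apply sact_def using B_supp[OF o(2) x] by simp
 qed
 show "ind U : Be" by (rule B_Be[OF B_ind])
 show "b : Be ==> b' : Be ==> b + b' : Be" by (rule Be_add)
 show "b : Be ==> b' : Be ==> b * b' : Be" by (rule Be_mult)
 show "b : Be ==> k : K' ==> sact b k : Be" by (rule Be_sact)
 show "EX b:Be. b x ~= b y" if "x : U" "y : U" "x ~= y" using sep[OF that] B_Be by blast
 show "EX (J::nat set) b. E.spanning J b" using spanning_ext[OF H.basis_spanning[OF bas]] by blast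
 show "b = 0" if b: "b : Be" and nd: "!!w. w : Be ==> (\<Sum>x\<in>U. b x * w x) = 0"
 proof -
  obtain k where k: "ALL i:I. k i : K'" "b = (\<Sum>i\<in>I. sact (v i) (k i))" by (rule Be_E[OF b])
  have "k j = 0" if j: "j : I" for j
  proof -
   have "0 = (\<Sum>x\<in>U. b x * v j x)" using nd B_Be o(2)[OF j] by simp
   also have "\<dots> = (\<Sum>x\<in>U. \<Sum>i\<in>I. v i x * v j x * k i)"
    unfolding k(2) fun_sum_apply sact_def sum_distrib_right by (intro sum.cong refl) (simp add: ac_simps)
   also have "\<dots> = (\<Sum>i\<in>I. \<Sum>x\<in>U. v i x * v j x * k i)" by (rule sum.swap)
   also have "\<dots> = (\<Sum>i\<in>I. trh U (ind U) (v i) (v j) * k i)"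
    unfolding trh_def sum_distrib_right by (intro sum.cong refl) (simp add: ind_one)
   also have "\<dots> = (\<Sum>i\<in>{j}. trh U (ind U) (v i) (v j) * k i)"
    using o j by (intro sum.mono_neutral_right) auto
   finally show "k j = 0" using o(3)[OF j] by simp
  qed
  then show "b = 0" unfolding k(2) by (intro sum.neutral ballI) (auto simp: sact_def fun_eq_iff)
 qed
next
 fix b assume b: "b : Be"
 obtain k where k: "ALL i:I. k i : K'" "b = (\<Sum>i\<in>I. sact (v i) (k i))" by (rule Be_E[OF b])
 have "(\<Sum>x\<in>U. b x) = (\<Sum>i\<in>I. \<Sum>x\<in>U. v i x * k i)"
  unfolding k(2) fun_sum_apply sact_def by (rule sum.swap)
 also have "\<dots> = (\<Sum>i\<in>I. (\<Sum>x\<in>U. v i x) * k i)" by (simp add: sum_distrib_right)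
 also have "\<dots> : K'"
 proof (rule K'.sum_closed)
  fix i assume "i : I"
  then show "(\<Sum>x\<in>U. v i x) * k i : K'" using B_tr[OF o(2)] sub k(1) by (intro K'.mult_closed) auto
 qed
 finally show "(\<Sum>x\<in>U. b x) : K'" .
qed

lemma Bu_Be: "z : Bu ==> z : etale.Bu U Be"
 using B_Be by (auto simp: Bu_def etale.Bu_def[OF etale_Be])

lemma sg_Be: assumes "z : Bu" shows "etale.sg K' \<P>' U Be z = sg z"
 unfolding sg_def etale.sg_def[OF etale_Be]
 by (rule sig_transport[OF trh_herm[OF assms] etale.trh_herm[OF etale_Be Bu_Be[OF assms]],
    where g = id and c = id]) (auto simp: ord_restrict spanning_ext)

end

text \<open>Over a real closed field this would be 2 to the number of entries, times the number of
  real points at which all entries are positive. Its sign is established below without real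
  closures.\<close>

definition psum :: "'o::field set => 'o set => nat set => (nat => 'o) set => (nat => 'o) list => int" where
 "psum K \<P> U B zs = (\<Sum>z\<in>#pfister zs {#ind U#}. etale.sg K \<P> U B z)"

lemma pfister_image:
 assumes f: "!!z w. z : S ==> w : S ==> f (z * w) = f z * f w"
  and S: "!!z w. z : S ==> w : S ==> z * w : S" and M: "set_mset M \<subseteq> S"
 shows "set zs \<subseteq> S ==> image_mset f (pfister zs M) = pfister (map f zs) (image_mset f M)"
proof (induction zs)
 case (Cons z zs)
 have sub: "set_mset (pfister zs M) \<subseteq> S" if "set zs \<subseteq> S" for zs
  using that by (induction zs) (use M S in auto)
 have "image_mset (\<lambda>w. f (z * w)) (pfister zs M) = image_mset (\<lambda>w. f z * f w) (pfister zs M)"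
  using sub[of zs] f Cons.prems by (intro image_mset_cong) auto
 then show ?case using Cons by (simp add: multiset.map_comp comp_def flip: Cons.IH)
qed simp

context etale
begin

lemma ind_mult_ind: "Y \<subseteq> U ==> ind Y * ind U = (ind Y :: nat => 'o)"
 by (auto simp: ind_def fun_eq_iff)

lemma psum_cut: assumes Y: "Y \<subseteq> U" "ind Y : B" and zs: "set zs \<subseteq> Bu"
 shows "psum K \<P> U B zs = psum K \<P> Y (cut Y) (map ((*) (ind Y)) zs) +
   psum K \<P> (U - Y) (cut (U - Y)) (map ((*) (ind (U - Y))) zs)"
proof -
 have ii: "ind A * (z * w) = ind A * z * (ind A * w)" for A and z w :: "nat => 'o"
  by (rule ext) (simp add: ind_def)
 have im: "psum K \<P> A (cut A) (map ((*) (ind A)) zs)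
   = (\<Sum>z\<in>#pfister zs {#ind U#}. etale.sg K \<P> A (cut A) (ind A * z))" if "A \<subseteq> U" for A
 proof -
  have "pfister (map ((*) (ind A)) zs) {#ind A#} = image_mset ((*) (ind A)) (pfister zs {#ind U#})"
   using pfister_image[of UNIV "(*) (ind A)" "{#ind U#}" zs] ii ind_mult_ind[OF that] by simp
  then show ?thesis by (simp add: psum_def multiset.map_comp comp_def)
 qed
 have "psum K \<P> U B zs = (\<Sum>z\<in>#pfister zs {#ind U#}. etale.sg K \<P> Y (cut Y) (ind Y * z)
   + etale.sg K \<P> (U - Y) (cut (U - Y)) (ind (U - Y) * z))"
  unfolding psum_def using pfister_Bu[OF zs] sg_cut[OF Y]
  by (intro arg_cong[of _ _ sum_mset] image_mset_cong) auto
 then show ?thesis using im[OF Y(1)] im[of "U - Y"] by (simp add: sum_mset.distrib)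
qed

lemma sg_point: assumes U: "U = {x}" and z: "z : Bu" shows "sg z = csgn (z x)"
proof -
 interpret H: herm_cone K 1 id \<P> B sact "trh U z" by (rule trh_herm[OF z])
 have zx: "z x ~= 0" using z unfolding Bu_def using U by auto
 have b: "b = sact (ind U) (b x)" "b x : K" if "b : B" for b
  using B_supp[OF that] B_tr[OF that] U by (auto simp: sact_def ind_def fun_eq_iff)
 have t: "trh U z (ind U) (ind U) = z x" using U by (simp add: trh_def ind_def)
 have sp: "mod.spanning {0::nat} (\<lambda>i. ind U)"
  unfolding mod.spanning_def
 proof (intro conjI ballI)
  fix w assume "w : B"
  then show "EX k. (ALL i:{0::nat}. k i : K) \<and> w = (\<Sum>i\<in>{0}. sact (ind U) (k i))"
   using b[of w] by (intro exI[of _ "\<lambda>i. w x"]) simp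
 qed (use B_ind in auto)
 have "H.orth {0::nat} (\<lambda>i. ind U)" using B_ind zx t by (simp add: H.orth_def)
 then have "H.basis {0::nat} (\<lambda>i. ind U)" by (rule H.basis_if_spanning[OF sp _ order_refl])
 from H.sig_eq[OF this] show ?thesis using t by (simp add: sg_def)
qed

lemma csgn_units: assumes "x : K" "x ~= 0" "y : K" "y ~= 0" shows "csgn (x * y) = csgn x * csgn y"
proof (cases "y : \<P>")
 case True
 then show ?thesis using csgn_mult(1)[OF ord assms(1,2) True assms(4)] by (simp add: csgn_def)
next
 case False
 then have y: "- y : \<P>" using cone_total assms by auto
 have "csgn (x * - y) = csgn x" using csgn_mult(1)[OF ord assms(1,2) y] assms by simp
 moreover have "csgn (- (x * y)) = - csgn (x * y)" using assms mult_closed by (intro csgn_neg) auto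
 moreover have "csgn y = - 1" using False by (simp add: csgn_def)
 ultimately show ?thesis by simp
qed

text \<open>At a single point the trace form is one-dimensional and the sign is multiplicative, so
  the sum over the Pfister entries factors; every factor is 0 or 2.\<close>

lemma psum_point: assumes U: "U = {x}" and zs: "set zs \<subseteq> Bu"
 shows "psum K \<P> U B zs = (\<Prod>z\<leftarrow>zs. 1 + csgn (z x))"
proof -
 have K: "z x : K" "z x ~= 0" if "z : Bu" for z
  using that B_tr[of z] unfolding Bu_def using U by auto
 have "psum K \<P> U B zs = (\<Sum>z\<in>#pfister zs {#ind U#}. csgn (z x))"
  unfolding psum_def using pfister_Bu[OF zs] sg_point[OF U]
  by (intro arg_cong[of _ _ sum_mset] image_mset_cong) auto
 also have "\<dots> = (\<Prod>z\<leftarrow>zs. 1 + csgn (z x))" using zs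
 proof (induction zs)
  case Nil
  have "csgn 1 = 1" using ordering_square[OF ord e_closed] by (simp add: csgn_def)
  then show ?case using U by (simp add: ind_def)
 next
  case (Cons z zs)
  have "(\<Sum>w\<in>#pfister zs {#ind U#}. csgn ((z * w) x)) = (\<Sum>w\<in>#pfister zs {#ind U#}. csgn (z x) * csgn (w x))"
  proof (intro arg_cong[of _ _ sum_mset] image_mset_cong)
   fix w assume "w \<in># pfister zs {#ind U#}"
   then have "w : Bu" "z : Bu" using pfister_Bu[of zs] Cons.prems by auto
   then show "csgn ((z * w) x) = csgn (z x) * csgn (w x)" using csgn_units K by simp
  qed
  also have "\<dots> = csgn (z x) * (\<Sum>w\<in>#pfister zs {#ind U#}. csgn (w x))" by (simp add: sum_mset_distrib_left)
  finally show ?case using Cons by (simp add: multiset.map_comp comp_def distrib_right)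
 qed
 finally show ?thesis .
qed

lemma psum_empty: assumes "U = {}" and zs: "set zs \<subseteq> Bu" shows "psum K \<P> U B zs = 0"
proof -
 have "sg z = 0" if z: "z : Bu" for z
 proof -
  interpret H: herm_cone K 1 id \<P> B sact "trh U z" by (rule trh_herm[OF z])
  obtain I :: "nat set" and v where v: "H.basis I v" using H.ex_basis by auto
  have "I = {}" using H.orthD(3)[OF H.basis_orth[OF v]] assms(1) by (auto simp: trh_def)
  then show ?thesis using H.sig_eq[OF v] by (simp add: sg_def)
 qed
 then show ?thesis unfolding psum_def using pfister_Bu[OF zs]
  by (subst image_mset_cong[where g = "\<lambda>_. 0"]) auto
qed

text \<open>For every other point \<open>y\<close>, a separating function shifted to vanish at
  \<open>x\<close> has a support idempotent that is 1 at \<open>y\<close> and 0 at \<open>x\<close>;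
  the product of the complementary idempotents is the indicator of \<open>x\<close>. The shift stays
  in \<open>B\<close> because the value at \<open>x\<close> lies in \<open>K\<close>.\<close>

lemma ind_point: assumes x: "x : U" and K: "!!b. b : B ==> b x : K" shows "ind {x} : B"
proof -
 have *: "finite Y ==> Y \<subseteq> U - {x} ==> EX u:B. u x = 1 \<and> (ALL y:Y. u y = 0)" for Y
 proof (induction Y rule: finite_induct)
  case empty
  then show ?case using B_ind x by (intro bexI[of _ "ind U"]) (auto simp: ind_def)
 next
  case (insert y Y)
  then obtain u where u: "u : B" "u x = 1" "ALL y:Y. u y = 0" by auto
  obtain b where b: "b : B" "b y ~= b x" using sep[of y x] insert x by auto
  define t where "t = b - sact (ind U) (b x)"
  have t: "t : B" "t x = 0" "t y ~= 0"
   using B_diff[OF b(1) B_sact[OF B_ind K[OF b(1)]]] b insert x by (auto simp: t_def sact_def ind_def)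
  obtain s where s: "s : B" "t * s = ind {x : U. t x ~= 0}" using supp[OF t(1)] by auto
  define r where "r = ind U - t * s"
  have r: "r : B" "r x = 1" "r y = 0" unfolding r_def
  proof -
   show "ind U - t * s : B" by (intro B_diff B_ind B_mult t s)
   show "(ind U - t * s) x = 1" "(ind U - t * s) y = 0"
    unfolding s(2) using t x insert by (auto simp: ind_def)
  qed
  then show ?case using u B_mult[OF u(1) r(1)] by (intro bexI[of _ "u * r"]) auto
 qed
 obtain u where u: "u : B" "u x = 1" "ALL y:U - {x}. u y = 0" using *[of "U - {x}"] finX by auto
 have "u = ind {x}"
 proof
  fix y show "u y = ind {x} y" using u B_supp[OF u(1), of y] by (cases "y : U") (auto simp: ind_def)
 qed
 then show ?thesis using u by simp
qed

end

locale etale_field = etale +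
 assumes nz: "b : B ==> b ~= 0 ==> x : U ==> b x ~= 0" and X_ne: "U ~= {}"
begin

lemma Bu_iff: "z : Bu \<longleftrightarrow> z : B \<and> z ~= 0"
proof
 obtain x where x: "x : U" using X_ne by auto
 assume "z : Bu"
 then have "z : B" "z x ~= 0" using x by (auto simp: Bu_def)
 then show "z : B \<and> z ~= 0" by auto
next
 assume "z : B \<and> z ~= 0"
 then show "z : Bu" unfolding Bu_def using nz by blast
qed

lemma id_involution: "involution (id :: 'c::comm_ring_1 => 'c)"
 by (simp add: involution_def mult.commute)

lemma two: "(1::'a) + 1 ~= 0"
 using two_nz .

sublocale L: sfield B "ind U" id
proof
 obtain x where x: "x : U" using X_ne by auto
 show "involution (id :: (nat => 'a) => _)" by (rule id_involution)
 fix b c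
 show "b : B ==> c : B ==> b + c : B" "b : B ==> c : B ==> b * c : B" "b : B ==> - b : B"
  by (rule B_add B_mult B_neg; assumption)+
 show "ind U : B" by (rule B_ind)
 show "ind U ~= (0 :: nat => 'a)" using x by (auto simp: ind_def fun_eq_iff)
 show "b : B ==> ind U * b = b" by (rule ind_left)
 show "b : B ==> b * ind U = b" using ind_left[of b] by (simp add: mult.commute)
 show "EX y:B. b * y = ind U \<and> y * b = ind U" if "b : B" "b ~= 0"
 proof -
  have "b : Bu" using that by (simp add: Bu_iff)
  from Bu_inverse[OF this] obtain s where "s : B" "b * s = ind U" by blast
  then show ?thesis using mult.commute[of b s] by metis
 qed
 show "ind U + ind U ~= (0 :: nat => 'a)"
 proof
  assume "ind U + ind U = (0 :: nat => 'a)"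
  from fun_cong[OF this, of x] show False using x two by (simp add: ind_def)
 qed
qed auto

text \<open>Copies of \<open>K\<close>, its ordering and the trace inside \<open>B\<close>, made of
  constant functions: the transfer setting wants the small field to be a subset of the large
  one.\<close>

definition Kh :: "(nat => 'a) set" where "Kh = sact (ind U) ` K"
definition Lh :: "(nat => 'a) set" where "Lh = sact (ind U) ` \<P>"
definition tau :: "(nat => 'a) => nat => 'a" where "tau b = sact (ind U) (\<Sum>x\<in>U. b x)"

abbreviation s :: "'a => nat => 'a" where "s \<equiv> sact (ind U)"

lemma s_add: "s k + s l = s (k + l)" and s_neg: "- s k = s (- k)" and s_mult: "s k * s l = s (k * l)"
 and s_B: "b : B ==> b * s k = sact b k"
 using B_supp[of b] by (auto simp: sact_def ind_def fun_eq_iff)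

lemma s_zero: "s 0 = 0"
 by (auto simp: sact_def fun_eq_iff)

lemma s_eq_0: assumes "s k = 0" shows "k = 0"
proof -
 obtain x where x: "x : U" using X_ne by auto
 show ?thesis using fun_cong[OF assms, of x] x by (simp add: sact_def ind_def)
qed

lemma s_inj: assumes "s k = s l" shows "k = l"
proof -
 obtain x where x: "x : U" using X_ne by auto
 show ?thesis using fun_cong[OF assms, of x] x by (simp add: sact_def ind_def)
qed

lemma s_in: "s k : Kh \<longleftrightarrow> k : K" "s k : Lh \<longleftrightarrow> k : \<P>"
 using s_inj by (auto simp: Kh_def Lh_def)

lemma s_one: "s 1 = ind U"
 by (auto simp: sact_def fun_eq_iff)

sublocale Kh: sfield Kh "ind U" id
proof
 fix b c
 show "b : Kh ==> c : Kh ==> b + c : Kh" "b : Kh ==> c : Kh ==> b * c : Kh" "b : Kh ==> - b : Kh"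
  using add_closed mult_closed neg_closed by (auto simp: Kh_def s_add s_neg s_mult)
 show "ind U : Kh" using imageI[OF e_closed, of s] by (simp add: Kh_def s_one)
 have sub: "Kh \<subseteq> B" using B_sact[OF B_ind] by (auto simp: Kh_def)
 show "b : Kh ==> ind U * b = b" "b : Kh ==> b * ind U = b" using sub L.e_left L.e_right by auto
 show "EX y:Kh. b * y = ind U \<and> y * b = ind U" if b: "b : Kh" "b ~= 0"
 proof -
  obtain k where k: "b = s k" "k : K" using b(1) unfolding Kh_def by blast
  moreover have "k ~= 0" using b(2) k(1) s_zero by auto
  ultimately obtain l where "l : K" "k * l = 1" using ex_inverse by blast
  then show ?thesis using k s_one s_in(1)[of l] by (intro bexI[of _ "s l"]) (simp_all add: s_mult mult.commute)
 qed
qed (use L.inv L.e_nz L.two_nz in auto)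

sublocale T: trace_ext B "ind U" id Kh Lh tau
proof
 show "Kh \<subseteq> B" using B_sact[OF B_ind] by (auto simp: Kh_def)
 show "ordering_on Kh Lh"
  using ord unfolding ordering_on_def Kh_def Lh_def
  by (auto simp: s_add s_mult s_neg image_iff dest!: s_inj) (metis s_zero)+
 fix x y k
 show "x : B ==> tau x : Kh" using B_tr by (auto simp: tau_def s_in)
 show "tau (x + y) = tau x + tau y" by (simp add: tau_def sum.distrib s_add)
 show "tau (x * k) = tau x * k" if k: "k : Kh"
 proof -
  obtain l where l: "k = s l" using k by (auto simp: Kh_def)
  have "(\<Sum>y\<in>U. (x * k) y) = (\<Sum>y\<in>U. x y) * l"
   unfolding l sum_distrib_right by (intro sum.cong) (auto simp: sact_def ind_def)
  then show ?thesis unfolding tau_def l by (simp add: s_mult)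
 qed
next
 show "EX x:B. tau x ~= 0"
 proof (rule ccontr)
  assume n: "\<not> ?thesis"
  have "(\<Sum>x\<in>U. w x) = 0" if "w : B" for w using n that s_eq_0 unfolding tau_def by blast
  then have "ind U = (0 :: nat => 'a)"
  proof (intro nondegenerate[OF B_ind])
   fix w assume w: "w : B"
   show "(\<Sum>x\<in>U. ind U x * w x) = 0"
    using \<open>!!w. w : B ==> (\<Sum>x\<in>U. w x) = 0\<close>[OF w] by (simp add: ind_def)
  qed
  then show False using L.e_nz by simp
 qed
 obtain I :: "nat set" and b where sp: "mod.spanning I b" using span by auto
 interpret M: smod Kh "ind U" id B "(*)"
  using L.zero_closed L.add_closed L.mult_closed B_sact[OF B_ind] L.e_right
  by unfold_locales (auto simp: Kh_def distrib_left distrib_right mult.assoc)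
 have "M.spanning I b"
  unfolding M.spanning_def
 proof (intro conjI ballI)
  show "finite I" "!!i. i : I ==> b i : B" using sp unfolding mod.spanning_def by auto
  fix x assume "x : B"
  then obtain k where k: "ALL i:I. k i : K" "x = (\<Sum>i\<in>I. sact (b i) (k i))" using sp unfolding mod.spanning_def by blast
  have "x = (\<Sum>i\<in>I. b i * s (k i))"
   unfolding k(2) using sp unfolding mod.spanning_def by (intro sum.cong refl s_B[symmetric]) auto
  then show "EX k. (ALL i:I. k i : Kh) \<and> x = (\<Sum>i\<in>I. b i * k i)"
   using k(1) by (intro exI[of _ "\<lambda>i. s (k i)"]) (simp add: s_in)
 qed
 then show "EX (I::nat set) b. smod.spanning Kh B (*) I b" by blast
qed

lemma tsig_sg: assumes "z : Bu" shows "T.tsig z = sg z"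
 unfolding sg_def T.tsig_def
proof (rule sig_transport[OF trh_herm[OF assms] T.tform_herm, where g = id and c = s])
 show "z : L.units" using assms by (simp add: Bu_iff L.units_def)
 show "T.tform z (id v) (id w) = s (trh U z v w)" for v w
  by (simp add: T.tform_def tau_def trh_def)
 show "T.mod.spanning I (\<lambda>i. id (b i))" if sp: "mod.spanning I b" for I :: "nat set" and b
  unfolding T.mod.spanning_def
 proof (intro conjI ballI)
  show "finite I" "!!i. i : I ==> id (b i) : B" using sp unfolding mod.spanning_def by auto
  fix x assume "x : B"
  then obtain k where k: "ALL i:I. k i : K" "x = (\<Sum>i\<in>I. sact (b i) (k i))" using sp unfolding mod.spanning_def by blast
  have "x = (\<Sum>i\<in>I. id (b i) * s (k i))"
   unfolding k(2) id_apply using sp unfolding mod.spanning_def by (intro sum.cong refl s_B[symmetric]) auto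
  then show "EX k. (ALL i:I. k i : Kh) \<and> x = (\<Sum>i\<in>I. id (b i) * k i)"
   using k(1) by (intro exI[of _ "\<lambda>i. s (k i)"]) (simp add: s_in)
 qed
qed (use s_zero s_eq_0 s_in in auto)

lemma ex_ordering_field: assumes "set zs \<subseteq> Bu" "psum K \<P> U B zs ~= 0"
 shows "EX \<P>'. ordering_on B \<P>' \<and> Lh \<subseteq> \<P>'"
proof (rule T.ex_ordering_ext)
 show "set_mset (pfister zs {#ind U#}) \<subseteq> L.units"
  using pfister_Bu[OF assms(1)] by (auto simp: Bu_iff L.units_def)
 have "(\<Sum>z\<in>#pfister zs {#ind U#}. T.tsig z) = psum K \<P> U B zs"
  unfolding psum_def using tsig_sg pfister_Bu[OF assms(1)]
  by (intro arg_cong[of _ _ sum_mset] image_mset_cong) auto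
 then show "(\<Sum>z\<in>#pfister zs {#ind U#}. T.tsig z) ~= 0" using assms(2) by simp
qed

text \<open>Evaluation at a point \<open>x\<close> identifies the field \<open>B\<close> with its
  image \<open>K'\<close>, which inherits the ordering \<open>\<P>'\<close>. After extending scalars
  to \<open>K'\<close> the point \<open>x\<close> splits off. It contributes a product of factors 0
  or 2, positive when all entries are positive, while the remaining points fall under the induction
  hypothesis.\<close>

lemma psum_ordering:
 assumes IH: "!!(K::'a set) \<P> Y B zs. card Y < card U ==> etale K \<P> Y B ==> set zs \<subseteq> etale.Bu Y B ==> 0 \<le> psum K \<P> Y B zs"
  and o: "ordering_on B \<P>'" "Lh \<subseteq> \<P>'" and zs: "set zs \<subseteq> Bu"
 shows "0 \<le> psum K \<P> U B zs" "set zs \<subseteq> \<P>' ==> 0 < psum K \<P> U B zs"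
proof -
 obtain x where x: "x : U" using X_ne by auto
 have oo: "\<P>' \<subseteq> B" "!!x y. x : \<P>' ==> y : \<P>' ==> x + y : \<P>'" "!!x y. x : \<P>' ==> y : \<P>' ==> x * y : \<P>'"
  "!!x. x : B ==> x : \<P>' \<or> - x : \<P>'" "!!x. x : \<P>' ==> - x : \<P>' ==> x = 0"
  using o(1) unfolding ordering_on_def by blast+
 define K' where "K' = (\<lambda>b. b x) ` B"
 define P where "P = (\<lambda>b. b x) ` \<P>'"
 have sx: "s k x = k" for k using x by (simp add: sact_def ind_def)
 have sK: "s k : B" if "k : K" for k using B_sact[OF B_ind that] .
 interpret K': sfield K' 1 id
 proof
  show "involution (id :: 'a => 'a)" by (rule id_involution)
  have I: "b x : K'" if "b : B" for b using that by (auto simp: K'_def)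
  fix b c
  show "b + c : K'" "b * c : K'" if "b : K'" "c : K'"
   using that I[OF B_add] I[OF B_mult] by (auto simp: K'_def)
  show "- b : K'" if "b : K'" using that I[OF B_neg] by (auto simp: K'_def)
  show "1 : K'" using I[OF sK[OF e_closed]] unfolding sx .
  show "EX y:K'. b * y = 1 \<and> y * b = 1" if b: "b : K'" "b ~= 0"
  proof -
   obtain t where t: "t : B" "b = t x" using b by (auto simp: K'_def)
   then have "t ~= 0" using b by auto
   then obtain r where r: "r : B" "t * r = ind U" using Bu_inverse[of t] t Bu_iff by auto
   from fun_cong[OF r(2), of x] have "b * r x = 1" using t x by (simp add: ind_def)
   then show ?thesis using I[OF r(1)] by (intro bexI[of _ "r x"]) (simp_all add: mult.commute)
  qed
 qed (use two in auto)
 have ordP: "ordering_on K' P"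
  unfolding ordering_on_def
 proof (intro conjI ballI impI)
  show "P \<subseteq> K'" using oo by (auto simp: P_def K'_def)
  show "a + b : P" "a * b : P" if "a : P" "b : P" for a b
  proof -
   obtain f g where f: "f : \<P>'" "g : \<P>'" "a = f x" "b = g x" using \<open>a : P\<close> \<open>b : P\<close> by (auto simp: P_def)
   show "a + b : P" unfolding P_def by (rule image_eqI[OF _ oo(2)[OF f(1,2)]]) (simp add: f)
   show "a * b : P" unfolding P_def by (rule image_eqI[OF _ oo(3)[OF f(1,2)]]) (simp add: f)
  qed
  show "a : P \<or> - a : P" if a: "a : K'" for a
  proof -
   obtain f where f: "f : B" "a = f x" using a by (auto simp: K'_def)
   from oo(4)[OF f(1)] show ?thesis
   proof
    assume "f : \<P>'" then show ?thesis by (auto simp: P_def f)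
   next
    assume "- f : \<P>'" then show ?thesis by (intro disjI2) (auto simp: P_def f intro!: image_eqI[of _ _ "- f"])
   qed
  qed
  show "a = 0" if "a : P" "- a : P" for a
  proof -
   obtain f g where f: "f : \<P>'" "g : \<P>'" "a = f x" "- a = g x" using \<open>a : P\<close> \<open>- a : P\<close> by (auto simp: P_def)
   have "(f + g) x = 0" unfolding plus_fun_apply f(3)[symmetric] f(4)[symmetric] by simp
   moreover have "f + g : B" using f oo B_add by blast
   ultimately have "f + g = 0" using nz[of "f + g" x] x by metis
   then have "g = - f" by (simp only: add_eq_0_iff)
   then have "f = 0" using oo(5)[OF f(1)] f(2) by simp
   then show "a = 0" using f(3) by simp
  qed
 qed
 interpret H: herm_cone K 1 id \<P> B sact "trh U (ind U)" by (rule trh_herm[OF Bu_ind])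
 obtain I :: "nat set" and v where v: "H.basis I v" using H.ex_basis by auto
 have KK': "k : K'" if "k : K" for k using imageI[OF sK[OF that], of "\<lambda>b. b x"] unfolding K'_def sx .
 have LP: "k : P" if "k : \<P>" for k
  using imageI[of "s k" \<P>' "\<lambda>b. b x"] o(2) that unfolding P_def sx by (auto simp: Lh_def)
 interpret E: etale_ext K \<P> U B K' P I v
  by unfold_locales (use KK' LP ordP v in auto)
 interpret Be: etale K' P U E.Be by (rule E.etale_Be)
 have zse: "set zs \<subseteq> etale.Bu U E.Be" using zs E.Bu_Be by auto
 have eq: "psum K \<P> U B zs = psum K' P U E.Be zs"
  unfolding psum_def using E.sg_Be pfister_Bu[OF zs]
  by (intro arg_cong[of _ _ sum_mset] image_mset_cong) (auto simp: subset_iff)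
 have val: "b x : K'" if b: "b : E.Be" for b
 proof -
  obtain k where k: "ALL i:I. k i : K'" "b = (\<Sum>i\<in>I. sact (v i) (k i))" by (rule E.Be_E[OF b])
  have "v i x : K'" if "i : I" for i using E.o(2)[OF that] by (auto simp: K'_def)
  then show ?thesis unfolding k(2) fun_sum_apply sact_def using k(1) by (intro K'.sum_closed K'.mult_closed) auto
 qed
 \<comment> \<open>All functions of the extended algebra take values in \<open>K'\<close> at
   \<open>x\<close>, so the indicator of \<open>x\<close> belongs to it.\<close>
 have Y: "{x} \<subseteq> U" "ind {x} : E.Be" using x Be.ind_point[of x] val by blast+
 have Y': "U - {x} \<subseteq> U" "ind (U - {x}) : E.Be" using Be.B_diff[OF Be.B_ind Y(2)] Be.ind_compl[OF Y(1)] by auto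
 interpret C: etale K' P "{x}" "Be.cut {x}" by (rule Be.etale_cut[OF Y])
 have r: "0 \<le> psum K' P (U - {x}) (Be.cut (U - {x})) (map ((*) (ind (U - {x}))) zs)"
 proof (rule IH)
  show "card (U - {x}) < card U" using x finX by (meson card_Diff1_less)
  show "etale K' P (U - {x}) (Be.cut (U - {x}))" by (rule Be.etale_cut[OF Y'])
  show "set (map ((*) (ind (U - {x}))) zs) \<subseteq> etale.Bu (U - {x}) (Be.cut (U - {x}))"
   using Be.Bu_cut[OF Y'] zse by auto
 qed
 have zsx: "set (map ((*) (ind {x})) zs) \<subseteq> C.Bu" using Be.Bu_cut[OF Y] zse by auto
 have p: "psum K' P {x} (Be.cut {x}) (map ((*) (ind {x})) zs) = (\<Prod>z\<leftarrow>zs. 1 + Be.csgn (z x))"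
  using C.psum_point[OF refl zsx] by (simp add: comp_def ind_def)
 have tot: "psum K \<P> U B zs = (\<Prod>z\<leftarrow>zs. 1 + Be.csgn (z x)) + psum K' P (U - {x}) (Be.cut (U - {x})) (map ((*) (ind (U - {x}))) zs)"
  unfolding eq Be.psum_cut[OF Y zse] p ..
 have "0 \<le> (\<Prod>z\<leftarrow>zs. 1 + Be.csgn (z x))" by (induction zs) (auto simp: Be.csgn_def)
 then show "0 \<le> psum K \<P> U B zs" using tot r by simp
 assume z: "set zs \<subseteq> \<P>'"
 have "z x : P" if "z : \<P>'" for z using that by (auto simp: P_def)
 then have "Be.csgn (z x) = 1" if "z : \<P>'" for z using that by (simp add: Be.csgn_def)
 with z have "0 < (\<Prod>z\<leftarrow>zs. 1 + Be.csgn (z x))" by (induction zs) auto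
 then show "0 < psum K \<P> U B zs" using tot r by simp
qed

end

text \<open>Induction on the number of points. A function with both a zero and a nonzero value
  splits \<open>B\<close> along its support. Otherwise \<open>B\<close> is a field or has no points;
  for a field, either the sum is zero or \<open>B\<close> carries an ordering above
  \<open>\<P>\<close>, to which \<open>psum_ordering\<close> applies.\<close>

theorem psum_nonneg:
 assumes "etale K \<P> U B" "set zs \<subseteq> etale.Bu U B"
 shows "0 \<le> psum K \<P> U B zs"
 using assms
proof (induction "card U" arbitrary: K \<P> U B zs rule: less_induct)
 case less
 interpret etale K \<P> U B by fact
 consider "U = {}" | y z t where "t : B" "y : U" "z : U" "t y = 0" "t z ~= 0"
  | "U ~= {}" "!!b x. b : B ==> b ~= 0 ==> x : U ==> b x ~= 0"
 proof (cases "EX t:B. EX y:U. EX z:U. t y = 0 \<and> t z ~= 0")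
  case False
  then have "b x ~= 0" if "b : B" "b ~= 0" "x : U" for b x
   using that B_supp[OF that(1)] by (auto simp: fun_eq_iff)
  then show ?thesis using that by blast
 qed (use that in blast)
 then show ?case
 proof cases
  case 1
  then show ?thesis using psum_empty less.prems by simp
 next
  case 2
  obtain s where s: "s : B" "t * s = ind {x : U. t x ~= 0}" using supp[OF 2(1)] by auto
  let ?Y = "{x : U. t x ~= 0}"
  have Y: "?Y \<subseteq> U" "ind ?Y : B" using B_mult[OF 2(1) s(1)] s(2) by auto
  have Y': "U - ?Y \<subseteq> U" "ind (U - ?Y) : B" using B_diff[OF B_ind Y(2)] ind_compl[OF Y(1)] by auto
  have c: "card ?Y < card U" "card (U - ?Y) < card U" using 2 finX by (auto intro!: psubset_card_mono)
  have "0 \<le> psum K \<P> ?Y (cut ?Y) (map ((*) (ind ?Y)) zs)"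
   by (rule less.hyps[OF c(1) etale_cut[OF Y]]) (use Bu_cut[OF Y] less.prems(2) in auto)
  moreover have "0 \<le> psum K \<P> (U - ?Y) (cut (U - ?Y)) (map ((*) (ind (U - ?Y))) zs)"
   by (rule less.hyps[OF c(2) etale_cut[OF Y']]) (use Bu_cut[OF Y'] less.prems(2) in auto)
  ultimately show ?thesis using psum_cut[OF Y less.prems(2)] by simp
 next
  case 3
  interpret etale_field K \<P> U B by unfold_locales (use 3 in auto)
  show ?thesis
  proof (cases "psum K \<P> U B zs = 0")
   case False
   then obtain \<P>' where o: "ordering_on B \<P>'" "Lh \<subseteq> \<P>'" using ex_ordering_field less.prems(2) by blast
   show ?thesis by (rule psum_ordering(1)[OF less.hyps o less.prems(2)])
  qed simp
 qed
qed

theorem (in etale_field) psum_pos: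
 assumes "ordering_on B \<P>'" "Lh \<subseteq> \<P>'" "set zs \<subseteq> Bu" "set zs \<subseteq> \<P>'"
 shows "0 < psum K \<P> U B zs"
 using psum_ordering(2)[OF psum_nonneg assms] .

section \<open>Embeddings into the algebraic closure\<close>

locale field_ext = E: sfield E e \<sigma> for E :: "'a::ring_1 set" and e \<sigma> +
 fixes scale :: "'f::field => 'a => 'a"
 assumes sc_add: "scale c (x + y) = scale c x + scale c y" and sc_plus: "scale (c + d) x = scale c x + scale d x"
  and sc_sc: "scale c (scale d x) = scale (c * d) x" and sc_one: "scale 1 x = x"
  and sc_left: "scale c x * y = scale c (x * y)" and sc_right: "x * scale c y = scale c (x * y)"
  and sc_E: "x : E ==> scale c x : E"
  and char0: "of_nat (Suc n) ~= (0::'f)"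
  and span: "EX (I::nat set) b. smod.spanning (UNIV :: 'f set) E (\<lambda>v c. scale c v) I b"
begin

sublocale F: star_div "UNIV :: 'f set" 1 id
 using char0[of 1]
 by unfold_locales (auto simp: involution_def mult.commute intro: exI[of _ "inverse _"] right_inverse)

sublocale Fmod: smod "UNIV :: 'f set" 1 id E "\<lambda>v c. scale c v"
 by unfold_locales (auto simp: E.zero_closed E.add_closed sc_E sc_add sc_plus sc_sc sc_one mult.commute)

lemma sc_zero: "scale 0 x = 0"
 using sc_plus[of 0 0 x] by simp

lemma sc_sum: "scale c (\<Sum>i\<in>I. f i) = (\<Sum>i\<in>I. scale c (f i))"
proof -
 have "scale c 0 = 0" using sc_add[of c 0 0] by simp
 then show ?thesis by (induction I rule: infinite_finite_induct) (auto simp: sc_add)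
qed

definition lin :: "('a => 'f alg_closure) => bool" where
 "lin \<xi> \<longleftrightarrow> (ALL x:E. ALL y:E. \<xi> (x + y) = \<xi> x + \<xi> y) \<and> (ALL x:E. ALL c. \<xi> (scale c x) = to_ac c * \<xi> x)"

lemma lin_add: "lin \<xi> ==> x : E ==> y : E ==> \<xi> (x + y) = \<xi> x + \<xi> y"
 and lin_scale: "lin \<xi> ==> x : E ==> \<xi> (scale c x) = to_ac c * \<xi> x"
 by (auto simp: lin_def)

lemma lin_zero: "lin \<xi> ==> \<xi> 0 = 0"
 using lin_scale[of \<xi> 0 0] E.zero_closed sc_zero by simp

lemma lin_sum: "lin \<xi> ==> (!!i. i : I ==> f i : E) ==> \<xi> (\<Sum>i\<in>I. f i) = (\<Sum>i\<in>I. \<xi> (f i))"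
 by (induction I rule: infinite_finite_induct) (auto simp: lin_zero lin_add E.sum_closed)

lemma lin_shift: "lin \<xi> ==> b : E ==> lin (\<lambda>x. \<xi> (b * x))"
 unfolding lin_def by (simp add: distrib_left E.mult_closed sc_right)

lemma lin_plus: "lin \<xi> ==> lin \<eta> ==> lin (\<lambda>x. \<xi> x + \<eta> x)"
 unfolding lin_def by (simp add: distrib_left)

lemma lin_mult: "lin \<xi> ==> lin (\<lambda>x. c * \<xi> x)"
 unfolding lin_def by (simp add: distrib_left mult.left_commute)

lemma pow_closed: "b : E ==> x : E ==> b ^ i * x : E"
 by (induction i) (auto simp: mult.assoc E.mult_closed)

text \<open>The action of the polynomial ring on functionals in which the variable acts as multiplication by \<open>b\<close>.\<close>

definition pact :: "'f alg_closure poly => 'a => ('a => 'f alg_closure) => 'a => 'f alg_closure" where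
 "pact P b \<xi> x = (\<Sum>i\<le>Polynomial.degree P. Polynomial.coeff P i * \<xi> (b ^ i * x))"

lemma pact_eq: assumes "Polynomial.degree P \<le> n"
 shows "pact P b \<xi> x = (\<Sum>i\<le>n. Polynomial.coeff P i * \<xi> (b ^ i * x))"
 unfolding pact_def using assms by (intro sum.mono_neutral_left) (auto simp: coeff_eq_0)

lemma pact_pCons: "pact (pCons a P) b \<xi> x = a * \<xi> x + pact P b \<xi> (b * x)"
proof -
 let ?n = "Polynomial.degree P"
 have "pact (pCons a P) b \<xi> x = (\<Sum>i\<le>Suc ?n. Polynomial.coeff (pCons a P) i * \<xi> (b ^ i * x))"
  by (rule pact_eq) (simp add: degree_pCons_le)
 also have "\<dots> = a * \<xi> x + (\<Sum>i\<le>?n. Polynomial.coeff P i * \<xi> (b ^ i * (b * x)))"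
  by (subst sum.atMost_Suc_shift) (simp add: power_Suc2 mult.assoc del: power_Suc)
 finally show ?thesis by (simp add: pact_def)
qed

lemma pact_0: "pact 0 b \<xi> x = 0"
 by (simp add: pact_def)

lemma pact_add: "pact (P + Q) b \<xi> x = pact P b \<xi> x + pact Q b \<xi> x"
proof -
 let ?n = "max (Polynomial.degree P) (Polynomial.degree Q)"
 show ?thesis using pact_eq[of P ?n] pact_eq[of Q ?n] pact_eq[of "P + Q" ?n] degree_add_le_max[of P Q]
  by (simp add: sum.distrib distrib_right)
qed

lemma pact_smult: "pact (smult c P) b \<xi> x = c * pact P b \<xi> x"
 by (induction P arbitrary: x) (auto simp: pact_0 pact_pCons distrib_left mult.assoc)

lemma pact_mult: "pact (P * Q) b \<xi> x = pact P b (pact Q b \<xi>) x"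
 by (induction P arbitrary: x) (auto simp: pact_0 pact_pCons pact_add pact_smult)

lemma pact_eigen: assumes "b : E" "!!x. x : E ==> \<xi> (b * x) = r * \<xi> x"
 shows "x : E ==> pact P b \<xi> x = poly P r * \<xi> x"
 by (induction P arbitrary: x) (auto simp: pact_0 pact_pCons assms E.mult_closed algebra_simps)

definition ev :: "'f poly => 'a => 'a => 'a" where
 "ev p b x = (\<Sum>i\<le>Polynomial.degree p. scale (Polynomial.coeff p i) (b ^ i * x))"

lemma ev_closed: "b : E ==> x : E ==> ev p b x : E"
 unfolding ev_def by (intro E.sum_closed sc_E pow_closed)

lemma ev_mult: "ev p b x * y = ev p b (x * y)"
 by (simp add: ev_def sum_distrib_right sc_left mult.assoc)

lemma pact_to_ac: assumes "lin \<xi>" "b : E" "x : E"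
 shows "pact (map_poly to_ac p) b \<xi> x = \<xi> (ev p b x)"
proof -
 have "pact (map_poly to_ac p) b \<xi> x = (\<Sum>i\<le>Polynomial.degree p. to_ac (Polynomial.coeff p i) * \<xi> (b ^ i * x))"
  by (simp add: pact_def degree_map_poly coeff_map_poly)
 also have "\<dots> = (\<Sum>i\<le>Polynomial.degree p. \<xi> (scale (Polynomial.coeff p i) (b ^ i * x)))"
  using assms pow_closed by (simp add: lin_scale)
 also have "\<dots> = \<xi> (ev p b x)"
  unfolding ev_def using assms pow_closed sc_E by (subst lin_sum) auto
 finally show ?thesis .
qed

text \<open>In characteristic zero the derivative of a minimal annihilating polynomial is nonzero of
  smaller degree, so by minimality it does not annihilate \<open>b\<close>.\<close>

lemma ex_minpoly: assumes b: "b : E"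
 obtains p where "p ~= 0" "ev p b e = 0" "pderiv p ~= 0" "ev (pderiv p) b e ~= 0"
proof -
 obtain I :: "nat set" and f where sp: "Fmod.spanning I f" using span by auto
 let ?N = "card I"
 have "EX c. (ALL j:{..?N}. c j : UNIV) \<and> (EX j:{..?N}. c j ~= (0::'f)) \<and> (\<Sum>j\<in>{..?N}. scale (c j) (b ^ j * e)) = 0"
  by (rule Fmod.spanning_dependent[OF sp]) (use pow_closed b E.e_closed in auto)
 then obtain c where c: "EX j<=?N. c j ~= (0::'f)" "(\<Sum>j\<le>?N. scale (c j) (b ^ j * e)) = 0" by auto
 define q where "q = (\<Sum>j\<le>?N. monom (c j) j)"
 have cq: "Polynomial.coeff q j = (if j \<le> ?N then c j else 0)" for j
  unfolding q_def by (simp add: coeff_sum)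
 have dq: "Polynomial.degree q \<le> ?N" by (rule degree_le) (simp add: cq)
 have "ev q b e = (\<Sum>i\<le>?N. scale (Polynomial.coeff q i) (b ^ i * e))"
  unfolding ev_def using dq by (intro sum.mono_neutral_left) (auto simp: coeff_eq_0 sc_zero)
 then have q: "q ~= 0" "ev q b e = 0" using c cq by (auto simp: poly_eq_iff)
 define p where "p = (ARG_MIN Polynomial.degree p. p ~= 0 \<and> ev p b e = 0)"
 have p: "p ~= 0" "ev p b e = 0"
  using arg_min_natI[of "\<lambda>p. p ~= 0 \<and> ev p b e = 0" q Polynomial.degree] q unfolding p_def by auto
 have min: "r = 0" if "Polynomial.degree r < Polynomial.degree p" "ev r b e = 0" for r
  using arg_min_nat_le[of "\<lambda>p. p ~= 0 \<and> ev p b e = 0" r Polynomial.degree] that unfolding p_def by fastforce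
 have d: "Polynomial.degree p ~= 0"
 proof
  assume d: "Polynomial.degree p = 0"
  then have "ev p b e = scale (Polynomial.coeff p 0) e" by (simp add: ev_def)
  moreover have "Polynomial.coeff p 0 ~= 0" using p d by (metis leading_coeff_0_iff)
  ultimately have "e = scale (inverse (Polynomial.coeff p 0)) 0" using p(2) sc_sc[of _ "Polynomial.coeff p 0" e] sc_one
   by (metis left_inverse)
  then show False using E.e_nz sc_sum[of _ id "{}"] by simp
 qed
 have "Polynomial.coeff (pderiv p) (Polynomial.degree p - 1) ~= 0"
  using d p char0[of "Polynomial.degree p - 1"] by (simp add: coeff_pderiv del: of_nat_Suc)
 then have nz: "pderiv p ~= 0" by auto
 have "Polynomial.degree (pderiv p) \<le> Polynomial.degree p - 1"
  by (rule degree_le) (auto simp: coeff_pderiv coeff_eq_0)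
 then have "Polynomial.degree (pderiv p) < Polynomial.degree p" using d by linarith
 then have "ev (pderiv p) b e ~= 0" using min[of "pderiv p"] nz by auto
 then show ?thesis using that p nz by blast
qed

text \<open>Semisimplicity: generalised eigenvectors of multiplication by \<open>b\<close> are eigenvectors.\<close>

lemma semisimple:
 assumes b: "b : E" and \<eta>: "lin \<eta>" and \<zeta>_def: "!!x. \<zeta> x = \<eta> (b * x) - r * \<eta> x"
  and eig: "!!x. x : E ==> \<zeta> (b * x) = r * \<zeta> x" and x: "x : E"
 shows "\<zeta> x = 0"
proof (rule ccontr)
 assume nz: "\<zeta> x ~= 0"
 obtain p where p: "p ~= 0" "ev p b e = 0" "pderiv p ~= 0" "ev (pderiv p) b e ~= 0" using ex_minpoly[OF b] .
 let ?P = "map_poly to_ac p"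
 have pe: "pact Q b \<zeta> y = poly Q r * \<zeta> y" if "y : E" for Q y
  using pact_eigen[of b \<zeta> r y Q] b eig that by blast
 have \<zeta>: "lin \<zeta>"
  using lin_plus[OF lin_shift[OF \<eta> b] lin_mult[OF \<eta>, of "- r"]] unfolding lin_def by (simp add: \<zeta>_def)
 have ev0: "ev p b y = 0" if "y : E" for y
  using ev_mult[of p b e y] p(2) E.e_left[OF that] by simp
 have "poly ?P r * \<zeta> x = 0"
  using pe[OF x, of ?P] pact_to_ac[OF \<zeta> b x, of p] ev0[OF x] lin_zero[OF \<zeta>] by simp
 then have "[:- r, 1:] dvd ?P" using nz by (simp add: poly_eq_0_iff_dvd)
 then obtain S where S: "?P = S * [:- r, 1:]" by (metis dvdE mult.commute)
 have pr: "pact [:- r, 1:] b \<eta> = \<zeta>"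
  by (rule ext) (simp add: pact_pCons pact_0 \<zeta>_def)
 have "pact S b \<zeta> x = 0"
  using pact_to_ac[OF \<eta> b x, of p] ev0[OF x] lin_zero[OF \<eta>] unfolding S pact_mult pr by simp
 then have Sr: "poly S r = 0" using pe[OF x, of S] nz by simp
 \<comment> \<open>Since \<open>S\<close> also vanishes at \<open>r\<close>, this is a double root
   of \<open>?P\<close> and hence a root of the derivative. So \<open>\<zeta>\<close> vanishes on
   all multiples of the unit \<open>?u\<close>, that is, on all of \<open>E\<close>.\<close>
 have "map_poly to_ac (pderiv p) = pderiv ?P"
  by (rule poly_eqI) (simp add: coeff_map_poly coeff_pderiv del: of_nat_Suc)
 then have "poly (map_poly to_ac (pderiv p)) r = 0"
  unfolding S pderiv_mult by (simp add: pderiv_pCons Sr)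
 then have z: "\<zeta> (ev (pderiv p) b y) = 0" if "y : E" for y
  using pe[OF that] pact_to_ac[OF \<zeta> b that, of "pderiv p"] by simp
 let ?u = "ev (pderiv p) b e"
 have u: "?u : E" "?u ~= 0" using ev_closed b E.e_closed p(4) by auto
 have y: "E.dinv ?u * x : E" using E.dinv_closed u x E.mult_closed by simp
 have "ev (pderiv p) b (E.dinv ?u * x) = ?u * (E.dinv ?u * x)" using ev_mult[of "pderiv p" b e] E.e_left[OF y] by simp
 also have "\<dots> = x" using E.dinv_right[OF u] E.e_left[OF x] by (simp flip: mult.assoc)
 finally show False using z[OF y] nz by simp
qed

text \<open>One linear factor at a time. The image \<open>\<zeta>\<close> of \<open>\<xi>\<close>
  under \<open>b - r\<close> splits by induction; its components with eigenvalue other than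
  \<open>r\<close> are divided by the difference of eigenvalues and subtracted from
  \<open>\<xi>\<close>. The rest is annihilated by the square of \<open>b - r\<close>, hence is an
  eigenvector by \<open>semisimple\<close>. The invariant \<open>W\<close> lets eigenvalue
  conditions for other elements survive the splitting.\<close>

lemma decompose_list:
 fixes W :: "('a => 'f alg_closure) => bool"
 assumes b: "b : E" and W_lin: "!!\<xi>. W \<xi> ==> lin \<xi>" and W_zero: "W (\<lambda>x. 0)"
  and W_add: "!!\<xi> \<eta>. W \<xi> ==> W \<eta> ==> W (\<lambda>x. \<xi> x + \<eta> x)" and W_mult: "!!c \<xi>. W \<xi> ==> W (\<lambda>x. c * \<xi> x)"
  and W_shift: "!!\<xi>. W \<xi> ==> W (\<lambda>x. \<xi> (b * x))"
 shows "W \<xi> ==> (!!x. x : E ==> pact (\<Prod>r\<leftarrow>rs. [:- r, 1:]) b \<xi> x = 0) ==>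
  EX \<eta>s. (ALL \<eta>:set \<eta>s. W \<eta> \<and> (EX r. ALL x:E. \<eta> (b * x) = r * \<eta> x)) \<and> (ALL x:E. \<xi> x = (\<Sum>\<eta>\<leftarrow>\<eta>s. \<eta> x))"
proof (induction rs arbitrary: \<xi>)
 case Nil
 then have "\<xi> x = 0" if "x : E" for x using Nil(2)[OF that] by (simp add: one_pCons pact_pCons pact_0)
 then show ?case by (intro exI[of _ "[]"]) simp
next
 case (Cons r rs)
 have W_diff: "W (\<lambda>x. \<xi> x - \<eta> x)" if "W \<xi>" "W \<eta>" for \<xi> \<eta>
  using W_add[OF that(1) W_mult[OF that(2), of "- 1"]] by simp
 have W_sum: "W (\<lambda>x. \<Sum>\<eta>\<leftarrow>\<eta>s. \<eta> x)" if "ALL \<eta>:set \<eta>s. W \<eta>" for \<eta>s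
  using that by (induction \<eta>s) (auto simp: W_zero W_add)
 define \<zeta> where "\<zeta> = (\<lambda>x. \<xi> (b * x) - r * \<xi> x)"
 have "pact [:- r, 1:] b \<xi> = \<zeta>" by (rule ext) (simp add: pact_pCons pact_0 \<zeta>_def)
 then have "pact (\<Prod>r\<leftarrow>rs. [:- r, 1:]) b \<zeta> x = 0" if "x : E" for x
  using Cons.prems(2)[OF that] by (simp add: pact_mult mult.commute[of "[:- r, 1:]"] del: mult_pCons_left mult_pCons_right)
 moreover have "W \<zeta>" unfolding \<zeta>_def by (intro W_diff W_shift W_mult Cons.prems)
 ultimately obtain \<eta>s where \<eta>s: "ALL \<eta>:set \<eta>s. W \<eta> \<and> (EX r. ALL x:E. \<eta> (b * x) = r * \<eta> x)"
  "ALL x:E. \<zeta> x = (\<Sum>\<eta>\<leftarrow>\<eta>s. \<eta> x)" using Cons.IH by blast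
 then have "ALL \<eta>:set \<eta>s. EX r. ALL x:E. \<eta> (b * x) = r * \<eta> x" by blast
 from bchoice[OF this] obtain \<rho> where \<rho>: "!!\<eta> x. \<eta> : set \<eta>s ==> x : E ==> \<eta> (b * x) = \<rho> \<eta> * \<eta> x" by blast
 define g where "g \<eta> = (\<lambda>x. inverse (\<rho> \<eta> - r) * \<eta> x)" for \<eta> :: "'a => 'f alg_closure"
 define \<theta>s where "\<theta>s = map g (filter (\<lambda>\<eta>. \<rho> \<eta> ~= r) \<eta>s)"
 define \<mu> where "\<mu> = (\<lambda>x. \<xi> x - (\<Sum>\<eta>\<leftarrow>\<theta>s. \<eta> x))"
 have \<theta>s: "W \<eta>" "EX r. ALL x:E. \<eta> (b * x) = r * \<eta> x" if h: "\<eta> : set \<theta>s" for \<eta>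
 proof -
  obtain \<eta>' where "\<eta>' : set \<eta>s" "\<eta> = g \<eta>'" using h by (auto simp: \<theta>s_def)
  then show "W \<eta>" "EX r. ALL x:E. \<eta> (b * x) = r * \<eta> x"
   using \<eta>s(1) \<rho> W_mult by (auto simp: g_def intro!: exI[of _ "\<rho> \<eta>'"])
 qed
 have W\<mu>: "W \<mu>" unfolding \<mu>_def using \<theta>s by (intro W_diff Cons.prems W_sum) auto
 have \<theta>: "(\<Sum>\<eta>\<leftarrow>\<theta>s. \<eta> (b * x)) - r * (\<Sum>\<eta>\<leftarrow>\<theta>s. \<eta> x) = (\<Sum>\<eta>\<leftarrow>filter (\<lambda>\<eta>. \<rho> \<eta> ~= r) \<eta>s. \<eta> x)" if x: "x : E" for x
 proof -
  have "set \<eta>s \<subseteq> {\<eta>. \<eta> (b * x) = \<rho> \<eta> * \<eta> x}" using \<rho> x by auto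
  then show ?thesis unfolding \<theta>s_def
  proof (induction \<eta>s)
   case (Cons \<eta> \<eta>s)
   have "g \<eta> (b * x) - r * g \<eta> x = \<eta> x" if "\<rho> \<eta> ~= r"
   proof -
    have "g \<eta> (b * x) - r * g \<eta> x = inverse (\<rho> \<eta> - r) * (\<rho> \<eta> - r) * \<eta> x"
     using Cons.prems by (simp add: g_def algebra_simps)
    then show ?thesis using that by simp
   qed
   then show ?case using Cons by (simp add: algebra_simps)
  qed simp
 qed
 have spl: "(\<Sum>\<eta>\<leftarrow>\<eta>s. \<eta> x) = (\<Sum>\<eta>\<leftarrow>filter (\<lambda>\<eta>. \<rho> \<eta> ~= r) \<eta>s. \<eta> x) + (\<Sum>\<eta>\<leftarrow>filter (\<lambda>\<eta>. \<rho> \<eta> = r) \<eta>s. \<eta> x)" for x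
  by (induction \<eta>s) (auto simp: algebra_simps)
 define \<nu> where "\<nu> = (\<lambda>x. \<mu> (b * x) - r * \<mu> x)"
 have \<nu>: "\<nu> x = (\<Sum>\<eta>\<leftarrow>filter (\<lambda>\<eta>. \<rho> \<eta> = r) \<eta>s. \<eta> x)" if x: "x : E" for x
 proof -
  have "\<nu> x = \<zeta> x - ((\<Sum>\<eta>\<leftarrow>\<theta>s. \<eta> (b * x)) - r * (\<Sum>\<eta>\<leftarrow>\<theta>s. \<eta> x))"
   by (simp add: \<nu>_def \<mu>_def \<zeta>_def algebra_simps)
  then show ?thesis using \<theta>[OF x] \<eta>s(2) x spl by simp
 qed
 have "\<nu> (b * x) = r * \<nu> x" if x: "x : E" for x
 proof -
  have "set \<eta>s \<subseteq> {\<eta>. \<eta> (b * x) = \<rho> \<eta> * \<eta> x}" using \<rho> x by auto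
  then have "(\<Sum>\<eta>\<leftarrow>filter (\<lambda>\<eta>. \<rho> \<eta> = r) \<eta>s. \<eta> (b * x)) = r * (\<Sum>\<eta>\<leftarrow>filter (\<lambda>\<eta>. \<rho> \<eta> = r) \<eta>s. \<eta> x)"
   by (induction \<eta>s) (auto simp: algebra_simps)
  then show ?thesis using \<nu> x b E.mult_closed by simp
 qed
 then have "\<nu> x = 0" if "x : E" for x
  using semisimple[OF b W_lin[OF W\<mu>], of \<nu> r] that unfolding \<nu>_def by blast
 then have "ALL x:E. \<mu> (b * x) = r * \<mu> x" by (simp add: \<nu>_def)
 then show ?case using \<theta>s W\<mu> by (intro exI[of _ "\<mu> # \<theta>s"]) (auto simp: \<mu>_def)
qed

lemma decompose:
 assumes b: "b : E" and S: "!!c. c : S ==> c : E" and \<xi>: "lin \<xi>" "ALL c:S. ALL x:E. \<xi> (c * x) = \<chi> c * \<xi> x"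
 shows "EX \<eta>s. (ALL \<eta>:set \<eta>s. lin \<eta> \<and> (EX \<chi>. ALL c:insert b S. ALL x:E. \<eta> (c * x) = \<chi> c * \<eta> x)) \<and>
  (ALL x:E. \<xi> x = (\<Sum>\<eta>\<leftarrow>\<eta>s. \<eta> x))"
proof -
 define W where "W \<xi> \<longleftrightarrow> lin \<xi> \<and> (ALL c:S. ALL x:E. \<xi> (c * x) = \<chi> c * \<xi> x)" for \<xi>
 obtain p where p: "p ~= 0" "ev p b e = 0" using ex_minpoly[OF b] .
 let ?P = "map_poly to_ac p"
 have nz: "?P ~= 0" using p by (metis coeff_map_poly leading_coeff_0_iff poly_eq_iff Polynomial.coeff_0 to_ac_0 to_ac_eq_0_iff)
 obtain A where A: "?P = smult (lead_coeff ?P) (\<Prod>x\<in>#A. [:- x, 1:])" using alg_closed_imp_factorization[OF nz] by blast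
 obtain rs where rs: "mset rs = A" using ex_mset by blast
 have P: "?P = smult (lead_coeff ?P) (\<Prod>r\<leftarrow>rs. [:- r, 1:])"
  using A unfolding rs[symmetric] by (simp flip: mset_map prod_mset_prod_list)
 have ann: "pact (\<Prod>r\<leftarrow>rs. [:- r, 1:]) b \<xi> x = 0" if x: "x : E" for x
 proof -
  have "ev p b x = 0" using ev_mult[of p b e x] p(2) E.e_left[OF x] by simp
  then have "pact ?P b \<xi> x = 0" using pact_to_ac[OF \<xi>(1) b x] lin_zero[OF \<xi>(1)] by simp
  then show ?thesis using nz by (subst (asm) P) (simp add: pact_smult)
 qed
 have cb: "c * (b * x) = b * (c * x)" if "c : S" for c x using E.comm3[OF S[OF that] b] .
 have "EX \<eta>s. (ALL \<eta>:set \<eta>s. W \<eta> \<and> (EX r. ALL x:E. \<eta> (b * x) = r * \<eta> x)) \<and> (ALL x:E. \<xi> x = (\<Sum>\<eta>\<leftarrow>\<eta>s. \<eta> x))"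
 proof (rule decompose_list[OF b _ _ _ _ _ _ ann])
  show "W \<xi>" using \<xi> by (simp add: W_def)
  show "!!\<xi>. W \<xi> ==> lin \<xi>" by (simp add: W_def)
  show "W (\<lambda>x. 0)" by (simp add: W_def lin_def)
  show "!!\<xi> \<eta>. W \<xi> ==> W \<eta> ==> W (\<lambda>x. \<xi> x + \<eta> x)" by (simp add: W_def lin_plus distrib_left)
  show "!!c \<xi>. W \<xi> ==> W (\<lambda>x. c * \<xi> x)" by (simp add: W_def lin_mult mult.left_commute)
  show "W (\<lambda>x. \<xi> (b * x))" if "W \<xi>" for \<xi>
   using that b lin_shift[of \<xi> b] cb E.mult_closed unfolding W_def by (simp flip: cb)
 qed
 then obtain \<eta>s where \<eta>s: "ALL \<eta>:set \<eta>s. W \<eta> \<and> (EX r. ALL x:E. \<eta> (b * x) = r * \<eta> x)" "ALL x:E. \<xi> x = (\<Sum>\<eta>\<leftarrow>\<eta>s. \<eta> x)"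
  by blast
 have "lin \<eta> \<and> (EX \<chi>. ALL c:insert b S. ALL x:E. \<eta> (c * x) = \<chi> c * \<eta> x)" if h: "\<eta> : set \<eta>s" for \<eta>
 proof -
  obtain r where r: "ALL x:E. \<eta> (b * x) = r * \<eta> x" using bspec[OF \<eta>s(1) h] by blast
  have W: "W \<eta>" using bspec[OF \<eta>s(1) h] by blast
  show ?thesis
  proof (cases "b : S")
   case True
   then show ?thesis using W unfolding W_def by (auto simp: insert_absorb)
  next
   case False
   then have "ALL c:insert b S. ALL x:E. \<eta> (c * x) = (\<chi>(b := r)) c * \<eta> x" using r W unfolding W_def by auto
   then show ?thesis using W unfolding W_def by blast
  qed
 qed
 then show ?thesis using \<eta>s(2) by blast
qed

lemma decompose_all:
 assumes "set bs \<subseteq> E" "lin \<xi>"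
 shows "EX \<eta>s. (ALL \<eta>:set \<eta>s. lin \<eta> \<and> (EX \<chi>. ALL c:set bs. ALL x:E. \<eta> (c * x) = \<chi> c * \<eta> x)) \<and>
  (ALL x:E. \<xi> x = (\<Sum>\<eta>\<leftarrow>\<eta>s. \<eta> x))"
 using assms
proof (induction bs)
 case Nil
 then show ?case by (intro exI[of _ "[\<xi>]"]) auto
next
 case (Cons b bs)
 then obtain \<eta>s where \<eta>s: "ALL \<eta>:set \<eta>s. lin \<eta> \<and> (EX \<chi>. ALL c:set bs. ALL x:E. \<eta> (c * x) = \<chi> c * \<eta> x)"
  "ALL x:E. \<xi> x = (\<Sum>\<eta>\<leftarrow>\<eta>s. \<eta> x)" by auto
 have "ALL \<eta>:set \<eta>s. EX \<theta>s. (ALL \<theta>:set \<theta>s. lin \<theta> \<and> (EX \<chi>. ALL c:set (b # bs). ALL x:E. \<theta> (c * x) = \<chi> c * \<theta> x)) \<and>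
  (ALL x:E. \<eta> x = (\<Sum>\<theta>\<leftarrow>\<theta>s. \<theta> x))"
 proof
  fix \<eta> assume "\<eta> : set \<eta>s"
  then obtain \<chi> where "lin \<eta>" "ALL c:set bs. ALL x:E. \<eta> (c * x) = \<chi> c * \<eta> x" using \<eta>s by blast
  then show "EX \<theta>s. (ALL \<theta>:set \<theta>s. lin \<theta> \<and> (EX \<chi>. ALL c:set (b # bs). ALL x:E. \<theta> (c * x) = \<chi> c * \<theta> x)) \<and>
   (ALL x:E. \<eta> x = (\<Sum>\<theta>\<leftarrow>\<theta>s. \<theta> x))"
   unfolding list.set by (intro decompose) (use Cons.prems(1) in auto)
 qed
 from bchoice[OF this] obtain t where t: "!!\<eta> \<theta>. \<eta> : set \<eta>s ==> \<theta> : set (t \<eta>) ==>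
   lin \<theta> \<and> (EX \<chi>. ALL c:set (b # bs). ALL x:E. \<theta> (c * x) = \<chi> c * \<theta> x)"
  "!!\<eta> x. \<eta> : set \<eta>s ==> x : E ==> \<eta> x = (\<Sum>\<theta>\<leftarrow>t \<eta>. \<theta> x)" by blast
 have "\<xi> x = (\<Sum>\<theta>\<leftarrow>concat (map t \<eta>s). \<theta> x)" if x: "x : E" for x
 proof -
  have "set \<eta>s \<subseteq> {\<eta>. \<eta> x = (\<Sum>\<theta>\<leftarrow>t \<eta>. \<theta> x)}" using t(2) x by auto
  then have "(\<Sum>\<eta>\<leftarrow>\<eta>s. \<eta> x) = (\<Sum>\<theta>\<leftarrow>concat (map t \<eta>s). \<theta> x)" by (induction \<eta>s) auto
  then show ?thesis using \<eta>s(2) x by simp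
 qed
 then show ?case using t(1) by (intro exI[of _ "concat (map t \<eta>s)"]) auto
qed

text \<open>The value 0 outside \<open>E\<close> makes homomorphisms that agree on \<open>E\<close>
  equal as functions.\<close>

definition hom :: "('a => 'f alg_closure) => bool" where
 "hom \<chi> \<longleftrightarrow> lin \<chi> \<and> \<chi> e = 1 \<and> (ALL x:E. ALL y:E. \<chi> (x * y) = \<chi> x * \<chi> y) \<and> (ALL x. x \<notin> E --> \<chi> x = 0)"

lemma hom_mult: "hom \<chi> ==> x : E ==> y : E ==> \<chi> (x * y) = \<chi> x * \<chi> y" and hom_e: "hom \<chi> ==> \<chi> e = 1"
 and hom_lin: "hom \<chi> ==> lin \<chi>" and hom_out: "hom \<chi> ==> x \<notin> E ==> \<chi> x = 0"
 by (auto simp: hom_def)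

lemma hom_nz: assumes "hom \<chi>" "x : E" "x ~= 0" shows "\<chi> x ~= 0"
 using hom_mult[OF assms(1,2) E.dinv_closed[OF assms(2,3)]] E.dinv_right[OF assms(2,3)] hom_e[OF assms(1)] by auto

text \<open>Splitting simultaneously for a spanning set of \<open>E\<close> leaves functionals on
  which every multiplication acts by a scalar. Such a functional is zero on \<open>E\<close>, or
  becomes multiplicative after division by its value at \<open>e\<close>.\<close>

lemma hom_combination:
 assumes \<xi>: "lin \<xi>"
 shows "EX U c. finite U \<and> (ALL \<chi>:U. hom \<chi>) \<and> (ALL x:E. \<xi> x = (\<Sum>\<chi>\<in>U. c \<chi> * \<chi> x))"
proof -
 obtain I :: "nat set" and f where sp: "Fmod.spanning I f" using span by auto
 have I: "finite I" and fE: "!!i. i : I ==> f i : E"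
  and sp': "!!x. x : E ==> EX k. x = (\<Sum>i\<in>I. scale (k i) (f i))" using sp unfolding Fmod.spanning_def by auto
 define bs where "bs = map f (sorted_list_of_set I)"
 have bs: "set bs = f ` I" "set bs \<subseteq> E" using I fE by (auto simp: bs_def)
 obtain \<eta>s where \<eta>s: "ALL \<eta>:set \<eta>s. lin \<eta> \<and> (EX \<chi>. ALL c:set bs. ALL x:E. \<eta> (c * x) = \<chi> c * \<eta> x)"
  "ALL x:E. \<xi> x = (\<Sum>\<eta>\<leftarrow>\<eta>s. \<eta> x)" using decompose_all[OF bs(2) \<xi>] by blast
 have one: "EX a \<chi>. hom \<chi> \<and> (ALL x:E. \<eta> x = a * \<chi> x) \<or> (ALL x:E. \<eta> x = 0)" if h: "\<eta> : set \<eta>s" for \<eta>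
 proof -
  obtain \<chi> where \<chi>: "lin \<eta>" "!!i x. i : I ==> x : E ==> \<eta> (f i * x) = \<chi> (f i) * \<eta> x"
   using bspec[OF \<eta>s(1) h] unfolding bs(1) by blast
  have ex: "EX s. ALL x:E. \<eta> (b * x) = s * \<eta> x" if b: "b : E" for b
  proof -
   obtain k where k: "b = (\<Sum>i\<in>I. scale (k i) (f i))" using sp'[OF b] by auto
   have "\<eta> (b * x) = (\<Sum>i\<in>I. to_ac (k i) * \<chi> (f i)) * \<eta> x" if x: "x : E" for x
   proof -
    have m: "f i * x : E" if "i : I" for i using fE[OF that] x E.mult_closed by simp
    have "\<eta> (b * x) = \<eta> (\<Sum>i\<in>I. scale (k i) (f i * x))" by (simp add: k sum_distrib_right sc_left)
    also have "\<dots> = (\<Sum>i\<in>I. \<eta> (scale (k i) (f i * x)))" using m sc_E by (intro lin_sum \<chi>) auto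
    also have "\<dots> = (\<Sum>i\<in>I. to_ac (k i) * \<chi> (f i) * \<eta> x)"
     using m \<chi> x by (intro sum.cong) (auto simp: lin_scale mult.assoc)
    finally show ?thesis by (simp add: sum_distrib_right)
   qed
   then show ?thesis by blast
  qed
  show ?thesis
  proof (cases "\<eta> e = 0")
   case True
   have "\<eta> x = 0" if x: "x : E" for x
    using ex[OF x] True E.e_closed E.e_right[OF x] by (metis mult_zero_right)
   then show ?thesis by blast
  next
   case False
   define h where "h x = (if x : E then \<eta> x / \<eta> e else 0)" for x
   have mul: "\<eta> (b * x) * \<eta> e = \<eta> b * \<eta> x" if b: "b : E" and x: "x : E" for b x
   proof -
    obtain s where s: "ALL x:E. \<eta> (b * x) = s * \<eta> x" using ex[OF b] by auto
    then have "\<eta> b = s * \<eta> e" using E.e_closed E.e_right[OF b] by metis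
    then show ?thesis using s x by simp
   qed
   have "hom h" unfolding hom_def
   proof (intro conjI ballI allI impI)
    show "lin h" using \<chi>(1) E.add_closed sc_E unfolding lin_def h_def by (simp add: add_divide_distrib)
    show "h e = 1" using False E.e_closed by (simp add: h_def)
    show "h (x * y) = h x * h y" if "x : E" "y : E" for x y
     using mul[OF that] that False E.mult_closed by (simp add: h_def field_simps)
   qed (simp add: h_def)
   then show ?thesis using False by (intro exI[of _ "\<eta> e"] exI[of _ h]) (simp add: h_def)
  qed
 qed
 have "EX U c. finite U \<and> (ALL \<chi>:U. hom \<chi>) \<and> (ALL x:E. (\<Sum>\<eta>\<leftarrow>\<eta>s. \<eta> x) = (\<Sum>\<chi>\<in>U. c \<chi> * \<chi> x))"
  using one
 proof (induction \<eta>s)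
  case Nil
  show ?case by (intro exI[of _ "{}"]) simp
 next
  case (Cons \<eta> \<eta>s)
  then obtain U c where U: "finite U" "ALL \<chi>:U. hom \<chi>" "ALL x:E. (\<Sum>\<eta>\<leftarrow>\<eta>s. \<eta> x) = (\<Sum>\<chi>\<in>U. c \<chi> * \<chi> x)" by auto
  consider a \<chi> where "hom \<chi>" "ALL x:E. \<eta> x = a * \<chi> x" | "ALL x:E. \<eta> x = 0" using Cons.prems[of \<eta>] by auto
  then show ?case
  proof cases
   case 1
   define d where "d \<theta> = (if \<theta> : U then c \<theta> else 0) + (if \<theta> = \<chi> then a else 0)" for \<theta>
   have "(\<Sum>\<theta>\<in>insert \<chi> U. d \<theta> * \<theta> x) = a * \<chi> x + (\<Sum>\<theta>\<in>U. c \<theta> * \<theta> x)" for x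
   proof -
    have "(\<Sum>\<theta>\<in>insert \<chi> U. d \<theta> * \<theta> x) = (\<Sum>\<theta>\<in>insert \<chi> U. (if \<theta> : U then c \<theta> * \<theta> x else 0)) +
      (\<Sum>\<theta>\<in>insert \<chi> U. (if \<theta> = \<chi> then a * \<theta> x else 0))"
     unfolding sum.distrib[symmetric] by (intro sum.cong) (auto simp: d_def distrib_right)
    also have "(\<Sum>\<theta>\<in>insert \<chi> U. (if \<theta> : U then c \<theta> * \<theta> x else 0)) = (\<Sum>\<theta>\<in>U. c \<theta> * \<theta> x)"
     using U(1) by (intro sum.mono_neutral_cong_right) auto
    finally show ?thesis using U(1) by (simp add: sum.delta)
   qed
   then show ?thesis using U 1 by (intro exI[of _ "insert \<chi> U"] exI[of _ d]) auto
  next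
   case 2
   then show ?thesis using U by (intro exI[of _ U] exI[of _ c]) auto
  qed
 qed
 then show ?thesis using \<eta>s(2) by auto
qed

text \<open>Artin's argument: for \<open>y\<close> separating two homomorphisms, subtracting
  \<open>\<theta> y\<close> times the relation at \<open>x\<close> from the relation at
  \<open>y * x\<close> removes \<open>\<theta>\<close>.\<close>

lemma hom_independent:
 assumes "finite U" "ALL \<chi>:U. hom \<chi>" "!!x. x : E ==> (\<Sum>\<chi>\<in>U. c \<chi> * \<chi> x) = 0"
 shows "ALL \<chi>:U. c \<chi> = 0"
 using assms
proof (induction U arbitrary: c rule: finite_induct)
 case (insert \<theta> U)
 have rest: "c \<chi> = 0" if \<chi>: "\<chi> : U" for \<chi>
 proof -
  have "EX y:E. \<chi> y ~= \<theta> y"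
  proof (rule ccontr)
   assume "\<not> ?thesis"
   then have "\<chi> = \<theta>" using insert.prems(1) \<chi> by (intro ext) (metis hom_out insert_iff)
   then show False using insert.hyps \<chi> by simp
  qed
  then obtain y where y: "y : E" "\<chi> y ~= \<theta> y" by auto
  have "(\<Sum>\<phi>\<in>U. (c \<phi> * (\<phi> y - \<theta> y)) * \<phi> x) = 0" if x: "x : E" for x
  proof -
   have "(\<Sum>\<phi>\<in>insert \<theta> U. c \<phi> * \<phi> (y * x)) - \<theta> y * (\<Sum>\<phi>\<in>insert \<theta> U. c \<phi> * \<phi> x) = 0"
    using insert.prems(2)[OF x] insert.prems(2)[OF E.mult_closed[OF y(1) x]] by (simp only:) simp
   moreover have "(\<Sum>\<phi>\<in>insert \<theta> U. c \<phi> * \<phi> (y * x)) - \<theta> y * (\<Sum>\<phi>\<in>insert \<theta> U. c \<phi> * \<phi> x)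
     = (\<Sum>\<phi>\<in>insert \<theta> U. (c \<phi> * (\<phi> y - \<theta> y)) * \<phi> x)"
    unfolding sum_distrib_left sum_subtractf[symmetric]
    using insert.prems(1) hom_mult[OF _ y(1) x] by (intro sum.cong) (auto simp: algebra_simps)
   ultimately show ?thesis using insert.hyps by simp
  qed
  from insert.IH[OF _ this] have "c \<chi> * (\<chi> y - \<theta> y) = 0" using insert.prems(1) \<chi> by auto
  then show ?thesis using y by simp
 qed
 have "c \<theta> * \<theta> e = 0" using insert.prems(2)[OF E.e_closed] insert.hyps rest by simp
 moreover have "\<theta> e = 1" using hom_e insert.prems(1) by blast
 ultimately show ?case using rest by auto
qed simp

end

section \<open>Transfer to the base field and its positivity\<close>

locale transfer = field_ext E e \<sigma> scale for E :: "'a::ring_1 set" and e \<sigma> and scale :: "'f::field => 'a => 'a" +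
 fixes f :: "'a => 'f" and T :: "'f set"
 assumes f_add: "x : E ==> y : E ==> f (x + y) = f x + f y"
  and f_scale: "x : E ==> f (scale c x) = c * f x"
  and f_nz: "EX x:E. f x ~= 0"
  and T: "ordering_on (UNIV :: 'f set) T"
begin

sublocale FF: sfield "UNIV :: 'f set" 1 id
 by unfold_locales simp

sublocale Tc: star_cone "UNIV :: 'f set" 1 id T
 by (rule FF.ordering_cone[OF T])

definition fform :: "'a => 'a => 'a => 'f" where "fform z x y = f (z * x * y)"

lemma fform_herm: assumes "z : E.units"
 shows "herm_cone (UNIV :: 'f set) 1 id T E (\<lambda>v c. scale c v) (fform z)"
proof -
 have z: "z : E" "z ~= 0" using assms E.units by auto
 have "herm (UNIV :: 'f set) 1 id E (\<lambda>v c. scale c v) (fform z)"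
 proof
  fix u v w c assume v: "v : E"
  show "fform z v w : UNIV" by simp
  show "u : E ==> w : E ==> fform z u (v + w) = fform z u v + fform z u w"
   using v z by (auto simp: fform_def E.mult_closed f_add distrib_left)
  show "w : E ==> fform z v (scale c w) = fform z v w * c"
   using v z f_scale[of "z * v * w" c] by (simp add: fform_def E.mult_closed sc_right mult.commute)
  show "id (fform z v w) = fform z w v" if w: "w : E"
   using v z w E.comm[of v w] by (simp add: fform_def mult.assoc)
  show "v = 0" if nd: "!!w. w : E ==> fform z v w = 0"
  proof (rule ccontr)
   assume nz: "v ~= 0"
   obtain x where x: "x : E" "f x ~= 0" using f_nz by auto
   have zv: "z * v : E" "z * v ~= 0" using z v nz E.mult_closed E.mult_nz by auto
   have d: "E.dinv (z * v) : E" using E.dinv_closed zv by auto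
   have "z * v * (E.dinv (z * v) * x) = x" using zv x E.dinv_right E.e_left by (simp flip: mult.assoc)
   then show False using nd[OF E.mult_closed[OF d x(1)]] x(2) by (simp add: fform_def)
  qed
 next
  show "Fmod.finite_dim" using span Fmod.spanning_finite_dim by blast
 qed
 then show ?thesis by (intro herm_cone.intro Tc.star_cone_axioms)
qed

definition fsig :: "'a => int" where
 "fsig z = herm_cone.sig (UNIV :: 'f set) 1 T E (\<lambda>v c. scale c v) (fform z)"

lemma f_sum: "(!!i. i : I ==> g i : E) ==> f (\<Sum>i\<in>I. g i) = (\<Sum>i\<in>I. f (g i))"
 using f_scale[of 0 0] E.zero_closed
 by (induction I rule: infinite_finite_induct) (auto simp: f_add E.sum_closed sc_zero)

text \<open>Written through dual bases, multiplication by \<open>w\<close> turns the functional into the trace.\<close>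

lemma ex_trace_multiplier:
 obtains w U where "w : E.units" "finite U" "U ~= {}" "!!\<chi>. \<chi> : U ==> hom \<chi>"
  "!!x. x : E ==> to_ac (f (w * x)) = (\<Sum>\<chi>\<in>U. \<chi> x)"
proof -
 interpret H: herm_cone "UNIV :: 'f set" 1 id T E "\<lambda>v c. scale c v" "fform e" by (rule fform_herm) simp
 obtain I :: "nat set" and v where bas: "H.basis I v" using H.ex_basis by auto
 note o = H.orthD[OF H.basis_orth[OF bas]]
 define d where "d i = f (v i * v i)" for i
 have d: "fform e (v i) (v i) = d i" "d i ~= 0" if "i : I" for i
  using o(2,3)[OF that] by (simp_all add: fform_def d_def E.e_left)
 have dinv: "F.dinv c = inverse c" if "c ~= 0" for c
  using that F.dinv_unique[of c "inverse c"] by simp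
 have exp: "x = (\<Sum>i\<in>I. scale (inverse (d i) * f (v i * x)) (v i))" if x: "x : E" for x
 proof -
  have "x = (\<Sum>i\<in>I. scale (F.dinv (fform e (v i) (v i)) * fform e (v i) x) (v i))"
   using bas x unfolding H.basis_def by blast
  also have "\<dots> = (\<Sum>i\<in>I. scale (inverse (d i) * f (v i * x)) (v i))"
   using d o(2) dinv by (intro sum.cong) (auto simp: fform_def E.e_left)
  finally show ?thesis .
 qed
 \<comment> \<open>Dual bases multiplied together and summed; \<open>\<chi> w\<close> turns out to
   be the inverse of the coefficient of \<open>\<chi>\<close> in the functional, so multiplying by
   \<open>w\<close> normalises all coefficients to 1.\<close>
 define w where "w = (\<Sum>i\<in>I. scale (inverse (d i)) (v i * v i))"
 have wE: "w : E" unfolding w_def using o by (intro E.sum_closed sc_E E.mult_closed) auto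
 have lf: "lin (\<lambda>x. to_ac (f x))" unfolding lin_def by (simp add: f_add f_scale)
 from hom_combination[OF lf] obtain U0 c where U0: "finite U0" "ALL \<chi>:U0. hom \<chi>" "ALL x:E. to_ac (f x) = (\<Sum>\<chi>\<in>U0. c \<chi> * \<chi> x)"
  by blast
 define U where "U = {\<chi> : U0. c \<chi> ~= 0}"
 have U: "finite U" "ALL \<chi>:U. hom \<chi>" using U0 by (auto simp: U_def)
 have fU: "to_ac (f x) = (\<Sum>\<chi>\<in>U. c \<chi> * \<chi> x)" if "x : E" for x
 proof -
  have "(\<Sum>\<chi>\<in>U0. c \<chi> * \<chi> x) = (\<Sum>\<chi>\<in>U. c \<chi> * \<chi> x)"
   using U0(1) by (intro sum.mono_neutral_right) (auto simp: U_def)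
  then show ?thesis using U0(3) that by simp
 qed
 have one: "c \<chi> * \<chi> w = 1" if \<chi>: "\<chi> : U" for \<chi>
 proof -
  have h: "hom \<chi>" "lin \<chi>" using U \<chi> hom_lin by auto
  \<comment> \<open>Applying \<open>\<chi>\<close> to the expansion of \<open>x\<close> rewrites
    \<open>\<chi> x\<close> as a combination of the homomorphisms in \<open>U\<close>; independence
    forces the coefficient of \<open>\<chi>\<close> itself to be 1.\<close>
  define a where "a \<theta> = c \<theta> * (\<Sum>i\<in>I. to_ac (inverse (d i)) * \<chi> (v i) * \<theta> (v i))" for \<theta>
  have "(\<Sum>\<theta>\<in>U. (a \<theta> - (if \<theta> = \<chi> then 1 else 0)) * \<theta> x) = 0" if x: "x : E" for x
  proof -
   have "\<chi> x = (\<Sum>i\<in>I. \<chi> (scale (inverse (d i) * f (v i * x)) (v i)))"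
    by (subst exp[OF x], rule lin_sum[OF h(2)]) (use o sc_E in auto)
   also have "\<dots> = (\<Sum>i\<in>I. to_ac (inverse (d i)) * \<chi> (v i) * to_ac (f (v i * x)))"
    using o by (intro sum.cong) (auto simp: lin_scale[OF h(2)])
   also have "\<dots> = (\<Sum>i\<in>I. \<Sum>\<theta>\<in>U. to_ac (inverse (d i)) * \<chi> (v i) * (c \<theta> * (\<theta> (v i) * \<theta> x)))"
    unfolding sum_distrib_left[symmetric]
    using o x U(2) by (intro sum.cong refl) (auto simp: fU E.mult_closed hom_mult intro!: sum.cong)
   also have "\<dots> = (\<Sum>\<theta>\<in>U. \<Sum>i\<in>I. to_ac (inverse (d i)) * \<chi> (v i) * (c \<theta> * (\<theta> (v i) * \<theta> x)))" by (rule sum.swap)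
   also have "\<dots> = (\<Sum>\<theta>\<in>U. a \<theta> * \<theta> x)"
    unfolding a_def sum_distrib_left sum_distrib_right by (intro sum.cong refl) (simp add: ac_simps)
   finally have "\<chi> x = (\<Sum>\<theta>\<in>U. a \<theta> * \<theta> x)" .
   moreover have "(\<Sum>\<theta>\<in>U. (if \<theta> = \<chi> then 1 else 0) * \<theta> x) = \<chi> x"
    using U(1) \<chi> by (simp add: if_distrib[of "\<lambda>a. a * _"] cong: if_cong)
   ultimately show ?thesis by (simp add: left_diff_distrib sum_subtractf)
  qed
  from hom_independent[OF U this] have "a \<chi> = 1" using \<chi> by auto
  moreover have "\<chi> w = (\<Sum>i\<in>I. to_ac (inverse (d i)) * \<chi> (v i) * \<chi> (v i))"
   unfolding w_def using o by (subst lin_sum[OF h(2)])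
    (auto simp: sc_E E.mult_closed lin_scale[OF h(2)] hom_mult[OF h(1)] mult.assoc)
  ultimately show ?thesis by (simp add: a_def)
 qed
 have ne: "U ~= {}" using f_nz fU by auto
 then have "w ~= 0" using one lin_zero hom_lin U(2) by fastforce
 then have "w : E.units" using wE by (rule E.unitsI[rotated])
 moreover have "to_ac (f (w * x)) = (\<Sum>\<chi>\<in>U. \<chi> x)" if x: "x : E" for x
 proof -
  have "to_ac (f (w * x)) = (\<Sum>\<chi>\<in>U. c \<chi> * \<chi> w * \<chi> x)"
   using fU[OF E.mult_closed[OF wE x]] U(2) hom_mult[OF _ wE x] by (simp add: mult.assoc)
  then show ?thesis using one by simp
 qed
 ultimately show ?thesis using that U ne by blast
qed

text \<open>After multiplication by \<open>w\<close> the functional is a sum of homomorphisms. Hence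
  \<open>ph\<close> embeds \<open>E\<close> as a field of functions on finitely many points whose
  trace is \<open>f (w * x)\<close>, and \<open>psum_pos\<close> applies.\<close>

theorem ex_positive_transfer:
 assumes lam: "ordering_on E \<P>" "!!c. c : T ==> scale c e : \<P>"
 shows "EX w:E.units. ALL zs. set zs \<subseteq> \<P> - {0} --> 0 < (\<Sum>z\<in>#pfister zs {#e#}. fsig (w * z))"
proof -
 obtain w U where w: "w : E.units" and U: "finite U" "U ~= {}" "!!\<chi>. \<chi> : U ==> hom \<chi>"
  and tr: "!!x. x : E ==> to_ac (f (w * x)) = (\<Sum>\<chi>\<in>U. \<chi> x)" by (rule ex_trace_multiplier) blast
 obtain g where g: "bij_betw g {0..<card U} U" using ex_bij_betw_nat_finite[OF U(1)] by auto
 define N where "N = {0..<card U}"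
 have gU: "g k : U" if "k : N" for k using g that unfolding N_def by (auto simp: bij_betw_def)
 have hg: "hom (g k)" "lin (g k)" if "k : N" for k using U(3)[OF gU[OF that]] hom_lin by auto
 have N: "finite N" "N ~= {}" using U by (auto simp: N_def card_gt_0_iff)
 have gsum: "(\<Sum>k\<in>N. g k x) = to_ac (f (w * x))" if "x : E" for x
  using sum.reindex_bij_betw[OF g, of "\<lambda>\<chi>. \<chi> x"] tr[OF that] by (simp add: N_def)
 define ph where "ph x = (\<lambda>k. if k : N then g k x else 0)" for x
 define B where "B = ph ` E"
 define K where "K = range (to_ac :: 'f => _)"
 define P where "P = to_ac ` T"
 have phB: "ph x : B" if "x : E" for x using that by (simp add: B_def)
 have ph_add: "ph (x + y) = ph x + ph y" and ph_mult: "ph (x * y) = ph x * ph y" if "x : E" "y : E" for x y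
  using that hg by (auto simp: ph_def fun_eq_iff lin_add hom_mult)
 have ph_scale: "ph (scale c x) = sact (ph x) (to_ac c)" if "x : E" for c x
  using that hg by (auto simp: ph_def fun_eq_iff lin_scale sact_def)
 have ph_zero: "ph 0 = 0" using hg lin_zero by (auto simp: ph_def fun_eq_iff)
 have ph_sum: "ph (\<Sum>i\<in>I. q i) = (\<Sum>i\<in>I. ph (q i))" if "!!i. i : I ==> q i : E" for I :: "nat set" and q
  using that by (induction I rule: infinite_finite_induct) (auto simp: ph_zero ph_add E.sum_closed)
 have ph_e: "ph e = ind N" using hg hom_e by (auto simp: ph_def ind_def fun_eq_iff)
 have ph_nz: "ph x k ~= 0" if "x : E" "x ~= 0" "k : N" for x k
  using hom_nz[OF hg(1)[OF that(3)] that(1,2)] that(3) by (simp add: ph_def)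
 have oT: "!!x y. x : T ==> y : T ==> x + y : T" "!!x y. x : T ==> y : T ==> x * y : T"
  "!!x. x : T \<or> - x : T" "!!x. x : T ==> - x : T ==> x = 0"
  using T unfolding ordering_on_def by blast+
 interpret K: sfield K 1 id
 proof
  fix x y :: "'f alg_closure"
  show "involution (id :: 'f alg_closure => _)" by (simp add: involution_def mult.commute)
  show "x : K ==> y : K ==> x + y : K" unfolding K_def by (auto simp flip: to_ac_add)
  show "x : K ==> y : K ==> x * y : K" unfolding K_def by (auto simp flip: to_ac_mult)
  show "x : K ==> - x : K" unfolding K_def by (auto simp flip: to_ac_minus)
  show "1 : K" unfolding K_def using rangeI[of to_ac 1] by simp
  show "EX y:K. x * y = 1 \<and> y * x = 1" if "x : K" "x ~= 0"
  proof (intro bexI conjI)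
   show "x * inverse x = 1" "inverse x * x = 1" using that by auto
   show "inverse x : K" using that unfolding K_def by (auto simp flip: to_ac_inverse)
  qed
  show "(1 :: 'f alg_closure) + 1 ~= 0" using char0[of 1] to_ac_eq_0_iff[of "1 + 1 :: 'f"] by simp
 qed auto
 have oP: "ordering_on K P" unfolding ordering_on_def
 proof (intro conjI ballI impI)
  show "P \<subseteq> K" by (auto simp: P_def K_def)
  show "!!x y. x : P ==> y : P ==> x + y : P" using oT(1) unfolding P_def by (auto simp flip: to_ac_add)
  show "!!x y. x : P ==> y : P ==> x * y : P" using oT(2) unfolding P_def by (auto simp flip: to_ac_mult)
  show "x : P \<or> - x : P" if x: "x : K" for x
  proof -
   obtain a where a: "x = to_ac a" "- x = to_ac (- a)" using x unfolding K_def by auto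
   show ?thesis using oT(3)[of a] unfolding P_def a(2) unfolding a(1) by blast
  qed
  show "x = 0" if "x : P" "- x : P" for x
  proof -
   obtain a b where "x = to_ac a" "- x = to_ac b" "a : T" "b : T" using \<open>x : P\<close> \<open>- x : P\<close> unfolding P_def by auto
   moreover from this have "b = - a" by (metis to_ac_eq_iff to_ac_minus)
   ultimately show ?thesis using oT(4)[of a] by simp
  qed
 qed
 have sp: "EX k. (ALL i:I. k i : K) \<and> y = (\<Sum>i\<in>I. sact (ph (q i)) (k i))"
  if sp: "Fmod.spanning I q" and y: "y : B" for I :: "nat set" and q y
 proof -
  obtain x where x: "x : E" "y = ph x" using y unfolding B_def by blast
  obtain k where k: "x = (\<Sum>i\<in>I. scale (k i) (q i))" and q: "!!i. i : I ==> q i : E"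
   using sp x(1) unfolding Fmod.spanning_def by blast
  have "y = (\<Sum>i\<in>I. ph (scale (k i) (q i)))" unfolding x(2) k by (rule ph_sum) (use q sc_E in auto)
  also have "\<dots> = (\<Sum>i\<in>I. sact (ph (q i)) (to_ac (k i)))" using q ph_scale by simp
  finally show ?thesis by (intro exI[of _ "\<lambda>i. to_ac (k i)"]) (simp add: K_def)
 qed
 interpret M: smod K 1 id B sact
 proof
  fix v w c d
  show "0 : B" using phB[OF E.zero_closed] ph_zero by simp
  show "v : B ==> w : B ==> v + w : B" unfolding B_def using E.add_closed by (auto simp flip: ph_add)
  show "v : B ==> c : K ==> sact v c : B" unfolding B_def K_def using sc_E by (auto simp flip: ph_scale)
 qed (auto simp: sact_def distrib_left distrib_right mult.assoc)
 have spM: "M.spanning I (\<lambda>i. ph (q i))" if s: "Fmod.spanning I q" for I :: "nat set" and q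
  unfolding M.spanning_def
 proof (intro conjI ballI)
  show "finite I" "!!i. i : I ==> ph (q i) : B" using s phB unfolding Fmod.spanning_def by auto
 qed (rule sp[OF s])
 interpret etale_field K P N B
 proof
  show "ordering_on K P" "finite N" by (fact oP N)+
  fix b b' k x y
  show "b : B ==> x \<notin> N ==> b x = 0" by (auto simp: B_def ph_def)
  show "ind N : B" using phB[OF E.e_closed] ph_e by simp
  show "b : B ==> b' : B ==> b + b' : B" by (rule M.M_add)
  show "b : B ==> b' : B ==> b * b' : B" unfolding B_def using E.mult_closed by (auto simp flip: ph_mult)
  show "b : B ==> k : K ==> sact b k : B" by (rule M.M_act)
  show "EX b:B. b x ~= b y" if xy: "x : N" "y : N" "x ~= y"
  proof -
   have "g x ~= g y" using g xy unfolding N_def bij_betw_def by (auto dest: inj_onD)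
   then obtain z where z: "g x z ~= g y z" by auto
   then have "z : E" using hom_out[OF hg(1)[OF xy(1)]] hom_out[OF hg(1)[OF xy(2)]] by metis
   then show ?thesis using z xy by (intro bexI[of _ "ph z"] phB) (auto simp: ph_def)
  qed
  show "(\<Sum>x\<in>N. b x) : K" if b: "b : B"
  proof -
   obtain x where x: "x : E" "b = ph x" using b by (auto simp: B_def)
   then show ?thesis using gsum[OF x(1)] by (simp add: ph_def K_def)
  qed
  show "EX (I::nat set) b. M.spanning I b" using span spM by blast
  show "b x ~= 0" if b: "b : B" "b ~= 0" and x: "x : N"
  proof -
   obtain y where y: "y : E" "b = ph y" using b by (auto simp: B_def)
   then have "y ~= 0" using b ph_zero by auto
   then show ?thesis using ph_nz y x by simp
  qed
  show "b = 0" if b: "b : B" and nd: "!!w. w : B ==> (\<Sum>x\<in>N. b x * w x) = 0"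
  proof -
   obtain x where x: "x : E" "b = ph x" using b by (auto simp: B_def)
   have "x = 0"
   proof (rule ccontr)
    assume nz: "x ~= 0"
    obtain y where y: "y : E" "f y ~= 0" using f_nz by auto
    have ww: "w : E" "w ~= 0" using w E.units by auto
    have wx: "w * x : E" "w * x ~= 0" using ww x nz E.mult_closed E.mult_nz by auto
    let ?z = "E.dinv (w * x) * y"
    have z: "?z : E" using E.dinv_closed wx y E.mult_closed by simp
    have "w * (x * ?z) = (w * x) * E.dinv (w * x) * y" by (simp add: mult.assoc)
    also have "\<dots> = y" using E.dinv_right wx y E.e_left by simp
    finally have "to_ac (f y) = (\<Sum>k\<in>N. g k (x * ?z))" using gsum[OF E.mult_closed[OF x(1) z]] by simp
    also have "\<dots> = (\<Sum>k\<in>N. b k * ph ?z k)"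
     unfolding x(2) by (intro sum.cong refl) (simp add: ph_def hom_mult[OF hg(1) x(1) z])
    also have "\<dots> = 0" using nd[OF phB[OF z]] .
    finally show False using y by simp
   qed
   then show "b = 0" using x ph_zero by simp
  qed
 qed (use N in auto)
 have Bu_ph: "ph z : Bu" if "z : E.units" for z
  using that E.units phB ph_nz by (auto simp: Bu_def)
 have sgE: "sg (ph z) = fsig (w * z)" if z: "z : E.units" for z
  unfolding sg_def fsig_def
 proof (rule sig_transport[OF fform_herm trh_herm[OF Bu_ph[OF z]], where g = ph and c = to_ac])
  show "w * z : E.units" using w z by simp
  show "trh N (ph z) (ph x) (ph y) = to_ac (fform (w * z) x y)" if "x : E" "y : E" for x y
  proof -
   have zz: "z : E" using z E.units by auto
   have "to_ac (fform (w * z) x y) = (\<Sum>k\<in>N. g k (z * x * y))"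
    using gsum[of "z * x * y"] zz that E.mult_closed by (simp add: fform_def mult.assoc)
   also have "\<dots> = trh N (ph z) (ph x) (ph y)"
    unfolding trh_def using that zz E.mult_closed by (intro sum.cong refl) (simp add: ph_def hom_mult[OF hg(1)])
   finally show ?thesis by simp
  qed
  show "M.spanning I (\<lambda>i. ph (b i))" if "Fmod.spanning I b" for I :: "nat set" and b by (rule spM[OF that])
 qed (auto simp: P_def)
 have oL: "\<P> \<subseteq> E" "!!x y. x : \<P> ==> y : \<P> ==> x + y : \<P>" "!!x y. x : \<P> ==> y : \<P> ==> x * y : \<P>"
  "!!x. x : E ==> x : \<P> \<or> - x : \<P>" "!!x. x : \<P> ==> - x : \<P> ==> x = 0"
  using lam(1) unfolding ordering_on_def by blast+
 have ph_neg: "ph (- x) = - ph x" if "x : E" for x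
  using ph_add[OF that E.neg_closed[OF that]] ph_zero by (simp add: eq_neg_iff_add_eq_0 add.commute)
 have ph_eq0: "x = 0" if "x : E" "ph x = 0" for x
  using ph_nz[OF that(1)] that(2) N by auto
 have oB: "ordering_on B (ph ` \<P>)" unfolding ordering_on_def
 proof (intro conjI ballI impI)
  show "ph ` \<P> \<subseteq> B" using oL(1) unfolding B_def by auto
  fix x y assume x: "x : ph ` \<P>"
  obtain a where a: "x = ph a" "a : \<P>" "a : E" using x oL(1) by auto
  show "x + y : ph ` \<P>" "x * y : ph ` \<P>" if y: "y : ph ` \<P>"
  proof -
   obtain b where b: "y = ph b" "b : \<P>" "b : E" using y oL(1) by auto
   show "x + y : ph ` \<P>" "x * y : ph ` \<P>"
    using imageI[OF oL(2)[OF a(2) b(2)], of ph] imageI[OF oL(3)[OF a(2) b(2)], of ph] a b ph_add ph_mult by auto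
  qed
  show "x = 0" if y: "- x : ph ` \<P>"
  proof -
   obtain b where b: "- x = ph b" "b : \<P>" "b : E" using y oL(1) by auto
   have "ph (a + b) = 0" using ph_add a b(3) by (simp flip: b(1))
   then have "a + b = 0" using ph_eq0 a b E.add_closed by blast
   then have "b = - a" by (simp only: add_eq_0_iff)
   then show ?thesis using oL(5) a b ph_zero by auto
  qed
 next
  fix x assume "x : B"
  then obtain a where a: "x = ph a" "a : E" by (auto simp: B_def)
  then show "x : ph ` \<P> \<or> - x : ph ` \<P>" using oL(4)[OF a(2)] ph_neg[OF a(2)] by (metis imageI)
 qed
 have Lh: "Lh \<subseteq> ph ` \<P>"
 proof
  fix x assume "x : Lh"
  then obtain c where c: "c : T" "x = sact (ind N) (to_ac c)" unfolding Lh_def unfolding P_def by blast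
  have "x = ph (scale c e)" using ph_scale[OF E.e_closed] c ph_e by simp
  then show "x : ph ` \<P>" using lam(2)[OF c(1)] by auto
 qed
 have "0 < (\<Sum>z\<in>#pfister zs {#e#}. fsig (w * z))" if zs: "set zs \<subseteq> \<P> - {0}" for zs
 proof -
  have u: "set zs \<subseteq> E.units" using zs oL(1) by (auto simp: E.units_def)
  have "0 < psum K P N B (map ph zs)"
   by (rule psum_pos[OF oB Lh]) (use u zs Bu_ph in auto)
  also have "psum K P N B (map ph zs) = (\<Sum>z\<in>#image_mset ph (pfister zs {#e#}). sg z)"
   unfolding psum_def using pfister_image[of E.units ph "{#e#}" zs] u ph_mult E.units ph_e by simp
  also have "\<dots> = (\<Sum>z\<in>#pfister zs {#e#}. fsig (w * z))"
   using E.pfister_units[of "{#e#}" zs] u sgE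
   by (simp add: multiset.map_comp comp_def) (intro arg_cong[of _ _ sum_mset] image_mset_cong, auto)
  finally show ?thesis .
 qed
 then show ?thesis using w by blast
qed

end

section \<open>Orderings that detect torsion\<close>

lemma pfister_union: "pfister ts (M + N) = pfister ts M + pfister ts N"
 by (induction ts) (auto simp: ac_simps)

lemma pfister_append: "pfister (ts @ ss) M = pfister ts (pfister ss M)"
 by (induction ts) auto

lemma pfister_image_left:
 assumes "!!s. s : set ss ==> t * s = s * t"
 shows "image_mset ((*) t) (pfister ss M) = pfister ss (image_mset ((*) t) M)"
 using assms
proof (induction ss)
 case (Cons s ss)
 have "t * (s * x) = s * (t * x)" for x using Cons.prems[of s] by (simp flip: mult.assoc)
 then have "image_mset ((*) t) (image_mset ((*) s) (pfister ss M)) = image_mset ((*) s) (image_mset ((*) t) (pfister ss M))"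
  by (simp add: multiset.map_comp comp_def)
 then show ?case using Cons by simp
qed simp

lemma pfister_commute:
 assumes "!!t s. t : set ts ==> s : set ss ==> t * s = s * t"
 shows "pfister ts (pfister ss M) = pfister ss (pfister ts M)"
 using assms
proof (induction ts)
 case (Cons t ts)
 have "pfister ts (pfister ss M) = pfister ss (pfister ts M)" using Cons.prems by (intro Cons.IH) auto
 moreover have "image_mset ((*) t) (pfister ss (pfister ts M)) = pfister ss (image_mset ((*) t) (pfister ts M))"
  using Cons.prems by (intro pfister_image_left) auto
 ultimately show ?case by (simp add: pfister_union)
qed simp

context star_div
begin

text \<open>Scaling all entries of a form by a central symmetric unit respects isometry, which is
  what Pfister entries have to do.\<close>

definition cunits :: "'a set" where "cunits = {f : symu. ALL d:D. f * d = d * f}"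

lemma cunits: "f : cunits ==> f : symu" "f : cunits ==> d : D ==> f * d = d * f"
 by (auto simp: cunits_def)

lemma torsion_pfister: "torsion M ==> set ts \<subseteq> cunits ==> torsion (pfister ts M)"
 by (induction ts) (auto intro!: torsion_add torsion_scale simp: cunits_def)

end

text \<open>\<open>Z\<close> says that \<open>\<langle>1, -b\<rangle> \<otimes> M\<close> becomes torsion after multiplication with a Pfister form with
 entries in \<open>T\<close>.\<close>

locale torsion_detect = star_div D e \<sigma> + K: sfield K e \<sigma> for D :: "'a::ring_1 set" and e \<sigma> and K +
 fixes b T
 assumes KD: "x : K ==> x : D" and Kb: "x : K ==> x * b = b * x" and b: "b : symu" and T: "T \<subseteq> cunits"
begin

definition tT :: "'a multiset => bool" where "tT M \<longleftrightarrow> (EX ts. set ts \<subseteq> T \<and> torsion (pfister ts M))"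

lemma T_comm: "set ts \<subseteq> T ==> set ss \<subseteq> T ==> pfister ts (pfister ss M) = pfister ss (pfister ts M)"
 using T cunits symu by (intro pfister_commute) blast

lemma tT_extend: assumes "torsion (pfister ts M)" "set ts \<subseteq> T" "set ss \<subseteq> T"
 shows "torsion (pfister (ss @ ts) M)" "torsion (pfister (ts @ ss) M)"
 using torsion_pfister[OF assms(1), of ss] assms(2,3) T T_comm[OF assms(2,3)] by (auto simp: pfister_append)

lemma torsion_tT: "torsion M ==> tT M"
 unfolding tT_def by (intro exI[of _ "[]"]) simp

lemma tT_add: assumes "tT M" "tT N" shows "tT (M + N)"
proof -
 obtain ts ss where ts: "set ts \<subseteq> T" "torsion (pfister ts M)" and ss: "set ss \<subseteq> T" "torsion (pfister ss N)"
  using assms unfolding tT_def by blast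
 have "torsion (pfister (ts @ ss) M)" "torsion (pfister (ts @ ss) N)"
  using tT_extend[OF ts(2,1) ss(1)] tT_extend[OF ss(2,1) ts(1)] by auto
 then show ?thesis unfolding tT_def using ts ss
  by (intro exI[of _ "ts @ ss"]) (auto simp: pfister_union intro: torsion_add)
qed

lemma tT_cancel: assumes "tT (M + N)" "tT N" shows "tT M"
proof -
 obtain ts ss where ts: "set ts \<subseteq> T" "torsion (pfister ts (M + N))" and ss: "set ss \<subseteq> T" "torsion (pfister ss N)"
  using assms unfolding tT_def by blast
 have "torsion (pfister (ts @ ss) M + pfister (ts @ ss) N)" "torsion (pfister (ts @ ss) N)"
  using tT_extend[OF ts(2,1) ss(1)] tT_extend[OF ss(2,1) ts(1)] by (auto simp: pfister_union)
 then have "torsion (pfister (ts @ ss) M)" by (rule torsion_cancel)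
 then show ?thesis unfolding tT_def using ts ss by (intro exI[of _ "ts @ ss"]) auto
qed

lemma tT_double: assumes "tT (M + M)" shows "tT M"
 using assms torsion_double unfolding tT_def pfister_union by blast

text \<open>The product of \<langle>1, -b\<rangle> with \<open>M\<close>; entries taken from
  \<open>K\<close> commute with \<open>b\<close>, so the products stay symmetric.\<close>

definition hb :: "'a multiset => 'a multiset" where "hb M = M + image_mset (\<lambda>x. - (x * b)) M"

lemma hb_union: "hb (M + N) = hb M + hb N"
 by (simp add: hb_def)

lemma hb_times: "hb (image_mset ((*) t) M) = image_mset ((*) t) (hb M)"
 by (simp add: hb_def multiset.map_comp comp_def mult.assoc)

lemma hb_pfister: "hb (pfister ts M) = pfister ts (hb M)"
 by (induction ts) (auto simp: hb_union hb_times)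

lemma units_symu: "x : K.units ==> x : symu"
 using K.units KD K.star_id by (auto intro!: symuI)

lemma units_b: "x : K.units ==> x * b : symu"
 using K.units KD Kb b symu K.star_id mult_closed mult_nz by (intro symuI) (auto simp: star_mult)

lemma torsion_pair: assumes "x : symu" "c : D" "c ~= 0" "y = \<sigma> c * x * c" shows "torsion {#y, - x#}" "torsion {#x, - y#}"
 using torsion_diff[OF isoM_conj[OF assms(1-3)]] torsion_diff[OF isoM_sym[OF isoM_conj[OF assms(1-3)]]]
 unfolding assms(4) by (simp_all add: add_mset_commute)

text \<open>An element \<open>c\<close> commuting with both \<open>z\<close> and \<open>b\<close>
  conjugates the two halves, \<open>z\<close> and \<open>z * b\<close>, simultaneously.\<close>

lemma hb_pair: assumes z: "z : K.units" and c: "c : D" "c ~= 0" and cz: "c * z = z * c" "c * b = b * c" "\<sigma> c * c * z = w"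
 shows "torsion (hb {#w, - z#})"
proof -
 have zK: "z : K" using z K.units by auto
 have "\<sigma> c * z * c = w" using cz by (simp add: mult.assoc)
 then have "torsion {#w, - z#}" using torsion_pair(1)[OF units_symu[OF z] c] by simp
 moreover have "\<sigma> c * (z * b) * c = w * b"
 proof -
  have "\<sigma> c * (z * b) * c = \<sigma> c * (z * (b * c))" by (simp add: mult.assoc)
  also have "\<dots> = \<sigma> c * (z * c) * b" unfolding cz(2)[symmetric] by (simp add: mult.assoc)
  also have "\<dots> = w * b" unfolding cz(1)[symmetric] cz(3)[symmetric] by (simp add: mult.assoc)
  finally show ?thesis .
 qed
 then have "torsion {#z * b, - (w * b)#}" using torsion_pair(2)[OF units_b[OF z] c] by simp
 ultimately show ?thesis using torsion_add by (force simp: hb_def add_mset_commute)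
qed

sublocale W: witt_pred K e \<sigma> "\<lambda>M. tT (hb M)"
proof
 fix x y z and M N :: "'a multiset"
 show "tT (hb M) ==> tT (hb N) ==> tT (hb (M + N))" by (simp add: hb_union tT_add)
 show "tT (hb (M + N)) ==> tT (hb N) ==> tT (hb M)" unfolding hb_union by (rule tT_cancel)
 show "tT (hb (M + M)) ==> tT (hb M)" unfolding hb_union by (rule tT_double)
 show "tT (hb {#z, - z#})" if z: "z : K.units"
 proof (rule torsion_tT)
  show "torsion (hb {#z, - z#})"
   using torsion_add[OF torsion_hyp[OF units_symu[OF z]] torsion_hyp[OF units_b[OF z]]]
   by (simp add: hb_def add_mset_commute)
 qed
 show "tT (hb {#x * x * z, - z#})" if x: "x : K.units" and z: "z : K.units"
 proof (rule torsion_tT, rule hb_pair[OF z])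
  show "x : D" "x ~= 0" "x * z = z * x" "x * b = b * x" "\<sigma> x * x * z = x * x * z"
   using x z K.units KD K.comm Kb K.star_id by auto
 qed
 show "tT (hb {#x, y, - (x + y), - (x * y * (x + y))#})"
  if xy: "x : K.units" "y : K.units" "x + y : K.units"
 proof (rule torsion_tT)
  let ?w = "x * y * (x + y)"
  have w: "?w : K.units" using xy by simp
  have K: "x : K" "y : K" "x + y : K" "?w : K" using xy w K.units by auto
  have bb: "b : D" "b ~= 0" "\<sigma> b = b" using b symu by auto
  have 1: "torsion {#x, y, - (x + y), - ?w#}"
   using torsion_diff[OF isoM_exchange[OF units_symu[OF xy(1)] units_symu[OF xy(2)] units_symu[OF xy(3)] K.comm[OF K(1,2)]]]
   by (simp add: add_mset_commute)
  have yb: "y * b = b * y" "x * b = b * x" "?w * b = b * ?w" using Kb K by auto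
  have "isoM {#x * b, y * b#} {#x * b + y * b, x * b * (y * b) * (x * b + y * b)#}"
  proof (rule isoM_exchange)
   show "x * b : symu" "y * b : symu" "x * b + y * b : symu"
    using units_b xy by (auto simp flip: distrib_right)
   have "x * b * (y * b) = x * (y * (b * b))" using yb by (metis mult.assoc)
   moreover have "y * b * (x * b) = y * (x * (b * b))" using yb by (metis mult.assoc)
   ultimately show "x * b * (y * b) = y * b * (x * b)" using K.comm3[OF K(1,2)] by simp
  qed
  \<comment> \<open>The second entry of the exchanged twisted plane is \<open>?w * b\<close>
    conjugated by \<open>b\<close>, so \<open>isoM_conj\<close> brings it to the required
    form.\<close>
  moreover have "x * b * (y * b) * (x * b + y * b) = \<sigma> b * (?w * b) * b"
  proof -
   have "x * b * (y * b) * (x * b + y * b) = x * y * (b * b) * ((x + y) * b)"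
    using yb by (simp add: distrib_right mult.assoc) (metis mult.assoc)
   also have "\<dots> = x * y * (b * (b * (x + y))) * b" by (simp only: mult.assoc)
   also have "b * (b * (x + y)) = (x + y) * (b * b)" using Kb[OF K(3)] by (metis mult.assoc)
   finally show ?thesis using yb(3) bb by (metis mult.assoc)
  qed
  ultimately have i: "isoM {#x * b, y * b#} {#(x + y) * b, \<sigma> b * (?w * b) * b#}" by (simp add: distrib_right)
  have "isoM {#(x + y) * b, \<sigma> b * (?w * b) * b#} {#(x + y) * b, ?w * b#}"
   using isoM_add[OF isoM_refl[of "{#(x + y) * b#}"] isoM_sym[OF isoM_conj[OF units_b[OF w] bb(1,2)]]]
    units_b[OF xy(3)] by (simp add: add_mset_commute)
  from torsion_diff[OF isoM_sym[OF isoM_trans[OF i this]]]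
  have 2: "torsion {#(x + y) * b, ?w * b, - (x * b), - (y * b)#}" by (simp add: add_mset_commute)
  have "- ((- x - y) * b) = (x + y) * b" by (simp add: algebra_simps)
  then show "torsion (hb {#x, y, - (x + y), - ?w#})"
   using torsion_add[OF 1 2] by (simp add: hb_def add_mset_commute)
 qed
qed

theorem ex_detecting_ordering:
 assumes "\<not> tT {#e, - b#}"
 shows "EX \<P>. ordering_on K \<P> \<and> (ALL zs. set zs \<subseteq> \<P> - {0} --> (EX z:K.units. \<not> tT (hb (image_mset ((*) z) (pfister zs {#e#})))))"
proof -
 have "hb {#e#} = {#e, - b#}" using b symu e_left by (simp add: hb_def add_mset_commute)
 then interpret F: witt_pred_form K e \<sigma> "\<lambda>M. tT (hb M)" "{#e#}"
  by unfold_locales (use assms in auto)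
 show ?thesis by (rule F.ex_ordering)
qed

end

context smod
begin

lemma ex_independent_basis:
 assumes finite_dim
 shows "EX n (v::nat => 'm). (ALL i<n. v i : M) \<and> (ALL x:M. EX k. (ALL i<n. k i : D) \<and> x = (\<Sum>i<n. act (v i) (k i))) \<and>
  (ALL k. (ALL i<n. k i : D) --> (\<Sum>i<n. act (v i) (k i)) = 0 --> (ALL i<n. k i = 0))"
proof -
 define ind where "ind n v \<longleftrightarrow> (ALL i<n. v i : M) \<and>
  (ALL k. (ALL i<n. k i : D) --> (\<Sum>i<n. act (v i) (k i)) = 0 --> (ALL i<n. k i = 0))" for n :: nat and v :: "nat => 'm"
 obtain N :: nat where N: "ALL v. (ALL i<=N. v i : M) -->
   (EX c. (ALL i<=N. c i : D) \<and> (EX i<=N. c i ~= 0) \<and> (\<Sum>i\<le>N. act (v i) (c i)) = 0)"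
  using assms unfolding finite_dim_def by (elim exE) (rule that)
 have bound: "n \<le> N" if i: "ind n v" for n v
 proof (rule ccontr)
  assume "\<not> n \<le> N"
  then have n: "N < n" by simp
  then have "ALL i<=N. v i : M" using i unfolding ind_def by auto
  then have "EX c. (ALL i<=N. c i : D) \<and> (EX i<=N. c i ~= 0) \<and> (\<Sum>i\<le>N. act (v i) (c i)) = 0"
   by (rule mp[OF spec[OF N]])
  then obtain c where c: "ALL i<=N. c i : D" "EX i<=N. c i ~= 0" "(\<Sum>i\<le>N. act (v i) (c i)) = 0"
   by - (erule exE, erule conjE, erule conjE, rule that; assumption)
  define k where "k i = (if i \<le> N then c i else 0)" for i
  have "(\<Sum>i<n. act (v i) (k i)) = (\<Sum>i\<le>N. act (v i) (c i))"
   using n i act_zero unfolding ind_def by (intro sum.mono_neutral_cong_right) (auto simp: k_def)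
  moreover have "ALL i<n. k i : D" using c(1) zero_closed by (simp add: k_def)
  ultimately have "ALL i<n. k i = 0" using i c(3) unfolding ind_def by simp
  then show False using c(2) n by (auto simp: k_def split: if_splits)
 qed
 have "ind 0 v" for v by (simp add: ind_def)
 then have ex: "EX v. ind 0 v" by blast
 obtain n where n: "EX v. ind n v" "!!m. EX v. ind m v ==> m \<le> n"
 proof -
  have "EX n. (EX v. ind n v) \<and> (ALL m. (EX v. ind m v) --> m \<le> n)"
   by (rule ex_has_greatest_nat[of "\<lambda>n. EX v. ind n v" 0 "\<lambda>n. n" "Suc N"]) (use ex bound le_imp_less_Suc in blast)+
  then show ?thesis using that by blast
 qed
 obtain v where v: "ind n v" using n(1) by blast
 have "EX k. (ALL i<n. k i : D) \<and> x = (\<Sum>i<n. act (v i) (k i))" if x: "x : M" for x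
 proof -
  have "\<not> ind (Suc n) (v(n := x))" using n(2)[of "Suc n"] by auto
  moreover have "ALL i<Suc n. (v(n := x)) i : M" using v x unfolding ind_def by (auto simp: less_Suc_eq)
  ultimately have "\<not> (ALL k. (ALL i<Suc n. k i : D) --> (\<Sum>i<Suc n. act ((v(n := x)) i) (k i)) = 0 --> (ALL i<Suc n. k i = 0))"
   unfolding ind_def by argo
  then obtain k where k: "ALL i<Suc n. k i : D" "(\<Sum>i<Suc n. act ((v(n := x)) i) (k i)) = 0"
   "EX i<Suc n. k i ~= 0" by (elim not_all[THEN iffD1, elim_format] exE) (use that in blast)
  have s: "(\<Sum>i<n. act (v i) (k i)) + act x (k n) = 0" using k(2) by simp
  have nz: "k n ~= 0"
  proof
   assume z: "k n = 0"
   then have "(\<Sum>i<n. act (v i) (k i)) = 0" using s act_zero[OF x] by simp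
   then have "ALL i<n. k i = 0" using v k(1) unfolding ind_def by simp
   then show False using k(3) z by (auto simp: less_Suc_eq)
  qed
  have kn: "k n : D" using k(1) by simp
  have d: "dinv (k n) : D" "k n * dinv (k n) = e" using dinv_closed dinv_right kn nz by auto
  have vM: "v i : M" if "i < n" for i using v that unfolding ind_def by auto
  have "act x (k n) = - (\<Sum>i<n. act (v i) (k i))"
   unfolding eq_neg_iff_add_eq_0 using s by (subst add.commute)
  also have "\<dots> = (\<Sum>i<n. act (v i) (- k i))"
   using vM k(1) by (subst sum_negf[symmetric]) (intro sum.cong, auto simp: act_neg)
  finally have "act x (k n) = (\<Sum>i<n. act (v i) (- k i))" .
  then have "act (act x (k n)) (dinv (k n)) = act (\<Sum>i<n. act (v i) (- k i)) (dinv (k n))" by simp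
  also have "\<dots> = (\<Sum>i<n. act (act (v i) (- k i)) (dinv (k n)))"
   using vM k(1) d neg_closed by (intro act_sum M_act) auto
  finally have "act (act x (k n)) (dinv (k n)) = (\<Sum>i<n. act (act (v i) (- k i)) (dinv (k n)))" .
  then have "x = (\<Sum>i<n. act (v i) (- k i * dinv (k n)))"
   using x kn d vM k(1) neg_closed act_e by (simp add: act_act)
  then show ?thesis using k(1) d neg_closed mult_closed by (intro exI[of _ "\<lambda>i. - k i * dinv (k n)"]) simp
 qed
 then show ?thesis using v unfolding ind_def by blast
qed

end

section \<open>Division algebras with involution and maximal commuting sets of symmetric
  elements\<close>

locale div_alg = star_div D e \<sigma> for D :: "'a::ring_1 set" and e \<sigma> +
 fixes scale :: "'f::field => 'a => 'a"
 assumes sc_add: "scale c (x + y) = scale c x + scale c y" and sc_plus: "scale (c + d) x = scale c x + scale d x"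
  and sc_sc: "scale c (scale d x) = scale (c * d) x" and sc_one: "scale 1 x = x"
  and sc_left: "scale c x * y = scale c (x * y)" and sc_right: "x * scale c y = scale c (x * y)"
  and sc_D: "x : D ==> scale c x : D" and sc_star: "\<sigma> (scale c x) = scale c (\<sigma> x)"
  and centre: "z : D ==> (!!d. d : D ==> z * d = d * z) ==> \<sigma> z = z ==> EX c. z = scale c e"
  and D_span: "EX (I::nat set) b. smod.spanning (UNIV :: 'f set) D (\<lambda>v c. scale c v) I b"
begin

lemma scale_zero: "scale 0 x = 0" "scale c 0 = 0"
 using sc_plus[of 0 0 x] sc_add[of c 0 0] by simp_all

lemma scale_neg: "scale (- c) x = - scale c x" "scale c (- x) = - scale c x"
 using sc_plus[of c "- c" x] sc_add[of c x "- x"] scale_zero by (simp_all add: eq_neg_iff_add_eq_0 add.commute)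

lemma scale_sum: "scale c (\<Sum>i\<in>I. f i) = (\<Sum>i\<in>I. scale c (f i))"
 by (induction I rule: infinite_finite_induct) (auto simp: sc_add scale_zero)

lemma scale_eq_0: assumes "scale c x = 0" "x ~= 0" shows "c = 0"
proof (rule ccontr)
 assume "c ~= 0"
 then have "x = scale (inverse c) (scale c x)" by (simp add: sc_sc sc_one)
 then show False using assms scale_zero by simp
qed

lemma scale_e: "x : D ==> scale c e * x = scale c x" "x : D ==> x * scale c e = scale c x"
 by (simp_all add: sc_left sc_right e_left e_right)

lemma scale_cunits: "c ~= 0 ==> scale c e : cunits"
 using scale_eq_0[of c e] e_closed e_nz sc_D by (auto simp: cunits_def sc_star star_e scale_e intro!: symuI)

lemma scale_inj: "scale c e = scale d e ==> c = d"
 using scale_eq_0[of "c - d" e] sc_plus[of c "- d" e] e_nz by (simp add: scale_neg)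

lemma two_F: "(1::'f) + 1 ~= 0"
 using two_nz sc_plus[of 1 1 e] scale_zero by (auto simp: sc_one)

sublocale Fs: star_div "UNIV :: 'f set" 1 id
 using two_F by unfold_locales (auto simp: involution_def mult.commute intro: exI[of _ "inverse _"] right_inverse)

sublocale DF: smod "UNIV :: 'f set" 1 id D "\<lambda>v c. scale c v"
 by unfold_locales (auto simp: zero_closed add_closed sc_D sc_add sc_plus sc_sc sc_one mult.commute)

text \<open>Commutators with elements of \<open>D\<close> shorten a relation, so a minimal one has central coefficients;
 its symmetric part is then a linear relation over the base field.\<close>

lemma dedekind:
 assumes "finite I" and b: "!!i. i : I ==> b i : D" "!!i. i : I ==> \<sigma> (b i) = b i"
  and ind: "!!k. (\<Sum>i\<in>I. scale (k i) (b i)) = 0 ==> (ALL i:I. k i = 0)"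
  and a: "!!i. i : I ==> a i : D" and rel: "!!x. x : D ==> (\<Sum>i\<in>I. a i * x * b i) = 0"
 shows "ALL i:I. a i = 0"
 using a rel
proof (induction "card {i : I. a i ~= 0}" arbitrary: a rule: less_induct)
 case less
 show ?case
 proof (rule ccontr)
  assume "\<not> (ALL i:I. a i = 0)"
  then obtain p where p: "p : I" "a p ~= 0" by auto
  define c where "c i = dinv (a p) * a i" for i
  have q: "dinv (a p) : D" "dinv (a p) * a p = e" "dinv (a p) ~= 0"
   using less.prems(1) p dinv_closed dinv_left dinv_nz by auto
  have cD: "c i : D" if "i : I" for i using that q less.prems(1) mult_closed by (simp add: c_def)
  have cp: "c p = e" using q by (simp add: c_def)
  have rc: "(\<Sum>i\<in>I. c i * x * b i) = 0" if "x : D" for x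
  proof -
   have "(\<Sum>i\<in>I. c i * x * b i) = dinv (a p) * (\<Sum>i\<in>I. a i * x * b i)" by (simp add: c_def sum_distrib_left mult.assoc)
   then show ?thesis using less.prems(2)[OF that] by simp
  qed
  have comm: "c i * d = d * c i" if i: "i : I" and d: "d : D" for i d
  proof -
   define k where "k i = c i * d - d * c i" for i
   have "{i : I. k i ~= 0} \<subset> {i : I. a i ~= 0}"
   proof
    show "{i : I. k i ~= 0} \<subseteq> {i : I. a i ~= 0}" by (auto simp: k_def c_def)
    have "k p = 0" using cp d by (simp add: k_def e_left e_right)
    then show "{i : I. k i ~= 0} ~= {i : I. a i ~= 0}" using p by auto
   qed
   then have "card {i : I. k i ~= 0} < card {i : I. a i ~= 0}" using assms(1) by (intro psubset_card_mono) auto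
   moreover have "k i : D" if "i : I" for i using cD[OF that] d mult_closed diff_closed by (simp add: k_def)
   moreover have "(\<Sum>i\<in>I. k i * x * b i) = 0" if x: "x : D" for x
   proof -
    have "(\<Sum>i\<in>I. k i * x * b i) = (\<Sum>i\<in>I. c i * (d * x) * b i) - d * (\<Sum>i\<in>I. c i * x * b i)"
     by (simp add: k_def left_diff_distrib sum_subtractf sum_distrib_left mult.assoc)
    then show ?thesis using rc x mult_closed[OF d x] by simp
   qed
   ultimately have "ALL i:I. k i = 0" by (rule less.hyps)
   then show ?thesis using i by (simp add: k_def)
  qed
  \<comment> \<open>The coefficients are central but perhaps not symmetric; adding their stars
    yields scalars, and the normalisation \<open>c p = e\<close> makes the one at \<open>p\<close>
    equal to twice \<open>e\<close>.\<close>
  have ss: "EX k. c i + \<sigma> (c i) = scale k e" if i: "i : I" for i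
  proof (rule centre)
   show "c i + \<sigma> (c i) : D" using cD[OF i] star_closed add_closed by simp
   show "\<sigma> (c i + \<sigma> (c i)) = c i + \<sigma> (c i)" by (simp add: star_add add.commute)
   fix d assume d: "d : D"
   have "\<sigma> (c i * \<sigma> d) = \<sigma> (\<sigma> d * c i)" using comm[OF i star_closed[OF d]] by simp
   then have "d * \<sigma> (c i) = \<sigma> (c i) * d" by (simp add: star_mult)
   then show "(c i + \<sigma> (c i)) * d = d * (c i + \<sigma> (c i))" using comm[OF i d] by (simp add: distrib_left distrib_right)
  qed
  then have "ALL i:I. EX k. c i + \<sigma> (c i) = scale k e" by blast
  from bchoice[OF this] obtain k where k: "!!i. i : I ==> c i + \<sigma> (c i) = scale (k i) e" by blast
  have s1: "(\<Sum>i\<in>I. c i * b i) = 0" using rc[OF e_closed] cD by (simp add: e_right)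
  then have "\<sigma> (\<Sum>i\<in>I. c i * b i) = 0" by simp
  then have s2: "(\<Sum>i\<in>I. \<sigma> (c i) * b i) = 0"
  proof -
   have "\<sigma> (\<Sum>i\<in>I. c i * b i) = (\<Sum>i\<in>I. \<sigma> (c i) * b i)" unfolding star_sum
   proof (intro sum.cong refl)
    fix i assume i: "i : I"
    have "\<sigma> (c i * \<sigma> (b i)) = \<sigma> (\<sigma> (b i) * c i)" using comm[OF i star_closed[OF b(1)[OF i]]] by simp
    then show "\<sigma> (c i * b i) = \<sigma> (c i) * b i" using b(2)[OF i] by (simp add: star_mult)
   qed
   then show ?thesis using \<open>\<sigma> (\<Sum>i\<in>I. c i * b i) = 0\<close> by simp
  qed
  have "(\<Sum>i\<in>I. scale (k i) (b i)) = (\<Sum>i\<in>I. c i * b i) + (\<Sum>i\<in>I. \<sigma> (c i) * b i)"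
   unfolding sum.distrib[symmetric] using k b(1) by (intro sum.cong) (auto simp: distrib_right[symmetric] scale_e)
  then have "k p = 0" using ind s1 s2 p by simp
  then have "e + e = 0" using k[OF p(1)] cp by (simp add: scale_zero star_e)
  then show False using two_nz by simp
 qed
qed

end

text \<open>\<open>E\<close> is maximal among commuting sets of symmetric elements, not among all
  subfields.\<close>

locale max_comm = div_alg D e \<sigma> scale for D :: "'a::ring_1 set" and e \<sigma> and scale :: "'f::field => 'a => 'a" +
 fixes E :: "'a set"
 assumes E_D: "x : E ==> x : D" and E_sym: "x : E ==> \<sigma> x = x" and E_comm: "x : E ==> y : E ==> x * y = y * x"
  and E_max: "x : D ==> \<sigma> x = x ==> (!!y. y : E ==> x * y = y * x) ==> x : E"
begin

lemma e_E: "e : E"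
 using e_closed star_e E_D by (intro E_max) (auto simp: e_left e_right)

sublocale E: sfield E e \<sigma>
proof
 fix x y
 show "involution \<sigma>" by (rule inv)
 show "x + y : E" if "x : E" "y : E"
  using that E_D E_sym E_comm add_closed by (intro E_max) (auto simp: star_add distrib_left distrib_right)
 show "- x : E" if "x : E"
  using that E_D E_sym E_comm neg_closed by (intro E_max) (auto simp: star_neg)
 show "x * y : E" if xy: "x : E" "y : E"
 proof (rule E_max)
  show "x * y : D" using xy E_D mult_closed by simp
  show "\<sigma> (x * y) = x * y" using xy E_sym E_comm by (simp add: star_mult)
  fix z assume "z : E"
  then show "x * y * z = z * (x * y)" using xy E_comm by (metis mult.assoc)
 qed
 show "e : E" "e ~= 0" "e + e ~= 0" using e_E e_nz two_nz by auto
 show "x : E ==> e * x = x" "x : E ==> x * e = x" using E_D e_left e_right by auto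
 show "EX y:E. x * y = e \<and> y * x = e" if x: "x : E" "x ~= 0"
 proof (intro bexI conjI)
  have xD: "x : D" using x E_D by simp
  have d: "dinv x : D" "x * dinv x = e" "dinv x * x = e" using dinv_closed dinv_right dinv_left xD x(2) by auto
  then show "x * dinv x = e" "dinv x * x = e" by auto
  show "dinv x : E"
  proof (rule E_max[OF d(1)])
   show "\<sigma> (dinv x) = dinv x" using star_dinv[OF xD x(2)] E_sym[OF x(1)] by simp
   fix y assume y: "y : E"
   have "dinv x * y = dinv x * y * (x * dinv x)" using d E_D[OF y] mult_closed e_right by simp
   also have "\<dots> = dinv x * (y * x) * dinv x" by (simp only: mult.assoc)
   also have "\<dots> = dinv x * x * (y * dinv x)" unfolding E_comm[OF y x(1)] by (simp only: mult.assoc)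
   also have "\<dots> = y * dinv x" using d E_D[OF y] mult_closed e_left by simp
   finally show "dinv x * y = y * dinv x" .
  qed
 qed
 show "x : E ==> \<sigma> x : E" "x : E ==> \<sigma> x = x" using E_sym by auto
qed

lemma scale_E: "x : E ==> scale c x : E"
 using E_D E_sym E_comm sc_D by (intro E_max) (auto simp: sc_star sc_left sc_right)

sublocale EF: smod "UNIV :: 'f set" 1 id E "\<lambda>v c. scale c v"
 by unfold_locales (auto simp: E.zero_closed E.add_closed scale_E sc_add sc_plus sc_sc sc_one mult.commute)

lemma E_basis:
 obtains n v where "ALL i<n. v i : E" "ALL x:E. EX k. x = (\<Sum>i<n. scale (k i) (v (i::nat)))"
  "ALL k. (\<Sum>i<n. scale (k i) (v i)) = 0 --> (ALL i<n. k i = 0)"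
proof -
 obtain I :: "nat set" and b where sp: "DF.spanning I b" using D_span by auto
 have "EF.finite_dim" unfolding EF.finite_dim_def
 proof (intro exI[of _ "card I"] allI impI)
  fix v :: "nat => 'a" assume v: "ALL i<=card I. v i : E"
  have "EX c. (ALL j:{..card I}. c j : UNIV) \<and> (EX j:{..card I}. c j ~= (0::'f)) \<and> (\<Sum>j\<in>{..card I}. scale (c j) (v j)) = 0"
   by (rule DF.spanning_dependent[OF sp]) (use v E_D in auto)
  then show "EX c. (ALL i<=card I. c i : UNIV) \<and> (EX i<=card I. c i ~= (0::'f)) \<and> (\<Sum>i\<le>card I. scale (c i) (v i)) = 0"
   by (auto simp: Bex_def)
 qed
 from EF.ex_independent_basis[OF this] show ?thesis using that by auto
qed

lemma E_span: "EX (I::nat set) b. EF.spanning I b"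
proof -
 obtain n v where v: "ALL i<n. v i : E" "ALL x:E. EX k. x = (\<Sum>i<n. scale (k i) (v (i::nat)))"
  by (rule E_basis)
 then have "EF.spanning {..<n} v" unfolding EF.spanning_def by auto
 then show ?thesis by blast
qed

lemma ex_functional:
 "EX L :: 'a => 'f. (ALL x:E. ALL y:E. L (x + y) = L x + L y) \<and> (ALL x:E. ALL c. L (scale c x) = c * L x) \<and> (EX x:E. L x ~= 0)"
proof -
 obtain n v where v': "ALL i<n. v i : E" "ALL x:E. EX k. x = (\<Sum>i<n. scale (k i) (v (i::nat)))"
  "ALL k. (\<Sum>i<n. scale (k i) (v i)) = 0 --> (ALL i<n. k i = 0)" by (rule E_basis)
 note v = v'(1)[rule_format] v'(2)[rule_format] v'(3)[rule_format]
 have uniq: "k i = l i" if "(\<Sum>i<n. scale (k i) (v i)) = (\<Sum>i<n. scale (l i) (v i))" "i < n" for k l i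
 proof -
  have "(\<Sum>i<n. scale (k i - l i) (v i)) = 0"
   using that(1) by (simp add: diff_conv_add_uminus sc_plus scale_neg sum.distrib sum_negf del: add_uminus_conv_diff)
  then show ?thesis using v(3)[of "\<lambda>i. k i - l i"] that(2) by simp
 qed
 have n: "0 < n"
 proof (rule ccontr)
  assume "\<not> 0 < n"
  then show False using v(2)[OF e_E] e_nz by simp
 qed
 define co where "co x = (SOME k. x = (\<Sum>i<n. scale (k i) (v i)))" for x
 have co: "x = (\<Sum>i<n. scale (co x i) (v i))" if "x : E" for x
  using someI_ex[OF v(2)[OF that]] unfolding co_def .
 define L where "L x = co x 0" for x
 have "L (x + y) = L x + L y" if "x : E" "y : E" for x y
 proof -
  have "(\<Sum>i<n. scale (co (x + y) i) (v i)) = x + y" using co[of "x + y"] that E.add_closed by simp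
  also have "\<dots> = (\<Sum>i<n. scale (co x i) (v i)) + (\<Sum>i<n. scale (co y i) (v i))" using co that by simp
  also have "\<dots> = (\<Sum>i<n. scale (co x i + co y i) (v i))" by (simp add: sc_plus sum.distrib)
  finally show ?thesis using uniq[of "co (x + y)" "\<lambda>i. co x i + co y i" 0] n by (simp add: L_def)
 qed
 moreover have "L (scale c x) = c * L x" if "x : E" for c x
 proof -
  have "(\<Sum>i<n. scale (co (scale c x) i) (v i)) = scale c x" using co[of "scale c x"] that scale_E by simp
  also have "\<dots> = scale c (\<Sum>i<n. scale (co x i) (v i))" using co[OF that] by simp
  also have "\<dots> = (\<Sum>i<n. scale (c * co x i) (v i))" by (simp only: scale_sum sc_sc)
  finally show ?thesis using uniq[of "co (scale c x)" "\<lambda>i. c * co x i" 0] n by (simp add: L_def)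
 qed
 moreover have "L (v 0) ~= 0"
 proof -
  have "(\<Sum>i<n. scale (co (v 0) i) (v i)) = v 0" using co[OF v(1)[OF n]] by simp
  also have "\<dots> = (\<Sum>i<n. scale (if i = 0 then 1 else 0) (v i))"
  proof -
   have "(\<Sum>i<n. scale (if i = 0 then 1 else 0) (v i)) = (\<Sum>i<n. if i = 0 then v 0 else 0)"
    by (intro sum.cong) (auto simp: sc_one scale_zero)
   then show ?thesis using n by simp
  qed
  finally show ?thesis using uniq[of "co (v 0)" "\<lambda>i. if i = 0 then 1 else 0" 0] n by (simp add: L_def)
 qed
 ultimately show ?thesis using v(1)[OF n] by blast
qed

text \<open>Maximality puts every symmetric element of the centraliser into \<open>E\<close>; an
  ordering of \<open>E\<close> therefore decides the sign of every symmetric element of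
  \<open>C\<close>.\<close>

definition C :: "'a set" where "C = {c : D. ALL y:E. c * y = y * c}"

lemma C_D: "c : C ==> c : D" and C_comm: "c : C ==> y : E ==> c * y = y * c" and E_C: "y : E ==> y : C"
 and C_sym: "c : C ==> \<sigma> c = c ==> c : E"
 using E_D E_comm by (auto simp: C_def intro: E_max)

lemma C_star: assumes "c : C" shows "\<sigma> c : C"
proof -
 have "\<sigma> c * y = y * \<sigma> c" if "y : E" for y
 proof -
  have "\<sigma> (c * y) = \<sigma> (y * c)" using C_comm[OF assms that] by simp
  then show ?thesis using E_sym[OF that] by (simp add: star_mult)
 qed
 then show ?thesis using assms star_closed by (auto simp: C_def)
qed

sublocale C: star_div C e \<sigma>
proof
 fix x y
 show "involution \<sigma>" by (rule inv)
 show "x : C ==> y : C ==> x + y : C" by (auto simp: C_def add_closed distrib_left distrib_right)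
 show "x : C ==> - x : C" by (auto simp: C_def neg_closed)
 show "x * y : C" if xy: "x : C" "y : C"
 proof -
  have "x * y * z = z * (x * y)" if "z : E" for z using C_comm[OF xy(1) that] C_comm[OF xy(2) that] by (metis mult.assoc)
  then show ?thesis using xy by (auto simp: C_def mult_closed)
 qed
 show "e : C" "e ~= 0" "e + e ~= 0" using e_E E_C e_nz two_nz by auto
 show "x : C ==> e * x = x" "x : C ==> x * e = x" using C_D e_left e_right by auto
 show "x : C ==> \<sigma> x : C" by (rule C_star)
 show "EX y:C. x * y = e \<and> y * x = e" if x: "x : C" "x ~= 0"
 proof (intro bexI conjI)
  have d: "dinv x : D" "x * dinv x = e" "dinv x * x = e" using dinv_closed dinv_right dinv_left C_D[OF x(1)] x(2) by auto
  then show "x * dinv x = e" "dinv x * x = e" by auto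
  have "dinv x * y = y * dinv x" if y: "y : E" for y
  proof -
   have "dinv x * y = dinv x * y * (x * dinv x)" using d E_D[OF y] mult_closed e_right by simp
   also have "\<dots> = dinv x * (y * x) * dinv x" by (simp only: mult.assoc)
   also have "\<dots> = dinv x * x * (y * dinv x)" unfolding C_comm[OF x(1) y, symmetric] by (simp only: mult.assoc)
   also have "\<dots> = y * dinv x" using d E_D[OF y] mult_closed e_left by simp
   finally show ?thesis .
  qed
  then show "dinv x : C" using d by (simp add: C_def)
 qed
qed

end

section \<open>Signatures at an ordering of a maximal commutative subfield\<close>

text \<open>The condition \<open>norm_L\<close> lets an ordering of \<open>E\<close> serve as a cone
  for the possibly noncommutative \<open>C\<close>; \<open>v\<close> is an orthogonal basis of
  \<open>E\<close> for the form \<open>L (x * y)\<close>.\<close>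

locale cent_form = max_comm D e \<sigma> scale E
 for D :: "'a::ring_1 set" and e \<sigma> and scale :: "'f::field => 'a => 'a" and E +
 fixes T :: "'f set" and \<P> :: "'a set" and L :: "'a => 'f" and I :: "nat set" and v :: "nat => 'a"
 assumes ordT: "ordering_on (UNIV :: 'f set) T" and ordL: "ordering_on E \<P>"
  and T_L: "c : T ==> scale c e : \<P>" and norm_L: "d : C ==> \<sigma> d * d : \<P>"
  and L_add: "x : E ==> y : E ==> L (x + y) = L x + L y" and L_scale: "x : E ==> L (scale c x) = c * L x"
  and L_nz: "EX x:E. L x ~= 0"
  and v_fin: "finite I" and v_E: "i : I ==> v i : E" and v_nz: "i : I ==> L (v i * v i) ~= 0"
  and v_orth: "i : I ==> j : I ==> i ~= j ==> L (v i * v j) = 0"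
  and v_expand: "x : E ==> x = (\<Sum>i\<in>I. scale (inverse (L (v i * v i)) * L (v i * x)) (v i))"
begin

lemma T_rules: "x : T ==> y : T ==> x + y : T" "x : T ==> y : T ==> x * y : T" "x : T \<or> - x : T"
  "x : T ==> - x : T ==> x = 0"
 using ordT unfolding ordering_on_def by blast+

lemma L_rules: "\<P> \<subseteq> E" "x : \<P> ==> y : \<P> ==> x + y : \<P>" "x : \<P> ==> y : \<P> ==> x * y : \<P>" "x : E ==> x : \<P> \<or> - x : \<P>"
  "x : \<P> ==> - x : \<P> ==> x = 0"
 using ordL unfolding ordering_on_def by blast+

sublocale X: transfer E e \<sigma> scale L T
 by unfold_locales (use sc_add sc_plus sc_sc sc_one sc_left sc_right scale_E ordering_char0[OF ordT] E_span L_add L_scale L_nz ordT in auto)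

sublocale C: star_cone C e \<sigma> \<P>
proof
 fix x y c
 show "x : \<P> ==> x : C" "x : \<P> ==> \<sigma> x = x" using L_rules(1) E_C E_sym by auto
 show "x : \<P> ==> y : \<P> ==> x + y : \<P>" "x : \<P> ==> - x : \<P> ==> x = 0" by (fact L_rules)+
 show "x : C ==> \<sigma> x = x ==> x : \<P> \<or> - x : \<P>" using C_sym L_rules(4) by blast
 show "\<sigma> c * x * c : \<P>" if x: "x : \<P>" and c: "c : C"
 proof -
  have "x * c = c * x" using C_comm[OF c] x L_rules(1) by auto
  then have "\<sigma> c * x * c = \<sigma> c * c * x" by (simp add: mult.assoc)
  then show ?thesis using L_rules(3)[OF norm_L[OF c] x] by simp
 qed
qed

definition d :: "nat => 'f" where "d i = inverse (L (v i * v i))"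

lemma d_nz: "i : I ==> d i ~= 0"
 using v_nz by (simp add: d_def)

lemma v_D: "i : I ==> v i : D" and v_sym: "i : I ==> \<sigma> (v i) = v i"
 using v_E E_D E_sym by auto

lemma v_indep: assumes "(\<Sum>i\<in>I. scale (k i) (v i)) = 0" shows "ALL i:I. k i = 0"
proof
 fix j assume j: "j : I"
 have "0 = L (\<Sum>i\<in>I. scale (k i) (v i * v j))"
  using arg_cong[OF assms, of "\<lambda>x. L (x * v j)"] L_scale[of 0 0] E.zero_closed by (simp add: sum_distrib_right sc_left scale_zero)
 also have "\<dots> = (\<Sum>i\<in>I. k i * L (v i * v j))"
  using v_E j by (subst X.f_sum) (auto simp: scale_E E.mult_closed L_scale)
 also have "\<dots> = (\<Sum>i\<in>{j}. k i * L (v i * v j))"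
  using v_orth j v_fin by (intro sum.mono_neutral_right) auto
 finally show "k j = 0" using v_nz[OF j] by simp
qed

lemma I_ne: "I ~= {}"
 using v_expand[OF e_E] e_nz by auto

text \<open>The Casimir element of \<open>E\<close> for \<open>L\<close>, with \<open>x\<close>
  inserted between the dual bases \<open>v i\<close> and \<open>scale (d i) (v i)\<close>; its
  invariance under \<open>E\<close> puts the value into the centraliser.\<close>

definition pr :: "'a => 'a" where "pr x = (\<Sum>i\<in>I. scale (d i) (v i * x * v i))"

lemma pr_D: "x : D ==> pr x : D"
 unfolding pr_def using v_D by (intro sum_closed sc_D mult_closed) auto

lemma pr_C: assumes x: "x : D" shows "pr x : C"
proof -
 have "pr x * y = y * pr x" if y: "y : E" for y
 proof -
  have vy: "v i * y : E" "y * v i : E" if "i : I" for i using v_E[OF that] y E.mult_closed by auto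
  have m: "scale (d i) (v i * x * scale k w) = scale (d i * k) (v i * x * w)"
   "scale (d i) (scale k w * x * v i) = scale (d i * k) (w * x * v i)" for i k w
   by (simp_all add: sc_right sc_left sc_sc)
  have "pr x * y = (\<Sum>i\<in>I. scale (d i) (v i * x * (v i * y)))"
   by (simp add: pr_def sum_distrib_right sc_left mult.assoc)
  also have "\<dots> = (\<Sum>i\<in>I. \<Sum>j\<in>I. scale (d i * (d j * L (v j * (v i * y)))) (v i * x * v j))"
  proof (intro sum.cong refl)
   fix i assume i: "i : I"
   have "v i * x * (v i * y) = v i * x * (\<Sum>j\<in>I. scale (d j * L (v j * (v i * y))) (v j))"
    using v_expand[OF vy(1)[OF i]] unfolding d_def by simp
   then show "scale (d i) (v i * x * (v i * y)) = (\<Sum>j\<in>I. scale (d i * (d j * L (v j * (v i * y)))) (v i * x * v j))"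
    by (simp add: sum_distrib_left scale_sum m)
  qed
  also have "\<dots> = (\<Sum>j\<in>I. \<Sum>i\<in>I. scale (d i * (d j * L (v j * (v i * y)))) (v i * x * v j))" by (rule sum.swap)
  also have "\<dots> = (\<Sum>j\<in>I. scale (d j) (y * v j * x * v j))"
  proof (intro sum.cong refl)
   fix j assume j: "j : I"
   have "L (v j * (v i * y)) = L (v i * (y * v j))" if "i : I" for i
    using E.comm[OF v_E[OF j] vy(1)[OF that]] by (simp add: mult.assoc)
   then have "(\<Sum>i\<in>I. scale (d i * (d j * L (v j * (v i * y)))) (v i * x * v j))
     = (\<Sum>i\<in>I. scale (d j) (scale (d i * L (v i * (y * v j))) (v i) * x * v j))"
    by (intro sum.cong refl) (simp add: sc_left sc_sc ac_simps)
   also have "\<dots> = scale (d j) ((\<Sum>i\<in>I. scale (d i * L (v i * (y * v j))) (v i)) * x * v j)"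
    by (simp add: sum_distrib_right scale_sum)
   also have "(\<Sum>i\<in>I. scale (d i * L (v i * (y * v j))) (v i)) = y * v j"
    using v_expand[OF vy(2)[OF j]] unfolding d_def by simp
   finally show "(\<Sum>i\<in>I. scale (d i * (d j * L (v j * (v i * y)))) (v i * x * v j)) = scale (d j) (y * v j * x * v j)" .
  qed
  also have "\<dots> = y * pr x" by (simp add: pr_def sum_distrib_left sc_right mult.assoc)
  finally show ?thesis .
 qed
 then show ?thesis using pr_D[OF x] by (simp add: C_def)
qed

lemma pr_add: "pr (x + y) = pr x + pr y"
 by (simp add: pr_def distrib_left distrib_right sc_add sum.distrib)

lemma pr_right: assumes "c : C" shows "pr (x * c) = pr x * c"
 unfolding pr_def sum_distrib_right sc_left
 using C_comm[OF assms v_E] by (intro sum.cong) (auto simp: mult.assoc)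

lemma pr_star: "\<sigma> (pr x) = pr (\<sigma> x)"
 unfolding pr_def star_sum sc_star using v_sym by (intro sum.cong refl) (simp add: star_mult mult.assoc)

lemma pr_neg: "pr (- x) = - pr x"
 by (simp add: pr_def scale_neg sum_negf)

lemma pr_scale: "pr (scale c x) = scale c (pr x)"
 by (simp add: pr_def scale_sum sc_left sc_right sc_sc mult.commute)

text \<open>By \<open>dedekind\<close>, a sum of maps \<open>x \<mapsto> a i * x * v i\<close> with
  independent symmetric \<open>v i\<close> vanishes identically only if all \<open>a i\<close>
  do.\<close>

lemma pr_nz: "EX x:D. pr x ~= 0"
proof (rule ccontr)
 assume n: "\<not> ?thesis"
 have "ALL i:I. scale (d i) (v i) = 0"
 proof (rule dedekind[OF v_fin v_D v_sym v_indep])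
  show "!!i. i : I ==> scale (d i) (v i) : D" using sc_D v_D by simp
  show "(\<Sum>i\<in>I. scale (d i) (v i) * x * v i) = 0" if "x : D" for x
   using n that by (simp add: pr_def sc_left)
 qed auto
 moreover obtain i where i: "i : I" using I_ne by auto
 moreover have "v i ~= 0"
 proof
  assume "v i = 0"
  then show False using v_nz[OF i] L_scale[of 0 0] E.zero_closed by (simp add: scale_zero)
 qed
 ultimately show False using scale_eq_0 d_nz by blast
qed

lemma D_spanning_C:
 assumes "DF.spanning (J :: nat set) u" "x : D"
 shows "EX k. (ALL i:J. k i : C) \<and> x = (\<Sum>i\<in>J. u i * k i)"
proof -
 have uD: "!!i. i : J ==> u i : D" using assms(1) unfolding DF.spanning_def by auto
 obtain k where "x = (\<Sum>i\<in>J. scale (k i) (u i))" using assms unfolding DF.spanning_def by blast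
 then have "x = (\<Sum>i\<in>J. u i * scale (k i) e)" using uD scale_e(2) by simp
 moreover have "scale c e : C" for c using scale_E[OF e_E] E_C by blast
 ultimately show ?thesis by (intro exI[of _ "\<lambda>i. scale (k i) e"]) simp
qed

lemma spanning_mult:
 assumes M: "smod D e \<sigma> M act" and w: "smod.spanning D M act (J :: 'j set) w"
  and u: "!!j. j : J ==> finite (Q j :: 'k set)" "!!j i. j : J ==> i : Q j ==> u j i : D"
   "!!j x. j : J ==> x : D ==> EX c. (ALL i:Q j. c i : C) \<and> x = (\<Sum>i\<in>Q j. u j i * c i)"
 shows "smod.spanning C M act (SIGMA j:J. Q j) (\<lambda>(j, i). act (w j) (u j i))"
proof -
 interpret smod D e \<sigma> M act by fact
 interpret P: smod C e \<sigma> M act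
  by unfold_locales (use M_zero M_add M_act act_add act_plus act_act act_e C_D in auto)
 have ow: "finite J" "!!j. j : J ==> w j : M" using w unfolding spanning_def by auto
 show ?thesis
  unfolding P.spanning_def
 proof (intro conjI ballI)
  show "finite (SIGMA j:J. Q j)" using ow(1) u(1) by auto
  show "!!p. p : (SIGMA j:J. Q j) ==> (case p of (j, i) => act (w j) (u j i)) : M" using ow u(2) M_act by auto
  fix x assume "x : M"
  then obtain k where k: "ALL j:J. k j : D" "x = (\<Sum>j\<in>J. act (w j) (k j))"
   using w unfolding spanning_def by blast
  have "ALL j:J. EX c. (ALL i:Q j. c i : C) \<and> k j = (\<Sum>i\<in>Q j. u j i * c i)" using u(3) k(1) by blast
  from bchoice[OF this] obtain c where c: "!!j i. j : J ==> i : Q j ==> c j i : C"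
   "!!j. j : J ==> k j = (\<Sum>i\<in>Q j. u j i * c j i)" by blast
  have "x = (\<Sum>j\<in>J. \<Sum>i\<in>Q j. act (act (w j) (u j i)) (c j i))"
   unfolding k(2)
  proof (intro sum.cong refl)
   fix j assume j: "j : J"
   have "act (w j) (k j) = (\<Sum>i\<in>Q j. act (w j) (u j i * c j i))"
    unfolding c(2)[OF j] using c(1)[OF j] C_D u(2) ow j by (intro act_sum_right mult_closed) auto
   then show "act (w j) (k j) = (\<Sum>i\<in>Q j. act (act (w j) (u j i)) (c j i))"
    using c(1)[OF j] C_D u(2)[OF j] ow(2)[OF j] by (simp add: act_act)
  qed
  also have "\<dots> = (\<Sum>(j, i)\<in>(SIGMA j:J. Q j). act (act (w j) (u j i)) (c j i))"
   using ow(1) u(1) by (intro sum.Sigma) auto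
  also have "\<dots> = (\<Sum>p\<in>(SIGMA j:J. Q j). act (case p of (j, i) => act (w j) (u j i)) (c (fst p) (snd p)))"
   by (intro sum.cong) auto
  finally show "EX k. (ALL p:(SIGMA j:J. Q j). k p : C) \<and>
    x = (\<Sum>p\<in>(SIGMA j:J. Q j). act (case p of (j, i) => act (w j) (u j i)) (k p))"
   using c(1) by (intro exI[of _ "\<lambda>p. c (fst p) (snd p)"]) auto
 qed
qed

text \<open>A nonzero value \<open>h x w\<close> can be moved to any element of \<open>D\<close> by
  scaling \<open>w\<close>, so nondegeneracy over \<open>C\<close> follows from \<open>pr\<close>
  not being identically zero.\<close>

lemma push_herm:
 assumes "herm D e \<sigma> M act h"
 shows "herm_cone C e \<sigma> \<P> M act (\<lambda>x y. pr (h x y))"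
proof -
 interpret herm D e \<sigma> M act h by fact
 interpret P: smod C e \<sigma> M act
  by unfold_locales (use M_zero M_add M_act act_add act_plus act_act act_e C_D in auto)
 have "herm C e \<sigma> M act (\<lambda>x y. pr (h x y))"
 proof
  fix u x y c
  show "x : M ==> y : M ==> pr (h x y) : C" by (rule pr_C[OF h_closed])
  show "u : M ==> x : M ==> y : M ==> pr (h u (x + y)) = pr (h u x) + pr (h u y)"
   by (simp add: h_add pr_add)
  show "x : M ==> y : M ==> c : C ==> pr (h x (act y c)) = pr (h x y) * c"
   using C_D by (simp add: h_act pr_right)
  show "x : M ==> y : M ==> \<sigma> (pr (h x y)) = pr (h y x)" by (simp add: pr_star h_star)
  show "x = 0" if x: "x : M" and z: "!!w. w : M ==> pr (h x w) = 0"
  proof (rule ccontr)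
   assume "x ~= 0"
   then obtain w where w: "w : M" "h x w ~= 0" using nondeg[OF x] by blast
   obtain y where y: "y : D" "pr y ~= 0" using pr_nz by auto
   have hd: "h x w : D" using h_closed x w by simp
   have "h x (act w (dinv (h x w) * y)) = h x w * (dinv (h x w) * y)"
    using x w y hd dinv_closed mult_closed by (intro h_act) auto
   also have "\<dots> = y" using dinv_right[OF hd w(2)] e_left[OF y(1)] by (simp flip: mult.assoc)
   finally show False using z[OF M_act[OF w(1) mult_closed[OF dinv_closed[OF hd w(2)] y(1)]]] y(2) by simp
  qed
 next
  obtain J :: "nat set" and w where w: "basis J w" using ex_basis by auto
  obtain Q :: "nat set" and u where u: "DF.spanning Q u" using D_span by auto
  have uD: "!!i. i : Q ==> u i : D" and Q: "finite Q" using u unfolding DF.spanning_def by auto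
  have "P.spanning (J \<times> Q) (\<lambda>(j, i). act (w j) (u i))"
   using uD Q D_spanning_C[OF u] by (intro spanning_mult smod_axioms basis_spanning[OF w]) auto
  then show P.finite_dim by (rule P.spanning_finite_dim)
 qed
 then show ?thesis by (intro herm_cone.intro C.star_cone_axioms)
qed

lemma one_dim: assumes a: "a : symu" shows "herm D e \<sigma> D (*) (\<lambda>x y. \<sigma> x * a * y)"
proof -
 have aD: "a : D" "\<sigma> a = a" "a ~= 0" using a symu by auto
 interpret smod D e \<sigma> D "(*)"
  by unfold_locales (auto simp: zero_closed add_closed mult_closed distrib_left distrib_right mult.assoc e_right)
 show ?thesis
 proof
  fix u x y c
  show "x : D ==> y : D ==> \<sigma> x * a * y : D" using aD star_closed mult_closed by simp
  show "\<sigma> u * a * (x + y) = \<sigma> u * a * x + \<sigma> u * a * y" by (simp add: distrib_left)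
  show "\<sigma> x * a * (y * c) = \<sigma> x * a * y * c" by (simp add: mult.assoc)
  show "\<sigma> (\<sigma> x * a * y) = \<sigma> y * a * x" using aD by (simp add: star_mult mult.assoc)
  show "x = 0" if x: "x : D" and z: "!!w. w : D ==> \<sigma> x * a * w = 0"
  proof -
   have "\<sigma> x * a = 0" using z[OF e_closed] e_right[OF mult_closed[OF star_closed[OF x] aD(1)]] by simp
   then have "\<sigma> x = 0" using no_zero_div[OF star_closed[OF x] aD(1)] aD(3) by blast
   then show ?thesis by simp
  qed
 next
  have "spanning {0::nat} (\<lambda>_. e)"
   unfolding spanning_def using e_closed e_left by (auto intro: exI[of _ "\<lambda>_. _"])
  then show finite_dim by (rule spanning_finite_dim)
 qed
qed

definition phi :: "'a => int" where
 "phi a = herm_cone.sig C e \<P> D (*) (\<lambda>x y. pr (\<sigma> x * a * y))"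

lemma phi_herm: "a : symu ==> herm_cone C e \<sigma> \<P> D (*) (\<lambda>x y. pr (\<sigma> x * a * y))"
 by (rule push_herm[OF one_dim])

text \<open>Over \<open>C\<close> each orthogonal line spanned by \<open>w j\<close> contributes the
  signature of the one-dimensional form with entry \<open>h (w j) (w j)\<close>. In particular the
  sum of \<open>phi\<close> over the diagonal entries does not depend on the
  diagonalisation.\<close>

lemma push_sig:
 assumes "herm D e \<sigma> M act h" "herm.basis D e M act h (J :: 'j set) w"
 shows "herm_cone.sig C e \<P> M act (\<lambda>x y. pr (h x y)) = (\<Sum>j\<in>J. phi (h (w j) (w j)))"
proof -
 interpret herm D e \<sigma> M act h by fact
 interpret P: herm_cone C e \<sigma> \<P> M act "\<lambda>x y. pr (h x y)" by (rule push_herm[OF assms(1)])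
 note ow = orthD[OF basis_orth[OF assms(2)]]
 have sy: "h (w j) (w j) : symu" if "j : J" for j using ow that by (intro symuI) auto
 have "ALL j:J. EX Qu. herm.basis C e D (*) (\<lambda>x y. pr (\<sigma> x * h (w j) (w j) * y)) (fst Qu :: nat set) (snd Qu)"
 proof
  fix j assume j: "j : J"
  interpret A: herm_cone C e \<sigma> \<P> D "(*)" "\<lambda>x y. pr (\<sigma> x * h (w j) (w j) * y)" by (rule phi_herm[OF sy[OF j]])
  obtain Q :: "nat set" and u where "A.basis Q u" using A.ex_basis by auto
  then show "EX Qu. A.basis (fst Qu :: nat set) (snd Qu)" by (intro exI[of _ "(Q, u)"]) simp
 qed
 from bchoice[OF this] obtain Qu where Qu: "!!j. j : J ==>
   herm.basis C e D (*) (\<lambda>x y. pr (\<sigma> x * h (w j) (w j) * y)) (fst (Qu j) :: nat set) (snd (Qu j))" by blast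
 define Q u where "Q j = fst (Qu j)" and "u j = snd (Qu j)" for j
 have bu: "herm.basis C e D (*) (\<lambda>x y. pr (\<sigma> x * h (w j) (w j) * y)) (Q j) (u j)" if "j : J" for j
  using Qu[OF that] by (simp add: Q_def u_def)
 have hm: "herm C e \<sigma> D (*) (\<lambda>x y. pr (\<sigma> x * h (w j) (w j) * y))" if "j : J" for j
  using phi_herm[OF sy[OF that]] herm_cone.axioms(2) by blast
 note o = herm.orthD[OF hm herm.basis_orth[OF hm bu]]
 have fQ: "finite (Q j)" if "j : J" for j using o(1) that by blast
 have uD: "u j i : D" if "j : J" "i : Q j" for j i using o(2) that by blast
 have val: "h (act (w j) x) (act (w j') y) = (if j = j' then \<sigma> x * h (w j) (w j) * y else 0)"
  if "j : J" "j' : J" "x : D" "y : D" for j j' x y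
 proof -
  have "h (act (w j) x) (act (w j') y) = \<sigma> x * h (w j) (w j') * y"
   using h_act[OF M_act[OF ow(2)[OF that(1)] that(3)] ow(2)[OF that(2)] that(4)]
    h_act_left[OF ow(2)[OF that(1)] ow(2)[OF that(2)] that(3)] by simp
  then show ?thesis using ow(4) that by auto
 qed
 have pr0: "pr 0 = 0" using pr_scale[of 0 0] by (simp add: scale_zero)
 have orth': "P.orth (SIGMA j:J. Q j) (\<lambda>(j, i). act (w j) (u j i))"
  unfolding P.orth_def
 proof (intro conjI ballI impI)
  show "finite (SIGMA j:J. Q j)" using ow(1) fQ by auto
  fix p assume "p : (SIGMA j:J. Q j)"
  then obtain j i where p: "p = (j, i)" "j : J" "i : Q j" by auto
  show "(case p of (j, i) => act (w j) (u j i)) : M" using p ow uD M_act by auto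
  show "pr (h (case p of (j, i) => act (w j) (u j i)) (case p of (j, i) => act (w j) (u j i))) ~= 0"
   using val[OF p(2,2) uD[OF p(2,3)] uD[OF p(2,3)]] o(3)[OF p(2) p(2) p(2) p(3)] p by simp
  fix q assume "q : (SIGMA j:J. Q j)" and ne: "p ~= q"
  then obtain j' i' where q: "q = (j', i')" "j' : J" "i' : Q j'" by auto
  show "pr (h (case p of (j, i) => act (w j) (u j i)) (case q of (j, i) => act (w j) (u j i))) = 0"
   using val[OF p(2) q(2) uD[OF p(2,3)] uD[OF q(2,3)]] o(4)[OF p(2) p(2) p(2) p(3), of i'] p q ne pr0 by (cases "j = j'") auto
 qed
 have "P.spanning (SIGMA j:J. Q j) (\<lambda>(j, i). act (w j) (u j i))"
 proof (rule spanning_mult[OF smod_axioms basis_spanning[OF assms(2)] fQ uD])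
  fix j x assume j: "j : J" and x: "x : D"
  interpret A: herm_cone C e \<sigma> \<P> D "(*)" "\<lambda>x y. pr (\<sigma> x * h (w j) (w j) * y)" by (rule phi_herm[OF sy[OF j]])
  show "EX c. (ALL i:Q j. c i : C) \<and> x = (\<Sum>i\<in>Q j. u j i * c i)"
   using A.basis_spanning[OF bu[OF j]] x unfolding A.spanning_def by blast
 qed
 from P.basis_if_spanning[OF this orth' order_refl]
 have "P.basis (SIGMA j:J. Q j) (\<lambda>(j, i). act (w j) (u j i))" .
 from P.sig_eq[OF this]
 have "P.sig = (\<Sum>p\<in>(SIGMA j:J. Q j). C.csgn (pr (h (case p of (j, i) => act (w j) (u j i)) (case p of (j, i) => act (w j) (u j i)))))" .
 also have "\<dots> = (\<Sum>(j, i)\<in>(SIGMA j:J. Q j). C.csgn (pr (\<sigma> (u j i) * h (w j) (w j) * u j i)))"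
  using val uD by (intro sum.cong) auto
 also have "\<dots> = (\<Sum>j\<in>J. \<Sum>i\<in>Q j. C.csgn (pr (\<sigma> (u j i) * h (w j) (w j) * u j i)))"
  using ow(1) fQ by (intro sum.Sigma[symmetric]) auto
 also have "\<dots> = (\<Sum>j\<in>J. phi (h (w j) (w j)))"
  unfolding phi_def using herm_cone.sig_eq[OF phi_herm[OF sy] bu] by (intro sum.cong) auto
 finally show ?thesis .
qed

lemma phi_neg: assumes a: "a : symu" shows "phi (- a) = - phi a"
proof -
 have a': "- a : symu" using a symu_neg by simp
 interpret A: herm_cone C e \<sigma> \<P> D "(*)" "\<lambda>x y. pr (\<sigma> x * a * y)" by (rule phi_herm[OF a])
 interpret B: herm_cone C e \<sigma> \<P> D "(*)" "\<lambda>x y. pr (\<sigma> x * - a * y)" by (rule phi_herm[OF a'])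
 obtain J :: "nat set" and w where w: "A.basis J w" using A.ex_basis by auto
 note ow = A.orthD[OF A.basis_orth[OF w]]
 have "B.orth J w" unfolding B.orth_def using ow by (auto simp: pr_neg)
 then have "B.basis J w" by (rule B.basis_if_spanning[OF A.basis_spanning[OF w] _ order_refl])
 from B.sig_eq[OF this] have "B.sig = (\<Sum>i\<in>J. C.csgn (- pr (\<sigma> (w i) * a * w i)))" by (simp add: pr_neg)
 also have "\<dots> = (\<Sum>i\<in>J. - C.csgn (pr (\<sigma> (w i) * a * w i)))"
  using ow by (intro sum.cong C.csgn_neg) auto
 finally show ?thesis using A.sig_eq[OF w] by (simp add: phi_def sum_negf)
qed

lemma phi_scale: assumes a: "a : symu" and c: "c : T" "c ~= 0" shows "phi (scale c a) = phi a"
proof -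
 have ce: "scale c e : \<P>" "scale c e ~= 0" using T_L[OF c(1)] scale_eq_0[of c e] c(2) e_nz by auto
 have a': "scale c a : symu" using a symu sc_D scale_eq_0 c by (intro symuI) (auto simp: sc_star)
 interpret A: herm_cone C e \<sigma> \<P> D "(*)" "\<lambda>x y. pr (\<sigma> x * a * y)" by (rule phi_herm[OF a])
 interpret B: herm_cone C e \<sigma> \<P> D "(*)" "\<lambda>x y. pr (\<sigma> x * scale c a * y)" by (rule phi_herm[OF a'])
 obtain J :: "nat set" and w where w: "A.basis J w" using A.ex_basis by auto
 note ow = A.orthD[OF A.basis_orth[OF w]]
 have pc: "pr (\<sigma> x * scale c a * y) = scale c (pr (\<sigma> x * a * y))" for x y
  by (simp add: sc_left sc_right pr_scale)
 have "B.orth J w" unfolding B.orth_def using ow scale_eq_0 c(2) by (auto simp: pc scale_zero)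
 then have "B.basis J w" by (rule B.basis_if_spanning[OF A.basis_spanning[OF w] _ order_refl])
 from B.sig_eq[OF this] have "B.sig = (\<Sum>i\<in>J. C.csgn (scale c (pr (\<sigma> (w i) * a * w i))))" by (simp add: pc)
 also have "\<dots> = (\<Sum>i\<in>J. C.csgn (pr (\<sigma> (w i) * a * w i)))"
 proof (intro sum.cong refl)
  fix i assume i: "i : J"
  let ?p = "pr (\<sigma> (w i) * a * w i)"
  have p: "?p : E" "?p ~= 0" using C_sym ow(3,5,6)[OF i] by auto
  have "scale c ?p = ?p * scale c e" using scale_e(2) E_D[OF p(1)] by simp
  then show "C.csgn (scale c ?p) = C.csgn ?p" using E.csgn_mult(1)[OF ordL p ce] by simp
 qed
 finally show ?thesis using A.sig_eq[OF w] by (simp add: phi_def)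
qed

text \<open>Diagonalisations over \<open>C\<close> are no longer than a spanning family of
  \<open>D\<close> over the base field; with integrality this provides elements at which
  \<open>phi\<close> is extremal.\<close>

lemma phi_bounded: "EX N::int. ALL a:symu. \<bar>phi a\<bar> \<le> N"
proof -
 obtain Q :: "nat set" and u where u: "DF.spanning Q u" using D_span by auto
 have "\<bar>phi a\<bar> \<le> int (card Q)" if a: "a : symu" for a
 proof -
  interpret A: herm_cone C e \<sigma> \<P> D "(*)" "\<lambda>x y. pr (\<sigma> x * a * y)" by (rule phi_herm[OF a])
  obtain J :: "nat set" and w where w: "A.basis J w" using A.ex_basis by auto
  have "A.spanning Q u" unfolding A.spanning_def
   using u D_spanning_C[OF u] unfolding DF.spanning_def by auto
  then have "card J \<le> card Q" by (rule A.orth_card_le[OF _ A.basis_orth[OF w]])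
  moreover have "\<bar>phi a\<bar> \<le> (\<Sum>i\<in>J. \<bar>C.csgn (pr (\<sigma> (w i) * a * w i))\<bar>)"
   unfolding phi_def A.sig_eq[OF w] by (rule sum_abs)
  moreover have "(\<Sum>i\<in>J. \<bar>C.csgn (pr (\<sigma> (w i) * a * w i))\<bar>) = int (card J)" by (simp add: C.csgn_def if_distrib cong: if_cong)
  ultimately show ?thesis by simp
 qed
 then show ?thesis by blast
qed

end

section \<open>Comparison of signatures\<close>

text \<open>The range \<open>D\<close> of the conjugating elements is a parameter, since cones are
  generated both in the whole algebra and in a corner.\<close>

inductive_set tcone :: "('f => 'a::ring_1 => 'a) => ('a => 'a) => 'f set => 'a set => 'a => 'a set"
 for scale \<sigma> T D a where
 zero: "0 : tcone scale \<sigma> T D a"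
| step: "p : tcone scale \<sigma> T D a ==> t : T ==> x : D ==> p + scale t (\<sigma> x * a * x) : tcone scale \<sigma> T D a"

lemma tcone_add:
 assumes "p : tcone scale \<sigma> T D a" "q : tcone scale \<sigma> T D a" shows "p + q : tcone scale \<sigma> T D a"
 using assms(2,1)
proof (induction rule: tcone.induct)
 case (step q t x)
 then show ?case using tcone.step[of "p + q" scale \<sigma> T D a t x] by (simp add: add.assoc)
qed simp

context cent_form
begin

abbreviation CT :: "'a => 'a set" where "CT \<equiv> tcone scale \<sigma> T D"

lemma T_one: "1 : T"
 using T_rules(3)[of 1] T_rules(2)[of "- 1" "- 1"] by auto

lemma CT_D: assumes a: "a : symu" and "p : CT a" shows "p : D \<and> \<sigma> p = p"
 using assms(2) by (induction rule: tcone.induct)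
  (auto simp: zero_closed add_closed sc_D mult_closed star_closed star_add sc_star star_mult mult.assoc symu[OF a])

lemma CT_symu: "a : symu ==> p : CT a ==> p ~= 0 ==> p : symu"
 using CT_D[of a p] by (intro symuI) auto

lemma CT_term: "t : T ==> x : D ==> scale t (\<sigma> x * a * x) : CT a"
 using tcone.step[OF tcone.zero, of t T x D scale \<sigma> a] by simp

lemma CT_conj: "x : D ==> \<sigma> x * a * x : CT a"
 using CT_term[OF T_one] by (simp add: sc_one)

lemma CT_self: "a : symu ==> a : CT a"
 using CT_conj[OF e_closed, of a] symu by (simp add: star_e e_left e_right)

lemma CT_cone: assumes "p : CT a" "t : T" "x : D" shows "scale t (\<sigma> x * p * x) : CT a"
 using assms(1)
proof (induction rule: tcone.induct)
 case (step p s y)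
 have "scale t (\<sigma> x * (p + scale s (\<sigma> y * a * y)) * x) = scale t (\<sigma> x * p * x) + scale (t * s) (\<sigma> (y * x) * a * (y * x))"
  by (simp add: distrib_left distrib_right sc_add sc_left sc_right sc_sc star_mult mult.assoc)
 then show ?case using tcone.step[OF step.IH T_rules(2)[OF assms(2) step.hyps(2)] mult_closed[OF step.hyps(3) assms(3)]] by simp
qed (simp add: scale_zero tcone.zero)

lemma CT_trans: assumes "a' : CT a" "p : CT a'" shows "p : CT a"
 using assms(2) by (induction rule: tcone.induct) (auto intro: tcone.zero tcone_add CT_cone assms(1))

lemma CT_neg: "p : CT a ==> - p : CT (- a)"
proof (induction rule: tcone.induct)
 case (step p t x)
 have "- (p + scale t (\<sigma> x * a * x)) = - p + scale t (\<sigma> x * (- a) * x)" by (simp add: scale_neg)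
 then show ?case using tcone.step[OF step.IH step.hyps(2,3)] by simp
qed (simp add: tcone.zero)

lemma CT_sum: assumes "p : CT a"
 shows "EX (n::nat) t x. (ALL i<n. t i : T \<and> t i ~= 0 \<and> x i : D) \<and> p = (\<Sum>i<n. scale (t i) (\<sigma> (x i) * a * x i))"
 using assms
proof (induction rule: tcone.induct)
 case zero
 show ?case by (intro exI[of _ 0]) simp
next
 case (step p s y)
 then obtain n :: nat and t x where n: "ALL i<n. t i : T \<and> t i ~= 0 \<and> x i : D" "p = (\<Sum>i<n. scale (t i) (\<sigma> (x i) * a * x i))"
  by blast
 show ?case
 proof (cases "s = 0")
  case True
  then show ?thesis using n by (intro exI[of _ n] exI[of _ t] exI[of _ x]) (simp add: scale_zero)
 next
  case False
  have "(\<Sum>i<n. scale ((t(n := s)) i) (\<sigma> ((x(n := y)) i) * a * (x(n := y)) i)) = p"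
   unfolding n(2) by (intro sum.cong) auto
  then show ?thesis using n(1) step.hyps False
   by (intro exI[of _ "Suc n"] exI[of _ "t(n := s)"] exI[of _ "x(n := y)"]) (auto simp: less_Suc_eq)
 qed
qed

lemma CT_value: fixes n :: nat assumes t: "!!i. i < n ==> t i : T" and x: "x : vec {..<n}"
 shows "dform {..<n} (\<lambda>i. scale (t i) a) x x : CT a"
proof -
 have "(\<Sum>i<m. \<sigma> (x i) * scale (t i) a * x i) : CT a" if "m \<le> n" for m
  using that
 proof (induction m)
  case (Suc m)
  then show ?case using t[of m] vec_D[OF x, of m] by (auto intro!: tcone_add CT_term simp: sc_left sc_right)
 qed (simp add: tcone.zero)
 then show ?thesis by (simp add: dform_def)
qed

text \<open>\<open>c\<close> is a value of the form with entries \<open>t i\<close> times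
  \<open>a\<close>. An orthogonal basis with \<open>c\<close> among its values has \<open>n\<close>
  of them, all in the cone of \<open>a\<close> and hence with \<open>phi\<close> at most
  \<open>phi a\<close>; by \<open>push_sig\<close> they add up to \<open>n\<close> times
  \<open>phi a\<close>, so none is smaller.\<close>

lemma phi_max_const:
 assumes a: "a : symu" and max: "!!u. u : CT a ==> u ~= 0 ==> phi u \<le> phi a" and c: "c : CT a" "c ~= 0"
 shows "phi c = phi a"
proof -
 obtain n :: nat and t x where n: "!!i. i < n ==> t i : T" "!!i. i < n ==> t i ~= 0" "!!i. i < n ==> x i : D"
  "c = (\<Sum>i<n. scale (t i) (\<sigma> (x i) * a * x i))" using CT_sum[OF c(1)] by blast
 let ?I = "{..<n}"
 define aa where "aa i = scale (t i) a" for i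
 have aa: "aa i : symu" if "i < n" for i
  using a symu sc_D scale_eq_0 n(2)[OF that] unfolding aa_def by (intro symuI) (auto simp: sc_star)
 have hm: "herm D e \<sigma> (vec ?I) vact (dform ?I aa)" using aa by (intro diag_herm) auto
 interpret herm D e \<sigma> "vec ?I" vact "dform ?I aa" by (rule hm)
 have ub: "basis ?I unitv" "!!i. i < n ==> dform ?I aa (unitv i) (unitv i) = aa i"
  using unitv_basis[of ?I aa] aa by auto
 define y where "y i = (if i < n then x i else 0)" for i
 have yv: "y : vec ?I" using n(3) by (auto simp: vec_def y_def)
 have yc: "dform ?I aa y y = c" unfolding dform_def n(4) by (intro sum.cong) (auto simp: y_def aa_def sc_left sc_right)
 have "orth {0::nat} (\<lambda>_. y)" using yv yc c(2) by (simp add: orth_def)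
 then obtain J :: "nat set" and w where w: "basis J w" "EX j:J. w j = y"
  using orth_extend_basis[of "{0::nat}" "\<lambda>_. y"] by fastforce
 note ow = orthD[OF basis_orth[OF w(1)]]
 have "card J = n" using orth_card_le[OF basis_spanning[OF w(1)] basis_orth[OF ub(1)]]
   orth_card_le[OF basis_spanning[OF ub(1)] basis_orth[OF w(1)]] by simp
 have "(\<Sum>i<n. phi (aa i)) = (\<Sum>j\<in>J. phi (dform ?I aa (w j) (w j)))"
  using push_sig[OF hm ub(1)] push_sig[OF hm w(1)] ub(2) by simp
 moreover have "(\<Sum>i<n. phi (aa i)) = (\<Sum>j\<in>J. phi a)"
  using phi_scale[OF a n(1,2)] \<open>card J = n\<close> by (simp add: aa_def)
 ultimately have s: "(\<Sum>j\<in>J. phi a - phi (dform ?I aa (w j) (w j))) = 0" by (simp add: sum_subtractf)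
 have le: "0 \<le> phi a - phi (dform ?I aa (w j) (w j))" if "j : J" for j
 proof -
  have "dform ?I aa (w j) (w j) : CT a" using CT_value[of n t "w j" a] n(1) ow(2)[OF that] unfolding aa_def by simp
  then show ?thesis using max ow(3)[OF that] by simp
 qed
 obtain j where j: "j : J" "w j = y" using w(2) by auto
 have "phi a - phi (dform ?I aa (w j) (w j)) = 0"
  using s le j(1) ow(1) by (simp add: sum_nonneg_eq_0_iff)
 then show ?thesis using j(2) yc by simp
qed

lemma phi_min_const:
 assumes a: "a : symu" and min: "!!u. u : CT a ==> u ~= 0 ==> phi a \<le> phi u" and c: "c : CT a" "c ~= 0"
 shows "phi c = phi a"
proof -
 have na: "- a : symu" using a symu_neg by simp
 have "phi (- c) = phi (- a)"
 proof (rule phi_max_const[OF na])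
  fix u assume u: "u : CT (- a)" "u ~= 0"
  then have "- u : CT a" using CT_neg[of u "- a"] by simp
  then show "phi u \<le> phi (- a)" using min[of "- u"] u CT_symu[OF na u] phi_neg[OF a] phi_neg[of u] by simp
 qed (use CT_neg c in auto)
 then show ?thesis using phi_neg[OF a] phi_neg[OF CT_symu[OF a c]] by simp
qed

lemma four_nz: "(4::'f) ~= 0"
 using ordering_char0[OF ordT, of 3] by simp

text \<open>Polarisation with the conjugating elements \<open>e + q\<close> and
  \<open>e - q\<close>: the cone contains twice the sum of \<open>u * q\<close> and
  \<open>\<sigma> q * u\<close>, and every symmetric \<open>w\<close> has this shape because
  \<open>u\<close> is invertible.\<close>

lemma CT_all: assumes a: "a : symu" and u: "u : CT a" "- u : CT a" "u ~= 0" and w: "w : symu" shows "w : CT a"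
proof -
 have us: "u : symu" using CT_symu[OF a u(1,3)] .
 have uD: "u : D" "\<sigma> u = u" and wD: "w : D" "\<sigma> w = w" using us w symu by auto
 \<comment> \<open>The factor one quarter compensates the four equal terms, since
   \<open>u * q\<close> and \<open>\<sigma> q * u\<close> coincide and each occurs twice.\<close>
 define q where "q = scale (inverse 4) (dinv u * w)"
 have q: "q : D" unfolding q_def using dinv_closed uD u(3) wD by (intro sc_D mult_closed) auto
 have uq: "u * q = scale (inverse 4) w"
  unfolding q_def sc_right using dinv_right[OF uD(1) u(3)] e_left[OF wD(1)] by (simp flip: mult.assoc)
 have "\<sigma> (u * q) = \<sigma> q * u" using uD by (simp add: star_mult)
 then have qu: "\<sigma> q * u = scale (inverse 4) w" unfolding uq using wD by (simp add: sc_star)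
 have 1: "\<sigma> (e + q) * u * (e + q) : CT a" "\<sigma> (e - q) * (- u) * (e - q) : CT a"
  using CT_trans[OF u(1) CT_conj] CT_trans[OF u(2) CT_conj] q e_closed add_closed diff_closed by auto
 have "\<sigma> (e + q) * u * (e + q) + \<sigma> (e - q) * (- u) * (e - q) = u * q + \<sigma> q * u + (u * q + \<sigma> q * u)"
  using uD q e_left e_right mult_closed star_closed by (simp add: star_add star_diff star_e algebra_simps)
 also have "\<dots> = scale 1 w"
 proof -
  define k where "k = inverse (4::'f)"
  have "k + k + (k + k) = 4 * k" by simp
  also have "\<dots> = 1" using four_nz by (simp add: k_def)
  finally have "scale 1 w = scale (k + k + (k + k)) w" by simp
  then show ?thesis unfolding uq qu k_def[symmetric] by (simp only: sc_plus)
 qed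
 finally show ?thesis using tcone_add[OF 1] by (simp add: sc_one)
qed

lemma ex_phi_max: assumes "S \<subseteq> symu" "s : S" shows "EX a:S. ALL u:S. phi u \<le> phi a"
proof -
 obtain N where N: "!!a. a : symu ==> \<bar>phi a\<bar> \<le> N" using phi_bounded by auto
 have "phi ` S \<subseteq> {- N..N}"
 proof
  fix k assume "k : phi ` S"
  then obtain a where "a : S" "k = phi a" by auto
  then show "k : {- N..N}" using N[of a] assms(1) by auto
 qed
 then have fin: "finite (phi ` S)" using finite_subset by blast
 have "Max (phi ` S) : phi ` S" using fin assms(2) by (intro Max_in) auto
 then obtain a where "a : S" "phi a = Max (phi ` S)" by auto
 then show ?thesis using fin by (intro bexI[of _ a]) auto
qed

lemma ex_phi_min: assumes "S \<subseteq> symu" "s : S" shows "EX a:S. ALL u:S. phi a \<le> phi u"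
proof -
 have "uminus ` S \<subseteq> symu" using assms(1) symu_neg by auto
 then obtain a where a: "a : S" "ALL u:uminus ` S. phi u \<le> phi (- a)" using ex_phi_max[of "uminus ` S" "- s"] assms(2) by auto
 have "phi a \<le> phi u" if "u : S" for u
 proof -
  have "u : symu" "a : symu" using a that assms(1) by auto
  then show ?thesis using a(2) that phi_neg[of u] phi_neg[of a] by auto
 qed
 then show ?thesis using a(1) by blast
qed

text \<open>All nonzero elements of the two cones are compared, not just \<open>p\<close> and
  \<open>q\<close>, because the condition is applied to elements at which \<open>phi\<close> is
  extremal.\<close>

definition linked :: "'a => 'a => bool" where
 "linked p q \<longleftrightarrow> (ALL a:CT p - {0}. ALL b:CT q - {0}. (EX c:CT a \<inter> CT b. c ~= 0) \<or>
   (EX u:CT a. u ~= 0 \<and> - u : CT a) \<or> (EX u:CT b. u ~= 0 \<and> - u : CT b))"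

lemma linked_sym: "linked p q ==> linked q p"
 unfolding linked_def by blast

text \<open>With \<open>a\<close> maximal in the cone of \<open>p\<close> and \<open>b\<close>
  minimal in that of \<open>q\<close>, a common element gives
  \<open>phi p \<le> phi a = phi b \<le> phi q\<close>. If instead one cone degenerates, it contains
  every symmetric unit, so \<open>phi\<close> is constant, and being odd it is zero.\<close>

lemma phi_le_if_linked:
 assumes p: "p : symu" and q: "q : symu" and l: "linked p q" shows "phi p \<le> phi q"
proof -
 obtain a where a: "a : CT p" "a ~= 0" and ma: "!!u. u : CT p ==> u ~= 0 ==> phi u \<le> phi a"
  using ex_phi_max[of "CT p - {0}" p] CT_symu[OF p] CT_self[OF p] p symu(3)[OF p] by blast
 obtain b where b: "b : CT q" "b ~= 0" and mb: "!!u. u : CT q ==> u ~= 0 ==> phi b \<le> phi u"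
  using ex_phi_min[of "CT q - {0}" q] CT_symu[OF q] CT_self[OF q] q symu(3)[OF q] by blast
 have as: "a : symu" and bs: "b : symu" using CT_symu p q a b by auto
 have pc: "phi c = phi a" if "c : CT a" "c ~= 0" for c
  by (rule phi_max_const[OF as _ that]) (use ma CT_trans[OF a(1)] in blast)
 have qc: "phi c = phi b" if "c : CT b" "c ~= 0" for c
  by (rule phi_min_const[OF bs _ that]) (use mb CT_trans[OF b(1)] in blast)
 have zero: "phi w = 0" if all: "!!w. w : symu ==> phi w = k" and w: "w : symu" for k w
  using all[OF w] all[OF symu_neg[OF w]] phi_neg[OF w] by simp
 consider c where "c : CT a" "c : CT b" "c ~= 0" | u where "u : CT a" "u ~= 0" "- u : CT a"
  | u where "u : CT b" "u ~= 0" "- u : CT b" using l a b unfolding linked_def by blast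
 then show ?thesis
 proof cases
  case 1
  have "phi p \<le> phi a" using ma[OF CT_self[OF p]] symu p by auto
  also have "\<dots> = phi b" using pc[OF 1(1,3)] qc[OF 1(2,3)] by simp
  also have "\<dots> \<le> phi q" using mb[OF CT_self[OF q]] symu q by auto
  finally show ?thesis .
 next
  case 2
  have k: "phi w = phi a" if "w : symu" for w
   using pc[OF CT_all[OF as 2(1,3,2) that]] symu(3)[OF that] by simp
  show ?thesis using zero[of "phi a", OF k p] zero[of "phi a", OF k q] by simp
 next
  case 3
  have k: "phi w = phi b" if "w : symu" for w
   using qc[OF CT_all[OF bs 3(1,3,2) that]] symu(3)[OF that] by simp
  show ?thesis using zero[of "phi b", OF k p] zero[of "phi b", OF k q] by simp
 qed
qed

end

section \<open>Induction and restriction between the centraliser and the division algebra\<close>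

context cent_form
begin

definition eta :: "'a => (nat => 'a) => nat => 'a" where "eta a w j = pr (\<sigma> (w j) * a * w j)"
definition cbasis :: "'a => nat set => (nat => 'a) => bool" where
 "cbasis a J w \<longleftrightarrow> a : symu \<and> herm.basis C e D (*) (\<lambda>x y. pr (\<sigma> x * a * y)) J w"

text \<open>The value at \<open>\<zeta>\<close> of the transfer from \<open>E\<close> to the centre: the Casimir element
 of the form, with \<open>\<zeta>\<close> inserted.\<close>

definition cas :: "'a => nat set => (nat => 'a) => 'a => 'a" where
 "cas a J w \<zeta> = (\<Sum>j\<in>J. w j * E.dinv (eta a w j) * \<zeta> * \<sigma> (w j))"

lemma ex_cbasis: assumes "a : symu" obtains J w where "cbasis a J w"
proof -
 interpret A: herm_cone C e \<sigma> \<P> D "(*)" "\<lambda>x y. pr (\<sigma> x * a * y)" by (rule phi_herm[OF assms])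
 obtain J :: "nat set" and w where "A.basis J w" using A.ex_basis by auto
 then show ?thesis using that assms by (auto simp: cbasis_def)
qed

lemma cbasisD: assumes "cbasis a J w"
 shows "a : symu" "finite J" "j : J ==> w j : D" "j : J ==> eta a w j : E" "j : J ==> eta a w j ~= 0"
  "j : J ==> k : J ==> j ~= k ==> pr (\<sigma> (w j) * a * w k) = 0"
  "x : D ==> x = (\<Sum>j\<in>J. w j * (E.dinv (eta a w j) * pr (\<sigma> (w j) * a * x)))"
  "(!!j. j : J ==> c j : C) ==> (\<Sum>j\<in>J. w j * c j) = 0 ==> j : J ==> c j = 0"
  "phi a = (\<Sum>j\<in>J. C.csgn (eta a w j))"
proof -
 have a: "a : symu" using assms by (simp add: cbasis_def)
 interpret A: herm_cone C e \<sigma> \<P> D "(*)" "\<lambda>x y. pr (\<sigma> x * a * y)" by (rule phi_herm[OF a])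
 have w: "A.basis J w" using assms by (simp add: cbasis_def)
 note o = A.orthD[OF A.basis_orth[OF w]]
 show "a : symu" by (rule a)
 show "finite J" "j : J ==> w j : D" "j : J ==> k : J ==> j ~= k ==> pr (\<sigma> (w j) * a * w k) = 0"
  using o by auto
 have etaE: "eta a w j : E" and etanz: "eta a w j ~= 0" if "j : J" for j
  using C_sym o(3,5,6)[OF that] by (auto simp: eta_def)
 then show "j : J ==> eta a w j : E" "j : J ==> eta a w j ~= 0" by auto
 have dv: "C.dinv (eta a w j) = E.dinv (eta a w j)" if "j : J" for j
  using C.dinv_unique[of "eta a w j" "E.dinv (eta a w j)"] E.dinv_closed E.dinv_right etaE[OF that] etanz[OF that] E_C by auto
 show "x = (\<Sum>j\<in>J. w j * (E.dinv (eta a w j) * pr (\<sigma> (w j) * a * x)))" if "x : D"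
 proof -
  have "x = (\<Sum>j\<in>J. w j * (C.dinv (pr (\<sigma> (w j) * a * w j)) * pr (\<sigma> (w j) * a * x)))"
   using w that unfolding A.basis_def by blast
  also have "\<dots> = (\<Sum>j\<in>J. w j * (E.dinv (eta a w j) * pr (\<sigma> (w j) * a * x)))"
   using dv by (intro sum.cong) (auto simp: eta_def)
  finally show ?thesis .
 qed
 show "(!!j. j : J ==> c j : C) ==> (\<Sum>j\<in>J. w j * c j) = 0 ==> j : J ==> c j = 0"
  using A.orth_indep[OF A.basis_orth[OF w]] by blast
 show "phi a = (\<Sum>j\<in>J. C.csgn (eta a w j))" unfolding phi_def A.sig_eq[OF w] by (simp add: eta_def)
qed

lemma cbasis_card: assumes "cbasis a J w" "cbasis b J' w'" shows "card J = card J'"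
proof -
 interpret A: herm_cone C e \<sigma> \<P> D "(*)" "\<lambda>x y. pr (\<sigma> x * a * y)" by (rule phi_herm[OF cbasisD(1)[OF assms(1)]])
 interpret B: herm_cone C e \<sigma> \<P> D "(*)" "\<lambda>x y. pr (\<sigma> x * b * y)" by (rule phi_herm[OF cbasisD(1)[OF assms(2)]])
 have A: "A.basis J w" and B: "B.basis J' w'" using assms by (auto simp: cbasis_def)
 show ?thesis
  using A.orth_card_le[OF B.basis_spanning[OF B] A.basis_orth[OF A]]
   B.orth_card_le[OF A.basis_spanning[OF A] B.basis_orth[OF B]] by simp
qed

lemma dinv_E: assumes "cbasis a J w" "j : J" shows "E.dinv (eta a w j) : E" "eta a w j * E.dinv (eta a w j) = e"
 "E.dinv (eta a w j) * eta a w j = e"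
 using E.dinv_closed E.dinv_right E.dinv_left cbasisD(4,5)[OF assms(1)] assms(2) by auto

lemma cas_add: "cas a J w (x + y) = cas a J w x + cas a J w y"
 by (simp add: cas_def distrib_left distrib_right sum.distrib)

lemma cas_scale: "cas a J w (scale c x) = scale c (cas a J w x)"
 by (simp add: cas_def scale_sum sc_left sc_right)

lemma pr_comm: "x : D ==> y : E ==> pr x * y = y * pr x"
 using C_comm[OF pr_C] by simp

text \<open>Expand \<open>x * w j\<close> and \<open>\<sigma> x * w k\<close> in the basis: the
  coefficients are stars of one another up to the diagonal entries. They lie in \<open>C\<close> and
  thus commute with elements of \<open>E\<close>, so multiplying by \<open>x\<close> on the left or
  on the right gives the same double sum.\<close>

lemma cas_central:
 assumes cb: "cbasis e J w" and \<zeta>: "\<zeta> : E" and x: "x : D"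
 shows "x * cas e J w \<zeta> = cas e J w \<zeta> * x"
proof -
 note b = cbasisD[OF cb]
 let ?d = "\<lambda>j. E.dinv (eta e w j)"
 define p where "p k j = pr (\<sigma> (w k) * e * (x * w j))" for k j
 have wD: "w j : D" if "j : J" for j using b(3)[OF that] .
 have pD: "\<sigma> (w k) * e * (x * w j) : D" if "k : J" "j : J" for j k
  using wD that x star_closed mult_closed e_closed by simp
 have cm: "p k j * ?d j * \<zeta> = ?d j * \<zeta> * p k j" "p k j * \<zeta> = \<zeta> * p k j" if "k : J" "j : J" for k j
  using C_comm[OF pr_C[OF pD[OF that]]] E.mult_closed[OF dinv_E(1)[OF cb that(2)] \<zeta>] \<zeta>
  by (auto simp: p_def mult.assoc)
 have "x * cas e J w \<zeta> = (\<Sum>j\<in>J. (x * w j) * ?d j * \<zeta> * \<sigma> (w j))"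
  by (simp add: cas_def sum_distrib_left mult.assoc)
 also have "\<dots> = (\<Sum>j\<in>J. \<Sum>k\<in>J. w k * ?d k * p k j * ?d j * \<zeta> * \<sigma> (w j))"
 proof (intro sum.cong refl)
  fix j assume j: "j : J"
  have "x * w j = (\<Sum>k\<in>J. w k * (?d k * p k j))" using b(7)[OF mult_closed[OF x wD[OF j]]] by (simp add: p_def)
  then have "(x * w j) * ?d j * \<zeta> * \<sigma> (w j) = (\<Sum>k\<in>J. w k * (?d k * p k j)) * ?d j * \<zeta> * \<sigma> (w j)" by simp
  then show "(x * w j) * ?d j * \<zeta> * \<sigma> (w j) = (\<Sum>k\<in>J. w k * ?d k * p k j * ?d j * \<zeta> * \<sigma> (w j))"
   by (simp add: sum_distrib_right mult.assoc)
 qed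
 also have "\<dots> = (\<Sum>k\<in>J. \<Sum>j\<in>J. w k * ?d k * p k j * ?d j * \<zeta> * \<sigma> (w j))" by (rule sum.swap)
 also have "\<dots> = (\<Sum>k\<in>J. w k * ?d k * \<zeta> * (\<sigma> (w k) * x))"
 proof (intro sum.cong refl)
  fix k assume k: "k : J"
  have q: "pr (\<sigma> (w j) * e * (\<sigma> x * w k)) = \<sigma> (p k j)" if "j : J" for j
   unfolding p_def pr_star using wD[OF k] wD[OF that] x e_left e_right star_closed mult_closed
   by (simp add: star_mult star_e mult.assoc)
  have "\<sigma> x * w k = (\<Sum>j\<in>J. w j * (?d j * \<sigma> (p k j)))"
   using b(7)[OF mult_closed[OF star_closed[OF x] wD[OF k]]] q by simp
  then have "\<sigma> (\<sigma> x * w k) = \<sigma> (\<Sum>j\<in>J. w j * (?d j * \<sigma> (p k j)))" by simp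
  then have "\<sigma> (w k) * x = (\<Sum>j\<in>J. p k j * \<sigma> (?d j) * \<sigma> (w j))" by (simp add: star_mult star_sum)
  also have "\<dots> = (\<Sum>j\<in>J. p k j * ?d j * \<sigma> (w j))" using E_sym dinv_E(1)[OF cb] by simp
  finally have "w k * ?d k * \<zeta> * (\<sigma> (w k) * x) = (\<Sum>j\<in>J. w k * ?d k * (\<zeta> * (p k j * ?d j)) * \<sigma> (w j))"
   by (simp add: sum_distrib_left mult.assoc)
  also have "\<dots> = (\<Sum>j\<in>J. w k * ?d k * p k j * ?d j * \<zeta> * \<sigma> (w j))"
  proof (intro sum.cong refl)
   fix j assume j: "j : J"
   have "\<zeta> * (p k j * ?d j) = p k j * (?d j * \<zeta>)"
    using cm(2)[OF k j] E_comm[OF \<zeta> dinv_E(1)[OF cb j]] by (metis mult.assoc)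
   then show "w k * ?d k * (\<zeta> * (p k j * ?d j)) * \<sigma> (w j) = w k * ?d k * p k j * ?d j * \<zeta> * \<sigma> (w j)" by (simp add: mult.assoc)
  qed
  finally show "(\<Sum>j\<in>J. w k * ?d k * p k j * ?d j * \<zeta> * \<sigma> (w j)) = w k * ?d k * \<zeta> * (\<sigma> (w k) * x)" by simp
 qed
 also have "\<dots> = cas e J w \<zeta> * x" by (simp add: cas_def sum_distrib_right mult.assoc)
 finally show ?thesis .
qed

text \<open>The form of \<open>a\<close> is the form of \<open>e\<close> with its second argument
  multiplied by \<open>a\<close>, so passing from one pair of dual bases to the other costs exactly
  a right factor \<open>a\<close>.\<close>

lemma cas_mult:
 assumes ce: "cbasis e J w" and ca: "cbasis a K u" and \<zeta>: "\<zeta> : E"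
 shows "cas a K u \<zeta> * a = cas e J w \<zeta>"
proof -
 note b = cbasisD[OF ce] and c = cbasisD[OF ca]
 let ?d = "\<lambda>j. E.dinv (eta e w j)" and ?g = "\<lambda>k. E.dinv (eta a u k)"
 have aD: "a : D" "\<sigma> a = a" using c(1) symu by auto
 define p where "p k j = pr (\<sigma> (u k) * a * w j)" for k j
 have pD: "\<sigma> (u k) * a * w j : D" if "k : K" "j : J" for j k
  using b(3)[OF that(2)] c(3)[OF that(1)] aD star_closed mult_closed by simp
 have "cas a K u \<zeta> * a = (\<Sum>k\<in>K. u k * ?g k * \<zeta> * (\<sigma> (u k) * a))" by (simp add: cas_def sum_distrib_right mult.assoc)
 also have "\<dots> = (\<Sum>k\<in>K. \<Sum>j\<in>J. u k * (?g k * p k j) * (?d j * \<zeta> * \<sigma> (w j)))"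
 proof (intro sum.cong refl)
  fix k assume k: "k : K"
  have q: "pr (\<sigma> (w j) * e * (a * u k)) = \<sigma> (p k j)" if "j : J" for j
   unfolding p_def pr_star using b(3)[OF that] c(3)[OF k] aD e_left e_right star_closed mult_closed
   by (simp add: star_mult mult.assoc)
  have "a * u k = (\<Sum>j\<in>J. w j * (?d j * \<sigma> (p k j)))"
   using b(7)[OF mult_closed[OF aD(1) c(3)[OF k]]] q by simp
  then have "\<sigma> (a * u k) = \<sigma> (\<Sum>j\<in>J. w j * (?d j * \<sigma> (p k j)))" by simp
  then have "\<sigma> (u k) * a = (\<Sum>j\<in>J. p k j * \<sigma> (?d j) * \<sigma> (w j))" using aD by (simp add: star_mult star_sum)
  also have "\<dots> = (\<Sum>j\<in>J. p k j * ?d j * \<sigma> (w j))" using E_sym dinv_E(1)[OF ce] by simp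
  finally have "u k * ?g k * \<zeta> * (\<sigma> (u k) * a) = (\<Sum>j\<in>J. u k * ?g k * (\<zeta> * (p k j * ?d j)) * \<sigma> (w j))"
   by (simp add: sum_distrib_left mult.assoc)
  also have "\<dots> = (\<Sum>j\<in>J. u k * (?g k * p k j) * (?d j * \<zeta> * \<sigma> (w j)))"
  proof (intro sum.cong refl)
   fix j assume j: "j : J"
   have "p k j * \<zeta> = \<zeta> * p k j" unfolding p_def by (rule pr_comm[OF pD[OF k j] \<zeta>])
   then have "\<zeta> * (p k j * ?d j) = p k j * (?d j * \<zeta>)"
    using E_comm[OF \<zeta> dinv_E(1)[OF ce j]] by (metis mult.assoc)
   then show "u k * ?g k * (\<zeta> * (p k j * ?d j)) * \<sigma> (w j) = u k * (?g k * p k j) * (?d j * \<zeta> * \<sigma> (w j))" by (simp add: mult.assoc)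
  qed
  finally show "u k * ?g k * \<zeta> * (\<sigma> (u k) * a) = (\<Sum>j\<in>J. u k * (?g k * p k j) * (?d j * \<zeta> * \<sigma> (w j)))" .
 qed
 also have "\<dots> = (\<Sum>j\<in>J. \<Sum>k\<in>K. u k * (?g k * p k j) * (?d j * \<zeta> * \<sigma> (w j)))" by (rule sum.swap)
 also have "\<dots> = (\<Sum>j\<in>J. w j * (?d j * \<zeta> * \<sigma> (w j)))"
  unfolding sum_distrib_right[symmetric] using c(7)[OF b(3)] by (intro sum.cong refl) (simp add: p_def)
 also have "\<dots> = cas e J w \<zeta>" by (simp add: cas_def mult.assoc)
 finally show ?thesis .
qed

lemma cas_symmetric: assumes cb: "cbasis a J w" and \<zeta>: "\<zeta> : E" shows "\<sigma> (cas a J w \<zeta>) = cas a J w \<zeta>"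
 unfolding cas_def star_sum
proof (intro sum.cong refl)
 fix j assume "j : J"
 then have "E.dinv (eta a w j) : E" by (rule dinv_E[OF cb])
 then show "\<sigma> (w j * E.dinv (eta a w j) * \<zeta> * \<sigma> (w j)) = w j * E.dinv (eta a w j) * \<zeta> * \<sigma> (w j)"
  using \<zeta> E_comm[of \<zeta>] by (simp add: star_mult E_sym mult.assoc[symmetric])
qed

lemma cas_D: assumes cb: "cbasis a J w" and \<zeta>: "\<zeta> : E" shows "cas a J w \<zeta> : D"
 unfolding cas_def using cbasisD[OF cb] dinv_E(1)[OF cb] E_D \<zeta>
 by (intro sum_closed mult_closed star_closed) auto

lemma ex_transfer_functional: assumes "cbasis e J w"
 shows "EX f. ALL \<zeta>:E. cas e J w \<zeta> = scale (f \<zeta>) e"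
proof -
 have "ALL \<zeta>:E. EX c. cas e J w \<zeta> = scale c e"
  using centre[OF cas_D[OF assms]] cas_central[OF assms] cas_symmetric[OF assms] by metis
 then show ?thesis by (rule bchoice)
qed

text \<open>Commutators with elements of \<open>E\<close> shorten a relation; a minimal one has coefficients in \<open>C\<close>.\<close>

lemma dedekind_E:
 assumes cb: "cbasis a J w" and u: "!!j. j : J ==> u j : D" and rel: "!!x. x : E ==> (\<Sum>j\<in>J. w j * x * u j) = 0"
 shows "ALL j:J. u j = 0"
 using u rel
proof (induction "card {j : J. u j ~= 0}" arbitrary: u rule: less_induct)
 case less
 note b = cbasisD[OF cb]
 show ?case
 proof (rule ccontr)
  assume "\<not> (ALL j:J. u j = 0)"
  then obtain p where p: "p : J" "u p ~= 0" by auto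
  define c where "c j = u j * dinv (u p)" for j
  have q: "dinv (u p) : D" "u p * dinv (u p) = e" using less.prems(1) p dinv_closed dinv_right by auto
  have cD: "c j : D" if "j : J" for j using that q less.prems(1) mult_closed by (simp add: c_def)
  have cp: "c p = e" using q by (simp add: c_def)
  have rc: "(\<Sum>j\<in>J. w j * x * c j) = 0" if "x : E" for x
  proof -
   have "(\<Sum>j\<in>J. w j * x * c j) = (\<Sum>j\<in>J. w j * x * u j) * dinv (u p)" by (simp add: c_def sum_distrib_right mult.assoc)
   then show ?thesis using less.prems(2)[OF that] by simp
  qed
  have comm: "c j * y = y * c j" if j: "j : J" and y: "y : E" for j y
  proof -
   define k where "k j = y * c j - c j * y" for j
   have "{j : J. k j ~= 0} \<subset> {j : J. u j ~= 0}"
   proof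
    show "{j : J. k j ~= 0} \<subseteq> {j : J. u j ~= 0}" by (auto simp: k_def c_def)
    have "k p = 0" using cp y E_D by (simp add: k_def e_left e_right)
    then show "{j : J. k j ~= 0} ~= {j : J. u j ~= 0}" using p by auto
   qed
   then have "card {j : J. k j ~= 0} < card {j : J. u j ~= 0}" using b(2) by (intro psubset_card_mono) auto
   moreover have "k j : D" if "j : J" for j using cD[OF that] E_D[OF y] mult_closed diff_closed by (simp add: k_def)
   moreover have "(\<Sum>j\<in>J. w j * x * k j) = 0" if x: "x : E" for x
   proof -
    have "(\<Sum>j\<in>J. w j * x * k j) = (\<Sum>j\<in>J. w j * (x * y) * c j) - (\<Sum>j\<in>J. w j * x * c j) * y"
     by (simp add: k_def right_diff_distrib sum_subtractf sum_distrib_right mult.assoc)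
    then show ?thesis using rc x y E.mult_closed by simp
   qed
   ultimately have "ALL j:J. k j = 0" by (rule less.hyps)
   then show ?thesis using j by (simp add: k_def)
  qed
  have "(\<Sum>j\<in>J. w j * c j) = 0" using rc[OF e_E] b(3) e_right by simp
  then have "c p = 0" by (rule b(8)[rotated]) (use cD comm p in \<open>auto simp: C_def\<close>)
  then show False using cp e_nz by simp
 qed
qed

text \<open>Maps \<open>E\<close> into the space of the diagonal form with entries
  \<open>z * eta a w j\<close> in such a way that the Gram values become
  \<open>cas a J w (z * x * y)\<close>: this links the form induced from \<open>E\<close> to
  \<open>D\<close> with the transfer of \<open>z\<close> to the base field.\<close>

definition Theta :: "'a => nat set => (nat => 'a) => 'a => nat => 'a" where
 "Theta a J w x = (\<lambda>j. if j : J then E.dinv (eta a w j) * x * \<sigma> (w j) else 0)"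

lemma Theta_vec: assumes "cbasis a J w" "x : E" shows "Theta a J w x : vec J"
 using cbasisD(3)[OF assms(1)] dinv_E(1)[OF assms(1)] E_D assms(2) star_closed mult_closed
 by (auto simp: vec_def Theta_def)

lemma Theta_form: assumes cb: "cbasis a J w" and z: "z : E" and x: "x : E" and u: "u : vec J"
 shows "dform J (\<lambda>j. z * eta a w j) (Theta a J w x) u = (\<Sum>j\<in>J. w j * x * (z * u j))"
 unfolding dform_def
proof (intro sum.cong refl)
 fix j assume j: "j : J"
 note d = dinv_E[OF cb j]
 have "\<sigma> (Theta a J w x j) = w j * x * E.dinv (eta a w j)"
  using j d(1) x E_sym by (simp add: Theta_def star_mult mult.assoc)
 then have "\<sigma> (Theta a J w x j) * (z * eta a w j) * u j = w j * x * (E.dinv (eta a w j) * (z * eta a w j)) * u j" by (simp add: mult.assoc)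
 also have "E.dinv (eta a w j) * (z * eta a w j) = z"
  using E_comm[OF z cbasisD(4)[OF cb j]] d(3) E.e_left[OF z] by (simp flip: mult.assoc)
 finally show "\<sigma> (Theta a J w x j) * (z * eta a w j) * u j = w j * x * (z * u j)" by (simp add: mult.assoc)
qed

lemma Theta_cas: assumes cb: "cbasis a J w" and z: "z : E" and x: "x : E" and y: "y : E"
 shows "dform J (\<lambda>j. z * eta a w j) (Theta a J w x) (Theta a J w y) = cas a J w (z * x * y)"
 unfolding Theta_form[OF cb z x Theta_vec[OF cb y]] cas_def
proof (intro sum.cong refl)
 fix j assume j: "j : J"
 note d = dinv_E(1)[OF cb j]
 have "x * (z * E.dinv (eta a w j)) = E.dinv (eta a w j) * (z * x)"
  using E_comm[OF x E.mult_closed[OF z d]] E_comm[OF z d] by (simp add: mult.assoc)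
 moreover have "w j * x * (z * Theta a J w y j) = w j * (x * (z * E.dinv (eta a w j))) * (y * \<sigma> (w j))"
  using j by (simp add: Theta_def mult.assoc)
 ultimately show "w j * x * (z * Theta a J w y j) = w j * E.dinv (eta a w j) * (z * x * y) * \<sigma> (w j)"
  by (simp add: mult.assoc)
qed

lemma z_eta_symu: assumes "cbasis a J w" "z : E.units" "j : J" shows "z * eta a w j : symu"
 using assms E.units[OF assms(2)] cbasisD(4,5)[OF assms(1,3)] E.mult_closed E.mult_nz E_D E_sym
 by (intro symuI) auto

text \<open>The vectors \<open>Theta\<close> span, so an orthogonal basis of the transferred form over the base field
 yields an orthogonal basis of the induced form over \<open>D\<close>.\<close>

lemma transfer_isoM:
 assumes ce: "cbasis e J w" and f: "!!\<zeta>. \<zeta> : E ==> cas e J w \<zeta> = scale (f \<zeta>) e"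
  and ca: "cbasis a K u" and z: "z : E.units"
  and N: "finite (N :: nat set)" "!!i. i : N ==> x i : E" "!!i. i : N ==> f (z * x i * x i) ~= 0"
   "!!i j. i : N ==> j : N ==> i ~= j ==> f (z * x i * x j) = 0"
   "!!y. y : E ==> EX k. y = (\<Sum>i\<in>N. scale (k i) (x i))"
 shows "isoM (image_mset (\<lambda>j. z * eta a u j) (mset_set K)) (image_mset (\<lambda>i. scale (f (z * x i * x i)) (dinv a)) (mset_set N))"
proof -
 note b = cbasisD[OF ca]
 have zE: "z : E" "z ~= 0" using z E.units by auto
 have aD: "a : D" "a ~= 0" "\<sigma> a = a" using b(1) symu by auto
 have da: "dinv a : D" "a * dinv a = e" "\<sigma> (dinv a) = dinv a" "dinv a ~= 0"
  using dinv_closed dinv_right star_dinv dinv_nz aD by auto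
 \<comment> \<open>The functional \<open>f\<close> is the one belonging to \<open>e\<close>; for
   general \<open>a\<close> its values appear multiplied by \<open>dinv a\<close>.\<close>
 have cas: "cas a K u \<zeta> = scale (f \<zeta>) (dinv a)" if "\<zeta> : E" for \<zeta>
 proof -
  have "cas a K u \<zeta> * a * dinv a = scale (f \<zeta>) e * dinv a" using cas_mult[OF ce ca that] f[OF that] by simp
  then show ?thesis using cas_D[OF ca that] da by (simp add: mult.assoc e_right sc_left e_left)
 qed
 let ?a = "\<lambda>j. z * eta a u j" and ?T = "\<lambda>i. Theta a K u (x i)"
 have sy: "!!j. j : K ==> ?a j : symu" using z_eta_symu[OF ca z] .
 have hm: "herm D e \<sigma> (vec K) vact (dform K ?a)" using sy b(2) by (intro diag_herm) auto
 interpret herm D e \<sigma> "vec K" vact "dform K ?a" by (rule hm)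
 have val: "dform K ?a (?T i) (?T j) = scale (f (z * x i * x j)) (dinv a)" if "i : N" "j : N" for i j
  using Theta_cas[OF ca zE(1) N(2)[OF that(1)] N(2)[OF that(2)]] cas[OF E.mult_closed[OF E.mult_closed[OF zE(1) N(2)[OF that(1)]] N(2)[OF that(2)]]] by simp
 have vy: "scale (f (z * x i * x i)) (dinv a) : symu" if "i : N" for i
  using da sc_D scale_eq_0 N(3)[OF that] by (intro symuI) (auto simp: sc_star)
 have o: "orth N ?T"
  unfolding orth_def using N Theta_vec[OF ca] val symu(3)[OF vy] by (auto simp: scale_zero)
 have bs: "basis N ?T"
 proof (rule ccontr)
  assume "\<not> basis N ?T"
  then obtain y where y: "y : vec K" "dform K ?a y y ~= 0" "ALL i:N. dform K ?a (?T i) y = 0"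
   using orth_extend_one[OF o] by blast
  \<comment> \<open>A vector orthogonal to all \<open>?T i\<close> satisfies this relation for every
    \<open>q\<close> of \<open>E\<close>, and \<open>dedekind_E\<close> then annihilates its
    coordinates.\<close>
  have "(\<Sum>j\<in>K. u j * q * (z * y j)) = 0" if q: "q : E" for q
  proof -
   obtain k where k: "q = (\<Sum>i\<in>N. scale (k i) (x i))" using N(5)[OF q] by auto
   have "(\<Sum>j\<in>K. u j * q * (z * y j)) = (\<Sum>j\<in>K. \<Sum>i\<in>N. scale (k i) (u j * x i * (z * y j)))"
    by (simp add: k sum_distrib_left sum_distrib_right sc_left sc_right)
   also have "\<dots> = (\<Sum>i\<in>N. \<Sum>j\<in>K. scale (k i) (u j * x i * (z * y j)))" by (rule sum.swap)
   also have "\<dots> = (\<Sum>i\<in>N. scale (k i) (dform K ?a (?T i) y))"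
    using Theta_form[OF ca zE(1) N(2) y(1)] by (simp add: scale_sum)
   also have "\<dots> = 0" using y(3) by (simp add: scale_zero)
   finally show ?thesis .
  qed
  then have "ALL j:K. z * y j = 0"
   by (intro dedekind_E[OF ca]) (use vec_D[OF y(1)] E_D zE mult_closed in auto)
  then have "ALL j:K. y j = 0" using no_zero_div[OF E_D[OF zE(1)] vec_D[OF y(1)]] zE(2) by blast
  then show False using y(2) by (simp add: dform_def)
 qed
 have ub: "basis K unitv" using unitv_basis(1)[of K ?a] b(2) sy by blast
 have "frame K ?a N (\<lambda>i. scale (f (z * x i * x i)) (dinv a)) ?T"
  unfolding frame_def using Theta_vec[OF ca N(2)] val N(4) by (auto simp: scale_zero)
 moreover have "card K = card N"
  by (rule le_antisym[OF orth_card_le[OF basis_spanning[OF bs] basis_orth[OF ub]] orth_card_le[OF basis_spanning[OF ub] o]])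
 ultimately show ?thesis using b(2) N(1) sy vy by (intro isoM_I) auto
qed

end

section \<open>Absorption of signs by Pfister forms\<close>

abbreviation npos :: "'a set => 'a multiset => nat" where "npos A M \<equiv> size (filter_mset (\<lambda>x. x : A) M)"
abbreviation nneg :: "'a set => 'a multiset => nat" where "nneg A M \<equiv> size (filter_mset (\<lambda>x. x \<notin> A) M)"

lemma pfister_front:
 assumes "t : set ts" "!!s. s : set ts ==> t * s = s * t"
 shows "pfister ts M = pfister (t # remove1 t ts) M"
 using assms
proof (induction ts)
 case (Cons s ts)
 show ?case
 proof (cases "s = t")
  case False
  define Y where "Y = pfister (remove1 t ts) M"
  have IH: "pfister ts M = Y + image_mset ((*) t) Y" using Cons False by (simp add: Y_def)
  have "s * (t * x) = t * (s * x)" for x using Cons.prems(2)[of s] by (simp flip: mult.assoc)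
  then have "image_mset ((*) s) (image_mset ((*) t) Y) = image_mset ((*) t) (image_mset ((*) s) Y)"
   by (simp add: multiset.map_comp comp_def)
  then show ?thesis using False by (simp add: IH flip: Y_def)
 qed simp
qed simp

lemma sum_mset_image_swap:
 fixes f :: "'h => 'z => 'y"
 shows "(\<Sum>h\<in>#H. image_mset (f h) Q) = (\<Sum>z\<in>#Q. image_mset (\<lambda>h. f h z) H)"
proof (induction H)
 case (add x H)
 have "(\<Sum>z\<in>#Q. add_mset (f x z) (g z)) = image_mset (f x) Q + (\<Sum>z\<in>#Q. g z)" for g
  by (induction Q) (auto simp: ac_simps)
 then show ?case using add by simp
qed simp

context star_div
begin

lemma isoM_sum: "(!!z. z \<in># P ==> isoM (g z) (g' z)) ==> isoM (\<Sum>z\<in>#P. g z) (\<Sum>z\<in>#P. g' z)"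
proof (induction P)
 case empty
 show ?case using isoM_refl[of "{#}"] by simp
next
 case (add z P)
 then show ?case using isoM_add[of "g z" "g' z"] by simp
qed

lemma isoM_neg: assumes "isoM M N" shows "isoM (image_mset uminus M) (image_mset uminus N)"
proof -
 have im: "image_mset ((*) (- e)) M = image_mset uminus M" if "set_mset M \<subseteq> symu" for M
 proof (intro image_mset_cong)
  fix x assume "x \<in># M"
  then have "x : D" using that symu by auto
  then show "- e * x = - x" by (simp add: e_left)
 qed
 have "isoM (image_mset ((*) (- e)) M) (image_mset ((*) (- e)) N)"
  using symu_neg[OF symu_e] by (intro isoM_scale[OF assms]) (auto simp: e_left e_right)
 then show ?thesis using im isoM_symu[OF assms] by simp
qed

lemma torsion_repeatI: "torsion M ==> torsion (repeat_mset n M)"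
 by (induction n) (auto intro: torsion_add torsion_empty)

text \<open>With \<open>t\<close> pulled to the front the form is \<open>R\<close> plus
  \<open>t\<close> times \<open>R\<close>. Scaling by \<open>t\<close> interchanges the two
  summands, except that an entry \<open>x\<close> of \<open>R\<close> turns into
  \<open>t * t * x\<close>, which is \<open>x\<close> conjugated by \<open>t\<close>.\<close>

lemma pfister_absorb:
 assumes t: "t : set ts" "t : symu" "!!s. s : set ts ==> t * s = s * t"
  and Q: "!!x. x \<in># pfister ts M ==> x : symu \<and> t * x = x * t"
 shows "isoM (image_mset ((*) t) (pfister ts M)) (pfister ts M)"
proof -
 define R where "R = pfister (remove1 t ts) M"
 have P: "pfister ts M = R + image_mset ((*) t) R" using pfister_front[OF t(1,3)] by (simp add: R_def)
 have R: "x : symu" "t * x : symu" "t * x = x * t" if "x \<in># R" for x using Q that unfolding P by auto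
 have "isoM (image_mset (\<lambda>x. x) R) (image_mset (\<lambda>x. t * (t * x)) R)"
 proof (rule isoM_image)
  fix x assume x: "x \<in># R"
  have "t * (t * x) = t * (x * t)" by (simp only: R(3)[OF x])
  then have "t * (t * x) = \<sigma> t * x * t" by (simp only: symu(2)[OF t(2)] mult.assoc)
  then show "isoM {#x#} {#t * (t * x)#}" using isoM_conj[OF R(1)[OF x], of t] symu[OF t(2)] by simp
 qed
 then have "isoM (image_mset (\<lambda>x. t * (t * x)) R) R" by (simp add: isoM_sym)
 moreover have "isoM (image_mset ((*) t) R) (image_mset ((*) t) R)" using R(2) by (intro isoM_refl) auto
 ultimately have "isoM (image_mset ((*) t) R + image_mset (\<lambda>x. t * (t * x)) R) (image_mset ((*) t) R + R)"
  using isoM_add by blast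
 then show ?thesis unfolding P by (simp add: multiset.map_comp comp_def add.commute)
qed

text \<open>A Pfister form absorbs its entries, so \<open>S\<close> may be replaced by the signs of its elements.\<close>

lemma pfister_absorb_signs:
 fixes S :: "'a multiset"
 assumes S: "!!h. h \<in># S ==> (if h : A then h else - h) : set ts"
  and ts: "!!t. t : set ts ==> t : symu" "!!t s. t : set ts ==> s : set ts ==> t * s = s * t"
  and Q: "!!x t. x \<in># pfister ts M ==> t : set ts ==> x : symu \<and> t * x = x * t" and M: "set_mset (pfister ts M) \<subseteq> symu"
 shows "isoM (\<Sum>h\<in>#S. image_mset ((*) h) (pfister ts M))
  (repeat_mset (npos A S) (pfister ts M) +
   repeat_mset (nneg A S) (image_mset uminus (pfister ts M)))"
 using S
proof (induction S)
 case empty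
 show ?case using isoM_refl[of "{#}"] by simp
next
 case (add h S)
 let ?Q = "pfister ts M"
 have IH: "isoM (\<Sum>h\<in>#S. image_mset ((*) h) ?Q)
  (repeat_mset (npos A S) ?Q + repeat_mset (nneg A S) (image_mset uminus ?Q))"
  using add by simp
 show ?case
 proof (cases "h : A")
  case True
  then have "h : set ts" using add.prems[of h] by simp
  then have "isoM (image_mset ((*) h) ?Q) ?Q" using ts Q by (intro pfister_absorb) auto
  then show ?thesis using isoM_add[OF _ IH] True by (simp add: add.assoc)
 next
  case False
  then have nh: "- h : set ts" using add.prems[of h] by simp
  have "isoM (image_mset ((*) (- h)) ?Q) ?Q"
   by (rule pfister_absorb[OF nh ts(1)[OF nh]]) (use ts(2)[OF nh] Q[OF _ nh] in blast)+
  from isoM_neg[OF this] have "isoM (image_mset ((*) h) ?Q) (image_mset uminus ?Q)"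
   by (simp add: multiset.map_comp comp_def)
  then show ?thesis using isoM_add[OF _ IH] False by (simp add: ac_simps)
 qed
qed

lemma isoM_pfister: assumes "isoM M N" "set ts \<subseteq> cunits" shows "isoM (pfister ts M) (pfister ts N)"
 using assms(2) by (induction ts) (auto intro!: isoM_add isoM_scale assms(1) simp: cunits_def)

lemma pfister_central: assumes "set_mset M \<subseteq> symu" "set ts \<subseteq> cunits" shows "set_mset (pfister ts M) \<subseteq> symu"
 using isoM_symu(1)[OF isoM_pfister[OF isoM_refl[OF assms(1)] assms(2)]] .

lemma sum_mset_pfister: "(!!h t. h \<in># S ==> t : set ts ==> h * t = t * h) ==>
  (\<Sum>h\<in>#S. image_mset ((*) h) (pfister ts {#a#})) = pfister ts (image_mset (\<lambda>h. h * a) S)"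
proof (induction S)
 case empty
 have "pfister ts {#} = {#}" by (induction ts) auto
 then show ?case by simp
next
 case (add h S)
 have "image_mset ((*) h) (pfister ts {#a#}) = pfister ts {#h * a#}"
  using pfister_image_left[of ts h "{#a#}"] add.prems[of h] by simp
 moreover have "(\<Sum>h\<in>#S. image_mset ((*) h) (pfister ts {#a#})) = pfister ts (image_mset (\<lambda>h. h * a) S)"
  using add.prems by (intro add.IH) auto
 moreover have "image_mset (\<lambda>h. h * a) (add_mset h S) = {#h * a#} + image_mset (\<lambda>h. h * a) S" by simp
 moreover have "(\<Sum>h\<in>#add_mset h S. image_mset ((*) h) (pfister ts {#a#})) =
   image_mset ((*) h) (pfister ts {#a#}) + (\<Sum>h\<in>#S. image_mset ((*) h) (pfister ts {#a#}))" by simp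
 ultimately show ?case by (simp only: pfister_union)
qed

end

context cent_form
begin

lemma sig_mset_size: "(\<Sum>j\<in>J. C.csgn (h j)) =
  int (npos \<P> (image_mset h (mset_set J))) - int (nneg \<P> (image_mset h (mset_set J)))"
 if "finite J" for J :: "nat set"
 using that by (induction J rule: finite_induct) (auto simp: C.csgn_def)

text \<open>Both diagonalisations have the same length, so equal signatures mean equally many
  positive and equally many negative entries.\<close>

lemma eta_signs:
 assumes cb: "cbasis a J w" and cb': "cbasis b K u" and ph: "phi a = phi b"
 shows "npos \<P> (image_mset (eta a w) (mset_set J)) = npos \<P> (image_mset (eta b u) (mset_set K))"
  "nneg \<P> (image_mset (eta a w) (mset_set J)) = nneg \<P> (image_mset (eta b u) (mset_set K))"
proof -
 have sz: "npos \<P> M + nneg \<P> M = size M" for M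
  by (simp flip: size_union multiset_partition)
 have c: "size (image_mset (eta a w) (mset_set J)) = size (image_mset (eta b u) (mset_set K))"
  using cbasis_card[OF cb cb'] by simp
 show "npos \<P> (image_mset (eta a w) (mset_set J)) = npos \<P> (image_mset (eta b u) (mset_set K))"
  "nneg \<P> (image_mset (eta a w) (mset_set J)) = nneg \<P> (image_mset (eta b u) (mset_set K))"
  using sz[of "image_mset (eta a w) (mset_set J)"] sz[of "image_mset (eta b u) (mset_set K)"] c ph
   cbasisD(9)[OF cb] cbasisD(9)[OF cb'] sig_mset_size[OF cbasisD(2)[OF cb], of "eta a w"] sig_mset_size[OF cbasisD(2)[OF cb'], of "eta b u"]
  by linarith+
qed

text \<open>Multiplying the diagonal forms of \<open>e\<close> and \<open>b\<close> by a Pfister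
  form that contains the absolute values of their entries leaves only the numbers of signs, and
  these agree. Transfer gives one form \<open>G\<close> over the base field such that
  \<open>G\<close> and \<open>G\<close> times \<open>b\<close> are isometric. The same absorption at
  \<open>T\<close> turns \<open>G\<close> into the integer \<open>p - q\<close> times a Pfister
  form, and positivity of the transferred signature makes this integer nonzero.\<close>

theorem torsion_if_phi_eq:
 assumes b: "b : symu" and ph: "phi e = phi b"
 shows "EX ts. set ts \<subseteq> T - {0} \<and> torsion (pfister (map (\<lambda>t. scale t e) ts) {#e, - b#})"
proof -
 obtain J w where ce: "cbasis e J w" using ex_cbasis[OF symu_e] .
 obtain K u where cb: "cbasis b K u" using ex_cbasis[OF b] .
 obtain f where f: "!!\<zeta>. \<zeta> : E ==> cas e J w \<zeta> = scale (f \<zeta>) e" using ex_transfer_functional[OF ce] by blast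
 have f_add: "f (x + y) = f x + f y" if "x : E" "y : E" for x y
  using f[OF that(1)] f[OF that(2)] f[OF E.add_closed[OF that]] cas_add by (intro scale_inj) (simp add: sc_plus)
 have f_scale: "f (scale c x) = c * f x" if "x : E" for c x
  using f[OF that] f[OF scale_E[OF that]] cas_scale by (intro scale_inj) (simp add: sc_sc)
 have J: "J ~= {}" using cbasisD(7)[OF ce e_closed] e_nz by auto
 have f_nz: "EX x:E. f x ~= 0"
 proof (rule ccontr)
  assume n: "\<not> ?thesis"
  have "(\<Sum>j\<in>J. w j * x * (E.dinv (eta e w j) * \<sigma> (w j))) = 0" if x: "x : E" for x
  proof -
   have "(\<Sum>j\<in>J. w j * x * (E.dinv (eta e w j) * \<sigma> (w j))) = cas e J w x"
    unfolding cas_def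
   proof (intro sum.cong refl)
    fix j assume "j : J"
    then have "x * E.dinv (eta e w j) = E.dinv (eta e w j) * x" using E_comm x dinv_E(1)[OF ce] by blast
    then show "w j * x * (E.dinv (eta e w j) * \<sigma> (w j)) = w j * E.dinv (eta e w j) * x * \<sigma> (w j)"
     by (metis mult.assoc)
   qed
   then show ?thesis using n f[OF x] x by (simp add: scale_zero)
  qed
  then have "ALL j:J. E.dinv (eta e w j) * \<sigma> (w j) = 0"
   by (intro dedekind_E[OF ce]) (use cbasisD(3)[OF ce] dinv_E(1)[OF ce] E_D star_closed mult_closed in auto)
  moreover obtain j where j: "j : J" using J by auto
  ultimately have "eta e w j * E.dinv (eta e w j) * \<sigma> (w j) = 0" by (simp add: mult.assoc)
  then have "\<sigma> (w j) = 0" using dinv_E(2)[OF ce j] cbasisD(3)[OF ce j] e_left[OF star_closed] by simp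
  then have "eta e w j = pr 0" by (simp add: eta_def)
  then show False using cbasisD(5)[OF ce j] pr_scale[of 0 0] by (simp add: scale_zero)
 qed
 interpret Y: transfer E e \<sigma> scale f T
  by unfold_locales (use f_add f_scale f_nz ordT in auto)
 define ab where "ab x = (if x : \<P> then x else - x)" for x
 \<comment> \<open>The absolute values of the diagonal entries of both forms are collected, so that
   one Pfister form absorbs the signs of either.\<close>
 define zs where "zs = map (\<lambda>j. ab (eta e w j)) (sorted_list_of_set J) @ map (\<lambda>k. ab (eta b u k)) (sorted_list_of_set K)"
 have fin: "finite J" "finite K" using cbasisD(2)[OF ce] cbasisD(2)[OF cb] by auto
 have zs_set: "set zs = (\<lambda>j. ab (eta e w j)) ` J \<union> (\<lambda>k. ab (eta b u k)) ` K" using fin by (simp add: zs_def)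
 have abp: "ab x : \<P> - {0}" if "x : E" "x ~= 0" for x using L_rules(4)[OF that(1)] that(2) by (auto simp: ab_def)
 have zsL: "set zs \<subseteq> \<P> - {0}" unfolding zs_set using abp cbasisD(4,5)[OF ce] cbasisD(4,5)[OF cb] by auto
 then have zsu: "set zs \<subseteq> E.units" using L_rules(1) by (auto simp: E.units_def)
 \<comment> \<open>\<open>v0\<close> corrects the functional \<open>f\<close>: with it the transfer
   of every Pfister form with positive entries has positive signature.\<close>
 obtain v0 where v0: "v0 : E.units" "!!zs. set zs \<subseteq> \<P> - {0} ==> 0 < (\<Sum>z\<in>#pfister zs {#e#}. Y.fsig (v0 * z))"
  using Y.ex_positive_transfer[OF ordL T_L] by blast
 define P where "P = pfister zs {#v0#}"
 have v0E: "v0 : E" using v0 E.units by auto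
 have P: "P = image_mset ((*) v0) (pfister zs {#e#})"
  unfolding P_def using pfister_image_left[of zs v0 "{#e#}"] zsu E.units E_comm[OF v0E] E.e_right[OF v0E] by (simp add: subset_iff)
 have Pu: "set_mset P \<subseteq> E.units" unfolding P_def using v0(1) zsu by (intro E.pfister_units) auto
 have pos: "0 < (\<Sum>z\<in>#P. Y.fsig z)" using v0(2)[OF zsL] by (simp add: P multiset.map_comp comp_def)
 have units_symu: "x : symu" if "x : E.units" for x using that E.units E_D E_sym by (intro symuI) auto
 have "ALL z:E.units. EX Nx. herm.basis (UNIV :: 'f set) 1 E (\<lambda>v c. scale c v) (Y.fform z) (fst Nx :: nat set) (snd Nx)"
 proof
  fix z assume "z : E.units"
  then interpret H: herm_cone "UNIV :: 'f set" 1 id T E "\<lambda>v c. scale c v" "Y.fform z" by (rule Y.fform_herm)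
  obtain N :: "nat set" and x where "H.basis N x" using H.ex_basis by auto
  then show "EX Nx. H.basis (fst Nx :: nat set) (snd Nx)" by (intro exI[of _ "(N, x)"]) simp
 qed
 from bchoice[OF this] obtain Nx where Nx: "!!z. z : E.units ==>
   herm.basis (UNIV :: 'f set) 1 E (\<lambda>v c. scale c v) (Y.fform z) (fst (Nx z) :: nat set) (snd (Nx z))" by blast
 define N x where "N z = fst (Nx z)" and "x z = snd (Nx z)" for z
 define Fm where "Fm z = image_mset (\<lambda>i. f (z * x z i * x z i)) (mset_set (N z))" for z
 have bz: "finite (N z)" "!!i. i : N z ==> x z i : E" "!!i. i : N z ==> f (z * x z i * x z i) ~= 0"
   "!!i j. i : N z ==> j : N z ==> i ~= j ==> f (z * x z i * x z j) = 0"
   "!!y. y : E ==> EX k. y = (\<Sum>i\<in>N z. scale (k i) (x z i))"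
   "Y.fsig z = (\<Sum>i\<in>N z. X.Tc.csgn (f (z * x z i * x z i)))" if z: "z : E.units" for z
 proof -
  interpret H: herm_cone "UNIV :: 'f set" 1 id T E "\<lambda>v c. scale c v" "Y.fform z" by (rule Y.fform_herm[OF z])
  have bs: "H.basis (N z) (x z)" using Nx[OF z] by (simp add: N_def x_def)
  note o = H.orthD[OF H.basis_orth[OF bs]]
  show "finite (N z)" "!!i. i : N z ==> x z i : E" "!!i. i : N z ==> f (z * x z i * x z i) ~= 0"
   "!!i j. i : N z ==> j : N z ==> i ~= j ==> f (z * x z i * x z j) = 0"
   using o by (auto simp: Y.fform_def)
  show "EX k. y = (\<Sum>i\<in>N z. scale (k i) (x z i))" if y: "y : E" for y
   using H.basis_spanning[OF bs] y unfolding EF.spanning_def by blast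
  show "Y.fsig z = (\<Sum>i\<in>N z. X.Tc.csgn (f (z * x z i * x z i)))"
   unfolding Y.fsig_def H.sig_eq[OF bs] by (simp add: Y.fform_def)
 qed
 have iso: "isoM (image_mset (\<lambda>j. z * eta a t j) (mset_set Q)) (image_mset (\<lambda>c. scale c (dinv a)) (Fm z))"
  if z: "z : E.units" and c: "cbasis a Q t" for z a Q t
  using transfer_isoM[OF ce f c z bz(1-5)[OF z]] by (simp add: Fm_def multiset.map_comp comp_def)
 \<comment> \<open>The diagonal entries in the base field of the transfer of the whole form
   \<open>P\<close>.\<close>
 define G where "G = (\<Sum>z\<in>#P. Fm z)"
 have Gnz: "c ~= 0" if "c \<in># G" for c
  using that bz(1,3) Pu unfolding G_def Fm_def by (auto simp: in_Union_mset_iff subset_iff)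
 have imG: "image_mset g G = (\<Sum>z\<in>#P. image_mset g (Fm z))" for g :: "'f => 'a"
  unfolding G_def by (induction P) auto
 have sumP: "isoM (\<Sum>h\<in>#image_mset (eta a t) (mset_set Q). image_mset ((*) h) P) (image_mset (\<lambda>c. scale c (dinv a)) G)"
  if c: "cbasis a Q t" for a Q t
 proof -
  have "isoM (\<Sum>z\<in>#P. image_mset (\<lambda>j. z * eta a t j) (mset_set Q)) (\<Sum>z\<in>#P. image_mset (\<lambda>c. scale c (dinv a)) (Fm z))"
   by (rule isoM_sum) (use iso[OF _ c] Pu in auto)
  also have "(\<Sum>z\<in>#P. image_mset (\<lambda>j. z * eta a t j) (mset_set Q)) = (\<Sum>z\<in>#P. image_mset (\<lambda>h. h * z) (image_mset (eta a t) (mset_set Q)))"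
  proof (intro arg_cong[of _ _ sum_mset] image_mset_cong)
   fix z assume z: "z \<in># P"
   have "z * eta a t j = eta a t j * z" if "j : Q" for j
    using E_comm[OF _ cbasisD(4)[OF c that], of z] Pu z E.units by auto
   then show "image_mset (\<lambda>j. z * eta a t j) (mset_set Q) = image_mset (\<lambda>h. h * z) (image_mset (eta a t) (mset_set Q))"
    using cbasisD(2)[OF c] by (auto simp: multiset.map_comp comp_def intro!: image_mset_cong)
  qed
  finally show ?thesis
   by (simp only: imG sum_mset_image_swap[where f = "(*)" and Q = P and H = "image_mset (eta a t) (mset_set Q)"])
 qed
 have zscomm: "t * s = s * t" if "t : set zs" "s : set zs" for s t using that zsu E.units E_comm by (meson subsetD)
 have signs: "isoM (\<Sum>h\<in>#image_mset (eta a t) (mset_set Q). image_mset ((*) h) P)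
   (repeat_mset (npos \<P> (image_mset (eta a t) (mset_set Q))) P +
    repeat_mset (nneg \<P> (image_mset (eta a t) (mset_set Q))) (image_mset uminus P))"
  if sub: "!!j. j : Q ==> ab (eta a t j) : set zs" and c: "cbasis a Q t" for a Q t
  unfolding P_def
 proof (rule pfister_absorb_signs)
  show "(if h : \<P> then h else - h) : set zs" if "h \<in># image_mset (eta a t) (mset_set Q)" for h
  proof -
   obtain j where "j : Q" "h = eta a t j" using \<open>h \<in># image_mset (eta a t) (mset_set Q)\<close> cbasisD(2)[OF c] by auto
   moreover from this have "ab h : set zs" using sub by simp
   ultimately show ?thesis unfolding ab_def by metis
  qed
  show "t : symu" if "t : set zs" for t using that zsu units_symu by auto
  show "set_mset (pfister zs {#v0#}) \<subseteq> symu" using Pu units_symu unfolding P_def by auto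
  show "y : symu \<and> t * y = y * t" if "y \<in># pfister zs {#v0#}" "t : set zs" for y t
   using that Pu zsu units_symu E.units E_comm unfolding P_def by (meson subsetD)
 qed (rule zscomm)
 \<comment> \<open>Both sides reduce to the same numbers of copies of \<open>P\<close> and of its
   negative.\<close>
 have "isoM (\<Sum>h\<in>#image_mset (eta e w) (mset_set J). image_mset ((*) h) P) (\<Sum>h\<in>#image_mset (eta b u) (mset_set K). image_mset ((*) h) P)"
 proof (rule isoM_trans)
  show "isoM (\<Sum>h\<in>#image_mset (eta e w) (mset_set J). image_mset ((*) h) P)
   (repeat_mset (npos \<P> (image_mset (eta e w) (mset_set J))) P +
    repeat_mset (nneg \<P> (image_mset (eta e w) (mset_set J))) (image_mset uminus P))"
   by (rule signs[OF _ ce]) (simp add: zs_set)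
  show "isoM (repeat_mset (npos \<P> (image_mset (eta e w) (mset_set J))) P +
    repeat_mset (nneg \<P> (image_mset (eta e w) (mset_set J))) (image_mset uminus P))
   (\<Sum>h\<in>#image_mset (eta b u) (mset_set K). image_mset ((*) h) P)"
   unfolding eta_signs[OF ce cb ph] by (rule isoM_sym[OF signs[OF _ cb]]) (simp add: zs_set)
 qed
 from isoM_trans[OF isoM_sym[OF sumP[OF ce]] isoM_trans[OF this sumP[OF cb]]]
 have G1: "isoM (image_mset (\<lambda>c. scale c (dinv e)) G) (image_mset (\<lambda>c. scale c (dinv b)) G)" .
 have bD: "b : D" "b ~= 0" "\<sigma> b = b" using b symu by auto
 \<comment> \<open>The entries with \<open>dinv b\<close> and with \<open>b\<close> differ by
   conjugation with \<open>b\<close>.\<close>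
 have "isoM (image_mset (\<lambda>c. scale c (dinv b)) G) (image_mset (\<lambda>c. scale c b) G)"
 proof (rule isoM_image)
  fix c assume c: "c \<in># G"
  have db: "dinv b : D" "\<sigma> (dinv b) = dinv b" "dinv b ~= 0" "b * dinv b = e" using dinv_closed star_dinv dinv_nz dinv_right bD by auto
  have "scale c (dinv b) : symu" using db sc_D scale_eq_0 Gnz[OF c] by (intro symuI) (auto simp: sc_star)
  moreover have "\<sigma> b * scale c (dinv b) * b = scale c b" using db bD e_left by (simp add: sc_left sc_right)
  ultimately show "isoM {#scale c (dinv b)#} {#scale c b#}" using isoM_conj[of "scale c (dinv b)" b] bD by simp
 qed
 moreover have "dinv e = e" using dinv_unique[OF e_closed e_closed] e_left[OF e_closed] by simp
 ultimately have G2: "isoM (image_mset (\<lambda>c. scale c e) G) (image_mset (\<lambda>c. scale c b) G)"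
  using isoM_trans[OF G1] by simp
 \<comment> \<open>Absolute values at \<open>T\<close> of the entries of \<open>G\<close>; as
   central units they form the Pfister form \<open>cs\<close> that absorbs the signs of
   \<open>G\<close>.\<close>
 define aT where "aT c = (if c : T then c else - c)" for c :: 'f
 obtain gs where gs: "mset gs = G" using ex_mset by blast
 define ts where "ts = map aT gs"
 have tsT: "set ts \<subseteq> T - {0}" unfolding ts_def using Gnz T_rules(3) by (auto simp: aT_def gs[symmetric])
 define cs where "cs = map (\<lambda>t. scale t e) ts"
 have csu: "set cs \<subseteq> cunits" using tsT scale_cunits by (auto simp: cs_def)
 define A where "A = (\<lambda>c. scale c e) ` T"
 define p q where "p = npos T G" and "q = nneg T G"
 have inA: "scale c e : A \<longleftrightarrow> c : T" for c using scale_inj by (auto simp: A_def)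
 have Gsig: "isoM (pfister cs (image_mset (\<lambda>c. scale c a) G)) (repeat_mset p (pfister cs {#a#}) + repeat_mset q (image_mset uminus (pfister cs {#a#})))"
  if a: "a : symu" for a
 proof -
  let ?S = "image_mset (\<lambda>c. scale c e) G"
  have sy: "set_mset (pfister cs {#a#}) \<subseteq> symu" using a csu by (intro pfister_central) auto
  have "isoM (\<Sum>h\<in>#?S. image_mset ((*) h) (pfister cs {#a#}))
   (repeat_mset (npos A ?S) (pfister cs {#a#}) + repeat_mset (nneg A ?S) (image_mset uminus (pfister cs {#a#})))"
  proof (rule pfister_absorb_signs)
   show "(if h : A then h else - h) : set cs" if h: "h \<in># ?S" for h
   proof -
    obtain c where c: "c \<in># G" "h = scale c e" using h by auto
    then have "scale (aT c) e : set cs" by (auto simp: cs_def ts_def gs[symmetric])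
    then show ?thesis using c inA by (auto simp: aT_def scale_neg)
   qed
   have cu: "t : cunits" if "t : set cs" for t using subsetD[OF csu that] .
   show "t : symu" if "t : set cs" for t using cunits(1)[OF cu[OF that]] .
   show "t * s = s * t" if "t : set cs" "s : set cs" for t s
    using cunits(2)[OF cu[OF that(1)] symu(1)[OF cunits(1)[OF cu[OF that(2)]]]] .
   show "y : symu \<and> t * y = y * t" if "y \<in># pfister cs {#a#}" "t : set cs" for y t
    using subsetD[OF sy that(1)] cunits(2)[OF cu[OF that(2)] symu(1)[OF subsetD[OF sy that(1)]]] by simp
   show "set_mset (pfister cs {#a#}) \<subseteq> symu" by (rule sy)
  qed
  moreover have "(\<Sum>h\<in>#?S. image_mset ((*) h) (pfister cs {#a#})) = pfister cs (image_mset (\<lambda>h. h * a) ?S)"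
   by (rule sum_mset_pfister) (auto simp: cs_def sc_left sc_right sc_sc mult.commute)
  moreover have "image_mset (\<lambda>h. h * a) ?S = image_mset (\<lambda>c. scale c a) G"
   using scale_e symu(1)[OF a] by (simp add: multiset.map_comp comp_def)
  moreover have "npos A ?S = p" "nneg A ?S = q"
   by (simp_all add: filter_mset_image_mset inA p_def q_def)
  ultimately show ?thesis by simp
 qed
 let ?N = "\<lambda>a. pfister cs {#a#}"
 \<comment> \<open>The difference \<open>p - q\<close> is the signature of \<open>G\<close> at
   \<open>T\<close>, which is the positive transferred signature of \<open>P\<close>.\<close>
 have pq: "q < p"
 proof -
  have "int (npos T (Fm z)) - int (nneg T (Fm z)) = Y.fsig z" if z: "z : E.units" for z
  proof -
   have "(\<Sum>i\<in>Q. X.Tc.csgn (g i)) = int (npos T (image_mset g (mset_set Q))) - int (nneg T (image_mset g (mset_set Q)))"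
    if "finite Q" for Q :: "nat set" and g :: "nat => 'f"
    using that by (induction Q rule: finite_induct) (auto simp: X.Tc.csgn_def)
   from this[OF bz(1)[OF z]] show ?thesis using bz(6)[OF z] by (simp add: Fm_def)
  qed
  then have "int (npos T (\<Sum>z\<in>#P. Fm z)) - int (nneg T (\<Sum>z\<in>#P. Fm z)) = (\<Sum>z\<in>#P. Y.fsig z)"
   using Pu
  proof (induction P)
   case (add z P)
   then show ?case by (simp add: algebra_simps)
  qed simp
  then show ?thesis using pos by (simp add: p_def q_def G_def)
 qed
 have X: "isoM (repeat_mset p (?N e) + repeat_mset q (image_mset uminus (?N e))) (repeat_mset p (?N b) + repeat_mset q (image_mset uminus (?N b)))"
  using isoM_trans[OF isoM_sym[OF Gsig[OF symu_e]] isoM_trans[OF isoM_pfister[OF G2 csu] Gsig[OF b]]] .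
 define H where "H = pfister cs {#e, - b#}"
 have negN: "image_mset uminus (pfister cs M) = pfister cs (image_mset uminus M)" for M
 proof (induction cs)
  case (Cons a cs)
  show ?case by (simp add: Cons.IH[symmetric] multiset.map_comp comp_def)
 qed simp
 have H: "H = ?N e + image_mset uminus (?N b)" using pfister_union[of cs "{#e#}" "{#- b#}"] negN[of "{#b#}"]
  by (simp add: H_def add_mset_commute)
 have nrep: "image_mset uminus (repeat_mset n M) = repeat_mset n (image_mset uminus M)" for n and M :: "'a multiset"
  by (induction n) auto
 have nn: "image_mset uminus (image_mset uminus M) = M" for M :: "'a multiset" by (simp add: multiset.map_comp comp_def)
 have radd: "repeat_mset n (M + N) = repeat_mset n M + repeat_mset n N" for n and M N :: "'a multiset"
  by (induction n) (auto simp: ac_simps)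
 have Hs: "set_mset H \<subseteq> symu" unfolding H_def using symu_e symu_neg[OF b] csu by (intro pfister_central) auto
 have hyp: "torsion (repeat_mset q (H + image_mset uminus H))"
  by (rule torsion_repeatI[OF torsion_diff[OF isoM_refl[OF Hs]]])
 \<comment> \<open>In the Witt group \<open>X\<close> equates \<open>p - q\<close> copies of the
   forms of \<open>e\<close> and of \<open>b\<close>, both multiplied by \<open>cs\<close>;
   \<open>H\<close> is the difference of these two forms.\<close>
 have "torsion (repeat_mset p H + repeat_mset q (image_mset uminus H))"
 proof -
  have nH: "image_mset uminus H = image_mset uminus (?N e) + ?N b" unfolding H image_mset_union nn ..
  have "image_mset uminus (repeat_mset p (?N b) + repeat_mset q (image_mset uminus (?N b)))
    = repeat_mset p (image_mset uminus (?N b)) + repeat_mset q (?N b)"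
   by (simp only: image_mset_union nrep nn)
  moreover have "repeat_mset p H + repeat_mset q (image_mset uminus H) = repeat_mset p (?N e) + repeat_mset q (image_mset uminus (?N e)) +
    (repeat_mset p (image_mset uminus (?N b)) + repeat_mset q (?N b))"
   unfolding nH unfolding H radd by (simp only: ac_simps)
  ultimately show ?thesis using torsion_diff[OF X] by simp
 qed
 also have "repeat_mset p H = repeat_mset (p - q) H + repeat_mset q H"
 proof -
  have "p - q + q = p" using pq by simp
  then show ?thesis using repeat_mset_distrib[of "p - q" q H] by (simp only:)
 qed
 finally have "torsion (repeat_mset (p - q) H + repeat_mset q (H + image_mset uminus H))"
  unfolding radd by (simp only: add.assoc)
 then have "torsion (repeat_mset (p - q) H)" using hyp by (rule torsion_cancel)
 then have "torsion H" by (rule torsion_repeat) (use pq in simp)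
 then show ?thesis using tsT unfolding H_def cs_def by blast
qed

end

section \<open>The local-global principle over the division algebra\<close>

context div_alg
begin

lemma scale_sfield: "sfield (range (\<lambda>c. scale c e)) e \<sigma>"
proof
 fix x y
 let ?K = "range (\<lambda>c. scale c e)"
 show "involution \<sigma>" by (rule inv)
 show "x : ?K ==> y : ?K ==> x + y : ?K" by (auto simp flip: sc_plus)
 show "x : ?K ==> - x : ?K" by (auto simp flip: scale_neg)
 show "x : ?K ==> y : ?K ==> x * y : ?K" by (auto simp: sc_left sc_right sc_sc e_left e_closed)
 show "e : ?K" using rangeI[of "\<lambda>c. scale c e" 1] by (simp add: sc_one)
 show "e ~= 0" "e + e ~= 0" using e_nz two_nz by auto
 show "x : ?K ==> e * x = x" "x : ?K ==> x * e = x" using sc_D e_closed by (auto simp: e_left e_right)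
 show "x : ?K ==> \<sigma> x : ?K" "x : ?K ==> \<sigma> x = x" by (auto simp: sc_star star_e)
 show "EX y:?K. x * y = e \<and> y * x = e" if x: "x : ?K" "x ~= 0"
 proof -
  obtain c where c: "x = scale c e" using x by auto
  then have "c ~= 0" using x(2) scale_zero by auto
  then show ?thesis using c by (intro bexI[of _ "scale (inverse c) e"]) (auto simp: sc_left sc_right sc_sc e_left e_closed sc_one)
 qed
qed

text \<open>Detection over the field of scalar multiples of \<open>e\<close>, with no Pfister
  entries allowed beforehand. The scaling \<open>z\<close> that comes with the ordering is a central
  unit, and scaling by it cannot destroy torsion.\<close>

lemma ex_base_ordering:
 assumes b: "b : symu" and nt: "\<not> torsion {#e, - b#}"
 shows "EX T. ordering_on (UNIV :: 'f set) T \<and>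
  (ALL ts. set ts \<subseteq> (\<lambda>c. scale c e) ` (T - {0}) --> \<not> torsion (pfister ts {#e, - b#}))"
proof -
 let ?K = "range (\<lambda>c. scale c e)"
 interpret K: sfield ?K e \<sigma> by (rule scale_sfield)
 have bD: "b : D" using b symu by auto
 interpret T: torsion_detect D e \<sigma> ?K b "{}"
  by unfold_locales (use b bD sc_D e_closed scale_e in auto)
 have "\<not> T.tT {#e, - b#}" using nt by (simp add: T.tT_def)
 from T.ex_detecting_ordering[OF this] obtain P where P: "ordering_on ?K P"
  "ALL zs. set zs \<subseteq> P - {0} --> (EX z:K.units. \<not> T.tT (T.hb (image_mset ((*) z) (pfister zs {#e#}))))"
  by (elim exE conjE) (rule that)
 define T where "T = {c. scale c e : P}"
 note o = ordering_onD[OF P(1)]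
 have "ordering_on UNIV T" unfolding ordering_on_def T_def
 proof (intro conjI ballI impI)
  fix c d assume "c : {c. scale c e : P}"
  then have c: "scale c e : P" by simp
  show "c + d : {c. scale c e : P}" "c * d : {c. scale c e : P}" if "d : {c. scale c e : P}"
   using o(2)[OF c, of "scale d e"] o(3)[OF c, of "scale d e"] that
   by (auto simp: sc_plus sc_left sc_right sc_sc e_left e_closed mult.commute)
  show "c = 0" if "- c : {c. scale c e : P}"
   using o(5)[OF c] that scale_eq_0[of c e] e_nz by (auto simp: scale_neg)
 next
  fix c :: 'f
  show "c : {c. scale c e : P} \<or> - c : {c. scale c e : P}" using o(4)[of "scale c e"] by (auto simp: scale_neg)
 qed simp
 moreover have "\<not> torsion (pfister ts {#e, - b#})" if ts: "set ts \<subseteq> (\<lambda>c. scale c e) ` (T - {0})" for ts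
 proof
  assume t: "torsion (pfister ts {#e, - b#})"
  have "set ts \<subseteq> P - {0}" using ts scale_eq_0 e_nz by (auto simp: T_def)
  then obtain z where z: "z : K.units" "\<not> T.tT (T.hb (image_mset ((*) z) (pfister ts {#e#})))" using P(2) by blast
  obtain c where c: "z = scale c e" "c ~= 0" using z(1) scale_zero unfolding K.units_def by auto
  have "z : cunits" using scale_cunits[OF c(2)] c(1) by simp
  then have "torsion (image_mset ((*) z) (pfister ts {#e, - b#}))"
   using torsion_scale[OF t] cunits by blast
  moreover have "T.hb {#e#} = {#e, - b#}" using bD e_left by (simp add: T.hb_def add_mset_commute)
  ultimately show False using z(2) T.torsion_tT by (simp add: T.hb_times T.hb_pfister)
 qed
 ultimately show ?thesis by blast
qed

lemma ex_max_comm: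
 assumes b: "b : symu" shows "EX E. b : E \<and> max_comm D e \<sigma> scale E"
proof -
 define A where "A = {E. E \<subseteq> {x : D. \<sigma> x = x} \<and> (ALL x:E. ALL y:E. x * y = y * x) \<and> b : E}"
 have "{b} : A" using b symu by (auto simp: A_def)
 moreover have "\<Union>\<C> : A" if c: "\<C> ~= {}" "subset.chain A \<C>" for \<C>
 proof -
  have CA: "\<C> \<subseteq> A" and tot: "!!U V. U : \<C> ==> V : \<C> ==> U \<subseteq> V \<or> V \<subseteq> U"
   using c(2) unfolding subset_chain_def by auto
  have "x * y = y * x" if xy: "x : \<Union>\<C>" "y : \<Union>\<C>" for x y
  proof -
   obtain U V where UV: "U : \<C>" "x : U" "V : \<C>" "y : V" using xy by auto
   then obtain W where "W : \<C>" "x : W" "y : W" using tot[OF UV(1,3)] by blast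
   then show ?thesis using CA unfolding A_def by blast
  qed
  moreover have "b : \<Union>\<C>" using c(1) CA unfolding A_def by blast
  moreover have "\<Union>\<C> \<subseteq> {x : D. \<sigma> x = x}" using CA unfolding A_def by blast
  ultimately show ?thesis unfolding A_def by blast
 qed
 ultimately obtain E where E: "E : A" "!!U. U : A ==> E \<subseteq> U ==> U = E"
  using subset_Zorn_nonempty[of A] by blast
 have "max_comm D e \<sigma> scale E"
 proof
  show "x : E ==> x : D" "x : E ==> \<sigma> x = x" "x : E ==> y : E ==> x * y = y * x" for x y
   using E(1) unfolding A_def by auto
  show "x : E" if x: "x : D" "\<sigma> x = x" "!!y. y : E ==> x * y = y * x" for x
  proof -
   have "insert x E : A" using E(1) x unfolding A_def by auto
   then show ?thesis using E(2)[of "insert x E"] by auto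
  qed
 qed
 then show ?thesis using E(1) unfolding A_def by blast
qed

text \<open>If \<open>b\<close> is not a sum of hermitian squares, an ordering \<open>T\<close> of
  the base field and then an ordering \<open>P\<close> of \<open>E\<close> detect this. The two
  compatibility conditions on \<open>P\<close> follow from detection itself: for an offending
  element \<open>t\<close> the entry \<open>- t\<close> would make the detected form vanish.\<close>

theorem sum_of_squares_if_linked:
 assumes b: "b : symu"
  and linked: "!!T p q. ordering_on (UNIV :: 'f set) T ==> p : tcone scale \<sigma> T D e ==> p ~= 0 ==>
   q : tcone scale \<sigma> T D b ==> q ~= 0 ==>
   (EX c. c : tcone scale \<sigma> T D p \<and> c : tcone scale \<sigma> T D q \<and> c ~= 0) \<or>
   (EX u. u : tcone scale \<sigma> T D p \<and> - u : tcone scale \<sigma> T D p \<and> u ~= 0) \<or>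
   (EX u. u : tcone scale \<sigma> T D q \<and> - u : tcone scale \<sigma> T D q \<and> u ~= 0)"
 shows "EX (n::nat) x. (ALL i<n. x i : D) \<and> b = (\<Sum>i<n. \<sigma> (x i) * x i)"
proof (rule torsion_sum_squares, rule ccontr)
 assume nt: "\<not> torsion {#e, - b#}"
 obtain T where T: "ordering_on (UNIV :: 'f set) T"
  and ntT: "!!ts. set ts \<subseteq> (\<lambda>c. scale c e) ` (T - {0}) ==> \<not> torsion (pfister ts {#e, - b#})"
  using ex_base_ordering[OF b nt] by blast
 obtain E where bE: "b : E" and mc: "max_comm D e \<sigma> scale E" using ex_max_comm[OF b] by blast
 interpret max_comm D e \<sigma> scale E by (rule mc)
 let ?T = "(\<lambda>c. scale c e) ` (T - {0})"
 interpret X: torsion_detect D e \<sigma> E b ?T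
  by unfold_locales (use E_D E_comm bE b scale_cunits in auto)
 have "\<not> X.tT {#e, - b#}" using ntT by (auto simp: X.tT_def)
 from X.ex_detecting_ordering[OF this] obtain P where P: "ordering_on E P"
  "ALL zs. set zs \<subseteq> P - {0} --> (EX z:E.units. \<not> X.tT (X.hb (image_mset ((*) z) (pfister zs {#e#}))))"
  by (elim exE conjE) (rule that)
 have o: "!!x y. x : P ==> y : P ==> x * y : P" "!!x. x : E ==> x : P \<or> - x : P" "0 : P"
  using ordering_onD[OF P(1)] ordering_onD(4)[OF P(1) E.zero_closed] by auto
 have pair: "torsion (X.hb {#z, - (w * z)#})" if z: "z : E.units" and c: "c : C" "c ~= 0" and w: "w = \<sigma> c * c" for z c w
 proof -
  have zE: "z : E" using z E.units by auto
  have "torsion (X.hb {#- (w * z), - (- z)#})"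
  proof (rule X.hb_pair[where c = c])
   show "- z : E.units" using z by simp
   show "c : D" "c ~= 0" "c * - z = - z * c" "c * b = b * c" using c C_D C_comm[OF c(1)] zE bE by auto
   show "\<sigma> c * c * - z = - (w * z)" by (simp add: w)
  qed
  then show ?thesis by (simp add: add_mset_commute)
 qed
 \<comment> \<open>If \<open>- t\<close> were positive, some \<langle>z, -tz\<rangle> would be
   detected. Yet multiplied by \<langle>1, t\<rangle>, an allowed factor, it is torsion: two entries
   cancel at once and the other two up to the square \<open>t * t\<close>.\<close>
 have T_P: "scale c e : P" if c: "c : T" for c
 proof (rule ccontr)
  assume n: "scale c e \<notin> P"
  define t where "t = scale c e"
  have c0: "c ~= 0" using n o(3) by (auto simp: scale_zero)
  have tE: "t : E" using scale_E[OF e_E] by (simp add: t_def)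
  have tnz: "t ~= 0" using scale_eq_0[of c e] c0 e_nz by (auto simp: t_def)
  have "- t : P - {0}" using o(2)[OF tE] n tnz by (auto simp: t_def)
  then obtain z where z: "z : E.units" "\<not> X.tT (X.hb (image_mset ((*) z) (pfister [- t] {#e#})))" using P(2)[rule_format, of "[- t]"] by auto
  have zE: "z : E" using z E.units by auto
  have zt: "z * t = t * z" using E_comm zE tE by simp
  have im: "image_mset ((*) z) (pfister [- t] {#e#}) = {#z, - (t * z)#}"
   using E.e_right zE tE E.mult_closed zt by (simp add: add_mset_commute)
  have 1: "torsion (X.hb {#t * z, - (t * z)#})"
  proof -
   have u: "t * z : E.units" using E.unitsI[OF tE tnz] z(1) by simp
   have "- (- (t * z) * b) = t * z * b" by simp
   then show ?thesis using torsion_add[OF torsion_hyp[OF X.units_symu[OF u]] torsion_hyp[OF X.units_b[OF u]]]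
    by (simp add: X.hb_def add_mset_commute)
  qed
  have 2: "torsion (X.hb {#z, - (t * t * z)#})"
   using pair[OF z(1) E_C[OF tE] tnz] E_sym[OF tE] by simp
  have "pfister [t] {#z, - (t * z)#} = {#t * z, - (t * z)#} + {#z, - (t * t * z)#}"
   by (simp add: mult.assoc add_mset_commute)
  then have "torsion (pfister [t] (X.hb {#z, - (t * z)#}))"
   using torsion_add[OF 1 2] X.hb_pfister[of "[t]" "{#z, - (t * z)#}"] X.hb_union by (simp only:)
  then have "X.tT (X.hb {#z, - (t * z)#})"
   unfolding X.tT_def using c c0 by (intro exI[of _ "[t]"]) (auto simp: t_def)
  then show False using z(2) im by simp
 qed
 \<comment> \<open>Here \<open>t = \<sigma> d * d\<close> where \<open>d\<close> commutes with
   \<open>z\<close> and \<open>b\<close>, so conjugation by \<open>d\<close> cancels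
   \<open>z\<close> against \<open>- (t * z)\<close> in both halves of \<open>hb\<close>.\<close>
 have norm_P: "\<sigma> d * d : P" if d: "d : C" for d
 proof (rule ccontr)
  assume n: "\<sigma> d * d \<notin> P"
  define t where "t = \<sigma> d * d"
  have d0: "d ~= 0" using n o(3) by auto
  have tE: "t : E" unfolding t_def using C.mult_closed[OF C_star[OF d] d] by (intro C_sym) (auto simp: star_mult)
  have tnz: "t ~= 0" unfolding t_def using mult_nz[OF star_closed[OF C_D[OF d]] C_D[OF d]] d0 by simp
  have "- t : P - {0}" using o(2)[OF tE] n tnz by (auto simp: t_def)
  then obtain z where z: "z : E.units" "\<not> X.tT (X.hb (image_mset ((*) z) (pfister [- t] {#e#})))" using P(2)[rule_format, of "[- t]"] by auto
  have zE: "z : E" using z E.units by auto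
  have zt: "z * t = t * z" using E_comm zE tE by simp
  have im: "image_mset ((*) z) (pfister [- t] {#e#}) = {#z, - (t * z)#}"
   using E.e_right zE tE E.mult_closed zt by (simp add: add_mset_commute)
  then show False using z(2) X.torsion_tT[OF pair[OF z(1) d d0 t_def]] by simp
 qed
 obtain L :: "'a => 'f" where L: "ALL x:E. ALL y:E. L (x + y) = L x + L y" "ALL x:E. ALL c. L (scale c x) = c * L x" "EX x:E. L x ~= 0"
  using ex_functional by blast
 interpret Y: transfer E e \<sigma> scale L T
  by unfold_locales (use sc_add sc_plus sc_sc sc_one sc_left sc_right scale_E ordering_char0[OF T] E_span L T in auto)
 interpret H: herm_cone "UNIV :: 'f set" 1 id T E "\<lambda>v c. scale c v" "Y.fform e" by (rule Y.fform_herm) simp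
 obtain I :: "nat set" and v where v: "H.basis I v" using H.ex_basis by auto
 note ov = H.orthD[OF H.basis_orth[OF v]]
 have fe: "Y.fform e x y = L (x * y)" if "x : E" for x y using E.e_left[OF that] by (simp add: Y.fform_def)
 have dinv: "Fs.dinv c = inverse c" if "c ~= 0" for c
  using that Fs.dinv_unique[of c "inverse c"] by simp
 interpret cent_form D e \<sigma> scale E T P L I v
 proof
  fix x i j
  show "ordering_on UNIV T" "ordering_on E P" by (fact T P(1))+
  show "!!c. c : T ==> scale c e : P" by (rule T_P)
  show "!!d. d : C ==> \<sigma> d * d : P" by (rule norm_P)
  show "!!x y. x : E ==> y : E ==> L (x + y) = L x + L y" "!!x c. x : E ==> L (scale c x) = c * L x" "EX x:E. L x ~= 0"
   using L by auto
  show "finite I" "i : I ==> v i : E" "i : I ==> L (v i * v i) ~= 0"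
   "i : I ==> j : I ==> i ~= j ==> L (v i * v j) = 0" using ov fe by auto
  show "x = (\<Sum>i\<in>I. scale (inverse (L (v i * v i)) * L (v i * x)) (v i))" if x: "x : E"
  proof -
   have "x = (\<Sum>i\<in>I. scale (Fs.dinv (Y.fform e (v i) (v i)) * Y.fform e (v i) x) (v i))"
    using v x unfolding H.basis_def by blast
   also have "\<dots> = (\<Sum>i\<in>I. scale (inverse (L (v i * v i)) * L (v i * x)) (v i))"
    using ov(2,3) fe dinv by (intro sum.cong) auto
   finally show ?thesis .
  qed
 qed
 have l: "linked e b" unfolding linked_def using assms(2)[OF T] by blast
 have "phi e = phi b"
  using phi_le_if_linked[OF symu_e b l] phi_le_if_linked[OF b symu_e linked_sym[OF l]] by simp
 then obtain ts where ts: "set ts \<subseteq> T - {0}" "torsion (pfister (map (\<lambda>t. scale t e) ts) {#e, - b#})"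
  using torsion_if_phi_eq[OF b] by blast
 have "set (map (\<lambda>t. scale t e) ts) \<subseteq> ?T" using ts(1) by auto
 then show False using ntT ts(2) by blast
qed

end

section \<open>Reduction to a division algebra\<close>

locale involution_algebra = algebra_with_involution scale \<sigma>
 for scale :: "'f::field => 'a::ring_1 => 'a" and \<sigma> +
 assumes two: "(1::'f) + 1 ~= 0"
begin

lemma inv_add: "\<sigma> (x + y) = \<sigma> x + \<sigma> y" and inv_mult: "\<sigma> (x * y) = \<sigma> y * \<sigma> x" and inv_inv [simp]: "\<sigma> (\<sigma> x) = x"
 using involution unfolding involution_def by auto

lemma inv_zero [simp]: "\<sigma> 0 = 0"
 using inv_add[of 0 0] by simp

lemma inv_neg: "\<sigma> (- x) = - \<sigma> x"
 using inv_add[of x "- x"] by (simp add: eq_neg_iff_add_eq_0 add.commute)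

lemma inv_diff: "\<sigma> (x - y) = \<sigma> x - \<sigma> y"
 using inv_add[of x "- y"] by (simp add: inv_neg)

lemma inv_one [simp]: "\<sigma> 1 = 1"
 using inv_mult[of 1 "\<sigma> 1"] by simp

lemma inv_scale: "\<sigma> (scale c x) = scale c (\<sigma> x)"
proof -
 have "scale c 1 : Sym \<sigma>" using base_field by blast
 then have "\<sigma> (scale c 1 * x) = \<sigma> x * scale c 1" by (simp add: inv_mult Sym_def)
 then show ?thesis by (simp add: scale_mult_left scale_mult_right)
qed

definition half :: 'a where "half = scale (inverse (1 + 1)) 1"

lemma half: "half + half = 1" "half * x = x * half" "\<sigma> half = half"
proof -
 define k where "k = inverse (1 + 1 :: 'f)"
 have "k + k = k * (1 + 1)" by (simp only: distrib_left mult_1_right)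
 also have "\<dots> = 1" unfolding k_def by (rule left_inverse[OF two])
 finally show "half + half = 1" unfolding half_def k_def[symmetric] scale_left_distrib[symmetric] by simp
qed (simp_all add: half_def scale_mult_left scale_mult_right inv_scale)

lemma add_self: fixes x :: 'a assumes "x + x = 0" shows "x = 0"
proof -
 have "x = (half + half) * x" by (simp add: half(1))
 also have "\<dots> = half * (x + x)" by (simp add: distrib_left distrib_right)
 finally show ?thesis using assms by simp
qed

lemma ideal_generated:
 fixes x a :: 'a
 assumes "x ~= 0" shows "EX l. a = (\<Sum>(p, q)\<leftarrow>l. p * x * q)"
proof -
 define I where "I = {a. EX l. a = (\<Sum>(p, q)\<leftarrow>l. p * x * q)}"
 have "two_sided_ideal I" unfolding two_sided_ideal_def
 proof (intro conjI ballI allI)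
  show "0 : I" unfolding I_def by (auto intro: exI[of _ "[]"])
  fix u assume "u : I"
  then obtain l where l: "u = (\<Sum>(p, q)\<leftarrow>l. p * x * q)" by (auto simp: I_def)
  show "u + w : I" if w: "w : I" for w
  proof -
   obtain m where "w = (\<Sum>(p, q)\<leftarrow>m. p * x * q)" using w by (auto simp: I_def)
   then have "u + w = (\<Sum>(p, q)\<leftarrow>l @ m. p * x * q)" by (simp add: l)
   then show ?thesis unfolding I_def by blast
  qed
  fix a
  have "a * (\<Sum>(p, q)\<leftarrow>l. p * x * q) = (\<Sum>(p, q)\<leftarrow>map (\<lambda>(p, q). (a * p, q)) l. p * x * q)"
   by (induction l) (auto simp: distrib_left mult.assoc)
  then show "a * u : I" unfolding I_def l by blast
  have "(\<Sum>(p, q)\<leftarrow>l. p * x * q) * a = (\<Sum>(p, q)\<leftarrow>map (\<lambda>(p, q). (p, q * a)) l. p * x * q)"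
   by (induction l) (auto simp: distrib_right mult.assoc)
  then show "u * a : I" unfolding I_def l by blast
 qed
 from simple[OF this] have "I = {0} \<or> I = UNIV" .
 moreover have "x : I" unfolding I_def by (auto intro!: exI[of _ "[(1, 1)]"])
 ultimately have "a : I" using assms by auto
 then show ?thesis by (simp add: I_def)
qed

definition hsq :: "'a set" where "hsq = {b. EX xs. b = (\<Sum>x\<leftarrow>xs. \<sigma> x * x)}"

lemma hsq_zero: "0 : hsq"
 unfolding hsq_def by (auto intro: exI[of _ "[]"])

lemma hsq_square: "\<sigma> x * x : hsq"
 unfolding hsq_def by (auto intro!: exI[of _ "[x]"])

lemma hsq_add: assumes "a : hsq" "b : hsq" shows "a + b : hsq"
proof -
 obtain xs ys where "a = (\<Sum>x\<leftarrow>xs. \<sigma> x * x)" "b = (\<Sum>x\<leftarrow>ys. \<sigma> x * x)" using assms by (auto simp: hsq_def)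
 then have "a + b = (\<Sum>x\<leftarrow>xs @ ys. \<sigma> x * x)" by simp
 then show ?thesis unfolding hsq_def by blast
qed

lemma hsq_sum: "(!!i. i : I ==> f i : hsq) ==> (\<Sum>i\<in>I. f i) : hsq"
 by (induction I rule: infinite_finite_induct) (auto intro: hsq_add hsq_zero)

lemma hsq_conj: assumes "b : hsq" shows "\<sigma> a * b * a : hsq"
proof -
 obtain xs where xs: "b = (\<Sum>x\<leftarrow>xs. \<sigma> x * x)" using assms by (auto simp: hsq_def)
 have "\<sigma> a * (\<Sum>x\<leftarrow>xs. \<sigma> x * x) * a = (\<Sum>x\<leftarrow>map (\<lambda>x. x * a) xs. \<sigma> x * x)"
  by (induction xs) (auto simp: distrib_left distrib_right inv_mult mult.assoc)
 then show ?thesis unfolding hsq_def xs by blast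
qed

lemma hsq_iff: "b : hsq \<longleftrightarrow> (EX (s::nat) x. b = (\<Sum>i=1..s. \<sigma> (x i) * x i))"
proof
 assume "b : hsq"
 then obtain xs where xs: "b = (\<Sum>x\<leftarrow>xs. \<sigma> x * x)" by (auto simp: hsq_def)
 have "b = (\<Sum>i=0..<length xs. \<sigma> (xs ! i) * xs ! i)" unfolding xs by (simp add: sum_list_sum_nth)
 also have "\<dots> = (\<Sum>i=1..length xs. \<sigma> (xs ! (i - 1)) * xs ! (i - 1))"
  by (rule sum.reindex_bij_witness[of _ "\<lambda>i. i - 1" Suc]) auto
 finally show "EX (s::nat) x. b = (\<Sum>i=1..s. \<sigma> (x i) * x i)" by (intro exI[of _ "length xs"] exI[of _ "\<lambda>i. xs ! (i - 1)"])
next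
 assume "EX (s::nat) x. b = (\<Sum>i=1..s. \<sigma> (x i) * x i)"
 then obtain s :: nat and x where "b = (\<Sum>i=1..s. \<sigma> (x i) * x i)" by blast
 then show "b : hsq" by (simp only:) (intro hsq_sum hsq_square)
qed

text \<open>By simplicity \<open>half\<close> is a sum of terms \<open>p * x * q\<close>. The
  squares of \<open>x * q * (a - R) + \<sigma> p\<close> lose their part quadratic in
  \<open>x\<close> because \<open>\<sigma> x * x = 0\<close>, and their cross terms add up to
  \<open>a - R\<close>.\<close>

lemma isotropic_hsq:
 assumes x: "x ~= 0" "\<sigma> x * x = 0" and a: "\<sigma> a = a" shows "a : hsq"
proof -
 obtain l where l: "half = (\<Sum>(p, q)\<leftarrow>l. p * x * q)" using ideal_generated[OF x(1)] by blast
 \<comment> \<open>The terms \<open>p * \<sigma> p\<close> that remain after squaring are subtracted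
   from \<open>a\<close> in advance.\<close>
 define R where "R = (\<Sum>(p, q)\<leftarrow>l. p * \<sigma> p)"
 have R: "\<sigma> R = R" unfolding R_def by (induction l) (auto simp: inv_add inv_mult)
 define F where "F = (\<lambda>(p, q). x * q * (a - R) + \<sigma> p)"
 define G where "G = (\<lambda>(p, q). p * x * q)"
 have sq: "\<sigma> (F c) * F c = (a - R) * \<sigma> (G c) + G c * (a - R) + (case c of (p, q) => p * \<sigma> p)" for c
 proof -
  obtain p q where c: "c = (p, q)" by (cases c)
  have "\<sigma> (x * q * (a - R) + \<sigma> p) = (a - R) * \<sigma> q * \<sigma> x + p"
   using a R by (simp add: inv_add inv_mult inv_diff mult.assoc)
  then have "\<sigma> (x * q * (a - R) + \<sigma> p) * (x * q * (a - R) + \<sigma> p) =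
    (a - R) * \<sigma> q * (\<sigma> x * x) * q * (a - R) + (a - R) * \<sigma> q * \<sigma> x * \<sigma> p + p * (x * q * (a - R)) + p * \<sigma> p"
   by (simp only: distrib_left distrib_right mult.assoc add.assoc add.commute add.left_commute)
  then show ?thesis using x(2) by (simp add: c F_def G_def inv_mult mult.assoc)
 qed
 have "(\<Sum>y\<leftarrow>map F l. \<sigma> y * y) = (a - R) * \<sigma> (\<Sum>c\<leftarrow>l. G c) + (\<Sum>c\<leftarrow>l. G c) * (a - R) + (\<Sum>c\<leftarrow>l. case c of (p, q) => p * \<sigma> p)"
  by (induction l) (simp_all add: sq inv_add distrib_left distrib_right)
 also have "\<dots> = (a - R) * half + half * (a - R) + R" using l half(3) by (simp add: G_def R_def)
 also have "\<dots> = (half + half) * (a - R) + R" unfolding distrib_right half(2)[of "a - R"] ..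
 also have "\<dots> = a" by (simp add: half(1))
 finally show ?thesis unfolding hsq_def by (intro CollectI exI[of _ "map F l"]) simp
qed

lemma F_star: "star_div (UNIV :: 'f set) 1 id"
 using two by unfold_locales (auto simp: involution_def mult.commute intro: exI[of _ "inverse _"] right_inverse)

lemma F_smod:
 assumes "0 : M" "!!x y. x : M ==> y : M ==> x + y : M" "!!x c. x : M ==> scale c x : M"
 shows "smod (UNIV :: 'f set) 1 id M (\<lambda>v c. scale c v)"
 by (intro smod.intro smod_axioms.intro F_star) (use assms in \<open>auto simp: scale_right_distrib scale_left_distrib mult.commute\<close>)

lemma UNIV_span: "EX (I::nat set) b. smod.spanning (UNIV :: 'f set) (UNIV :: 'a set) (\<lambda>v c. scale c v) I b"
proof -
 interpret M: smod "UNIV :: 'f set" 1 id "UNIV :: 'a set" "\<lambda>v c. scale c v" by (rule F_smod) auto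
 obtain B where B: "finite B" "span B = UNIV" using finite_dim by auto
 obtain g where g: "bij_betw g {0..<card B} B" using ex_bij_betw_nat_finite[OF B(1)] by auto
 have "M.spanning {0..<card B} g"
  unfolding M.spanning_def
 proof (intro conjI ballI)
  fix x :: 'a
  have "x : range (\<lambda>u. \<Sum>v\<in>B. scale (u v) v)" using span_finite[OF B(1)] B(2) by auto
  then obtain u where "x = (\<Sum>v\<in>B. scale (u v) v)" by auto
  also have "\<dots> = (\<Sum>i\<in>{0..<card B}. scale (u (g i)) (g i))" using sum.reindex_bij_betw[OF g, of "\<lambda>v. scale (u v) v"] by simp
  finally show "EX k. (ALL i:{0..<card B}. k i : UNIV) \<and> x = (\<Sum>i\<in>{0..<card B}. scale (k i) (g i))" by auto
 qed auto
 then show ?thesis by blast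
qed

text \<open>Dimensions of subspaces, used only as a measure for termination.\<close>

lemma ex_dim: "EX d :: 'a set => nat. (ALL U V. subspace U --> subspace V --> U \<subset> V --> d U < d V) \<and> (ALL V. subspace V --> d V \<le> d UNIV)"
proof -
 obtain B where B: "finite B" "span B = UNIV" using finite_dim by auto
 obtain B' where B': "B' \<subseteq> B" "independent B'" "span B' = span B"
  using maximal_independent_subset[of B] by (metis span_eq span_superset subset_trans)
 interpret V: finite_dimensional_vector_space scale B'
  using B B' finite_subset by unfold_locales auto
 show ?thesis
 proof (intro exI[of _ dim] conjI allI impI)
  fix U V :: "'a set" assume "subspace U" "subspace V" "U \<subset> V"
  then show "dim U < dim V" using V.dim_psubset[of U V] by (simp add: span_eq_iff[THEN iffD2])
 next
  fix V :: "'a set" assume "subspace V"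
  show "dim V \<le> dim (UNIV :: 'a set)" by (rule V.dim_subset) simp
 qed
qed

lemma powers_dependent:
 fixes y :: 'a
 obtains N :: nat and c where "EX i<=N. c i ~= (0::'f)" "(\<Sum>i\<le>N. scale (c i) (y ^ Suc i)) = 0"
proof -
 interpret M: smod "UNIV :: 'f set" 1 id "UNIV :: 'a set" "\<lambda>v c. scale c v" by (rule F_smod) auto
 obtain I :: "nat set" and b where sp: "M.spanning I b" using UNIV_span by auto
 have "EX c. (ALL j:{..card I}. c j : UNIV) \<and> (EX j:{..card I}. c j ~= (0::'f)) \<and> (\<Sum>j\<in>{..card I}. scale (c j) (y ^ Suc j)) = 0"
  by (rule M.spanning_dependent[OF sp]) auto
 then show ?thesis using that by (auto simp: Bex_def simp del: power_Suc)
qed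

end

section \<open>Minimal symmetric idempotents of an anisotropic algebra\<close>

locale anisotropic_algebra = involution_algebra scale \<sigma>
 for scale :: "'f::field => 'a::ring_1 => 'a" and \<sigma> +
 assumes anisotropic: "\<sigma> x * x = 0 ==> x = 0"
begin

text \<open>Fitting's lemma for symmetric elements: \<open>y\<close> and \<open>y\<^sup>2\<close> have the same kernel.\<close>

lemma symmetric_regular:
 assumes y: "\<sigma> y = y" shows "EX g. \<sigma> g = g \<and> y * g = g * y \<and> y = y * y * g"
proof -
 have ker: "y * z = 0" if "y * (y * z) = 0" for z
  using anisotropic[of "y * z"] that y by (simp add: inv_mult mult.assoc)
 have ker_pow: "y * z = 0" if "y ^ Suc k * z = 0" for k z
  using that
 proof (induction k)
  case (Suc k)
  have "y * (y * (y ^ k * z)) = 0" using Suc.prems by (simp add: mult.assoc)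
  then have "y ^ Suc k * z = 0" using ker by (simp add: mult.assoc)
  then show ?case by (rule Suc.IH)
 qed simp
 obtain N :: nat and c where c: "EX i<=N. c i ~= (0::'f)" "(\<Sum>i\<le>N. scale (c i) (y ^ Suc i)) = 0" by (rule powers_dependent)
 \<comment> \<open>The lowest nonzero coefficient of the relation: its power of \<open>y\<close>
   factors out, and \<open>ker_pow\<close> lowers that power to \<open>y\<close> itself.\<close>
 define m where "m = (LEAST i. i \<le> N \<and> c i ~= 0)"
 have m: "m \<le> N" "c m ~= 0" using LeastI_ex[OF c(1)] unfolding m_def by auto
 have lt: "c i = 0" if "i < m" for i using not_less_Least[OF that[unfolded m_def]] that m(1) by simp
 define g where "g = scale (- inverse (c m)) (\<Sum>i\<in>{m<..N}. scale (c i) (y ^ (i - Suc m)))"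
 have sp: "\<sigma> (y ^ k) = y ^ k" for k by (induction k) (auto simp: inv_mult y power_commutes)
 have ss: "\<sigma> (\<Sum>i\<in>I. f i) = (\<Sum>i\<in>I. \<sigma> (f i))" for I :: "nat set" and f
  by (induction I rule: infinite_finite_induct) (auto simp: inv_add)
 have sg: "\<sigma> g = g" by (simp add: g_def inv_scale inv_neg ss sp)
 have com: "y * g = g * y"
  by (simp add: g_def scale_mult_left scale_mult_right sum_distrib_left sum_distrib_right power_commutes)
 have "0 = (\<Sum>i\<in>{m..N}. scale (c i) (y ^ Suc i))"
  unfolding c(2)[symmetric] using lt by (intro sum.mono_neutral_right) auto
 also have "{m..N} = insert m {m<..N}" using m by auto
 also have "(\<Sum>i\<in>insert m {m<..N}. scale (c i) (y ^ Suc i)) = scale (c m) (y ^ Suc m) + (\<Sum>i\<in>{m<..N}. scale (c i) (y ^ Suc i))"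
  by (subst sum.insert) auto
 also have "(\<Sum>i\<in>{m<..N}. scale (c i) (y ^ Suc i)) = y ^ Suc m * (y * (\<Sum>i\<in>{m<..N}. scale (c i) (y ^ (i - Suc m))))"
  unfolding sum_distrib_left
 proof (intro sum.cong refl)
  fix i assume "i : {m<..N}"
  then have "Suc i = Suc m + Suc (i - Suc m)" by auto
  then have "y ^ Suc i = y ^ Suc m * (y * y ^ (i - Suc m))" by (simp only: power_add power_Suc)
  then show "scale (c i) (y ^ Suc i) = y ^ Suc m * (y * scale (c i) (y ^ (i - Suc m)))" by (simp add: scale_mult_right)
 qed
 finally have z: "y ^ Suc m * (scale (c m) 1 + y * (\<Sum>i\<in>{m<..N}. scale (c i) (y ^ (i - Suc m)))) = 0"
  by (simp add: distrib_left scale_mult_right)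
 have "y * (scale (c m) 1 + y * (\<Sum>i\<in>{m<..N}. scale (c i) (y ^ (i - Suc m)))) = 0" by (rule ker_pow[OF z])
 then have "scale (c m) y = - (y * (y * (\<Sum>i\<in>{m<..N}. scale (c i) (y ^ (i - Suc m)))))"
  by (simp add: distrib_left scale_mult_right eq_neg_iff_add_eq_0)
 then have "scale (inverse (c m)) (scale (c m) y) = scale (inverse (c m)) (- (y * (y * (\<Sum>i\<in>{m<..N}. scale (c i) (y ^ (i - Suc m))))))"
  by simp
 then have "y = y * y * g" using m(2) by (simp add: g_def scale_mult_right mult.assoc)
 then show ?thesis using sg com by blast
qed

lemma right_ideal_subspace: "subspace (range ((*) f))"
proof -
 have "scale c (f * x) = f * scale c x" for c x by (simp add: scale_mult_right)
 then show ?thesis unfolding subspace_def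
  by (auto simp flip: distrib_left intro: range_eqI[of _ _ 0])
qed

text \<open>Take a symmetric idempotent \<open>f\<close> with smallest right ideal. For nonzero
  \<open>x\<close> in its corner, \<open>\<sigma> x * x\<close> is symmetric and nonzero by
  anisotropy, and \<open>symmetric_regular\<close> turns it into a nonzero symmetric idempotent
  \<open>h\<close> whose right ideal lies in that of \<open>f\<close>. Minimality gives
  \<open>h = f\<close>, from which a left inverse of \<open>x\<close> is read off.\<close>

lemma ex_division_corner:
 "EX f. \<sigma> f = f \<and> f * f = f \<and> f ~= 0 \<and> (ALL x. x ~= 0 --> f * x * f = x --> (EX y. f * y * f = y \<and> x * y = f \<and> y * x = f))"
proof -
 obtain d :: "'a set => nat" where d: "!!U V. subspace U ==> subspace V ==> U \<subset> V ==> d U < d V"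
  using ex_dim by blast
 define I where "I f \<longleftrightarrow> \<sigma> f = f \<and> f * f = f \<and> f ~= 0" for f
 have "I 1" by (simp add: I_def)
 define f where "f = (ARG_MIN (\<lambda>f. d (range ((*) f))) f. I f)"
 have f: "I f" and min: "!!g. I g ==> d (range ((*) f)) \<le> d (range ((*) g))"
  using arg_min_nat_lemma[of I 1 "\<lambda>f. d (range ((*) f))"] \<open>I 1\<close> unfolding f_def by auto
 have ff: "\<sigma> f = f" "f * f = f" "f ~= 0" using f by (auto simp: I_def)
 have left: "EX y. f * y * f = y \<and> y * x = f" if x: "x ~= 0" "f * x * f = x" for x
 proof -
  have fx: "f * x = x" by (subst (1 2) x(2)[symmetric]) (simp add: ff(2) flip: mult.assoc)
  have xf: "x * f = x" by (subst (1 2) x(2)[symmetric]) (simp add: mult.assoc ff(2))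
  define y where "y = \<sigma> x * x"
  have y: "\<sigma> y = y" by (simp add: y_def inv_mult)
  have ynz: "y ~= 0" using anisotropic[of x] x(1) by (simp add: y_def, blast)
  have fy: "f * y = y" "y * f = y"
  proof -
   show "y * f = y" using xf by (simp add: y_def mult.assoc)
   then have "\<sigma> (y * f) = \<sigma> y" by simp
   then show "f * y = y" using y ff by (simp add: inv_mult)
  qed
  obtain g where g: "\<sigma> g = g" "y * g = g * y" "y = y * y * g" using symmetric_regular[OF y] by blast
  define h where "h = y * g"
  have yh: "y * h = y" using g(3) by (simp add: h_def mult.assoc)
  have "I h" unfolding I_def
  proof (intro conjI)
   show "\<sigma> h = h" using g y by (simp add: h_def inv_mult)
   have "h * h = g * (y * h)" by (simp add: h_def g(2) mult.assoc)
   then show "h * h = h" using yh g(2) by (simp add: h_def)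
   show "h ~= 0" using yh ynz by auto
  qed
  have fh: "f * h = h" using fy by (simp add: h_def flip: mult.assoc)
  have sub: "range ((*) h) \<subseteq> range ((*) f)"
  proof
   fix z assume "z : range ((*) h)"
   then obtain w where "z = h * w" by auto
   then have "z = f * (h * w)" using fh by (simp flip: mult.assoc)
   then show "z : range ((*) f)" by blast
  qed
  have "range ((*) h) = range ((*) f)"
  proof (rule ccontr)
   assume "range ((*) h) ~= range ((*) f)"
   then have "d (range ((*) h)) < d (range ((*) f))" using sub by (intro d right_ideal_subspace) auto
   then show False using min[OF \<open>I h\<close>] by simp
  qed
  then have "f : range ((*) h)" using ff(2) by (metis rangeI)
  then obtain w where "f = h * w" by auto
  then have hf: "h * f = f" using \<open>I h\<close> by (simp add: I_def flip: mult.assoc)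
  have "\<sigma> (f * h) = \<sigma> h" using fh by simp
  then have "h * f = h" using ff(1) \<open>I h\<close> by (simp add: inv_mult I_def)
  then have hF: "y * g = f" using hf by (simp add: h_def)
  show ?thesis
  proof (intro exI[of _ "f * g * \<sigma> x * f"] conjI)
   have "f * (f * g * \<sigma> x * f) * f = (f * f) * g * \<sigma> x * (f * f)" by (simp only: mult.assoc)
   then show "f * (f * g * \<sigma> x * f) * f = f * g * \<sigma> x * f" using ff(2) by simp
   have "f * g * \<sigma> x * f * x = f * (g * y)" using fx by (simp add: y_def mult.assoc)
   also have "\<dots> = f" using hF g(2) ff(2) by simp
   finally show "f * g * \<sigma> x * f * x = f" .
  qed
 qed
 \<comment> \<open>A left inverse \<open>z\<close> of the left inverse \<open>y\<close> coincides
   with \<open>x\<close>, so the inverse is two-sided.\<close>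
 have "EX y. f * y * f = y \<and> x * y = f \<and> y * x = f" if x: "x ~= 0" "f * x * f = x" for x
 proof -
  obtain y where y: "f * y * f = y" "y * x = f" using left[OF x] by auto
  have "y ~= 0" using y(2) ff(3) by auto
  then obtain z where z: "f * z * f = z" "z * y = f" using left y(1) by blast
  have "z * f = z" by (subst (1 2) z(1)[symmetric]) (simp add: mult.assoc ff(2))
  then have "z = z * y * x" using y(2) by (simp add: mult.assoc)
  also have "\<dots> = f * x" using z(2) by simp
  also have "\<dots> = x" by (subst (1 2) x(2)[symmetric]) (simp add: ff(2) flip: mult.assoc)
  finally have "z = x" .
  then show ?thesis using y z by auto
 qed
 then show ?thesis using ff by blast
qed

end

lemma (in involution_algebra) half_form:
 fixes x :: 'a assumes "x = - x" shows "x = 0"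
proof (rule add_self)
 have "x + x = x + - x" using assms by simp
 then show "x + x = 0" by simp
qed

section \<open>The division algebra cut out by the idempotent\<close>

locale corner_algebra = anisotropic_algebra scale \<sigma>
 for scale :: "'f::field => 'a::ring_1 => 'a" and \<sigma> +
 fixes f :: 'a
 assumes star_f: "\<sigma> f = f" and f_idem: "f * f = f" and f_nz: "f ~= 0"
  and f_inverse: "x ~= 0 ==> f * x * f = x ==> EX y. f * y * f = y \<and> x * y = f \<and> y * x = f"
begin

definition corner :: "'a set" where "corner = {x. f * x * f = x}"

lemma cornerI: "f * x * f : corner"
proof -
 have "f * (f * x * f) * f = (f * f) * x * (f * f)" by (simp only: mult.assoc)
 then show ?thesis by (simp add: corner_def f_idem)
qed

lemma corner_iff: "x : corner \<longleftrightarrow> f * x = x \<and> x * f = x"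
proof
 assume x: "x : corner"
 have "f * (f * x * f) = f * f * x * f" "(f * x * f) * f = f * x * (f * f)" by (simp_all only: mult.assoc)
 then show "f * x = x \<and> x * f = x" using x by (simp add: corner_def f_idem)
qed (simp add: corner_def)

lemma corner_star: "x : corner ==> \<sigma> x : corner"
 by (simp add: corner_def) (metis inv_mult star_f mult.assoc)

lemma corner_conj: assumes "v * f = v" "w * f = w" shows "\<sigma> v * c * w : corner"
proof -
 have "f * \<sigma> v = \<sigma> v" using inv_mult[of v f] assms(1) star_f by simp
 then show ?thesis using assms(2) unfolding corner_iff by (simp add: mult.assoc flip: mult.assoc[of f "\<sigma> v"])
qed

lemma sum_list_conj: "a * (\<Sum>(p, q)\<leftarrow>l. p * x * q) * b = (\<Sum>(p, q)\<leftarrow>l. a * (p * x * q) * (b :: 'a))"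
 by (induction l) (auto simp: distrib_left distrib_right)

lemma sum_list_0: "(!!p q. g (p, q) = (0::'a)) ==> (\<Sum>z\<leftarrow>l. g z) = 0"
 by (induction l) auto

text \<open>The ideal generated by \<open>f\<close> contains 1, which may be inserted between
  \<open>a\<close> and \<open>b\<close>.\<close>

lemma corner_detect:
 assumes "!!p q. a * p * f * q * b = 0" shows "a * b = (0 :: 'a)"
proof -
 obtain l where l: "1 = (\<Sum>(p, q)\<leftarrow>l. p * f * q)" using ideal_generated[OF f_nz] by blast
 have "a * b = a * (\<Sum>(p, q)\<leftarrow>l. p * f * q) * b" using l by simp
 also have "\<dots> = (\<Sum>(p, q)\<leftarrow>l. a * (p * f * q) * b)" by (rule sum_list_conj)
 also have "\<dots> = 0" using assms by (intro sum_list_0) (simp add: mult.assoc)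
 finally show ?thesis .
qed

text \<open>If \<open>\<sigma> v * c * v\<close> always vanishes, then the form \<open>\<sigma> v * c * w\<close> is skew-symmetric in
 \<open>v\<close> and \<open>w\<close>, hence its values are skew; but the values form a right ideal of the corner and
 \<open>f\<close> is not skew.\<close>

lemma ex_corner_value:
 assumes c: "\<sigma> c = c" "c ~= 0" shows "EX v. v * f = v \<and> \<sigma> v * c * v ~= 0"
proof (rule ccontr)
 assume "\<nexists>v. v * f = v \<and> \<sigma> v * c * v ~= 0"
 then have z: "\<sigma> v * c * v = 0" if "v * f = v" for v using that by blast
 have skew: "\<sigma> (\<sigma> v * c * w) = - (\<sigma> v * c * w)" if v: "v * f = v" and w: "w * f = w" for v w
 proof -
  have "0 = \<sigma> (v + w) * c * (v + w)" using z[of "v + w"] v w by (simp add: distrib_right)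
  also have "\<dots> = \<sigma> v * c * v + \<sigma> v * c * w + (\<sigma> w * c * v + \<sigma> w * c * w)" by (simp add: inv_add distrib_left distrib_right)
  also have "\<dots> = \<sigma> v * c * w + \<sigma> w * c * v" using z v w by simp
  finally have "\<sigma> w * c * v = - (\<sigma> v * c * w)" by (simp add: eq_neg_iff_add_eq_0 add.commute)
  then show ?thesis using c(1) by (simp add: inv_mult mult.assoc)
 qed
 have zero: "\<sigma> v * c * w = 0" if v: "v * f = v" and w: "w * f = w" for v w
 proof (rule ccontr)
  assume nz: "\<sigma> v * c * w ~= 0"
  have "f * (\<sigma> v * c * w) * f = \<sigma> v * c * w" using corner_conj[OF v w] by (simp add: corner_def)
  from f_inverse[OF nz this] obtain y where y: "f * y * f = y" "\<sigma> v * c * w * y = f" by blast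
  have "y * f = y" using y(1) corner_iff[of y] by (simp add: corner_def)
  then have "w * y * f = w * y" by (simp add: mult.assoc)
  from skew[OF v this] have "\<sigma> f = - f" using y(2) by (simp add: mult.assoc)
  then have "f = 0" using star_f half_form[of f] by simp
  then show False using f_nz by simp
 qed
 have "c * (b * f) = 0" for b
 proof -
  have "1 * (c * b * f) = 0"
  proof (rule corner_detect)
   fix p q
   have "\<sigma> (\<sigma> q * f) * c * (b * f) = 0" by (rule zero) (simp_all add: mult.assoc f_idem)
   then have "f * q * c * (b * f) = 0" using star_f by (simp add: inv_mult)
   then have "p * (f * q * c * (b * f)) = 0" by simp
   then show "1 * p * f * q * (c * b * f) = 0" by (simp add: mult.assoc)
  qed
  then show ?thesis by (simp add: mult.assoc)
 qed
 then have "c * p * f * q * 1 = 0" for p q by (metis mult.assoc mult_zero_left)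
 from corner_detect[OF this] have "c * 1 = 0" .
 then show False using c(2) by simp
qed

lemma kernel_subspace: "subspace {x. b * x = 0}"
 by (auto simp: subspace_def distrib_left scale_mult_right)

text \<open>Splitting off one square: \<open>b = b' + \<sigma> w * \<beta> * w\<close> with \<open>w = \<beta>\<^sup>-\<^sup>1 * \<sigma> v * b\<close>, where the kernel of
 \<open>b'\<close> contains \<open>v\<close> in addition to the kernel of \<open>b\<close>.\<close>

lemma hsq_if_values:
 assumes "\<sigma> b = b" "!!v. v * f = v ==> \<sigma> v * b * v : hsq" shows "b : hsq"
proof -
 obtain d :: "'a set => nat" where d: "!!U V. subspace U ==> subspace V ==> U \<subset> V ==> d U < d V" "!!V. subspace V ==> d V \<le> d UNIV"
  using ex_dim by blast
 define m where "m = (\<lambda>b. d UNIV - d {x. b * x = 0})"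
 show ?thesis using assms
 proof (induction "m b" arbitrary: b rule: less_induct)
  case less
  show ?case
  proof (cases "b = 0")
   case False
   obtain v where v: "v * f = v" "\<sigma> v * b * v ~= 0" using ex_corner_value[OF less.prems(1) False] by blast
   define \<beta> where "\<beta> = \<sigma> v * b * v"
   have bc: "\<beta> : corner" unfolding \<beta>_def by (rule corner_conj) (rule v(1))+
   have sb: "\<sigma> \<beta> = \<beta>" using less.prems(1) by (simp add: \<beta>_def inv_mult mult.assoc)
   obtain y where y: "f * y * f = y" "\<beta> * y = f" "y * \<beta> = f"
    using f_inverse[of \<beta>] v(2) bc by (auto simp: corner_def \<beta>_def)
   have fy: "f * y = y" "y * f = y" using y(1) corner_iff[of y] by (auto simp: corner_def)
   have sy: "\<sigma> y = y"
   proof -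
    have "\<beta> * \<sigma> y = f" using y(3) inv_mult[of y \<beta>] sb star_f by simp
    then have "y * \<beta> * \<sigma> y = y" using fy by (simp add: mult.assoc)
    then have "f * \<sigma> y = y" using y(3) by simp
    then show ?thesis using fy inv_mult[of y f] star_f by simp
   qed
   define w where "w = y * \<sigma> v * b"
   define b' where "b' = b - \<sigma> w * \<beta> * w"
   have sw: "\<sigma> w = b * v * y" using sy less.prems(1) by (simp add: w_def inv_mult mult.assoc)
   have wbw: "\<sigma> w * \<beta> * w = b * v * y * \<sigma> v * b"
   proof -
    have "\<sigma> w * \<beta> * w = b * v * (y * \<beta> * y) * \<sigma> v * b" unfolding sw unfolding w_def by (simp only: mult.assoc)
    then show ?thesis using y(3) fy by simp
   qed
   have b'eq: "b' = b - b * v * y * \<sigma> v * b" by (simp add: b'_def wbw)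
   have sb': "\<sigma> b' = b'" using less.prems(1) sb by (simp add: b'_def inv_diff inv_mult mult.assoc)
   have bv: "b * v ~= 0" using v(2) by (auto simp: mult.assoc)
   have b'v: "b' * v = 0"
   proof -
    have "b * v * y * \<sigma> v * b * v = b * v * (y * \<beta>)" by (simp add: \<beta>_def mult.assoc)
    also have "\<dots> = b * v" using y(3) v(1) by (simp add: mult.assoc)
    finally show ?thesis by (simp add: b'eq left_diff_distrib)
   qed
   have "{x. b * x = 0} \<subset> {x. b' * x = 0}"
   proof
    have "b' * x = b * x - b * v * y * \<sigma> v * (b * x)" for x by (simp add: b'eq left_diff_distrib mult.assoc)
    then show "{x. b * x = 0} \<subseteq> {x. b' * x = 0}" by auto
    show "{x. b * x = 0} ~= {x. b' * x = 0}" using b'v bv by blast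
   qed
   then have "d {x. b * x = 0} < d {x. b' * x = 0}" by (intro d kernel_subspace)
   moreover have "d {x. b' * x = 0} \<le> d UNIV" by (intro d kernel_subspace)
   ultimately have "m b' < m b" by (simp add: m_def)
   moreover have "\<sigma> u * b' * u : hsq" if u: "u * f = u" for u
   proof -
    \<comment> \<open>A projection of \<open>u\<close>, orthogonal to \<open>v\<close> with respect
      to \<open>b\<close>: the value of \<open>b'\<close> at \<open>u\<close> is the value of
      \<open>b\<close> at \<open>u'\<close>, so the hypothesis on values is inherited.\<close>
    define u' where "u' = u - v * y * \<sigma> v * b * u"
    have "u' * f = u'" using u by (simp add: u'_def left_diff_distrib mult.assoc)
    then have "\<sigma> u' * b * u' : hsq" by (rule less.prems)
    have bb: "b * u' = b' * u" by (simp add: u'_def b'eq left_diff_distrib right_diff_distrib mult.assoc)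
    have "\<sigma> u' = \<sigma> u - \<sigma> u * b * v * y * \<sigma> v"
     using less.prems(1) sy by (simp add: u'_def inv_diff inv_mult mult.assoc)
    then have "\<sigma> u' * (b' * u) = \<sigma> u * (b' * u) - \<sigma> u * b * v * y * (\<sigma> v * b') * u"
     by (simp add: left_diff_distrib mult.assoc)
    also have "\<sigma> v * b' = 0" using b'v sb' inv_mult[of b' v] by simp
    finally show ?thesis using \<open>\<sigma> u' * b * u' : hsq\<close> bb by (simp add: mult.assoc)
   qed
   ultimately have "b' : hsq" using sb' less.hyps by blast
   moreover have "\<sigma> w * \<beta> * w : hsq" unfolding \<beta>_def by (intro hsq_conj less.prems v(1))
   ultimately have "b' + \<sigma> w * \<beta> * w : hsq" by (rule hsq_add)
   then show ?thesis by (simp add: b'_def)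
  qed (simp add: hsq_zero)
 qed
qed

lemma corner_star_div: "star_div corner f \<sigma>"
proof
 show "involution \<sigma>" by (rule involution)
 show "f : corner" by (simp add: corner_iff f_idem)
 show "f + f ~= 0" using add_self[of f] f_nz by blast
 show "EX y:corner. x * y = f \<and> y * x = f" if "x : corner" "x ~= 0" for x
  using f_inverse[of x] that by (auto simp: corner_def)
 fix x y assume x: "x : corner"
 show "\<sigma> x : corner" "- x : corner" using corner_star[OF x] x by (auto simp: corner_iff)
 show "f * x = x" "x * f = x" using x by (auto simp: corner_iff)
 assume y: "y : corner"
 show "x + y : corner" using x y by (auto simp: corner_iff distrib_left distrib_right)
 have "f * (x * y) = (f * x) * y" "(x * y) * f = x * (y * f)" by (simp_all only: mult.assoc)
 then show "x * y : corner" using x y by (simp add: corner_iff)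
qed (fact f_nz)

text \<open>As \<open>f\<close> generates the unit ideal, \<open>z\<close> extends to a central
  element \<open>Z\<close> of the whole algebra with \<open>Z * f = z\<close>. The difference of
  \<open>Z\<close> and its star is central and kills \<open>f\<close>; since the centre is a field
  it vanishes, and \<open>base_field\<close> identifies \<open>Z\<close> with a scalar.\<close>

lemma corner_centre:
 assumes z: "z : corner" "!!d. d : corner ==> z * d = d * z" "\<sigma> z = z" shows "EX c. z = scale c f"
proof -
 obtain l where l: "1 = (\<Sum>(p, q)\<leftarrow>l. p * f * q)" using ideal_generated[OF f_nz] by blast
 have fz: "f * z = z" "z * f = z" using z(1) by (auto simp: corner_iff)
 have zc: "f * x * z = z * x * f" for x
 proof -
  have "z * (f * x * f) = f * x * f * z" by (intro z(2) cornerI)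
  then show ?thesis using fz by (simp add: mult.assoc flip: mult.assoc[of z f])
 qed
 define Z where "Z = (\<Sum>(p, q)\<leftarrow>l. p * z * q)"
 have Zf: "Z * f = z"
 proof -
  have "Z * f = (\<Sum>(p, q)\<leftarrow>l. p * z * q * f)" using sum_list_conj[of 1 z l f] by (simp add: Z_def)
  also have "\<dots> = (\<Sum>(p, q)\<leftarrow>l. p * f * q * z)" using zc by (simp add: mult.assoc)
  also have "\<dots> = z" using sum_list_conj[of 1 f l z] l by simp
  finally show ?thesis .
 qed
 have comm: "Z * a = a * Z" for a
 proof -
  have "f * q * a * Z = z * q * a" for q
  proof -
   have r: "f * q * a * (p' * z * q') = z * q * a * (p' * f * q')" for p' q'
   proof -
    have "f * q * a * (p' * z * q') = f * (q * a * p') * z * q'" by (simp only: mult.assoc)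
    also have "\<dots> = z * q * a * (p' * f * q')" unfolding zc by (simp only: mult.assoc)
    finally show ?thesis .
   qed
   have "f * q * a * Z = (\<Sum>(p', q')\<leftarrow>l. f * q * a * (p' * z * q'))"
    using sum_list_conj[of "f * q * a" z l 1] by (simp add: Z_def)
   also have "\<dots> = (\<Sum>(p', q')\<leftarrow>l. z * q * a * (p' * f * q'))"
    by (simp only: r)
   also have "\<dots> = z * q * a" using sum_list_conj[of "z * q * a" f l 1] l by simp
   finally show ?thesis .
  qed
  then have "(\<Sum>(p, q)\<leftarrow>l. p * f * q * (a * Z)) = (\<Sum>(p, q)\<leftarrow>l. p * z * q * a)" by (simp add: mult.assoc)
  then show ?thesis using sum_list_conj[of 1 f l "a * Z"] sum_list_conj[of 1 z l a] l by (simp add: Z_def)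
 qed
 have sZ: "\<sigma> Z = Z"
 proof (rule ccontr)
  assume ne: "\<sigma> Z ~= Z"
  define W where "W = Z - \<sigma> Z"
  have sc: "\<sigma> Z * a = a * \<sigma> Z" for a using comm[of "\<sigma> a"] inv_mult[of Z "\<sigma> a"] inv_mult[of "\<sigma> a" Z] by simp
  have "W : ring_centre" using comm sc by (simp add: ring_centre_def W_def left_diff_distrib right_diff_distrib)
  then obtain u where u: "u : ring_centre" "W * u = 1" using centre_field ne unfolding W_def by (metis right_minus_eq)
  have "\<sigma> Z * f = z" using inv_mult[of f Z] Zf comm[of f] star_f z(3) sc[of f] by simp
  then have "W * f = 0" by (simp add: W_def left_diff_distrib Zf)
  moreover have "f = W * u * f" using u(2) by simp
  moreover have "W * u * f = u * (W * f)" using u(1) by (simp add: ring_centre_def mult.assoc)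
  ultimately show False using f_nz by simp
 qed
 have "Z : ring_centre \<inter> Sym \<sigma>" using comm sZ by (simp add: ring_centre_def Sym_def)
 then obtain c where "Z = scale c 1" using base_field by blast
 then have "z = scale c f" using Zf by (simp add: scale_mult_left)
 then show ?thesis by blast
qed

lemma corner_div_alg: "div_alg corner f \<sigma> scale"
proof (intro div_alg.intro corner_star_div div_alg_axioms.intro)
 show "scale c x : corner" if "x : corner" for c x using that by (simp add: corner_iff scale_mult_left scale_mult_right)
 interpret M: smod "UNIV :: 'f set" 1 id corner "\<lambda>v c. scale c v"
  by (rule F_smod) (simp_all add: corner_iff scale_mult_left scale_mult_right distrib_left distrib_right)
 interpret N: smod "UNIV :: 'f set" 1 id "UNIV :: 'a set" "\<lambda>v c. scale c v" by (rule F_smod) auto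
 obtain I :: "nat set" and b where b: "N.spanning I b" using UNIV_span by auto
 have "M.spanning I (\<lambda>i. f * b i * f)" unfolding M.spanning_def
 proof (intro conjI ballI)
  show "finite I" using b by (simp add: N.spanning_def)
  fix x assume x: "x : corner"
  obtain k where k: "x = (\<Sum>i\<in>I. scale (k i) (b i))" using b by (auto simp: N.spanning_def)
  have "x = f * x * f" using x by (simp add: corner_def)
  also have "\<dots> = (\<Sum>i\<in>I. scale (k i) (f * b i * f))"
   unfolding k by (simp add: sum_distrib_left sum_distrib_right scale_mult_left scale_mult_right)
  finally show "EX k. (ALL i:I. k i : UNIV) \<and> x = (\<Sum>i\<in>I. scale (k i) (f * b i * f))" by auto
 qed (auto intro: cornerI)
 then show "EX (I::nat set) b. M.spanning I b" by blast
qed (auto simp: scale_right_distrib scale_left_distrib scale_mult_left scale_mult_right inv_scale intro: corner_centre)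

end

section \<open>Positive cones\<close>

lemma ordering_on_UNIV_iff: "ordering_on (UNIV :: 'f::field set) T \<longleftrightarrow> field_ordering T"
proof
 assume T: "ordering_on UNIV T"
 have u: "x : T \<or> x : uminus ` T" for x using ordering_onD(4)[OF T UNIV_I, of x] by (metis imageI minus_minus)
 have "0 : T" using ordering_onD(4)[OF T UNIV_I, of 0] by simp
 then show "field_ordering T" using ordering_onD[OF T] u unfolding field_ordering_def by force
next
 assume T: "field_ordering T"
 have "x : T \<or> - x : T" for x
 proof -
  have "x : T \<union> uminus ` T" using T unfolding field_ordering_def by blast
  then show ?thesis by auto
 qed
 moreover have "x = 0" if "x : T" "- x : T" for x
 proof -
  have "x : T \<inter> uminus ` T" using that by force
  then show ?thesis using T unfolding field_ordering_def by blast
 qed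
 ultimately show "ordering_on UNIV T" using T unfolding field_ordering_def ordering_on_def by blast
qed

text \<open>A scalar \<open>u\<close> outside \<open>T\<close> has its negative in \<open>T\<close>,
  so \<open>scale u p\<close> and its negative would both lie in \<open>P\<close>, forcing
  \<open>u = 0\<close>.\<close>

lemma (in involution_algebra) cone_scalarsI:
 assumes T: "field_ordering T" "T \<subseteq> cone_scalars scale P" and p: "p : P" "p ~= 0" and P: "P \<inter> uminus ` P = {0}"
 shows "cone_scalars scale P = T"
proof -
 have "u : T" if u: "u : cone_scalars scale P" for u
 proof (rule ccontr)
  assume n: "u \<notin> T"
  then have "- u : T" using T(1) unfolding ordering_on_UNIV_iff[symmetric] ordering_on_def by blast
  then have "scale u p : P" "- scale u p : P" using T(2) p(1) u unfolding cone_scalars_def by auto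
  then have "scale u p : P \<inter> uminus ` P" by (simp add: image_iff) (metis minus_minus)
  then have "u = 0" using P p(2) by simp
  then show False using n \<open>- u : T\<close> by simp
 qed
 then show ?thesis using T(2) by blast
qed

context involution_algebra
begin

lemma prepositive_cone_scalars_mono:
 assumes P: "prepositive_cone scale \<sigma> P" and Q: "prepositive_cone scale \<sigma> Q" and sub: "P \<subseteq> Q" and p: "p : P" "p ~= 0"
 shows "cone_scalars scale P \<subseteq> cone_scalars scale Q"
proof
 fix t assume t: "t : cone_scalars scale P"
 have oQ: "field_ordering (cone_scalars scale Q)" and Q0: "Q \<inter> uminus ` Q = {0}" using Q unfolding prepositive_cone_def by auto
 show "t : cone_scalars scale Q"
 proof (rule ccontr)
  assume n: "t \<notin> cone_scalars scale Q"
  then have m: "- t : cone_scalars scale Q" using oQ unfolding ordering_on_UNIV_iff[symmetric] ordering_on_def by blast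
  then have "- scale t p : Q" using sub p(1) unfolding cone_scalars_def by auto
  moreover have "scale t p : Q" using t sub p(1) unfolding cone_scalars_def by auto
  ultimately have "scale t p : Q \<inter> uminus ` Q" by (simp add: image_iff) (metis minus_minus)
  then have "t = 0" using Q0 p(2) by simp
  then show False using n m by simp
 qed
qed

text \<open>Zorn's lemma. The delicate axiom for the union of a chain is the one on scalars: the
  ordering attached to \<open>P\<close> preserves every member, and properness of the union at the
  nonzero \<open>p\<close> shows that no further scalar preserves it.\<close>

lemma ex_positive_cone:
 assumes P: "prepositive_cone scale \<sigma> P" and p: "p : P" "p ~= 0"
 shows "EX Q:positive_cones scale \<sigma>. P \<subseteq> Q"
proof -
 define \<Q> where "\<Q> = {Q. prepositive_cone scale \<sigma> Q \<and> P \<subseteq> Q}"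
 have "EX M:\<Q>. ALL X':\<Q>. M \<subseteq> X' --> X' = M"
 proof (rule subset_Zorn_nonempty)
  show "\<Q> ~= {}" using P unfolding \<Q>_def by blast
  fix \<C> assume ne: "\<C> ~= {}" and ch: "subset.chain \<Q> \<C>"
  have C: "prepositive_cone scale \<sigma> Q" "P \<subseteq> Q" if "Q : \<C>" for Q
   using ch that unfolding subset_chain_def \<Q>_def by auto
  have two: "EX R:\<C>. x : R \<and> y : R" if x: "x : \<Union>\<C>" and y: "y : \<Union>\<C>" for x y
  proof -
   obtain R S where RS: "R : \<C>" "x : R" "S : \<C>" "y : S" using x y by blast
   then have "R \<subseteq> S \<or> S \<subseteq> R" using ch unfolding subset_chain_def by blast
   then show ?thesis using RS by blast
  qed
  have sub: "P \<subseteq> \<Union>\<C>" using C(2) ne by blast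
  have Z: "\<Union>\<C> \<inter> uminus ` \<Union>\<C> = {0}"
  proof -
   have "0 : P" using P unfolding prepositive_cone_def by blast
   then have "0 : \<Union>\<C> \<inter> uminus ` \<Union>\<C>" using sub by (auto intro: image_eqI[of _ _ 0])
   moreover have "x = 0" if h: "x : \<Union>\<C> \<inter> uminus ` \<Union>\<C>" for x
   proof -
    have "x : \<Union>\<C>" "- x : \<Union>\<C>" using h by (simp_all add: image_iff) force
    then obtain R where R: "R : \<C>" "x : R" "- x : R" using two by blast
    then have "x : R \<inter> uminus ` R" by (simp add: image_iff) (metis minus_minus)
    then show ?thesis using C(1)[OF R(1)] unfolding prepositive_cone_def by blast
   qed
   ultimately show ?thesis by blast
  qed
  have "cone_scalars scale P \<subseteq> cone_scalars scale (\<Union>\<C>)"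
  proof
   fix t assume t: "t : cone_scalars scale P"
   have "scale t x : Q" if "Q : \<C>" "x : Q" for Q x
    using prepositive_cone_scalars_mono[OF P C[OF that(1)] p] t that(2) unfolding cone_scalars_def by blast
   then show "t : cone_scalars scale (\<Union>\<C>)" unfolding cone_scalars_def by blast
  qed
  moreover have oP: "field_ordering (cone_scalars scale P)" using P unfolding prepositive_cone_def by blast
  moreover have "p : \<Union>\<C>" using p(1) sub by blast
  ultimately have "cone_scalars scale (\<Union>\<C>) = cone_scalars scale P" using p(2) Z by (intro cone_scalarsI)
  then have "field_ordering (cone_scalars scale (\<Union>\<C>))" using oP by simp
  moreover have "x + y : \<Union>\<C>" if xy: "x : \<Union>\<C>" "y : \<Union>\<C>" for x y
  proof -
   obtain R where R: "R : \<C>" "x : R" "y : R" using two[OF xy] by blast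
   then have "x + y : R" using C(1)[OF R(1)] unfolding prepositive_cone_def by blast
   then show ?thesis using R(1) by blast
  qed
  moreover have "\<sigma> a * x * a : \<Union>\<C>" if "x : \<Union>\<C>" for a x
   using that C(1) unfolding prepositive_cone_def by blast
  moreover have "\<Union>\<C> \<subseteq> Sym \<sigma>" using C(1) unfolding prepositive_cone_def by blast
  moreover have "\<Union>\<C> ~= {}" using sub p(1) by blast
  ultimately show "\<Union>\<C> : \<Q>" unfolding \<Q>_def using sub Z
   by (simp only: mem_Collect_eq prepositive_cone_def) blast
 qed
 then obtain M where M: "M : \<Q>" "!!X'. X' : \<Q> ==> M \<subseteq> X' ==> X' = M" by blast
 then have "M : positive_cones scale \<sigma>" unfolding positive_cones_def \<Q>_def by blast
 then show ?thesis using M(1) unfolding \<Q>_def by blast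
qed

lemma tcone_sym:
 assumes "\<sigma> a = a" "x : tcone scale \<sigma> T D a" shows "\<sigma> x = x"
 using assms(2) by induction (simp_all add: inv_add inv_scale inv_mult assms(1) mult.assoc)

lemma tcone_conj:
 assumes "x : tcone scale \<sigma> T UNIV a" shows "\<sigma> c * x * c : tcone scale \<sigma> T UNIV a"
 using assms
proof induction
 case zero
 show ?case by (simp add: tcone.zero)
next
 case (step p t x)
 have "\<sigma> c * (p + scale t (\<sigma> x * a * x)) * c = \<sigma> c * p * c + scale t (\<sigma> (x * c) * a * (x * c))"
  by (simp add: distrib_left distrib_right scale_mult_left scale_mult_right inv_mult mult.assoc)
 then show ?case using tcone.step[OF step.IH step.hyps(2) UNIV_I, of "x * c"] by simp
qed

lemma tcone_scale:
 assumes "x : tcone scale \<sigma> T D a" "!!t. t : T ==> c * t : T" shows "scale c x : tcone scale \<sigma> T D a"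
 using assms(1)
proof induction
 case (step p t x)
 then show ?case using tcone.step[OF step.IH assms(2) step.hyps(3)] by (simp add: scale_right_distrib)
qed (simp add: tcone.zero)

lemma tcone_subset_cone:
 assumes P: "prepositive_cone scale \<sigma> P" and T: "T \<subseteq> cone_scalars scale P" and a: "a : P" and x: "x : tcone scale \<sigma> T D a"
 shows "x : P"
 using x
proof induction
 case zero
 show ?case using P unfolding prepositive_cone_def by blast
next
 case (step p t x)
 have "\<sigma> x * a * x : P" using P a unfolding prepositive_cone_def by blast
 then have "scale t (\<sigma> x * a * x) : P" using step.hyps(2) T unfolding cone_scalars_def by blast
 then show ?case using P step.IH unfolding prepositive_cone_def by blast
qed

lemma tcone_base: assumes "field_ordering T" shows "a : tcone scale \<sigma> T UNIV a"
proof -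
 have "1 : T"
 proof -
  have "1 : T \<or> - 1 : T" using assms unfolding ordering_on_UNIV_iff[symmetric] ordering_on_def by blast
  moreover have "(- 1) * (- 1) : T" if "- 1 : T" using assms that unfolding field_ordering_def by blast
  ultimately show ?thesis by auto
 qed
 from tcone.step[where x = 1, OF tcone.zero this UNIV_I, where scale = scale and \<sigma> = \<sigma> and a = a] show ?thesis by simp
qed

end

section \<open>Generated cones in the corner\<close>

context corner_algebra
begin

text \<open>As \<open>a = f * a * f\<close>, conjugating a generator by \<open>v\<close> amounts to
  conjugating \<open>a\<close> by \<open>f * x * v\<close>, which lies in the corner.\<close>

lemma tcone_cut:
 assumes "x : tcone scale \<sigma> T UNIV a" "a : corner" "v * f = v" shows "\<sigma> v * x * v : tcone scale \<sigma> T corner a"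
 using assms(1)
proof induction
 case zero
 show ?case by (simp add: tcone.zero)
next
 case (step p t x)
 have fa: "f * a = a" "a * f = a" using assms(2) by (auto simp: corner_iff)
 have "\<sigma> (f * x * v) * a * (f * x * v) = \<sigma> v * \<sigma> x * (f * a * f) * x * v" using star_f by (simp add: inv_mult mult.assoc)
 also have "\<dots> = \<sigma> v * (\<sigma> x * a * x) * v" using fa by (simp add: mult.assoc)
 finally have "\<sigma> v * (p + scale t (\<sigma> x * a * x)) * v = \<sigma> v * p * v + scale t (\<sigma> (f * x * v) * a * (f * x * v))"
  by (simp add: distrib_left distrib_right scale_mult_left scale_mult_right)
 moreover have "f * x * v : corner" using corner_conj[of f v x] f_idem star_f assms(3) by simp
 ultimately show ?case using tcone.step[where x = "f * x * v", OF step.IH step.hyps(2)] by simp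
qed

lemma tcone_corner: assumes "a : corner" "x : tcone scale \<sigma> T corner a" shows "x : corner"
proof -
 interpret D: star_div corner f \<sigma> by (rule corner_star_div)
 show ?thesis using assms(2)
 proof induction
  case (step p t x)
  have "\<sigma> x * a * x : corner" by (intro D.mult_closed D.star_closed step.hyps assms)
  then show ?case using step.IH by (simp add: corner_iff distrib_left distrib_right scale_mult_left scale_mult_right)
 qed (rule D.zero_closed)
qed

text \<open>Let \<open>P\<close> be the difference of the cones generated by \<open>p\<close> and
  \<open>q\<close> in the whole algebra. Were it proper, it would lie in a positive cone containing
  \<open>p\<close> and \<open>- q\<close>, which contradicts either choice of sign for 1. So
  \<open>P\<close> contains some nonzero \<open>s\<close> together with \<open>- s\<close>, and
  comparing the two decompositions produces a common element or a degenerate cone.\<close>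

lemma linked_in_corner:
 assumes hyp: "!!P. P : positive_cones scale \<sigma> ==> 1 : P \<or> - 1 : P"
  and b: "!!P. P : positive_cones scale \<sigma> ==> 1 : P ==> b : P" and \<beta>: "\<beta> : corner" "\<sigma> \<beta> = \<beta>" "\<beta> = \<sigma> v * b * v"
  and T: "ordering_on (UNIV :: 'f set) T"
  and p: "p : tcone scale \<sigma> T corner f" "p ~= 0" and q: "q : tcone scale \<sigma> T corner \<beta>" "q ~= 0"
 shows "(EX c. c : tcone scale \<sigma> T corner p \<and> c : tcone scale \<sigma> T corner q \<and> c ~= 0) \<or>
   (EX u. u : tcone scale \<sigma> T corner p \<and> - u : tcone scale \<sigma> T corner p \<and> u ~= 0) \<or>
   (EX u. u : tcone scale \<sigma> T corner q \<and> - u : tcone scale \<sigma> T corner q \<and> u ~= 0)"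
proof -
 let ?C = "tcone scale \<sigma> T UNIV"
 define P where "P = {x - y | x y. x : ?C p \<and> y : ?C q}"
 have fT: "field_ordering T" using T by (simp add: ordering_on_UNIV_iff)
 have fc: "f : corner" by (simp add: corner_iff f_idem)
 have pc: "p : corner" and qc: "q : corner" by (rule tcone_corner[OF fc p(1)], rule tcone_corner[OF \<beta>(1) q(1)])
 have ps: "\<sigma> p = p" and qs: "\<sigma> q = q" by (rule tcone_sym[OF star_f p(1)], rule tcone_sym[OF \<beta>(2) q(1)])
 have PI: "x - y : P" if "x : ?C p" "y : ?C q" for x y using that unfolding P_def by blast
 have pP: "p : P" using PI[OF tcone_base[OF fT] tcone.zero] by simp
 have qP: "- q : P" using PI[OF tcone.zero tcone_base[OF fT]] by simp
 have zP: "0 : P" using PI[OF tcone.zero tcone.zero] by simp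
 have "P \<inter> uminus ` P ~= {0}"
 proof
  assume P0: "P \<inter> uminus ` P = {0}"
  have T_sc: "T \<subseteq> cone_scalars scale P"
  proof
   fix t assume t: "t : T"
   have "t * u : T" if "u : T" for u using fT t that unfolding field_ordering_def by blast
   then have "scale t (x - y) : P" if "x : ?C p" "y : ?C q" for x y
    unfolding scale_right_diff_distrib using that by (intro PI tcone_scale)
   then show "t : cone_scalars scale P" unfolding cone_scalars_def P_def by blast
  qed
  have pre: "prepositive_cone scale \<sigma> P" unfolding prepositive_cone_def
  proof (intro conjI ballI allI P0)
   show "field_ordering (cone_scalars scale P)" using cone_scalarsI[OF fT T_sc pP p(2) P0] fT by simp
   show "P ~= {}" using zP by blast
   show "P \<subseteq> Sym \<sigma>" using tcone_sym[OF ps] tcone_sym[OF qs] unfolding P_def Sym_def by (auto simp: inv_diff)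
   fix z assume z: "z : P"
   then obtain x y where xy: "z = x - y" "x : ?C p" "y : ?C q" unfolding P_def by blast
   have "\<sigma> a * x * a - \<sigma> a * y * a : P" for a by (intro PI tcone_conj xy)
   then show "\<sigma> a * z * a : P" for a by (simp add: xy(1) left_diff_distrib right_diff_distrib)
   fix z' assume "z' : P"
   then obtain x' y' where xy': "z' = x' - y'" "x' : ?C p" "y' : ?C q" unfolding P_def by blast
   have "x + x' - (y + y') : P" by (intro PI tcone_add xy xy')
   then show "z + z' : P" by (simp add: xy(1) xy'(1) algebra_simps)
  qed
  obtain Q where Q: "Q : positive_cones scale \<sigma>" "P \<subseteq> Q" using ex_positive_cone[OF pre pP p(2)] by blast
  have preQ: "prepositive_cone scale \<sigma> Q" using Q(1) unfolding positive_cones_def by blast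
  have T_Q: "T \<subseteq> cone_scalars scale Q" using prepositive_cone_scalars_mono[OF pre preQ Q(2) pP p(2)] T_sc by blast
  have Q0: "x = 0" if "x : Q" "- x : Q" for x
  proof -
   have "x : Q \<inter> uminus ` Q" using that by (simp add: image_iff) (metis minus_minus)
   then show ?thesis using preQ unfolding prepositive_cone_def by blast
  qed
  have conj: "\<sigma> a * x * a : Q" if "x : Q" for a x using preQ that unfolding prepositive_cone_def by blast
  show False
  proof (cases "1 : Q")
   case True
   \<comment> \<open>\<open>q\<close> is generated over \<open>T\<close> by \<open>\<beta>\<close>,
     a conjugate of \<open>b\<close>, so \<open>Q\<close> would contain both \<open>q\<close> and
     \<open>- q\<close>.\<close>
   then have "\<beta> : Q" unfolding \<beta>(3) by (intro conj b Q(1))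
   then have "q : Q" by (rule tcone_subset_cone[OF preQ T_Q _ q(1)])
   then show False using Q0[of q] qP Q(2) q(2) by blast
  next
   case False
   then have "- 1 : Q" using hyp[OF Q(1)] by blast
   \<comment> \<open>\<open>p\<close> is generated over \<open>T\<close> by \<open>f\<close>, the
     conjugate of 1 by \<open>f\<close>, so here \<open>- p\<close> joins \<open>p\<close> in
     \<open>Q\<close>.\<close>
   from conj[OF this, of f] have fQ: "- f : Q" by (simp add: star_f f_idem)
   have "- p : Q" using p(1)
   proof induction
    case zero
    show ?case using preQ unfolding prepositive_cone_def by auto
   next
    case (step p t x)
    have "\<sigma> x * (- f) * x : Q" by (rule conj[OF fQ])
    then have "scale t (\<sigma> x * (- f) * x) : Q" using step.hyps(2) T_Q unfolding cone_scalars_def by blast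
    then have "- p + scale t (\<sigma> x * (- f) * x) : Q" using preQ step.IH unfolding prepositive_cone_def by blast
    then show ?case by simp
   qed
   then show False using Q0[of p] pP Q(2) p(2) by blast
  qed
 qed
 then obtain s where s: "s : P" "- s : P" "s ~= 0" using zP by (force simp: image_iff)
 obtain x y x' y' where xy: "s = x - y" "x : ?C p" "y : ?C q" "- s = x' - y'" "x' : ?C p" "y' : ?C q"
  using s(1,2) unfolding P_def by blast
 have c: "x + x' = y + y'"
 proof -
  have "x - y + (x' - y') = 0" using xy(1,4) by (metis add.right_inverse)
  then show ?thesis by (simp add: algebra_simps)
 qed
 show ?thesis
 proof (cases "x + x' = 0")
  case False
  have "\<sigma> (x + x') = x + x'" using tcone_sym[OF ps] xy by (simp add: inv_add)
  \<comment> \<open>The common element lives in the whole algebra; \<open>ex_corner_value\<close>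
    brings it into the corner without making it zero.\<close>
  then obtain w where w: "w * f = w" "\<sigma> w * (x + x') * w ~= 0" using ex_corner_value[OF _ False] by blast
  have "\<sigma> w * (x + x') * w : tcone scale \<sigma> T corner p" by (rule tcone_cut[OF tcone_add[OF xy(2,5)] pc w(1)])
  moreover have "\<sigma> w * (x + x') * w : tcone scale \<sigma> T corner q" unfolding c by (rule tcone_cut[OF tcone_add[OF xy(3,6)] qc w(1)])
  ultimately show ?thesis using w(2) by blast
 next
  case True
  have iso: "EX u. u : tcone scale \<sigma> T corner a \<and> - u : tcone scale \<sigma> T corner a \<and> u ~= 0"
   if a: "a : corner" "\<sigma> a = a" and z: "z : ?C a" "z' : ?C a" "z + z' = 0" "z ~= 0" for a z z'
  proof -
   obtain w where w: "w * f = w" "\<sigma> w * z * w ~= 0" using ex_corner_value[OF tcone_sym[OF a(2) z(1)] z(4)] by blast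
   have "z' = - z" using z(3) by (metis add_eq_0_iff)
   then have "- (\<sigma> w * z * w) = \<sigma> w * z' * w" by simp
   then show ?thesis using tcone_cut[OF z(1) a(1) w(1)] tcone_cut[OF z(2) a(1) w(1)] w(2) by metis
  qed
  have "x ~= 0 \<or> y ~= 0" using s(3) xy(1) by auto
  then show ?thesis using iso[OF pc ps xy(2,5) True] iso[OF qc qs xy(3,6)] True c by auto
 qed
qed

lemma hsq_if_in_cones:
 assumes hyp: "!!P. P : positive_cones scale \<sigma> ==> 1 : P \<or> - 1 : P"
  and b: "\<sigma> b = b" "!!P. P : positive_cones scale \<sigma> ==> 1 : P ==> b : P"
 shows "b : hsq"
proof (rule hsq_if_values[OF b(1)])
 fix v assume v: "v * f = v"
 define \<beta> where "\<beta> = \<sigma> v * b * v"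
 show "\<sigma> v * b * v : hsq"
 proof (cases "\<beta> = 0")
  case False
  interpret D: div_alg corner f \<sigma> scale by (rule corner_div_alg)
  have bc: "\<beta> : corner" unfolding \<beta>_def by (rule corner_conj) (rule v)+
  have sb: "\<sigma> \<beta> = \<beta>" using b(1) by (simp add: \<beta>_def inv_mult mult.assoc)
  have "\<beta> : D.symu" by (rule D.symuI) (use bc sb False in auto)
  from D.sum_of_squares_if_linked[OF this linked_in_corner[OF hyp b(2) bc sb \<beta>_def]]
  obtain n :: nat and x where "\<beta> = (\<Sum>i<n. \<sigma> (x i) * x i)" by blast
  then have "\<beta> : hsq" by (simp only:) (intro hsq_sum hsq_square)
  then show ?thesis by (simp add: \<beta>_def)
 qed (simp add: \<beta>_def hsq_zero)
qed

end

theorem corollary7p15: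
  fixes scale :: "'f::field \<Rightarrow> 'a::ring_1 \<Rightarrow> 'a" and \<sigma> :: "'a \<Rightarrow> 'a"
  assumes "CHAR('f) \<noteq> 2"
    and "algebra_with_involution scale \<sigma>"
    and "\<forall>P\<in>positive_cones scale \<sigma>. 1 \<in> P \<union> uminus ` P"
  shows "Sym \<sigma> \<inter> \<Inter>{P \<in> positive_cones scale \<sigma>. 1 \<in> P} =
    {(\<Sum>i=1..s. \<sigma> (x i) * x i) | (s::nat) (x :: nat \<Rightarrow> 'a). True}"
proof -
 interpret A: algebra_with_involution scale \<sigma> by (rule assms(2))
 have "(1 :: 'f) + 1 ~= 0"
 proof
  assume "(1 :: 'f) + 1 = 0"
  then have "of_nat 2 = (0 :: 'f)" by simp
  then have "CHAR('f) dvd 2" by (simp only: of_nat_eq_0_iff_char_dvd)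
  \<comment> \<open>Only the divisors 1 and 2 of 2 remain, and characteristic 1 is impossible in a
    field.\<close>
  then have "CHAR('f) = 1" using assms(1) two_is_prime_nat by (auto simp: prime_nat_iff)
  then have "of_nat 1 = (0 :: 'f)" by (simp only: of_nat_eq_0_iff_char_dvd) simp
  then show False by simp
 qed
 then interpret A: involution_algebra scale \<sigma> by unfold_locales
 have cone: "1 : P \<or> - 1 : P" if "P : positive_cones scale \<sigma>" for P
 proof -
  have "1 : P \<union> uminus ` P" using assms(3) that by (rule bspec)
  then show ?thesis by (simp add: image_iff) (metis minus_minus)
 qed
 have main: "b : A.hsq \<longleftrightarrow> b : Sym \<sigma> \<inter> \<Inter>{P : positive_cones scale \<sigma>. 1 : P}" for b
 proof
  assume "b : A.hsq"
  then obtain xs where b: "b = (\<Sum>x\<leftarrow>xs. \<sigma> x * x)" unfolding A.hsq_def by blast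
  have "b : P" if P: "P : positive_cones scale \<sigma>" "1 : P" for P
  proof -
   have pre: "prepositive_cone scale \<sigma> P" using P(1) unfolding positive_cones_def by blast
   have "\<sigma> x * 1 * x : P" for x using pre P(2) unfolding prepositive_cone_def by blast
   moreover have "0 : P" using pre unfolding prepositive_cone_def by blast
   ultimately show ?thesis unfolding b using pre unfolding prepositive_cone_def by (induction xs) auto
  qed
  moreover have "\<sigma> b = b" unfolding b by (induction xs) (auto simp: A.inv_add A.inv_mult)
  ultimately show "b : Sym \<sigma> \<inter> \<Inter>{P : positive_cones scale \<sigma>. 1 : P}" by (simp add: Sym_def)
 next
  assume b: "b : Sym \<sigma> \<inter> \<Inter>{P : positive_cones scale \<sigma>. 1 : P}"
  then have bs: "\<sigma> b = b" by (simp add: Sym_def)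
  show "b : A.hsq"
  proof (cases "EX x. x ~= 0 \<and> \<sigma> x * x = 0")
   case True
   then show ?thesis using A.isotropic_hsq bs by blast
  next
   case False
   then have an: "\<sigma> x * x = 0 ==> x = 0" for x by blast
   interpret A: anisotropic_algebra scale \<sigma> by unfold_locales (rule an)
   obtain f where "\<sigma> f = f" "f * f = f" "f ~= 0"
    "!!x. x ~= 0 ==> f * x * f = x ==> EX y. f * y * f = y \<and> x * y = f \<and> y * x = f"
    using A.ex_division_corner by blast
   then interpret C: corner_algebra scale \<sigma> f by unfold_locales
   have "b : P" if "P : positive_cones scale \<sigma>" "1 : P" for P using b that by simp
   from C.hsq_if_in_cones[OF cone bs this] show ?thesis .
  qed
 qed
 show ?thesis by (rule Set.set_eqI) (simp only: main[symmetric] A.hsq_iff mem_Collect_eq simp_thms)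
qed

end
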